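(* Let $(\mathbf{R},\mathfrak{m})$ be a Cohen--Macaulay local domain of dimension $d\ge 1$ and let $I\subset \mathbf{R}$ be an almost complete intersection of codimension $g$ satisfying one of the following conditions: (a) $I$ is $\mathfrak{m}$-primary; (b) $\operatorname{height} I=d-1$; (c) $\operatorname{height} I=d-2$ and $\operatorname{depth}\mathbf{R}/I\ge 1$. Let $\mathbf{B}$, $\mathbf{L}$, $L_1$, $\mathbf{S}=\mathbf{B}/(L_1)=\operatorname{Sym}(I)$ and $T=\mathbf{L}/(L_1)$ be as defined in the context. Then: (i) $(L_1)$ is a Cohen--Macaulay ideal of $\mathbf{B}$ (that is, $\mathbf{B}/(L_1)$ is a Cohen--Macaulay ring). (ii) $T$ is a Cohen--Macaulay $\mathbf{S}$-module if and only if $\operatorname{depth}\mathbf{R}[It]\ge d$. (iii) If $I$ is $\mathfrak{m}$-primary, then $\mathcal{N}=T\cap \mathfrak{m}\mathbf{S}$ is the nilradical of $\mathbf{S}$, and $\mathcal{N}^s=0$ if and only if $\mathfrak{m}^sT=0$. Equivalently, $\operatorname{sdeg}(I)$ is the index of nilpotency of $\operatorname{Sym}(I)$. (iv) With $\mathcal{N}=T\cap\mathfrak{m}\mathbf{S}$, one has $T=\mathcal{N}+\mathcal{F}$, where $\mathcal{F}\subset T$ is generated by lifts to $\mathbf{S}$ (chosen in $T$) of the relations in $\mathbf{S}/\mathfrak{m}\mathbf{S}$ of the special fiber ring $\mathcal{F}(I)=\mathbf{R}[It]\otimes \mathbf{R}/\mathfrak{m}$, i.e. of generators of the kernel of $\mathbf{S}/\mathfrak{m}\mathbf{S}\to\mathcal{F}(I)$.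 In particular, if $\mathcal{F}(I)$ is a hypersurface ring (this kernel is generated by a single element, with lift $f$), then $T=(f,\mathcal{N})$.
   Context: An almost complete intersection is an ideal $I=(a_1,\dots,a_g,a_{g+1})$ of codimension $g$ such that $J=(a_1,\dots,a_g)$ is a complete intersection (generated by a regular sequence) and $a_{g+1}\notin J$. Put $\mathbf{B}=\mathbf{R}[\mathbf{T}_1,\dots,\mathbf{T}_{g+1}]$ and let $\mathbf{L}$ be the kernel of the graded surjection $\mathbf{B}\to\mathbf{R}[It]$, $\mathbf{T}_i\mapsto a_it$. Write $\mathbf{L}=L_1+L_2+\cdots$, where $L_j$ is the component of degree $j$ in the $\mathbf{T}_i$; $(L_1)$ is the ideal of $\mathbf{B}$ generated by $L_1$ (the linear forms coming from the syzygies of $I$), so $\mathbf{S}=\mathbf{B}/(L_1)=\operatorname{Sym}(I)$. The module $T=\mathbf{L}/(L_1)$ is called the module of nonlinear relations; it sits in the exact sequence $0\to T\to\mathbf{S}\to\mathbf{R}[It]\to 0$. The saturation exponent is $\operatorname{sdeg}(I)=\inf\{s\mid \mathfrak{m}^s\mathbf{L}\subset (L_1)\}$. The index of nilpotency of $\mathbf{S}$ is $\inf\{s\mid \mathcal{N}^s=0\}$, with $\mathcal N$ the nilradical; exponents $s$ are positive integers. Depths of graded modules are taken with respect to the maximal homogeneous ideal. The zero module is regarded as Cohen--Macaulay. *)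

theory Defs
  imports
    "HOL-Algebra.Algebra"
    "HOL-Algebra.Algebraic_Closure_Type"
    "HOL-Algebra.Ideal_Product"
    "HOL-Algebra.Ring_Divisibility"
    "HOL-Library.Poly_Mapping"
    "HOL-Library.Extended_Nat"
begin

text \<open>Powers of an ideal are powers in the library's monoid \<open>ideals_set A\<close> of ideals under
  \<open>ideal_prod\<close>, so that the power with exponent 0 is the unit ideal.\<close>

abbreviation ideal_power :: "('a, 'm) ring_scheme \<Rightarrow> 'a set \<Rightarrow> nat \<Rightarrow> 'a set"
  where "ideal_power A I s \<equiv> I [^]\<^bsub>ideals_set A\<^esub> s"

definition local_ring :: "('a, 'm) ring_scheme \<Rightarrow> 'a set \<Rightarrow> bool"
  where "local_ring A \<mm> \<longleftrightarrow>
    cring A \<and> maximalideal \<mm> A \<and> (\<forall>\<nn>. maximalideal \<nn> A \<longrightarrow> \<nn> = \<mm>)"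

definition radical :: "('a, 'm) ring_scheme \<Rightarrow> 'a set \<Rightarrow> 'a set"
  where "radical A I = {x \<in> carrier A. \<exists>n::nat. x [^]\<^bsub>A\<^esub> n \<in> I}"

definition nilradical :: "('a, 'm) ring_scheme \<Rightarrow> 'a set"
  where "nilradical A = radical A {\<zero>\<^bsub>A\<^esub>}"

definition primary_ideal :: "('a, 'm) ring_scheme \<Rightarrow> 'a set \<Rightarrow> bool"
  where "primary_ideal A Q \<longleftrightarrow>
    ideal Q A \<and> Q \<noteq> carrier A \<and>
    (\<forall>x\<in>carrier A. \<forall>y\<in>carrier A. x \<otimes>\<^bsub>A\<^esub> y \<in> Q \<longrightarrow> x \<in> Q \<or> y \<in> radical A Q)"

definition is_primary_to :: "('a, 'm) ring_scheme \<Rightarrow> 'a set \<Rightarrow> 'a set \<Rightarrow> bool"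
  where "is_primary_to A P Q \<longleftrightarrow> primary_ideal A Q \<and> radical A Q = P"

definition prime_chain :: "('a, 'm) ring_scheme \<Rightarrow> nat \<Rightarrow> (nat \<Rightarrow> 'a set) \<Rightarrow> bool"
  where "prime_chain A n P \<longleftrightarrow>
    (\<forall>i\<le>n. primeideal (P i) A) \<and> (\<forall>i<n. P i \<subset> P (Suc i))"

definition krull_dim :: "('a, 'm) ring_scheme \<Rightarrow> enat"
  where "krull_dim A = Sup {enat n | n P. prime_chain A n P}"

definition prime_height :: "('a, 'm) ring_scheme \<Rightarrow> 'a set \<Rightarrow> enat"
  where "prime_height A Q = Sup {enat n | n P. prime_chain A n P \<and> P n = Q}"

text \<open>The unit ideal has height \<open>\<infinity>\<close>; an ideal of finite height is proper.\<close>

definition ideal_height :: "('a, 'm) ring_scheme \<Rightarrow> 'a set \<Rightarrow> enat"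
  where "ideal_height A I = Inf {prime_height A Q | Q. primeideal Q A \<and> I \<subseteq> Q}"

text \<open>The ring \<open>C\<close> as a module over a ring \<open>A\<close> through a homomorphism \<open>h\<close> from \<open>A\<close> to \<open>C\<close>.\<close>

definition scalar_module :: "('a \<Rightarrow> 'c) \<Rightarrow> ('c, 'm) ring_scheme \<Rightarrow> ('a, 'c) module"
  where "scalar_module h C =
    \<lparr>carrier = carrier C, monoid.mult = monoid.mult C, one = one C,
     ring.zero = ring.zero C, add = add C,
     module.smult = (\<lambda>r x. h r \<otimes>\<^bsub>C\<^esub> x)\<rparr>"

abbreviation self_module :: "('a, 'm) ring_scheme \<Rightarrow> ('a, 'a) module"
  where "self_module A \<equiv> scalar_module (\<lambda>x. x) A"

definition span_module :: "('a, 'm) ring_scheme \<Rightarrow> ('a, 'c, 'k) module_scheme \<Rightarrow> 'c set \<Rightarrow> 'c set"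
  where "span_module A M G = \<Inter>{N. submodule N A M \<and> G \<subseteq> N}"

text \<open>The product \<open>\<aa>N\<close> inside \<open>M\<close>; \<open>\<aa>\<close> may also be a mere set of generators of an ideal.\<close>

definition ideal_smult ::
    "('a, 'm) ring_scheme \<Rightarrow> ('a, 'c, 'k) module_scheme \<Rightarrow> 'a set \<Rightarrow> 'c set \<Rightarrow> 'c set"
  where "ideal_smult A M \<aa> N = span_module A M {x \<odot>\<^bsub>M\<^esub> v | x v. x \<in> \<aa> \<and> v \<in> N}"

definition finitely_generated :: "('a, 'm) ring_scheme \<Rightarrow> ('a, 'c, 'k) module_scheme \<Rightarrow> bool"
  where "finitely_generated A M \<longleftrightarrow>
    (\<exists>G. finite G \<and> G \<subseteq> carrier M \<and> span_module A M G = carrier M)"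

definition annihilator :: "('a, 'm) ring_scheme \<Rightarrow> ('a, 'c, 'k) module_scheme \<Rightarrow> 'a set"
  where "annihilator A M = {x \<in> carrier A. \<forall>v\<in>carrier M. x \<odot>\<^bsub>M\<^esub> v = \<zero>\<^bsub>M\<^esub>}"

definition module_dim :: "('a, 'm) ring_scheme \<Rightarrow> ('a, 'c, 'k) module_scheme \<Rightarrow> enat"
  where "module_dim A M = krull_dim (A Quot annihilator A M)"

text \<open>Each \<open>x\<^sub>i\<close> is a nonzerodivisor on \<open>M/(x\<^sub>1,\<dots>,x\<^sub>i\<^sub>-\<^sub>1)M\<close>, and \<open>M \<noteq> (x\<^sub>1,\<dots>,x\<^sub>n)M\<close>.\<close>

definition regular_sequence ::
    "('a, 'm) ring_scheme \<Rightarrow> ('a, 'c, 'k) module_scheme \<Rightarrow> 'a list \<Rightarrow> bool"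
  where "regular_sequence A M xs \<longleftrightarrow>
    set xs \<subseteq> carrier A \<and>
    (\<forall>i<length xs. \<forall>v\<in>carrier M.
       xs ! i \<odot>\<^bsub>M\<^esub> v \<in> ideal_smult A M (set (take i xs)) (carrier M) \<longrightarrow>
       v \<in> ideal_smult A M (set (take i xs)) (carrier M)) \<and>
    ideal_smult A M (set xs) (carrier M) \<noteq> carrier M"

text \<open>Depth of \<open>M\<close> with respect to \<open>\<aa>\<close>. It is only meaningful when \<open>\<aa>M \<noteq> M\<close>; in particular
  the zero module is not given depth \<open>\<infinity>\<close> here.\<close>

definition depth ::
    "('a, 'm) ring_scheme \<Rightarrow> 'a set \<Rightarrow> ('a, 'c, 'k) module_scheme \<Rightarrow> enat"
  where "depth A \<aa> M = Sup {enat (length xs) | xs. set xs \<subseteq> \<aa> \<and> regular_sequence A M xs}"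

text \<open>To be used for a finitely generated module over a Noetherian local ring \<open>(A, \<mm>)\<close>.\<close>

definition cm_local :: "('a, 'm) ring_scheme \<Rightarrow> 'a set \<Rightarrow> ('a, 'c, 'k) module_scheme \<Rightarrow> bool"
  where "cm_local A \<mm> M \<longleftrightarrow> carrier M = {\<zero>\<^bsub>M\<^esub>} \<or> depth A \<mm> M = module_dim A M"

text \<open>The fraction \<open>x/s\<close>, for a multiplicative set \<open>W\<close>, as an equivalence class of pairs.\<close>

definition frac ::
    "('a, 'm) ring_scheme \<Rightarrow> ('a, 'c, 'k) module_scheme \<Rightarrow> 'a set \<Rightarrow> 'c \<Rightarrow> 'a \<Rightarrow> ('c \<times> 'a) set"
  where "frac A M W x s =
    {(y, t). y \<in> carrier M \<and> t \<in> W \<and> (\<exists>u\<in>W. u \<odot>\<^bsub>M\<^esub> (t \<odot>\<^bsub>M\<^esub> x) = u \<odot>\<^bsub>M\<^esub> (s \<odot>\<^bsub>M\<^esub> y))}"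

definition frac_add ::
    "('a, 'm) ring_scheme \<Rightarrow> ('a, 'c, 'k) module_scheme \<Rightarrow> 'a set \<Rightarrow>
     ('c \<times> 'a) set \<Rightarrow> ('c \<times> 'a) set \<Rightarrow> ('c \<times> 'a) set"
  where "frac_add A M W U V =
    (\<Union>(x, s)\<in>U. \<Union>(y, t)\<in>V. frac A M W (t \<odot>\<^bsub>M\<^esub> x \<oplus>\<^bsub>M\<^esub> s \<odot>\<^bsub>M\<^esub> y) (s \<otimes>\<^bsub>A\<^esub> t))"

definition frac_smult ::
    "('a, 'm) ring_scheme \<Rightarrow> ('a, 'c, 'k) module_scheme \<Rightarrow> 'a set \<Rightarrow>
     ('a \<times> 'a) set \<Rightarrow> ('c \<times> 'a) set \<Rightarrow> ('c \<times> 'a) set"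
  where "frac_smult A M W U V =
    (\<Union>(x, s)\<in>U. \<Union>(y, t)\<in>V. frac A M W (x \<odot>\<^bsub>M\<^esub> y) (s \<otimes>\<^bsub>A\<^esub> t))"

definition loc_ring :: "('a, 'm) ring_scheme \<Rightarrow> 'a set \<Rightarrow> ('a \<times> 'a) set ring"
  where "loc_ring A W =
    \<lparr>carrier = {frac A (self_module A) W x s | x s. x \<in> carrier A \<and> s \<in> W},
     monoid.mult = frac_smult A (self_module A) W,
     one = frac A (self_module A) W \<one>\<^bsub>A\<^esub> \<one>\<^bsub>A\<^esub>,
     ring.zero = frac A (self_module A) W \<zero>\<^bsub>A\<^esub> \<one>\<^bsub>A\<^esub>,
     add = frac_add A (self_module A) W\<rparr>"

text \<open>The fields \<open>mult\<close> and \<open>one\<close> of a module record carry no information.\<close>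

definition loc_module ::
    "('a, 'm) ring_scheme \<Rightarrow> 'a set \<Rightarrow> ('a, 'c, 'k) module_scheme \<Rightarrow>
     (('a \<times> 'a) set, ('c \<times> 'a) set) module"
  where "loc_module A W M =
    \<lparr>carrier = {frac A M W x s | x s. x \<in> carrier M \<and> s \<in> W},
     monoid.mult = undefined,
     one = undefined,
     ring.zero = frac A M W \<zero>\<^bsub>M\<^esub> \<one>\<^bsub>A\<^esub>,
     add = frac_add A M W,
     module.smult = frac_smult A M W\<rparr>"

text \<open>The extension \<open>PA\<^sub>P\<close> of a prime ideal \<open>P\<close> to the localization at \<open>P\<close>.\<close>

definition loc_max_ideal :: "('a, 'm) ring_scheme \<Rightarrow> 'a set \<Rightarrow> ('a \<times> 'a) set set"
  where "loc_max_ideal A P =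
    {frac A (self_module A) (carrier A - P) x s | x s. x \<in> P \<and> s \<in> carrier A - P}"

definition cohen_macaulay_module ::
    "('a, 'm) ring_scheme \<Rightarrow> ('a, 'c, 'k) module_scheme \<Rightarrow> bool"
  where "cohen_macaulay_module A M \<longleftrightarrow>
    noetherian_ring A \<and> module A M \<and> finitely_generated A M \<and>
    (\<forall>P. maximalideal P A \<longrightarrow>
       cm_local (loc_ring A (carrier A - P)) (loc_max_ideal A P)
         (loc_module A (carrier A - P) M))"

definition cohen_macaulay_ring :: "('a, 'm) ring_scheme \<Rightarrow> bool"
  where "cohen_macaulay_ring A \<longleftrightarrow> cohen_macaulay_module A (self_module A)"

definition cohen_macaulay_local_ring :: "('a, 'm) ring_scheme \<Rightarrow> 'a set \<Rightarrow> bool"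
  where "cohen_macaulay_local_ring A \<mm> \<longleftrightarrow>
    noetherian_ring A \<and> local_ring A \<mm> \<and> cm_local A \<mm> (self_module A)"

definition complete_intersection :: "('a, 'm) ring_scheme \<Rightarrow> 'a set \<Rightarrow> bool"
  where "complete_intersection A J \<longleftrightarrow>
    (\<exists>xs. regular_sequence A (self_module A) xs \<and> J = Idl\<^bsub>A\<^esub> (set xs))"

text \<open>The base ring is the type \<open>'a\<close>; \<open>ring_of_type_algebra\<close> is its ring record.
  Generators of an ideal are \<open>a 1, \<dots>, a n\<close>.\<close>

definition gen_ideal :: "nat \<Rightarrow> (nat \<Rightarrow> 'a::comm_ring_1) \<Rightarrow> 'a set"
  where "gen_ideal n a = Idl\<^bsub>ring_of_type_algebra\<^esub> (a ` {1..n})"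

definition almost_complete_intersection :: "nat \<Rightarrow> (nat \<Rightarrow> 'a::comm_ring_1) \<Rightarrow> bool"
  where "almost_complete_intersection g a \<longleftrightarrow>
    ideal_height ring_of_type_algebra (gen_ideal (g + 1) a) = enat g \<and>
    complete_intersection ring_of_type_algebra (gen_ideal g a) \<and>
    a (g + 1) \<notin> gen_ideal g a"

text \<open>A monomial is its exponent vector and a polynomial its finitely supported family of
  coefficients. The variables of \<open>mpoly_ring n\<close> have the indices \<open>1, \<dots>, n\<close>.\<close>

type_synonym 'a mpolynomial = "(nat \<Rightarrow>\<^sub>0 nat) \<Rightarrow>\<^sub>0 'a"

definition mpoly_ring :: "nat \<Rightarrow> 'a::comm_ring_1 mpolynomial ring"
  where "mpoly_ring n = ring_of_type_algebra
    \<lparr>carrier := {p. \<forall>e\<in>Poly_Mapping.keys p. Poly_Mapping.keys e \<subseteq> {1..n}}\<rparr>"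

definition mconst :: "'a::comm_ring_1 \<Rightarrow> 'a mpolynomial"
  where "mconst r = Poly_Mapping.single 0 r"

definition mdegree :: "(nat \<Rightarrow>\<^sub>0 nat) \<Rightarrow> nat"
  where "mdegree e = (\<Sum>i\<in>Poly_Mapping.keys e. Poly_Mapping.lookup e i)"

definition rees_algebra :: "'a::comm_ring_1 set \<Rightarrow> 'a poly ring"
  where "rees_algebra I = ring_of_type_algebra
    \<lparr>carrier := {p. \<forall>j. poly.coeff p j \<in> ideal_power ring_of_type_algebra I j}\<rparr>"

text \<open>The ideal \<open>(\<mm>, It)\<close> of the Rees algebra.\<close>

definition rees_max_ideal :: "'a::comm_ring_1 set \<Rightarrow> 'a set \<Rightarrow> 'a poly set"
  where "rees_max_ideal \<mm> I = {p \<in> carrier (rees_algebra I). poly.coeff p 0 \<in> \<mm>}"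

text \<open>The homomorphism \<open>T\<^sub>i \<mapsto> a\<^sub>i t\<close>.\<close>

definition rees_map :: "(nat \<Rightarrow> 'a::comm_ring_1) \<Rightarrow> 'a mpolynomial \<Rightarrow> 'a poly"
  where "rees_map a p =
    (\<Sum>e\<in>Poly_Mapping.keys p. Polynomial.smult (Poly_Mapping.lookup p e)
       (\<Prod>i\<in>Poly_Mapping.keys e. (Polynomial.monom (a i) 1) ^ Poly_Mapping.lookup e i))"

definition rees_relations :: "nat \<Rightarrow> (nat \<Rightarrow> 'a::comm_ring_1) \<Rightarrow> 'a mpolynomial set"
  where "rees_relations n a =
    a_kernel (mpoly_ring n) (rees_algebra (gen_ideal n a)) (rees_map a)"

definition linear_relations :: "nat \<Rightarrow> (nat \<Rightarrow> 'a::comm_ring_1) \<Rightarrow> 'a mpolynomial set"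
  where "linear_relations n a =
    {p \<in> rees_relations n a. \<forall>e\<in>Poly_Mapping.keys p. mdegree e = 1}"

definition linear_relations_ideal :: "nat \<Rightarrow> (nat \<Rightarrow> 'a::comm_ring_1) \<Rightarrow> 'a mpolynomial set"
  where "linear_relations_ideal n a = Idl\<^bsub>mpoly_ring n\<^esub> (linear_relations n a)"

definition sym_algebra :: "nat \<Rightarrow> (nat \<Rightarrow> 'a::comm_ring_1) \<Rightarrow> 'a mpolynomial set ring"
  where "sym_algebra n a = mpoly_ring n Quot linear_relations_ideal n a"

definition sym_const :: "nat \<Rightarrow> (nat \<Rightarrow> 'a::comm_ring_1) \<Rightarrow> 'a \<Rightarrow> 'a mpolynomial set"
  where "sym_const n a r = linear_relations_ideal n a +>\<^bsub>mpoly_ring n\<^esub> mconst r"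

definition nonlinear_relations ::
    "nat \<Rightarrow> (nat \<Rightarrow> 'a::comm_ring_1) \<Rightarrow> 'a mpolynomial set set"
  where "nonlinear_relations n a =
    (\<lambda>l. linear_relations_ideal n a +>\<^bsub>mpoly_ring n\<^esub> l) ` rees_relations n a"

text \<open>The map on cosets induced by \<open>h\<close>; used only for \<open>h\<close> constant on each coset.\<close>

definition induced_map :: "('b \<Rightarrow> 'c) \<Rightarrow> 'b set \<Rightarrow> 'c"
  where "induced_map h U = the_elem (h ` U)"

definition sdeg :: "'a::comm_ring_1 set \<Rightarrow> nat \<Rightarrow> (nat \<Rightarrow> 'a) \<Rightarrow> enat"
  where "sdeg \<mm> n a = Inf {enat s | s. 1 \<le> s \<and>
    ideal_smult ring_of_type_algebra (scalar_module mconst (mpoly_ring n))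
      (ideal_power ring_of_type_algebra \<mm> s) (rees_relations n a)
    \<subseteq> linear_relations_ideal n a}"

definition nilpotency_index :: "('a, 'm) ring_scheme \<Rightarrow> enat"
  where "nilpotency_index A =
    Inf {enat s | s. 1 \<le> s \<and> ideal_power A (nilradical A) s = {\<zero>\<^bsub>A\<^esub>}}"

text \<open>\<open>\<mm>C\<close> for an algebra \<open>C\<close> over the base ring with structure map \<open>h\<close>.\<close>

definition extended_ideal ::
    "('a::comm_ring_1 \<Rightarrow> 'c) \<Rightarrow> ('c, 'm) ring_scheme \<Rightarrow> 'a set \<Rightarrow> 'c set"
  where "extended_ideal h C \<mm> =
    ideal_smult ring_of_type_algebra (scalar_module h C) \<mm> (carrier C)"

text \<open>The special fiber ring, with the tensor product of \<open>R[It]\<close> and \<open>R/\<mm>\<close> written as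
  \<open>R[It]/\<mm>R[It]\<close>.\<close>

definition special_fiber :: "'a::comm_ring_1 set \<Rightarrow> 'a set \<Rightarrow> 'a poly set ring"
  where "special_fiber \<mm> I =
    rees_algebra I Quot extended_ideal (\<lambda>r. [:r:]) (rees_algebra I) \<mm>"

definition sym_fiber ::
    "'a::comm_ring_1 set \<Rightarrow> nat \<Rightarrow> (nat \<Rightarrow> 'a) \<Rightarrow> 'a mpolynomial set set ring"
  where "sym_fiber \<mm> n a =
    sym_algebra n a Quot extended_ideal (sym_const n a) (sym_algebra n a) \<mm>"

definition sym_fiber_proj ::
    "'a::comm_ring_1 set \<Rightarrow> nat \<Rightarrow> (nat \<Rightarrow> 'a) \<Rightarrow> 'a mpolynomial set \<Rightarrow> 'a mpolynomial set set"
  where "sym_fiber_proj \<mm> n a x =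
    extended_ideal (sym_const n a) (sym_algebra n a) \<mm> +>\<^bsub>sym_algebra n a\<^esub> x"

text \<open>The kernel of the map from \<open>S/\<mm>S\<close> to the special fiber ring induced by \<open>rees_map a\<close>.\<close>

definition fiber_relations ::
    "'a::comm_ring_1 set \<Rightarrow> nat \<Rightarrow> (nat \<Rightarrow> 'a) \<Rightarrow> 'a mpolynomial set set set"
  where "fiber_relations \<mm> n a =
    a_kernel (sym_fiber \<mm> n a) (special_fiber \<mm> (gen_ideal n a))
      (induced_map (\<lambda>x.
        extended_ideal (\<lambda>r. [:r:]) (rees_algebra (gen_ideal n a)) \<mm>
          +>\<^bsub>rees_algebra (gen_ideal n a)\<^esub> induced_map (rees_map a) x))"

end

theory Submission imports Defs begin

text \<open>
  Let \<open>J = (a\<^sub>1,\<dots>,a\<^sub>g)\<close>, \<open>c = a\<^sub>g\<^sub>+\<^sub>1\<close> and \<open>K = J : c\<close>. As \<open>J\<close> is generated by a regular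
  sequence, \<open>Sym J = R[Ju]\<close>, so sending \<open>T\<^sub>i\<close> to \<open>a\<^sub>iu\<close> and \<open>T\<^sub>g\<^sub>+\<^sub>1\<close> to \<open>t\<close> identifies \<open>Sym I\<close>
  with \<open>R[Ju,t]/(t - cu)KR[Ju,t]\<close>. Each of (a), (b), (c) gives \<open>depth R/K \<ge> d - g\<close> or
  \<open>K = J\<close>, \<open>T = 0\<close>, and depth chasing yields \<open>depth Sym I \<ge> d + 1\<close> at the maximal homogeneous
  ideal; Krull's height theorem gives \<open>dim Sym I \<le> d + 1\<close>. A graded module that is
  Cohen--Macaulay at the maximal homogeneous ideal is so everywhere, since a prime has height
  at most one over the largest graded ideal in it. Part (ii) is the depth lemma for
  \<open>0 \<rightarrow> T \<rightarrow> S \<rightarrow> R[It] \<rightarrow> 0\<close>. For (iii), \<open>T\<close> is \<open>J\<close>-torsion and \<open>S\<close> is unmixed, so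
  elements outside \<open>\<mm>S\<close> act injectively on \<open>T\<close>; multiplying by an element of \<open>T\<close> outside \<open>\<mm>S\<close>,
  which exists for dimension reasons, compares the powers of \<open>T \<inter> \<mm>S\<close> with \<open>\<mm>\<^sup>sT\<close>.
\<close>

text \<open>The hypothesis says that J is generated by some regular sequence xs, not that a_1, ...,
  a_g is one. The a_i therefore serve to present Sym I, while the inductions run along xs. Comparing
  heights leaves two cases: xs has g elements, or it has g - 1. In the second case c is regular
  modulo J, which is why K = J there. Conditions (a), (b), (c) enter only through the depth of R/K,
  which is isomorphic to I/J and so sits in 0 -> I/J -> R/J -> R/I -> 0. The passage from J to J +
  (x) rests on R[(J,x)u] = R[Ju,t]/(t - xu)J R[Ju,t]. This has the shape of the presentation of Sym
  I, with x and J in place of c and K, so one computation serves for the linear type of J, for the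
  depth of R[Ju] and for the depth of Sym I. All modules are subquotients U/V of a ring, possibly
  localized, so a pair of ideals represents them. Depth is the existence of a regular sequence of
  given length; exchange arguments and division by common nonzerodivisors replace homological
  algebra. The ring and module records of the statement are compared with these pairs at the
  end.\<close>

abbreviation "lookup \<equiv> Poly_Mapping.lookup"
abbreviation "keys \<equiv> Poly_Mapping.keys"
abbreviation "single \<equiv> Poly_Mapping.single"

section \<open>Primes, associated primes and prime avoidance\<close>

definition is_ideal :: "'r::comm_ring_1 set => 'r set => bool" where
 "is_ideal C U \<longleftrightarrow> U <= C & 0 : U & (ALL x:U. ALL y:U. x + y : U) & (ALL c:C. ALL x:U. c * x : U)"

definition is_prime :: "'r::comm_ring_1 set => 'r set => bool" where
 "is_prime C P \<longleftrightarrow> is_ideal C P & 1 ~: P & (ALL x:C. ALL y:C. x * y : P --> x : P \<or> y : P)"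

definition is_mult :: "'r::comm_ring_1 set => 'r set => bool" where
 "is_mult C W \<longleftrightarrow> W <= C & 1 : W & (ALL x:W. ALL y:W. x * y : W)"

definition isum :: "'r::comm_ring_1 set => 'r set => 'r set" where
 "isum U V = {u + v | u v. u : U & v : V}"

text \<open>Ideals \<open>V <= U\<close> of a ring and a multiplicative set \<open>W\<close> stand for the module \<open>U/V\<close> localized at \<open>W\<close>; its
 submodules correspond to the ideals \<open>Z = sat W U Z\<close> with \<open>V <= Z <= U\<close>.\<close>

definition sat :: "'r::comm_ring_1 set => 'r set => 'r set => 'r set" where
 "sat W U Z = {v : U. EX w:W. w * v : Z}"

definition nzd_on :: "'r::comm_ring_1 => 'r set => 'r set => bool" where
 "nzd_on x U V \<longleftrightarrow> (ALL v:U. x * v : V --> v : V)"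

definition annid :: "'r::comm_ring_1 set => 'r set => 'r => 'r set" where
 "annid C V v = {c : C. c * v : V}"

definition colon :: "'r::comm_ring_1 set => 'r set => 'r set => 'r set" where
 "colon C V U = {c : C. ALL u:U. c * u : V}"

definition min_over :: "'r::comm_ring_1 set => 'r set => 'r set => bool" where
 "min_over C K P \<longleftrightarrow> is_prime C P & K <= P & (ALL Q. is_prime C Q --> K <= Q --> Q <= P --> Q = P)"

text \<open>The maximal ones among the annihilators of nonzero elements of U/V. They are prime,
  finite in number and cover the zerodivisors on U/V, and so stand in for the full set of associated
  primes.\<close>

definition max_anns :: "'r::comm_ring_1 set => 'r set => 'r set => 'r set set" where
 "max_anns C U V = {annid C V v | v. v : U - V &
   (ALL v':U - V. annid C V v <= annid C V v' --> annid C V v' = annid C V v)}"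

lemma isumI: "u : U ==> v : V ==> u + v : isum U V"
 by (auto simp: isum_def)

lemma isumE: assumes "x : isum U V" obtains u v where "u : U" "v : V" "x = u + v"
 using assms by (auto simp: isum_def)

lemma satI: "v : U ==> w : W ==> w * v : Z ==> v : sat W U Z"
 by (auto simp: sat_def)

lemma satE: assumes "v : sat W U Z" obtains w where "v : U" "w : W" "w * v : Z"
 using assms by (auto simp: sat_def)

lemma nzd_onD: "nzd_on x U V ==> v : U ==> x * v : V ==> v : V"
 by (auto simp: nzd_on_def)

lemma idlD:
 assumes "is_ideal C U"
 shows "U <= C" "0 : U" "x : U ==> y : U ==> x + y : U" "c : C ==> x : U ==> c * x : U"
  "c : C ==> x : U ==> x * c : U"
 using assms by (auto simp: is_ideal_def mult.commute)

lemma prmD: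
 assumes "is_prime C P"
 shows "is_ideal C P" "1 ~: P" "x : C ==> y : C ==> x * y : P ==> x : P \<or> y : P"
 using assms by (auto simp: is_prime_def)

lemma min_overD:
 assumes "min_over C K P"
 shows "is_prime C P" "K <= P" "is_prime C Q ==> K <= Q ==> Q <= P ==> Q = P"
 using assms by (auto simp: min_over_def)

section \<open>Ideals of a subring, saturation, prime avoidance\<close>

locale comm_subring =
 fixes C :: "'r::comm_ring_1 set"
 assumes one_mem [simp, intro]: "1 : C"
  and add_mem [simp, intro]: "x : C ==> y : C ==> x + y : C"
  and mult_mem [simp, intro]: "x : C ==> y : C ==> x * y : C"
  and uminus_mem [simp, intro]: "x : C ==> - x : C"
begin

abbreviation "idl \<equiv> is_ideal C"
abbreviation "prm \<equiv> is_prime C"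

lemma zero_mem [simp, intro]: "0 : C"
 using add_mem[OF one_mem uminus_mem[OF one_mem]] by simp

lemma diff_mem [simp, intro]: "x : C ==> y : C ==> x - y : C"
 using add_mem[of x "- y"] by simp

lemma power_mem [simp, intro]: "x : C ==> x ^ n : C"
 by (induction n) auto

lemma idl_uminus: "idl U ==> x : U ==> - x : U"
 using idlD(4)[of C U "- 1" x] by auto

lemma idl_diff: "idl U ==> x : U ==> y : U ==> x - y : U"
 using idlD(3)[of C U x "- y"] idl_uminus[of U y] by simp

lemma idl_add_cancel: "idl U ==> x + y : U ==> y : U ==> x : U"
 using idl_diff[of U "x + y" y] by simp

lemma idl_add_cancel': "idl U ==> x + y : U ==> x : U ==> y : U"
 using idl_diff[of U "x + y" x] by simp

lemma idl_mult: "idl U ==> c : C ==> x : U ==> c * x : U"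
 by (rule idlD(4))

lemma idl_add: "idl U ==> x : U ==> y : U ==> x + y : U"
 by (rule idlD(3))

lemma idl_lin: "idl U ==> a : C ==> b : C ==> x : U ==> y : U ==> a * x + b * y : U"
 using idlD(3,4) by metis

lemma idl_lin_diff: "idl U ==> a : C ==> b : C ==> x : U ==> y : U ==> a * x - b * y : U"
 using idl_diff idlD(4) by metis

lemma idl_C [simp, intro]: "idl C"
 by (auto simp: is_ideal_def)

lemma idl_zero [simp, intro]: "idl {0}"
 by (auto simp: is_ideal_def)

lemma idl_mem: "idl U ==> u : U ==> u : C"
 using idlD(1) by blast

lemma idl_isum: assumes "idl U" "idl V" shows "idl (isum U V)"
proof -
 have "isum U V <= C" using assms by (auto simp: isum_def dest: idl_mem)
 moreover have "0 : isum U V" using isumI[of 0 U 0 V] assms by (auto simp: is_ideal_def)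
 moreover have "x + y : isum U V" if "x : isum U V" "y : isum U V" for x y
 proof -
  obtain a b c d where "a : U" "b : V" "c : U" "d : V" "x = a + b" "y = c + d"
   using \<open>x : isum U V\<close> \<open>y : isum U V\<close> by (auto elim!: isumE)
  then have "(a + c) + (b + d) : isum U V" using assms by (intro isumI) (auto dest: idlD(3))
  then show ?thesis using \<open>x = a + b\<close> \<open>y = c + d\<close> by (simp add: algebra_simps)
 qed
 moreover have "c * x : isum U V" if "c : C" "x : isum U V" for c x
 proof -
  obtain a b where "a : U" "b : V" "x = a + b" using \<open>x : isum U V\<close> by (auto elim!: isumE)
  then have "c * a + c * b : isum U V" using assms that by (intro isumI) (auto dest: idlD(4))
  then show ?thesis using \<open>x = a + b\<close> by (simp add: algebra_simps)
 qed
 ultimately show ?thesis by (auto simp: is_ideal_def)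
qed

lemma isum_upper1: "idl V ==> U <= isum U V"
 using isumI[of _ U 0 V] idlD(2)[of C V] by fastforce

lemma isum_upper2: "idl U ==> V <= isum U V"
 using isumI[of 0 U _ V] idlD(2)[of C U] by fastforce

lemma isum_least: "idl Z ==> U <= Z ==> V <= Z ==> isum U V <= Z"
 by (auto simp: isum_def dest: idlD(3) subsetD)

lemma idl_image: assumes "idl U" "x : C" shows "idl ((*) x ` U)"
proof -
 have "(*) x ` U <= C" using assms by (auto dest: idl_mem)
 moreover have "0 : (*) x ` U" using assms idlD(2)[of C U] image_iff by fastforce
 moreover have "x * a + x * b : (*) x ` U" if "a : U" "b : U" for a b
  using assms that idlD(3)[of C U a b] by (auto simp: distrib_left[symmetric])
 moreover have "c * (x * a) : (*) x ` U" if "c : C" "a : U" for a c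
  using assms that idlD(4)[of C U c a] by (auto simp: image_iff intro!: bexI[of _ "c * a"])
 ultimately show ?thesis by (auto simp: is_ideal_def)
qed

lemma image_sub: "idl U ==> x : C ==> (*) x ` U <= U"
 by (auto dest: idlD(4))

lemma image_principal_sub: "idl U ==> x : U ==> (*) x ` C <= U"
 by (auto dest: idlD(5))

lemma mem_principal: "z : (*) z ` C"
 using image_eqI[of z "(*) z" 1 C] by simp

lemma idl_Int: "idl U ==> idl V ==> idl (U \<inter> V)"
 by (auto simp: is_ideal_def)

lemma idl_Inter: assumes "F ~= {}" "!!I. I : F ==> idl I" shows "idl (\<Inter>F)"
proof -
 obtain I where "I : F" using assms by auto
 then have "\<Inter>F <= C" using assms(2)[of I] idlD(1) by blast
 then show ?thesis using assms(2) by (auto simp: is_ideal_def)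
qed

lemma idl_sat: assumes "idl U" "idl Z" "is_mult C W" shows "idl (sat W U Z)"
proof -
 have "sat W U Z <= C" using assms by (auto simp: sat_def dest: idl_mem)
 moreover have "0 : sat W U Z"
  using assms by (auto simp: sat_def is_ideal_def is_mult_def intro!: bexI[of _ 1])
 moreover have "x + y : sat W U Z" if xy: "x : sat W U Z" "y : sat W U Z" for x y
 proof -
  obtain w w' where w: "x : U" "w : W" "w * x : Z" and w': "y : U" "w' : W" "w' * y : Z"
   using xy by (auto elim!: satE)
  have "w : C" "w' : C" using w w' assms by (auto simp: is_mult_def)
  then have "w' * (w * x) + w * (w' * y) : Z"
   using assms(2) w(3) w'(3) by (auto intro: idlD(3)[of C Z] idlD(4)[of C Z])
  moreover have "w' * (w * x) + w * (w' * y) = (w * w') * (x + y)" by (simp add: algebra_simps)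
  ultimately show ?thesis using w w' assms
   by (intro satI[of _ _ "w * w'"]) (auto simp: is_mult_def dest: idlD(3))
 qed
 moreover have "c * x : sat W U Z" if x: "c : C" "x : sat W U Z" for c x
 proof -
  obtain w where w: "x : U" "w : W" "w * x : Z" using x by (auto elim!: satE)
  have "c * (w * x) : Z" using assms w x by (auto dest: idlD(4))
  moreover have "c * (w * x) = w * (c * x)" by (simp add: algebra_simps)
  ultimately show ?thesis using w x assms by (intro satI[of _ _ w]) (auto dest: idlD(4))
 qed
 ultimately show ?thesis by (auto simp: is_ideal_def)
qed

lemma sat_upper: "is_mult C W ==> Z <= U ==> Z <= sat W U Z"
 by (auto simp: sat_def is_mult_def intro!: bexI[of _ 1])

lemma sat_sub: "sat W U Z <= U"
 by (auto simp: sat_def)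

lemma sat_mono: "Z <= Z' ==> sat W U Z <= sat W U Z'"
 by (auto simp: sat_def)

lemma nzd_on_sat: assumes "is_mult C W" "w : W" shows "nzd_on w U (sat W U Z)"
proof -
 have "v : sat W U Z" if v: "v : U" "w * v : sat W U Z" for v
 proof -
  obtain w' where "w' : W" "w' * (w * v) : Z" using v by (auto simp: sat_def)
  then show ?thesis using assms v
   by (intro satI[of _ _ "w' * w"]) (auto simp: is_mult_def mult.assoc)
 qed
 then show ?thesis by (auto simp: nzd_on_def)
qed

text \<open>Under \<open>clsd W U V\<close> the quotient U/V embeds into its localization at W. The
  submodules of that localization correspond to the Z between V and U with
  \<open>clsd W U Z\<close>.\<close>

definition clsd :: "'r set => 'r set => 'r set => bool" where
 "clsd W U V \<longleftrightarrow> idl U & idl V & V <= U & (ALL w:W. nzd_on w U V)"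

lemma clsdD:
 assumes "clsd W U V"
 shows "idl U" "idl V" "V <= U" "w : W ==> v : U ==> w * v : V ==> v : V"
 using assms by (auto simp: clsd_def nzd_on_def)

lemma clsd_sat: "idl U ==> idl Z ==> is_mult C W ==> clsd W U (sat W U Z)"
 by (auto simp: clsd_def idl_sat nzd_on_sat dest: subsetD[OF sat_sub])

lemma sat_least: "clsd W U V ==> Z <= V ==> sat W U Z <= V"
 by (auto elim!: satE intro: clsdD(4))

lemma mult_compl: "prm P ==> is_mult C (C - P)"
 by (auto simp: is_mult_def dest: prmD)

lemma mult_one: "is_mult C {1}"
 by (auto simp: is_mult_def)

lemma is_mult_powers:
 assumes "is_mult C W" "x : C" shows "is_mult C {w * x ^ k | w k. w : W}"
proof -
 have "1 * x ^ 0 : {w * x ^ k | w k. w : W}" using assms unfolding is_mult_def by blast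
 moreover have "(w * x ^ k) * (w' * x ^ k') : {w * x ^ k | w k. w : W}" if "w : W" "w' : W" for w w' k k'
 proof -
  have "(w * x ^ k) * (w' * x ^ k') = (w * w') * x ^ (k + k')" by (simp add: power_add algebra_simps)
  then show ?thesis using that assms unfolding is_mult_def by blast
 qed
 ultimately show ?thesis using assms unfolding is_mult_def by auto
qed

lemma idl_annid: assumes "idl V" "v : C" shows "idl (annid C V v)"
 using assms by (auto simp: is_ideal_def annid_def algebra_simps)

lemma idl_colon: "idl V ==> U <= C ==> idl (colon C V U)"
 by (auto simp: is_ideal_def colon_def algebra_simps subset_iff)

lemma prm_idl: "prm P ==> idl P" by (simp add: is_prime_def)

lemma prm_mult_notin: "prm P ==> x : C ==> y : C ==> x ~: P ==> y ~: P ==> x * y ~: P"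
 by (auto dest: prmD)

lemma prm_power: "prm P ==> x : C ==> x ^ n : P ==> x : P"
proof (induction n)
 case (Suc n) then show ?case using prmD(3)[of C P x "x ^ n"] by auto
qed (auto dest: prmD)

text \<open>Multiply one witness per ideal. Closure of H under products keeps the result among the
  elements that prime avoidance may use.\<close>

lemma inter_not_sub:
 assumes "finite S" "prm Q" "H <= C" "1 : H" "!!x y. x : H ==> y : H ==> x * y : H"
  and "!!I. I : S ==> idl I & (EX h:H \<inter> I. h ~: Q)"
 shows "EX z:H. (ALL I:S. z : I) & z ~: Q"
 using assms(1,6)
proof (induction S)
 case empty then show ?case using assms(2,4) by (auto dest: prmD)
next
 case (insert I S)
 obtain z where z: "z : H" "ALL I:S. z : I" "z ~: Q" using insert by blast
 obtain h where h: "h : H" "h : I" "h ~: Q" "idl I" using insert.prems by blast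
 have "h * z : J" if "J : insert I S" for J
  using that h z assms(3) insert.prems by (auto dest: idlD(4,5) subsetD)
 moreover have "h * z ~: Q" using h z assms(2,3) by (intro prm_mult_notin) auto
 ultimately show ?case using assms(5) h z by blast
qed

text \<open>The set \<open>H\<close> is either the whole ring or the set of homogeneous elements; in the second
 case \<open>s\<close> and \<open>t\<close> adjust the degrees.\<close>

lemma prime_avoidance:
 assumes fin: "finite F" and pr: "!!Q. Q : F ==> prm Q"
  and H: "H <= C" "0 : H" "1 : H" "!!x y. x : H ==> y : H ==> x * y : H"
  and comb: "!!y z. y : H ==> z : H ==>
    EX s:C. EX t:C. s * y + t * z : H & (ALL Q:F. s ~: Q & t ~: Q)"
  and wit: "!!P Q. P : F ==> Q : F ==> ~ P <= Q ==> EX h:H \<inter> P. h ~: Q"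
  and a: "idl A" "!!Q. Q : F ==> EX h:H \<inter> A. h ~: Q"
 shows "EX y:H \<inter> A. ALL Q:F. y ~: Q"
proof -
 \<comment> \<open>It suffices to avoid the maximal members of F. Among these there are no
   inclusions, so each contains an admissible element outside any other.\<close>
 define G where "G = {Q : F. ALL P:F. Q <= P --> Q = P}"
 have above: "EX P:G. Q <= P" if "Q : F" for Q
  using finite_has_maximal2[OF fin that] by (auto simp: G_def)
 have main: "G' <= G ==> EX y:H \<inter> A. ALL Q:G'. y ~: Q" if "finite G'" for G'
  using that
 proof (induction G')
  case empty then show ?case using H a by (auto dest: idlD)
 next
  case (insert q G')
  obtain y where y: "y : H" "y : A" "ALL Q:G'. y ~: Q" using insert by auto
  have q: "q : F" "q : G" "prm q" using insert.prems pr by (auto simp: G_def)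
  show ?case
  proof (cases "y : q")
   case False then show ?thesis using y by blast
  next
   case True
   obtain h where h: "h : H" "h : A" "h ~: q" using a q by blast
   have "idl I & (EX h:H \<inter> I. h ~: q)" if "I : G'" for I
   proof -
    have "I : F" "I ~= q" using that insert by (auto simp: G_def)
    moreover have "~ I <= q" using that insert q \<open>I ~= q\<close> by (auto simp: G_def)
    ultimately show ?thesis using wit[of I q] q pr[of I] by (auto dest: prmD)
   qed
   then obtain z where z: "z : H" "ALL I:G'. z : I" "z ~: q"
    using inter_not_sub[of G' q H] insert.hyps q H by blast
   have hC: "h : C" "z : C" "y : C" using h(1) z(1) y(1) H(1) by auto
   have hz: "h * z : H" "h * z : A" "h * z ~: q" "h : C" "z : C" "y : C"
    using H(4)[OF h(1) z(1)] idlD(5)[OF a(1) hC(2) h(2)] prm_mult_notin[OF q(3) hC(1,2) h(3) z(3)] hC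
    by auto
   obtain s t where st: "s : C" "t : C" "s * y + t * (h * z) : H" "ALL Q:F. s ~: Q & t ~: Q"
    using comb[of y "h * z"] y hz by blast
   have "s * y + t * (h * z) : A" using st y hz a by (auto intro!: idlD(3)[of C A] dest: idlD(4))
   moreover have "s * y + t * (h * z) ~: Q" if "Q : G'" for Q
   proof
    assume "s * y + t * (h * z) : Q"
    have Q: "Q : F" "prm Q" "idl Q" using that insert.prems pr by (auto simp: G_def dest: prmD)
    have "z : Q" using z that by blast
    then have "t * (h * z) : Q" using Q hz st by (auto dest: idlD(4))
    then have "s * y : Q" using Q \<open>s * y + t * (h * z) : Q\<close> idl_add_cancel by blast
    then show False using prm_mult_notin[of Q s y] Q st hz y that by blast
   qed
   moreover have "s * y + t * (h * z) ~: q"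
   proof
    assume *: "s * y + t * (h * z) : q"
    have "s * y : q" using True st q by (auto dest!: prmD(1) idlD(4))
    then have "t * (h * z) : q" using * q idl_add_cancel' prm_idl by blast
    then show False using prm_mult_notin[of q t "h * z"] q st hz by blast
   qed
   ultimately show ?thesis using st by blast
  qed
 qed
 have "finite G" using fin by (auto simp: G_def)
 then obtain y where y: "y : H \<inter> A" "ALL Q:G. y ~: Q" using main[of G] by blast
 then have "ALL Q:F. y ~: Q" using above by blast
 then show ?thesis using y by blast
qed

lemma prime_avoidance_all:
 assumes "finite F" "!!Q. Q : F ==> prm Q" "idl A" "!!Q. Q : F ==> ~ A <= Q"
 shows "EX y:A. ALL Q:F. y ~: Q"
proof -
 have "EX y:C \<inter> A. ALL Q:F. y ~: Q"
 proof (rule prime_avoidance)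
  show "EX s:C. EX t:C. s * y + t * z : C & (ALL Q:F. s ~: Q & t ~: Q)" if "y : C" "z : C" for y z
   using that assms(2) by (intro bexI[of _ 1]) (auto dest: prmD)
  show "EX h:C \<inter> P. h ~: Q" if "P : F" "Q : F" "~ P <= Q" for P Q
   using that assms(2)[of P] by (auto dest!: prmD(1) idlD(1))
  show "EX h:C \<inter> A. h ~: Q" if "Q : F" for Q
   using assms(3) assms(4)[OF that] by (auto dest!: idlD(1))
 qed (use assms in auto)
 then show ?thesis by blast
qed

end

section \<open>Maximal annihilators and Nakayama's lemma over a Noetherian ring\<close>

locale noeth_subring = comm_subring C for C :: "'r::comm_ring_1 set" +
 assumes noeth: "F ~= {} ==> (!!I. I : F ==> is_ideal C I) ==> EX I:F. ALL J:F. I <= J --> J = I"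
begin

lemma noeth_max:
 assumes "K : F" "!!I. I : F ==> idl I"
 obtains M where "M : F" "!!J. J : F ==> M <= J ==> J = M"
proof -
 have "F ~= {}" using assms(1) by auto
 from noeth[OF this assms(2)] show ?thesis using that by blast
qed

lemma prime_exists:
 assumes "idl K" "is_mult C W" "K \<inter> W = {}"
 shows "EX Q. prm Q & K <= Q & Q \<inter> W = {}"
proof -
 define F where "F = {I. idl I & K <= I & I \<inter> W = {}}"
 have "K : F" using assms by (auto simp: F_def)
 moreover have "!!I. I : F ==> idl I" by (simp add: F_def)
 ultimately obtain Q where Q: "Q : F" "!!J. J : F ==> Q <= J ==> J = Q" using noeth_max by blast
 have idlQ: "idl Q" "K <= Q" "Q \<inter> W = {}" using Q by (auto simp: F_def)
 have "x : Q \<or> y : Q" if xy: "x : C" "y : C" "x * y : Q" for x y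
 proof (rule ccontr)
  assume neg: "~ (x : Q \<or> y : Q)"
  have *: "EX w:W. EX q:Q. EX c:C. w = q + z * c" if z: "z : C" "z ~: Q" for z
  proof -
   let ?J = "isum Q ((*) z ` C)"
   have J: "idl ?J" "Q <= ?J" using idlQ z by (auto intro!: idl_isum idl_image isum_upper1 dest: subsetD)
   have "z : ?J" using isum_upper2[OF idlQ(1), of "(*) z ` C"] mem_principal[of z] by blast
   then have "?J ~: F" using J Q z by blast
   then have "?J \<inter> W ~= {}" using J idlQ by (auto simp: F_def)
   then show ?thesis by (auto elim!: isumE)
  qed
  obtain w q c where w: "w : W" "q : Q" "c : C" "w = q + x * c" using *[of x] xy neg by blast
  obtain w' q' c' where w': "w' : W" "q' : Q" "c' : C" "w' = q' + y * c'" using *[of y] xy neg by blast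
  have "w' * q + (x * c) * q' + (c * c') * (x * y) : Q"
   using w(2,3) w'(2,3) xy assms(2) w'(1) by (auto simp: is_mult_def simp del: mult_mem intro!: idlD(3)[OF idlQ(1)] idlD(4)[OF idlQ(1)] mult_mem)
  moreover have "w' * q + (x * c) * q' + (c * c') * (x * y) = w * w'" using w w' by (simp add: algebra_simps)
  ultimately show False using w w' idlQ assms(2) by (auto simp: is_mult_def)
 qed
 then have "prm Q" using idlQ assms(2) by (auto simp: is_prime_def is_mult_def)
 then show ?thesis using idlQ by blast
qed

lemma max_anns_prime: assumes "idl U" "idl V" "Q : max_anns C U V" shows "prm Q"
proof -
 obtain v where v: "v : U - V" "Q = annid C V v"
  and mx: "!!v'. v' : U - V ==> annid C V v <= annid C V v' ==> annid C V v' = annid C V v"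
  using assms by (auto simp: max_anns_def)
 have "v : C" using v assms by (auto dest: idl_mem)
 have "x : Q \<or> y : Q" if "x : C" "y : C" "x * y : Q" for x y
 proof (rule ccontr)
  assume neg: "~ (x : Q \<or> y : Q)"
  have yv: "y * v : U - V" using neg that v assms by (auto simp: annid_def dest: idlD(4))
  moreover have "annid C V v <= annid C V (y * v)"
  proof
   fix c assume c: "c : annid C V v"
   then have "y * (c * v) : V" using that(2) by (auto simp: annid_def intro: idlD(4)[OF assms(2)])
   then show "c : annid C V (y * v)" using c by (auto simp: annid_def algebra_simps)
  qed
  ultimately have "annid C V (y * v) = annid C V v" by (rule mx)
  moreover have "x : annid C V (y * v)" using that v by (auto simp: annid_def algebra_simps)
  ultimately show False using neg v by auto
 qed
 moreover have "1 ~: Q" using v by (auto simp: annid_def)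
 ultimately show ?thesis using idl_annid[OF assms(2) \<open>v : C\<close>] v by (auto simp: is_prime_def)
qed

lemma max_anns_above:
 assumes "idl U" "idl V" "v : U - V"
 shows "EX Q:max_anns C U V. annid C V v <= Q"
proof -
 define F where "F = {annid C V v' | v'. v' : U - V & annid C V v <= annid C V v'}"
 have "annid C V v : F" using assms by (auto simp: F_def)
 moreover have "idl I" if "I : F" for I
  using that assms by (auto simp: F_def intro!: idl_annid dest: idl_mem)
 ultimately obtain I where I: "I : F" "!!J. J : F ==> I <= J ==> J = I" using noeth_max by blast
 then obtain v' where v': "v' : U - V" "annid C V v <= annid C V v'" "I = annid C V v'" by (auto simp: F_def)
 have "annid C V v'' = annid C V v'" if "v'' : U - V" "annid C V v' <= annid C V v''" for v''
  using I that v' by (auto simp: F_def)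
 then have "I : max_anns C U V" using v' unfolding max_anns_def by blast
 then show ?thesis using v' by blast
qed

lemma not_nzd_max_anns:
 assumes "idl U" "idl V" "x : C" "~ nzd_on x U V"
 shows "EX Q:max_anns C U V. x : Q"
proof -
 obtain v where "v : U - V" "x * v : V" using assms by (auto simp: nzd_on_def)
 then show ?thesis using max_anns_above[OF assms(1,2), of v] assms(3) by (auto simp: annid_def)
qed

text \<open>Choose \<open>g Q\<close> in U with annihilator Q. A largest ideal among those generated
  by V and finitely many \<open>g Q\<close> contains every further \<open>g Q\<close>. Hence each Q
  contains the intersection of finitely many members, so one of them by primality, and equals it by
  maximality.\<close>

lemma finite_max_anns:
 assumes "idl U" "idl V" "V <= U"
 shows "finite (max_anns C U V)"
proof -
 have "EX v. v : U - V & Q = annid C V v" if "Q : max_anns C U V" for Q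
  using that by (auto simp: max_anns_def)
 then obtain g where g: "!!Q. Q : max_anns C U V ==> g Q : U - V & Q = annid C V (g Q)" by metis
 define gen where "gen S = \<Inter>{I. idl I & V <= I & g ` S <= I}" for S
 have gC: "Q : max_anns C U V ==> g Q : C" for Q using g assms by (auto dest: idl_mem)
 have idl_gen: "idl (gen S)" if "S <= max_anns C U V" for S
 proof -
  have "g ` S <= C" using gC that by auto
  then have "C : {I. idl I & V <= I & g ` S <= I}" using idlD(1)[OF assms(2)] by auto
  then show ?thesis unfolding gen_def by (intro idl_Inter) auto
 qed
 define F where "F = {gen S | S. finite S & S <= max_anns C U V}"
 have "gen {} : F" by (auto simp: F_def)
 moreover have "!!I. I : F ==> idl I" using idl_gen by (auto simp: F_def)
 ultimately obtain I where I: "I : F" "!!J. J : F ==> I <= J ==> J = I" using noeth_max by blast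
 then obtain S where S: "finite S" "S <= max_anns C U V" "I = gen S" by (auto simp: F_def)
 have "max_anns C U V <= S"
 proof
  fix Q assume Q: "Q : max_anns C U V"
  have "gen (insert Q S) : F" using S Q by (auto simp: F_def)
  moreover have "gen S <= gen (insert Q S)" by (auto simp: gen_def)
  ultimately have eq: "gen (insert Q S) = gen S" using I S by blast
  have "g Q : gen (insert Q S)" by (auto simp: gen_def)
  then have gQ: "g Q : gen S" using eq by simp
  \<comment> \<open>The elements whose annihilator modulo V contains the intersection of S. It is an
    ideal containing V and all \<open>g q\<close> with q in S, so it also contains
    \<open>g Q\<close>.\<close>
  define Z where "Z = {v : U. ALL c:C \<inter> \<Inter>S. c * v : V}"
  have "idl Z" using assms unfolding Z_def is_ideal_def by (auto simp: algebra_simps subset_iff)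
  moreover have "V <= Z" using assms by (auto simp: Z_def dest: idlD(4))
  moreover have "g ` S <= Z"
  proof (safe, unfold Z_def, safe)
   fix q assume q: "q : S" then show "g q : U" using g S by auto
   fix c assume "c : C" "c : \<Inter>S"
   then have "c : annid C V (g q)" using g S q by blast
   then show "c * g q : V" by (auto simp: annid_def)
  qed
  ultimately have "g Q : Z" using gQ by (auto simp: gen_def)
  then have sub: "C \<inter> \<Inter>S <= Q" using g[OF Q] by (auto simp: Z_def annid_def)
  have prQ: "prm Q" using max_anns_prime assms Q by blast
  have "EX Q':S. Q' <= Q"
  proof (rule ccontr)
   assume "~ ?thesis"
   then have ns: "~ I <= Q" if "I : S" for I using that by blast
   have "idl I & (EX h:C \<inter> I. h ~: Q)" if "I : S" for I
   proof -
    have "idl I" using max_anns_prime[OF assms(1,2), of I] S that prm_idl by blast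
    then show ?thesis using ns[OF that] idlD(1)[of C I] by blast
   qed
   then have "EX z:C. (ALL I:S. z : I) & z ~: Q"
    by (intro inter_not_sub[OF S(1) prQ]) auto
   then obtain z where "z : C" "ALL I:S. z : I" "z ~: Q" by blast
   then show False using sub by auto
  qed
  then obtain Q' where Q': "Q' : S" "Q' <= Q" by blast
  then have "Q' : max_anns C U V" using S by blast
  then have "Q = Q'" using Q Q' unfolding max_anns_def by blast
  then show "Q : S" using Q' by simp
 qed
 then show ?thesis using S finite_subset by blast
qed

text \<open>Prime avoidance against all maximal annihilators of all the modules at once. None
  contains A, because A has a nonzerodivisor on each module.\<close>

lemma common_nzd:
 assumes "finite M" "!!U V. (U, V) : M ==> idl U & idl V & V <= U" "idl A"
  and "!!U V. (U, V) : M ==> EX x:A. nzd_on x U V"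
 shows "EX x:A. ALL (U, V):M. nzd_on x U V"
proof -
 define F where "F = (\<Union>(U, V)\<in>M. max_anns C U V)"
 have "finite F" using assms by (auto simp: F_def intro!: finite_max_anns)
 moreover have "prm Q" if "Q : F" for Q using that assms max_anns_prime by (fastforce simp: F_def)
 moreover have "~ A <= Q" if QF: "Q : F" for Q
 proof
  assume sub: "A <= Q"
  obtain U V where UV: "(U, V) : M" "Q : max_anns C U V" using QF by (auto simp: F_def)
  then obtain v where v: "v : U - V" "Q = annid C V v" by (auto simp: max_anns_def)
  obtain x where "x : A" "nzd_on x U V" using assms UV by blast
  then show False using v sub by (auto simp: nzd_on_def annid_def)
 qed
 ultimately obtain y where y: "y : A" "ALL Q:F. y ~: Q" using prime_avoidance_all assms(3) by metis
 have "nzd_on y U V" if "(U, V) : M" for U V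
  using not_nzd_max_anns[of U V y] assms(2)[OF that] y that assms(3) by (auto simp: F_def dest: idl_mem)
 then show ?thesis using y by auto
qed

text \<open>If A consists of zerodivisors, prime avoidance puts all of A into a single maximal
  annihilator, so one element v is killed by the whole of A.\<close>

lemma no_nzd_killed:
 assumes "idl U" "idl V" "V <= U" "idl A" "!!x. x : A ==> ~ nzd_on x U V"
 shows "EX v:U - V. prm (annid C V v) & A <= annid C V v"
proof -
 have "EX Q:max_anns C U V. A <= Q"
 proof (rule ccontr)
  assume "~ ?thesis"
  then obtain y where y: "y : A" "ALL Q:max_anns C U V. y ~: Q"
   using prime_avoidance_all[of "max_anns C U V" A] finite_max_anns max_anns_prime assms by metis
  then show False using not_nzd_max_anns[of U V y] assms by (auto dest: idl_mem)
 qed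
 then obtain Q where Q: "Q : max_anns C U V" "A <= Q" by blast
 then obtain v where "v : U - V" "Q = annid C V v" by (auto simp: max_anns_def)
 then show ?thesis using Q max_anns_prime[OF assms(1,2)] by auto
qed

text \<open>Take Z maximal among the proper saturated submodules above V. If pu were outside Z, the
  saturation of Z + (pu) would be U, so wu = z + puc with w outside P. Then w - cp is also outside P
  and sends u into Z, hence u lies in Z.\<close>

lemma nakayama:
 assumes "prm P" "clsd (C - P) U V" "V ~= U"
 shows "EX Z. clsd (C - P) U Z & V <= Z & Z ~= U & (ALL p:P. ALL u:U. p * u : Z)"
proof -
 define F where "F = {Z. clsd (C - P) U Z & V <= Z & Z ~= U}"
 have "V : F" using assms by (auto simp: F_def)
 moreover have "!!I. I : F ==> idl I" by (auto simp: F_def dest: clsdD)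
 ultimately obtain Z where Z: "Z : F" "!!J. J : F ==> Z <= J ==> J = Z" using noeth_max by blast
 have Z': "clsd (C - P) U Z" "V <= Z" "Z ~= U" using Z by (auto simp: F_def)
 have "p * u : Z" if p: "p : P" "u : U" for p u
 proof (rule ccontr)
  assume neg: "p * u ~: Z"
  note UC = clsdD(1)[OF assms(2)]
  have pC: "p : C" "u : C" using p assms UC by (auto dest: idl_mem prm_idl)
  have pu: "p * u : U" using p pC UC by (auto dest: idlD(4))
  let ?J = "isum Z ((*) (p * u) ` C)"
  have J: "idl ?J" using Z' pC by (auto intro!: idl_isum idl_image dest: clsdD)
  have JU: "?J <= U" using Z' UC pu by (intro isum_least image_principal_sub) (auto dest: clsdD)
  have cl: "clsd (C - P) U (sat (C - P) U ?J)" using J UC assms by (auto intro!: clsd_sat mult_compl)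
  have sub: "?J <= sat (C - P) U ?J" using JU mult_compl[OF assms(1)] by (rule sat_upper[rotated])
  have "Z <= ?J" using pC by (auto intro!: isum_upper1 idl_image dest: subsetD)
  then have ZJ: "Z <= sat (C - P) U ?J" using sub by blast
  have "p * u : ?J" using isum_upper2[of Z "(*) (p * u) ` C"] mem_principal[of "p * u"] clsdD(2)[OF Z'(1)] by blast
  then have "sat (C - P) U ?J ~= Z" using sub neg by blast
  then have "sat (C - P) U ?J ~: F" using Z ZJ by blast
  then have "sat (C - P) U ?J = U" using cl ZJ Z' by (auto simp: F_def)
  then obtain w z c where w: "w : C - P" "z : Z" "c : C" "w * u = z + p * u * c"
  proof -
   have "u : sat (C - P) U ?J" using \<open>sat (C - P) U ?J = U\<close> p by simp
   then obtain w where "w : C - P" "w * u : ?J" by (rule satE)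
   then show ?thesis using that by (auto elim!: isumE)
  qed
  have "c * p : P" using w p assms by (auto dest: prm_idl idlD(4))
  then have "w - c * p : C - P" using w pC assms idl_add_cancel'[of P "c * p" "w - c * p"]
    idlD(3)[of C P "w - c * p" "c * p"] by (auto dest: prm_idl)
  moreover have "(w - c * p) * u : Z" using w by (simp add: algebra_simps)
  ultimately have "u : Z" using clsdD(4)[OF Z'(1)] p by blast
  then show False using neg pC Z' by (auto dest: clsdD idlD(4))
 qed
 then show ?thesis using Z' by blast
qed

end

section \<open>Regular sequences and depth\<close>

text \<open>The saturation of V + xU: the quotient of U by it stands for U/V modulo x, localized at
  W.\<close>

definition qt :: "'r::comm_ring_1 set => 'r set => 'r set => 'r => 'r set" where
 "qt W U V x = sat W U (isum V ((*) x ` U))"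

text \<open>In contrast to \<open>regular_sequence\<close>, the last quotient may be zero; where
  properness matters, Nakayama or a proper ideal above the quotient supplies it.\<close>

primrec regseq :: "'r::comm_ring_1 set => 'r set => 'r set => 'r list => bool" where
 "regseq W U V [] \<longleftrightarrow> True"
| "regseq W U V (x # xs) \<longleftrightarrow> nzd_on x U V & regseq W U (qt W U V x) xs"

primrec quo :: "'r::comm_ring_1 set => 'r set => 'r set => 'r list => 'r set" where
 "quo W U V [] = V"
| "quo W U V (x # xs) = quo W U (qt W U V x) xs"

text \<open>Expresses depth >= n. A zero module satisfies it for all n as soon as A is nonempty, so
  exact sequences with zero terms require no convention.\<close>

definition dpt :: "'r::comm_ring_1 set => 'r set => nat => 'r set => 'r set => bool" where
 "dpt W A n U V \<longleftrightarrow> (EX xs. length xs = n & set xs <= A & regseq W U V xs)"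

definition is_maxl :: "'r::comm_ring_1 set => 'r set => bool" where
 "is_maxl C P \<longleftrightarrow> is_prime C P & (ALL c:C - P. EX d:C. 1 - c * d : P)"

lemma dpt_0 [simp]: "dpt W A 0 U V"
 by (auto simp: dpt_def)

lemma dpt_Suc: "dpt W A (Suc n) U V \<longleftrightarrow> (EX x:A. nzd_on x U V & dpt W A n U (qt W U V x))"
proof
 assume "dpt W A (Suc n) U V"
 then obtain xs where "length xs = Suc n" "set xs <= A" "regseq W U V xs" by (auto simp: dpt_def)
 then show "EX x:A. nzd_on x U V & dpt W A n U (qt W U V x)"
  by (cases xs) (auto simp: dpt_def)
next
 assume "EX x:A. nzd_on x U V & dpt W A n U (qt W U V x)"
 then obtain x xs where "x : A" "nzd_on x U V" "length xs = n" "set xs <= A" "regseq W U (qt W U V x) xs"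
  by (auto simp: dpt_def)
 then show "dpt W A (Suc n) U V" unfolding dpt_def by (intro exI[of _ "x # xs"]) auto
qed

lemma regseq_append: "regseq W U V (xs @ ys) \<longleftrightarrow> regseq W U V xs & regseq W U (quo W U V xs) ys"
 by (induction xs arbitrary: V) auto

lemma quo_append: "quo W U V (xs @ ys) = quo W U (quo W U V xs) ys"
 by (induction xs arbitrary: V) auto

lemma dpt_mono: assumes "dpt W A n U V" "m <= n" shows "dpt W A m U V"
proof -
 obtain xs where xs: "length xs = n" "set xs <= A" "regseq W U V xs" using assms by (auto simp: dpt_def)
 have "regseq W U V (take m xs @ drop m xs)" using xs by simp
 then have "regseq W U V (take m xs)" unfolding regseq_append by blast
 then show ?thesis unfolding dpt_def using xs assms(2) set_take_subset[of m xs]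
  by (intro exI[of _ "take m xs"]) auto
qed

lemma qtI: "v : U ==> w : W ==> v0 : V ==> u : U ==> w * v = v0 + x * u ==> v : qt W U V x"
 unfolding qt_def by (rule satI[of _ _ w]) (auto simp: isum_def)

lemma qtE:
 assumes "v : qt W U V x"
 obtains w v0 u where "v : U" "w : W" "v0 : V" "u : U" "w * v = v0 + x * u"
 using assms by (auto simp: qt_def sat_def isum_def)

section \<open>Quotients by elements and transport of regular sequences\<close>

context comm_subring
begin

lemma clsd_sub: assumes "clsd W U V" "idl Y" "V <= Y" "Y <= U" shows "clsd W Y V"
 unfolding clsd_def nzd_on_def using clsdD[OF assms(1)] assms(2-4) by (meson subsetD)

lemma clsd_qt: "clsd W U V ==> is_mult C W ==> x : C ==> clsd W U (qt W U V x)"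
 unfolding qt_def by (intro clsd_sat idl_isum idl_image) (auto dest: clsdD)

lemma qt_upper:
 assumes "clsd W U V" "is_mult C W" "x : C"
 shows "V <= qt W U V x" "u : U ==> x * u : qt W U V x"
proof -
 have idl: "idl U" "idl V" "V <= U" using assms clsdD by auto
 then have sub: "isum V ((*) x ` U) <= U" using assms by (intro isum_least image_sub) auto
 have s: "isum V ((*) x ` U) <= qt W U V x" unfolding qt_def using assms(2) sub by (rule sat_upper)
 show "V <= qt W U V x" using s isum_upper1[OF idl_image[OF idl(1) assms(3)]] by blast
 show "x * u : qt W U V x" if "u : U" using s isum_upper2[OF idl(2), of "(*) x ` U"] that by blast
qed

lemma qt_least:
 assumes "clsd W U Z" "V <= Z" "!!u. u : U ==> x * u : Z"
 shows "qt W U V x <= Z"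
 unfolding qt_def using assms by (intro sat_least isum_least) (auto dest: clsdD)

lemma qt_mono: "V <= V' ==> qt W U V x <= qt W U V' x"
 unfolding qt_def by (intro sat_mono) (auto simp: isum_def)

lemma qt_swap_sub:
 assumes "clsd W U V" "is_mult C W" "x : C" "z : C"
 shows "qt W U (qt W U V x) z <= qt W U (qt W U V z) x"
proof -
 have z: "clsd W U (qt W U V z)" using assms clsd_qt by blast
 have zx: "clsd W U (qt W U (qt W U V z) x)" using z assms clsd_qt by blast
 show ?thesis
  using qt_upper[OF assms(1,2,4)] qt_upper[OF z assms(2,3)] by (intro qt_least zx qt_mono) auto
qed

lemma qt_swap:
 assumes "clsd W U V" "is_mult C W" "x : C" "z : C"
 shows "qt W U (qt W U V x) z = qt W U (qt W U V z) x"
 using qt_swap_sub[OF assms] qt_swap_sub[OF assms(1,2,4,3)] by auto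

lemma clsd_quo: "clsd W U V ==> is_mult C W ==> set xs <= C ==> clsd W U (quo W U V xs)"
 by (induction xs arbitrary: V) (auto intro: clsd_qt)

lemma quo_upper: "clsd W U V ==> is_mult C W ==> set xs <= C ==> V <= quo W U V xs"
proof (induction xs arbitrary: V)
 case (Cons x xs)
 then show ?case using Cons.IH[of "qt W U V x"] qt_upper(1)[of W U V x] clsd_qt[of W U V x] by auto
qed auto

lemma quo_upper_smult:
 "clsd W U V ==> is_mult C W ==> set xs <= C ==> x : set xs ==> u : U ==> x * u : quo W U V xs"
proof (induction xs arbitrary: V)
 case (Cons y xs)
 then show ?case using Cons.IH[of "qt W U V y"] quo_upper[of W U "qt W U V y" xs]
   qt_upper(2)[of W U V y u] clsd_qt[of W U V y] by auto
qed auto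

lemma quo_least:
 "clsd W U V ==> is_mult C W ==> set xs <= C ==> clsd W U Z ==> V <= Z
  ==> (!!x u. x : set xs ==> u : U ==> x * u : Z) ==> quo W U V xs <= Z"
proof (induction xs arbitrary: V)
 case (Cons y xs)
 then show ?case using Cons.IH[of "qt W U V y"] qt_least[of W U Z V y] clsd_qt[of W U V y] by auto
qed auto

text \<open>The exchange of x and z in a regular sequence. Nothing is assumed local, so the
  regularity of z on U/V is a hypothesis; callers obtain it from \<open>common_nzd\<close>. From xm
  = zm' modulo V, z being regular modulo x gives m' = xm'' and cancelling x gives m = zm''.\<close>

lemma nzd_swap:
 assumes "clsd W U V" "is_mult C W" "x : C" "z : C"
  and "nzd_on x U V" "nzd_on z U (qt W U V x)" "nzd_on z U V"
 shows "nzd_on x U (qt W U V z)"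
 unfolding nzd_on_def
proof safe
 fix m assume m: "m : U" "x * m : qt W U V z"
 note U = clsdD[OF assms(1)]
 obtain w v m' where w: "w : W" "v : V" "m' : U" "w * (x * m) = v + z * m'" using m by (elim qtE)
 have wC: "w : C" using w assms by (auto simp: is_mult_def)
 have "w * (x * m) : qt W U V x" using qt_upper(2)[OF assms(1-3), of "w * m"] U m wC
  by (auto simp: mult.left_commute dest: idlD)
 moreover have "v : qt W U V x" using qt_upper(1)[OF assms(1-3)] w by blast
 ultimately have "z * m' : qt W U V x"
  using w idl_add_cancel'[of "qt W U V x" v "z * m'"] clsdD(2)[OF clsd_qt[OF assms(1-3)]] by auto
 then have "m' : qt W U V x" using assms w by (auto simp: nzd_on_def)
 then obtain w' v' m'' where w': "w' : W" "v' : V" "m'' : U" "w' * m' = v' + x * m''" by (elim qtE)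
 have w'C: "w' : C" using w' assms by (auto simp: is_mult_def)
 have "x * (w' * w * m - z * m'') = w' * (w * (x * m)) - z * (x * m'')" by (simp add: algebra_simps)
 also have "\<dots> = w' * v + z * v'"
 proof -
  have e: "x * m'' = w' * m' - v'" using w' by simp
  show ?thesis unfolding e w(4) by (simp add: algebra_simps)
 qed
 also have "\<dots> : V" using idl_lin[OF U(2) w'C assms(4) w(2) w'(2)] .
 finally have "w' * w * m - z * m'' : V"
  using nzd_onD[OF assms(5) idl_lin_diff[OF U(1) mult_mem[OF w'C wC] assms(4) m(1) w'(3)]] by simp
 then show "m : qt W U V z"
  using m w w' assms(2) by (intro qtI[of m U "w' * w" W "w' * w * m - z * m''" V m'']) (auto simp: is_mult_def)
qed

text \<open>One principle for all isomorphisms between localized subquotients: \<phi> is additive,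
  surjective up to denominators and V', and induces an injection on U/V. It is applied to
  inclusions, constant terms, evaluation of t and multiplication by c or by t - cu.\<close>

lemma regseq_corr:
 fixes \<phi> :: "'r => 's::comm_ring_1"
 assumes C': "comm_subring C'" and W: "is_mult C W" "is_mult C' W'"
  and list: "list_all2 (%x x'. x : C & x' : C' & (ALL u:U. \<phi> (x * u) = x' * \<phi> u)) xs xs'"
  and cl: "clsd W U V" "comm_subring.clsd C' W' U' V'"
  and \<phi>: "!!u. u : U ==> \<phi> u : U'" "!!u v. u : U ==> v : U ==> \<phi> (u + v) = \<phi> u + \<phi> v"
  and surj: "!!u'. u' : U' ==> EX w:W'. EX u:U. w * u' - \<phi> u : V'"
  and W1: "!!w. w : W ==> EX w':W'. ALL u:U. \<phi> (w * u) = w' * \<phi> u"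
  and W2: "!!w'. w' : W' ==> EX w:W. ALL u:U. \<phi> (w * u) = w' * \<phi> u"
  and ker: "!!u. u : U ==> \<phi> u : V' \<longleftrightarrow> u : V"
 shows "regseq W U V xs \<longleftrightarrow> regseq W' U' V' xs'"
 using list cl surj ker
proof (induction xs xs' arbitrary: V V' rule: list_all2_induct)
 case Nil then show ?case by simp
next
 case (Cons x xs x' xs')
 interpret C': comm_subring C' by (rule C')
 note cl = Cons.prems(1,2) and surj = Cons.prems(3) and ker = Cons.prems(4)
 have x: "x : C" "x' : C'" "!!u. u : U ==> \<phi> (x * u) = x' * \<phi> u" using Cons.hyps by auto
 note U = clsdD[OF cl(1)] and U' = C'.clsdD[OF cl(2)]
 have WC: "w : C" if "w : W" for w using that W by (auto simp: is_mult_def)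
 have WC': "w : C'" if "w : W'" for w using that W by (auto simp: is_mult_def)
 have diff: "\<phi> (u - v) = \<phi> u - \<phi> v" if "u : U" "v : U" for u v
  using \<phi>(2)[of "u - v" v] that U idl_diff by simp
 have nzd: "nzd_on x U V \<longleftrightarrow> nzd_on x' U' V'"
 proof
  assume n: "nzd_on x U V"
  show "nzd_on x' U' V'" unfolding nzd_on_def
  proof safe
   fix u' assume u': "u' : U'" "x' * u' : V'"
   obtain w u where w: "w : W'" "u : U" "w * u' - \<phi> u : V'" using surj u' by blast
   have "x' * (w * u' - \<phi> u) : V'" using w x U' by (auto dest: idlD(4))
   moreover have "w * (x' * u') : V'" using idlD(4)[OF U'(2) WC'[OF w(1)] u'(2)] .
   ultimately have "w * (x' * u') - x' * (w * u' - \<phi> u) : V'" using U' by (auto intro: C'.idl_diff)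
   then have "\<phi> (x * u) : V'" using x w by (simp add: algebra_simps)
   then have "x * u : V" using ker[of "x * u"] idlD(4)[OF U(1) x(1) w(2)] by simp
   then have "\<phi> u : V'" using n w ker by (auto simp: nzd_on_def)
   then have "w * u' : V'" using w U' C'.idl_add_cancel[of V' "w * u'" "- \<phi> u"] C'.idl_uminus by auto
   then show "u' : V'" using U'(4) w u' by blast
  qed
 next
  assume n: "nzd_on x' U' V'"
  show "nzd_on x U V" unfolding nzd_on_def
  proof safe
   fix u assume u: "u : U" "x * u : V"
   then have "x' * \<phi> u : V'" using ker[of "x * u"] x U by auto
   then show "u : V" using n u ker \<phi> by (auto simp: nzd_on_def)
  qed
 qed
 have ker1: "\<phi> u : qt W' U' V' x' \<longleftrightarrow> u : qt W U V x" if u: "u : U" for u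
 proof
  assume "u : qt W U V x"
  then obtain w v u1 where w: "w : W" "v : V" "u1 : U" "w * u = v + x * u1" by (elim qtE)
  obtain w' where w': "w' : W'" "ALL u:U. \<phi> (w * u) = w' * \<phi> u" using W1 w by blast
  have "w' * \<phi> u = \<phi> (v + x * u1)" using w(4) w'(2) u by (metis)
  also have "\<dots> = \<phi> v + x' * \<phi> u1"
   using \<phi>(2)[of v "x * u1"] idlD(4)[OF U(1) x(1) w(3)] x(3)[OF w(3)] U(3) w(2) by auto
  finally have "w' * \<phi> u = \<phi> v + x' * \<phi> u1" .
  moreover have "\<phi> v : V'" using ker[of v] w U by auto
  ultimately show "\<phi> u : qt W' U' V' x'" using w' w u \<phi> by (intro qtI[of _ _ w' _ "\<phi> v" _ "\<phi> u1"]) auto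
 next
  assume "\<phi> u : qt W' U' V' x'"
  then obtain w' v' u1' where w': "w' : W'" "v' : V'" "u1' : U'" "w' * \<phi> u = v' + x' * u1'" by (elim qtE)
  obtain w1' u1 where u1: "w1' : W'" "u1 : U" "w1' * u1' - \<phi> u1 : V'" using surj w' by blast
  have "w1' * w' : W'" using u1 w' W by (auto simp: is_mult_def)
  then obtain w where w: "w : W" "!!u. u : U ==> \<phi> (w * u) = w1' * w' * \<phi> u" using W2 by blast
  have "w1' * v' + x' * (w1' * u1' - \<phi> u1) : V'"
   using C'.idl_lin[OF U'(2) WC'[OF u1(1)] x(2) w'(2) u1(3)] .
  also have "w1' * v' + x' * (w1' * u1' - \<phi> u1) = w1' * (w' * \<phi> u) - x' * \<phi> u1"
   using w' by (simp add: algebra_simps)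
  also have "\<dots> = \<phi> (w * u) - \<phi> (x * u1)" using w u x u1 by (simp add: algebra_simps)
  also have "\<dots> = \<phi> (w * u - x * u1)" using diff[of "w * u" "x * u1"] idl_mult[OF U(1)] u w(1) u1(2) x(1) WC by auto
  finally have "w * u - x * u1 : V"
   using ker[OF idl_lin_diff[OF U(1) WC[OF w(1)] x(1) u u1(2)]] by simp
  then show "u : qt W U V x" using w u u1 by (intro qtI[of u U w W "w * u - x * u1" V u1]) auto
 qed
 have "regseq W U (qt W U V x) xs \<longleftrightarrow> regseq W' U' (qt W' U' V' x') xs'"
 proof (rule Cons.IH)
  show "clsd W U (qt W U V x)" using clsd_qt cl W x by blast
  show "C'.clsd W' U' (qt W' U' V' x')" using C'.clsd_qt cl W x by blast
  show "EX w:W'. EX u:U. w * u' - \<phi> u : qt W' U' V' x'" if "u' : U'" for u'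
   using surj[OF that] C'.qt_upper(1)[OF cl(2) W(2) x(2)] by blast
 qed (rule ker1)
 then show ?case using nzd by simp
qed

lemma qt_sat:
 assumes W: "is_mult C W" "is_mult C W'" "W <= W'" and cl: "clsd W U V" and x: "x : C"
 shows "qt W' U (sat W' U V) x = sat W' U (qt W U V x)"
proof
 note U = clsdD[OF cl]
 have cl': "clsd W' U (sat W' U V)" using U W by (intro clsd_sat) auto
 have sub: "V <= sat W' U V" using W U by (intro sat_upper) auto
 have q: "clsd W U (qt W U V x)" using clsd_qt cl W x by blast
 have q': "clsd W' U (qt W' U (sat W' U V) x)" using clsd_qt cl' W x by blast
 have "qt W U V x <= qt W' U (sat W' U V) x"
  using W sub unfolding qt_def sat_def isum_def by blast
 then show "sat W' U (qt W U V x) <= qt W' U (sat W' U V) x" by (rule sat_least[OF q'])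
 show "qt W' U (sat W' U V) x <= sat W' U (qt W U V x)"
 proof (rule qt_least)
  show "clsd W' U (sat W' U (qt W U V x))" using q U W by (intro clsd_sat) (auto dest: clsdD)
  show "sat W' U V <= sat W' U (qt W U V x)" using qt_upper(1)[OF cl W(1) x] by (intro sat_mono)
  show "x * u : sat W' U (qt W U V x)" if "u : U" for u
   using qt_upper(2)[OF cl W(1) x that] sat_upper[OF W(2), of "qt W U V x" U] clsdD(3)[OF q] by blast
 qed
qed

text \<open>Enlarging the set of denominators is exact, so it commutes with dividing by x
  (\<open>qt_sat\<close>) and preserves nonzerodivisors.\<close>

lemma regseq_localize:
 assumes W: "is_mult C W" "is_mult C W'" "W <= W'" and "clsd W U V" "set xs <= C" "regseq W U V xs"
 shows "regseq W' U (sat W' U V) xs"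
 using assms(4-)
proof (induction xs arbitrary: V)
 case (Cons x xs)
 note U = clsdD[OF Cons.prems(1)]
 have x: "x : C" "nzd_on x U V" using Cons.prems by auto
 have WC': "w : C" if "w : W'" for w using that W by (auto simp: is_mult_def)
 have cl': "clsd W' U (sat W' U V)" using U W by (intro clsd_sat) auto
 have sub: "V <= sat W' U V" using W U by (intro sat_upper) auto
 have 1: "nzd_on x U (sat W' U V)" unfolding nzd_on_def
 proof safe
  fix v assume v: "v : U" "x * v : sat W' U V"
  then obtain w where w: "w : W'" "w * (x * v) : V" by (auto simp: sat_def)
  then have "x * (w * v) : V" by (simp add: mult.left_commute)
  then have "w * v : V" using x(2) idlD(4)[OF U(1) WC'[OF w(1)] v(1)] by (auto simp: nzd_on_def)
  then show "v : sat W' U V" using v w by (intro satI) auto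
 qed
 have "qt W' U (sat W' U V) x = sat W' U (qt W U V x)"
  by (rule qt_sat[OF W Cons.prems(1) x(1)])
 moreover have "clsd W U (qt W U V x)" using clsd_qt Cons.prems(1) W x by blast
 ultimately show ?case using Cons.IH[of "qt W U V x"] Cons.prems 1 by simp
qed simp

end

section \<open>Invariance of depth and depth along exact sequences\<close>

context noeth_subring
begin

text \<open>Dividing by any nonzerodivisor y in A lowers the depth by at most one, whichever regular
  sequence witnessed it. The given first element x is traded for a common nonzerodivisor z and then
  z for y; this replaces the description of depth by Ext.\<close>

lemma dpt_inv:
 assumes "is_mult C W" "idl A" "clsd W U V" "dpt W A (Suc n) U V" "y : A" "nzd_on y U V"
 shows "dpt W A n U (qt W U V y)"
 using assms(3-)
proof (induction n arbitrary: V y)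
 case 0 then show ?case by simp
next
 case (Suc n)
 note W = assms(1) and cl = Suc.prems(1)
 note U = clsdD[OF cl]
 obtain x where x: "x : A" "nzd_on x U V" "dpt W A (Suc n) U (qt W U V x)" using Suc.prems by (auto simp: dpt_Suc)
 obtain x2 where x2: "x2 : A" "nzd_on x2 U (qt W U V x)" using x by (auto simp: dpt_Suc)
 have inC: "x : C" "x2 : C" "y : C" using x x2 Suc.prems assms(2) by (auto dest: idl_mem)
 have WC: "w : C" if "w : W" for w using that W by (auto simp: is_mult_def)
 have clx: "clsd W U (qt W U V x)" and cly: "clsd W U (qt W U V y)" using clsd_qt cl W inC by auto
 note yn = Suc.prems(4)
 \<comment> \<open>Otherwise A kills some m outside yU modulo yU. Write xm = ym' and x2 m = y m2 up
   to denominators. Cancelling y gives x2 m' = x m2 modulo V, so m' lies in xU because x2 is regular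
   modulo x; cancelling x then puts m into yU.\<close>
 have "EX x':A. nzd_on x' U (qt W U V y)"
 proof (rule ccontr)
  assume "~ ?thesis"
  then have "EX v:U - qt W U V y. prm (annid C (qt W U V y) v) & A <= annid C (qt W U V y) v"
   using clsdD[OF cly] assms(2) by (intro no_nzd_killed) auto
  then obtain m where m: "m : U" "m ~: qt W U V y" "!!a. a : A ==> a * m : qt W U V y"
   by (auto simp: annid_def)
  obtain w v m' where w: "w : W" "v : V" "m' : U" "w * (x * m) = v + y * m'"
   using m(3)[OF x(1)] by (elim qtE)
  obtain w2 v2 m2 where w2: "w2 : W" "v2 : V" "m2 : U" "w2 * (x2 * m) = v2 + y * m2"
   using m(3)[OF x2(1)] by (elim qtE)
  have "y * (w2 * (x2 * m') - x * (w * m2)) = w2 * x2 * (y * m') - x * w * (y * m2)" by (simp add: algebra_simps)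
  also have "\<dots> = x * w * v2 - w2 * x2 * v"
  proof -
   have e: "y * m' = w * (x * m) - v" "y * m2 = w2 * (x2 * m) - v2" using w w2 by simp_all
   show ?thesis unfolding e by (simp add: algebra_simps)
  qed
  also have "\<dots> : V"
   using idl_lin_diff[OF U(2) mult_mem[OF inC(1) WC[OF w(1)]] mult_mem[OF WC[OF w2(1)] inC(2)] w2(2) w(2)] .
  finally have *: "y * (w2 * (x2 * m') - x * (w * m2)) : V" .
  have mem: "x2 * m' : U" "w * m2 : U" using idlD(4)[OF U(1)] inC w w2 WC by blast+
  have "w2 * (x2 * m') - x * (w * m2) : V"
   using nzd_onD[OF yn idl_lin_diff[OF U(1) WC[OF w2(1)] inC(1) mem] *] .
  then have "x2 * m' : qt W U V x" using w2 mem
   by (intro qtI[of _ _ w2 _ "w2 * (x2 * m') - x * (w * m2)" _ "w * m2"]) auto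
  then have "m' : qt W U V x" using x2 w by (auto simp: nzd_on_def)
  then obtain w3 v3 m3 where w3: "w3 : W" "v3 : V" "m3 : U" "w3 * m' = v3 + x * m3" by (elim qtE)
  have "x * (w3 * w * m - y * m3) = w3 * (w * (x * m)) - y * (x * m3)" by (simp add: algebra_simps)
  also have "\<dots> = w3 * v + y * v3"
  proof -
   have e: "x * m3 = w3 * m' - v3" using w3 by simp
   show ?thesis unfolding e w(4) by (simp add: algebra_simps)
  qed
  also have "\<dots> : V" using idl_lin[OF U(2) WC[OF w3(1)] inC(3) w(2) w3(2)] .
  finally have "w3 * w * m - y * m3 : V"
   using nzd_onD[OF x(2) idl_lin_diff[OF U(1) mult_mem[OF WC[OF w3(1)] WC[OF w(1)]] inC(3) m(1) w3(3)]] by simp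
  then have "m : qt W U V y" using w w3 m W
   by (intro qtI[of _ _ "w3 * w" _ "w3 * w * m - y * m3" _ m3]) (auto simp: is_mult_def)
  then show False using m by blast
 qed
 \<comment> \<open>With z regular on U/V and modulo both x and y, the induction hypothesis is used
   twice: for U/(x) divided by z, which is U/(z) divided by x, and for U/(z) divided by y.\<close>
 then have "EX z:A. ALL (U', V'):{(U, V), (U, qt W U V x), (U, qt W U V y)}. nzd_on z U' V'"
  using x x2 U clsdD[OF clx] clsdD[OF cly] assms(2) by (intro common_nzd) auto
 then obtain z where z: "z : A" "nzd_on z U V" "nzd_on z U (qt W U V x)" "nzd_on z U (qt W U V y)" by auto
 have zC: "z : C" using z assms(2) by (auto dest: idl_mem)
 have clz: "clsd W U (qt W U V z)" using clsd_qt cl W zC by auto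
 have "dpt W A n U (qt W U (qt W U V x) z)" by (rule Suc.IH[OF clx x(3) z(1,3)])
 then have "dpt W A n U (qt W U (qt W U V z) x)" using qt_swap[OF cl W inC(1) zC] by simp
 moreover have "nzd_on x U (qt W U V z)" using nzd_swap[OF cl W inC(1) zC x(2) z(3,2)] .
 ultimately have "dpt W A (Suc n) U (qt W U V z)" using x by (auto simp: dpt_Suc)
 moreover have "nzd_on y U (qt W U V z)" using nzd_swap[OF cl W inC(3) zC yn z(4,2)] .
 ultimately have "dpt W A n U (qt W U (qt W U V z) y)" using Suc.IH[OF clz] Suc.prems(3) by blast
 then have "dpt W A n U (qt W U (qt W U V y) z)" using qt_swap[OF cl W inC(3) zC] by simp
 then show ?case using z by (auto simp: dpt_Suc)
qed

lemma dpt_quo: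
 assumes "is_mult C W" "idl A" "clsd W U V" "dpt W A (length xs + k) U V" "set xs <= A" "regseq W U V xs"
 shows "dpt W A k U (quo W U V xs)"
 using assms(3-)
proof (induction xs arbitrary: V)
 case (Cons x xs)
 have "x : C" using Cons.prems assms(2) by (auto dest: idl_mem)
 then have "clsd W U (qt W U V x)" using clsd_qt Cons.prems(1) assms(1) by blast
 moreover have "dpt W A (length xs + k) U (qt W U V x)" using dpt_inv[OF assms(1,2)] Cons.prems by auto
 ultimately show ?case using Cons by auto
qed simp

text \<open>As z is regular on U/Y, elements of zU in Y come from zY. So Y/V modulo z is isomorphic
  to (Y + zU)/(V + zU), the kernel of U/V -> U/Y after division by z.\<close>

lemma dpt_sub_shift:
 assumes W: "is_mult C W" and A: "idl A" and cl: "clsd W U V" "clsd W U Y" "V <= Y"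
  and z: "z : A" "nzd_on z U V" "nzd_on z U Y"
 shows "dpt W A n (qt W U Y z) (qt W U V z) \<longleftrightarrow> dpt W A n Y (qt W Y V z)"
proof -
 note U = clsdD[OF cl(1)] and Y = clsdD[OF cl(2)]
 have zC: "z : C" using z A by (auto dest: idl_mem)
 let ?Y = "qt W U Y z" and ?V = "qt W U V z"
 have clYV: "clsd W Y V" using clsd_sub[OF cl(1) Y(2) cl(3) Y(3)] .
 have qY: "clsd W U ?Y" and qV: "clsd W U ?V" using clsd_qt cl W zC by auto
 have sub: "?V <= ?Y" using cl by (intro qt_mono)
 have clq: "clsd W ?Y ?V" using clsd_sub[OF qV clsdD(2)[OF qY] sub clsdD(3)[OF qY]] .
 have WC: "w : C" if "w : W" for w using that W by (auto simp: is_mult_def)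
 have "regseq W Y (qt W Y V z) xs \<longleftrightarrow> regseq W ?Y ?V xs" if xs: "set xs <= A" for xs
 proof (rule regseq_corr[where \<phi> = "%x. x"])
  show "comm_subring C" by unfold_locales
  show "list_all2 (%x x'. x : C & x' : C & (ALL u:Y. x * u = x' * u)) xs xs"
   using xs A by (auto simp: list_all2_conv_all_nth dest!: idlD(1) nth_mem)
  show "clsd W Y (qt W Y V z)" using clsd_qt clYV W zC by blast
  show "clsd W ?Y ?V" by (rule clq)
  show "u : ?Y" if "u : Y" for u using qt_upper(1)[OF cl(2) W zC] that by blast
  show "EX w:W. EX u:Y. w * u' - u : ?V" if u': "u' : ?Y" for u'
  proof -
   obtain w y u where w: "w : W" "y : Y" "u : U" "w * u' = y + z * u" using u' by (elim qtE)
   then have "w * u' - y = z * u" by simp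
   then show ?thesis using w qt_upper(2)[OF cl(1) W zC, of u] by (metis)
  qed
  show "u : ?V \<longleftrightarrow> u : qt W Y V z" if u: "u : Y" for u
  proof
   assume "u : ?V"
   then obtain w v u1 where w: "w : W" "v : V" "u1 : U" "w * u = v + z * u1" by (elim qtE)
   have "w * u : Y" using idlD(4)[OF Y(2) WC[OF w(1)] u] .
   moreover have "v : Y" using w cl by auto
   ultimately have "z * u1 : Y" using w idl_add_cancel'[of Y v "z * u1"] Y by auto
   then have "u1 : Y" using z w by (auto simp: nzd_on_def)
   then show "u : qt W Y V z" using w u by (intro qtI[of _ _ w _ v _ u1])
  next
   assume "u : qt W Y V z"
   then show "u : ?V" using Y(3) by (auto elim!: qtE intro: qtI)
  qed
 qed (use W in auto)
 then show ?thesis unfolding dpt_def by blast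
qed

text \<open>For 0 -> Y/V -> U/V -> U/Y -> 0: divide by a common nonzerodivisor of the last two
  terms. The sequence stays exact by \<open>dpt_sub_shift\<close>, and all depths drop by
  one.\<close>

lemma depth_lemma_sub:
 assumes W: "is_mult C W" and A: "idl A"
  and "clsd W U V" "clsd W U Y" "V <= Y" "dpt W A (Suc n) U V" "dpt W A n U Y"
 shows "dpt W A (Suc n) Y V"
 using assms(3-)
proof (induction n arbitrary: V Y)
 case 0
 then show ?case using clsdD(3)[OF 0(2)] by (auto simp: dpt_Suc nzd_on_def subset_iff)
next
 case (Suc n)
 note cl = Suc.prems(1,2,3)
 note U = clsdD[OF cl(1)] and Y = clsdD[OF cl(2)]
 have "EX z:A. ALL (U', V'):{(U, V), (U, Y)}. nzd_on z U' V'"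
  using Suc.prems(4,5) U Y A by (intro common_nzd) (auto simp: dpt_Suc)
 then obtain z where z: "z : A" "nzd_on z U V" "nzd_on z U Y" by auto
 have zC: "z : C" using z A by (auto dest: idl_mem)
 have "dpt W A (Suc n) (qt W U Y z) (qt W U V z)"
 proof (rule Suc.IH)
  show "clsd W U (qt W U V z)" "clsd W U (qt W U Y z)" using clsd_qt cl W zC by auto
  show "qt W U V z <= qt W U Y z" using cl by (intro qt_mono)
  show "dpt W A (Suc n) U (qt W U V z)" "dpt W A n U (qt W U Y z)"
   using dpt_inv[OF W A] Suc.prems z by auto
 qed
 then have "dpt W A (Suc n) Y (qt W Y V z)" using dpt_sub_shift[OF W A cl z] by blast
 moreover have "nzd_on z Y V" using z Y by (auto simp: nzd_on_def subset_iff)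
 ultimately show ?case using z dpt_Suc by blast
qed

text \<open>The same induction, but here a nonzerodivisor on the quotient U/Y has to be found
  first.\<close>

lemma depth_lemma_quot:
 assumes W: "is_mult C W" and A: "idl A"
  and "clsd W U V" "clsd W U Y" "V <= Y" "dpt W A n U V" "dpt W A (Suc n) Y V"
 shows "dpt W A n U Y"
 using assms(3-)
proof (induction n arbitrary: V Y)
 case 0 then show ?case by simp
next
 case (Suc n)
 note cl = Suc.prems(1,2,3)
 note U = clsdD[OF cl(1)] and Y = clsdD[OF cl(2)]
 have clYV: "clsd W Y V" using clsd_sub[OF cl(1) Y(2) cl(3) Y(3)] .
 have WC: "w : C" if "w : W" for w using that W by (auto simp: is_mult_def)
 obtain x where x: "x : A" "nzd_on x U V" using Suc.prems(4) by (auto simp: dpt_Suc)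
 have xY: "nzd_on x Y V" using x Y by (auto simp: nzd_on_def subset_iff)
 have xC: "x : C" using x A by (auto dest: idl_mem)
 \<comment> \<open>If A kills v modulo Y, then xv and x2 v lie in Y and x2(xv) = x(x2 v) lies in xY.
   Regularity of x2 on Y modulo x puts xv into xY, and cancelling x puts v into Y.\<close>
 have "EX z:A. nzd_on z U Y"
 proof (rule ccontr)
  assume "~ ?thesis"
  then have "EX v:U - Y. prm (annid C Y v) & A <= annid C Y v" using Y A by (intro no_nzd_killed) auto
  then obtain v where v: "v : U" "v ~: Y" "!!a. a : A ==> a * v : Y" by (auto simp: annid_def)
  have "dpt W A (Suc n) Y (qt W Y V x)" using dpt_inv[OF W A clYV Suc.prems(5) x(1) xY] .
  then obtain x2 where x2: "x2 : A" "nzd_on x2 Y (qt W Y V x)" by (auto simp: dpt_Suc)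
  have "x2 * (x * v) : qt W Y V x" using qt_upper(2)[OF clYV W xC, of "x2 * v"] v(3)[OF x2(1)]
   by (simp add: mult.left_commute)
  then have "x * v : qt W Y V x" using x2 v(3)[OF x(1)] by (auto simp: nzd_on_def)
  then obtain w v0 y where w: "w : W" "v0 : V" "y : Y" "w * (x * v) = v0 + x * y" by (elim qtE)
  then have "x * (w * v - y) = v0" by (simp add: algebra_simps)
  moreover have "w * v - y : U" using w(3) Y(3) idlD(4)[OF U(1) WC[OF w(1)] v(1)] by (intro idl_diff[OF U(1)]) auto
  ultimately have "w * v - y : V" using x(2) w(2) by (auto simp: nzd_on_def)
  then have "w * v : Y" using w cl Y idlD(3)[of C Y "w * v - y" y] by auto
  then show False using v Y(4)[OF w(1)] by blast
 qed
 then have "EX z:A. ALL (U', V'):{(U, V), (U, Y)}. nzd_on z U' V'"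
  using x U Y A by (intro common_nzd) auto
 then obtain z where z: "z : A" "nzd_on z U V" "nzd_on z U Y" by auto
 have zC: "z : C" using z A by (auto dest: idl_mem)
 have zY: "nzd_on z Y V" using z Y by (auto simp: nzd_on_def subset_iff)
 have "dpt W A (Suc n) Y (qt W Y V z)" using dpt_inv[OF W A clYV Suc.prems(5) z(1) zY] .
 then have "dpt W A (Suc n) (qt W U Y z) (qt W U V z)" using dpt_sub_shift[OF W A cl z] by blast
 then have "dpt W A n U (qt W U Y z)"
 proof (rule Suc.IH[rotated 4])
  show "clsd W U (qt W U V z)" "clsd W U (qt W U Y z)" using clsd_qt cl W zC by auto
  show "qt W U V z <= qt W U Y z" using cl by (intro qt_mono)
  show "dpt W A n U (qt W U V z)" using dpt_inv[OF W A] Suc.prems z by auto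
 qed
 then show ?case using z by (auto simp: dpt_Suc)
qed

text \<open>Regular sequences at the localization are replaced by regular sequences in the ring
  itself. If v is killed by M modulo V and vanishes in the localization, it is killed by some w
  outside M as well; M and w generate the unit ideal, so v lies in V.\<close>

lemma dpt_global:
 assumes M: "is_maxl C M" and "idl U" "idl V" "V <= U" "dpt (C - M) M n U (sat (C - M) U V)"
 shows "dpt {1} M n U V"
 using assms(3-)
proof (induction n arbitrary: V)
 case 0 then show ?case by simp
next
 case (Suc n)
 let ?W = "C - M"
 have prM: "prm M" "idl M" using M by (auto simp: is_maxl_def is_prime_def)
 have W: "is_mult C ?W" using prM by (intro mult_compl)
 have cl1: "clsd {1} U V" using Suc.prems assms(2) by (auto simp: clsd_def nzd_on_def)
 have clW: "clsd ?W U (sat ?W U V)" using Suc.prems assms(2) W by (intro clsd_sat) auto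
 obtain x where x: "x : M" "nzd_on x U (sat ?W U V)" using Suc.prems by (auto simp: dpt_Suc)
 have "EX z:M. nzd_on z U V"
 proof (rule ccontr)
  assume "~ ?thesis"
  then have "EX v:U - V. prm (annid C V v) & M <= annid C V v" using Suc.prems assms(2) prM
   by (intro no_nzd_killed) auto
  then obtain v where v: "v : U" "v ~: V" "!!a. a : M ==> a * v : V" by (auto simp: annid_def)
  have "x * v : sat ?W U V" using v(3)[OF x(1)] sat_upper[OF W Suc.prems(2)] by blast
  then have "v : sat ?W U V" using x v by (auto simp: nzd_on_def)
  then obtain w where w: "w : ?W" "w * v : V" by (auto simp: sat_def)
  then obtain d where d: "d : C" "1 - w * d : M" using M by (auto simp: is_maxl_def)
  have "d * (w * v) + (1 - w * d) * v : V"
   using w d v(3)[of "1 - w * d"] idlD(4)[OF Suc.prems(1), of d "w * v"] idlD(3)[OF Suc.prems(1)] by blast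
  then show False using v by (simp add: algebra_simps)
 qed
 then obtain z where z: "z : M" "nzd_on z U V" by blast
 have zC: "z : C" using z prM by (auto dest: idl_mem)
 have reg: "regseq ?W U (sat ?W U V) [z]" 
  using regseq_localize[OF mult_one W, of U V "[z]"] cl1 zC z W by (auto simp: is_mult_def)
 have eq: "qt ?W U (sat ?W U V) z = sat ?W U (qt {1} U V z)"
  using W by (intro qt_sat[OF mult_one W _ cl1 zC]) (auto simp: is_mult_def)
 have "dpt ?W M n U (qt ?W U (sat ?W U V) z)"
  using dpt_inv[OF W prM(2) clW Suc.prems(3) z(1)] reg by auto
 then have "dpt {1} M n U (qt {1} U V z)"
  using Suc.IH[of "qt {1} U V z"] clsdD[OF clsd_qt[OF cl1 mult_one zC]] eq by auto
 then show ?case using z by (auto simp: dpt_Suc)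
qed

end

section \<open>Chains of primes and Krull's height theorem\<close>

primrec pchain :: "'r::comm_ring_1 set => 'r set => nat => 'r set => bool" where
 "pchain C K 0 P \<longleftrightarrow> is_prime C P & K <= P"
| "pchain C K (Suc n) P \<longleftrightarrow> is_prime C P & (EX Q. Q \<subset> P & pchain C K n Q)"

lemma pchain_prime: "pchain C K n P ==> is_prime C P"
 by (cases n) auto

lemma pchain_sub: "pchain C K n P ==> K <= P"
 by (induction n arbitrary: P) fastforce+

lemma pchain_anti: "pchain C K n P ==> K' <= K ==> pchain C K' n P"
proof (induction n arbitrary: P)
 case (Suc n) then show ?case unfolding pchain.simps by blast
qed auto

lemma pchain_top: "pchain C K n Q ==> Q <= P ==> is_prime C P ==> pchain C K n P"
 by (cases n) (simp_all, blast+)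

lemma pchain_append: "pchain C K n p ==> pchain C p m P ==> pchain C K (n + m) P"
proof (induction m arbitrary: P)
 case 0 then show ?case using pchain_top by auto
next
 case (Suc m) then show ?case by auto
qed

lemma pchain_bottom: "pchain C K n P ==> EX Q. is_prime C Q & K <= Q & pchain C Q n P"
proof (induction n arbitrary: P)
 case (Suc n)
 then obtain Q where Q: "Q \<subset> P" "pchain C K n Q" by auto
 then obtain Q' where "is_prime C Q'" "K <= Q'" "pchain C Q' n Q" using Suc.IH by blast
 then show ?case using Q Suc.prems unfolding pchain.simps by blast
qed auto

lemma pchain_shorter: "pchain C K (Suc n) P ==> pchain C K n P"
 by (meson pchain.simps(2) pchain_top psubset_imp_subset)

lemma pchain_le: assumes "pchain C K n P" "m <= n" shows "pchain C K m P"
 using assms(2,1) by (induction rule: dec_induct) (blast dest: pchain_shorter)+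

context comm_subring
begin

lemma sat_sat:
 assumes "is_mult C W" "is_mult C W'" "W <= W'" "idl U" "idl V" "V <= U"
 shows "sat W' U (sat W U V) = sat W' U V"
proof
 have "clsd W' U (sat W' U V)" using assms by (intro clsd_sat)
 moreover have "sat W U V <= sat W' U V" using assms(3) by (auto simp: sat_def)
 ultimately show "sat W' U (sat W U V) <= sat W' U V" by (rule sat_least)
 show "sat W' U V <= sat W' U (sat W U V)" using sat_upper[OF assms(1,6)] by (rule sat_mono)
qed

end

section \<open>Krull's theorems and chains of primes from regular sequences\<close>

context noeth_subring
begin

lemma clsd_prime:
 assumes "prm q" "W <= C - q" shows "clsd W C q"
proof -
 have "nzd_on w C q" if "w : W" for w
  using that assms(2) prmD(3)[OF assms(1)] unfolding nzd_on_def by blast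
 then show ?thesis using prm_idl[OF assms(1)] idlD(1) unfolding clsd_def by blast
qed

lemma nakayama_qt:
 assumes "prm P" "clsd (C - P) U V" "x : P" "U <= qt (C - P) U V x"
 shows "U = V"
proof (rule ccontr)
 assume "U ~= V"
 then obtain Z where Z: "clsd (C - P) U Z" "V <= Z" "Z ~= U" "ALL p:P. ALL u:U. p * u : Z"
  using nakayama[OF assms(1,2)] by blast
 then have "qt (C - P) U V x <= Z" using assms(3) by (intro qt_least) auto
 then show False using assms(4) Z clsdD(3)[OF Z(1)] by blast
qed

text \<open>A finitely generated module that vanishes at W is killed by a single w. Instead of
  generators, a maximal submodule killed by one element of W is taken; it absorbs every u in
  U.\<close>

lemma sat_uniform:
 assumes "idl U" "idl V" "V <= U" "is_mult C W" "U <= sat W U V"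
 shows "EX w:W. ALL u:U. w * u : V"
proof -
 define F where "F = {N. idl N & V <= N & N <= U & (EX w:W. ALL u:N. w * u : V)}"
 have "V : F" using assms by (auto simp: F_def is_mult_def intro!: bexI[of _ 1])
 moreover have "!!N. N : F ==> idl N" by (simp add: F_def)
 ultimately obtain N where N: "N : F" "!!J. J : F ==> N <= J ==> J = N" using noeth_max by blast
 have N': "idl N" "V <= N" "N <= U" using N by (auto simp: F_def)
 obtain w where w: "w : W" "ALL u:N. w * u : V" using N by (auto simp: F_def)
 have WC: "w : C" if "w : W" for w using that assms by (auto simp: is_mult_def)
 have "U <= N"
 proof
  fix u assume u: "u : U"
  then obtain w' where w': "w' : W" "w' * u : V" using assms(5) by (auto simp: sat_def)
  have uC: "u : C" using u assms by (auto dest: idl_mem)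
  let ?J = "isum N ((*) u ` C)"
  have J: "idl ?J" "N <= ?J" using N' uC by (auto intro!: idl_isum idl_image isum_upper1 dest: subsetD)
  have "(w * w') * (n + u * c) : V" if "n : N" "c : C" for n c
  proof -
   have "w' * (w * n) + (w * c) * (w' * u) : V"
    using that w w' WC by (intro idl_lin[OF assms(2)]) auto
   then show ?thesis by (simp add: algebra_simps)
  qed
  then have "ALL v:?J. (w * w') * v : V" by (auto simp: isum_def)
  moreover have "w * w' : W" using w w' assms by (auto simp: is_mult_def)
  moreover have "?J <= U" using N' u assms by (intro isum_least image_principal_sub) auto
  ultimately have "?J : F" using J N' unfolding F_def by blast
  then have "?J = N" using N J by blast
  then show "u : N" using isum_upper2[OF N'(1), of "(*) u ` C"] mem_principal[of u] by blast
 qed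
 then show ?thesis using w by blast
qed

text \<open>Krull's argument: modulo q and x, the localization at P satisfies the descending chain
  condition. This is applied to contracted ideals formed from the powers of an element y of Q
  outside q, and Nakayama makes them stationary.\<close>

lemma principal_ideal_theorem:
 assumes mo: "min_over C (K \<union> {x}) P" and x: "x : C"
  and q: "prm q" "prm Q" "K <= q" "q \<subset> Q" "Q \<subset> P"
 shows False
proof -
 have P: "prm P" "idl P" "x : P" using mo by (auto simp: min_over_def is_prime_def)
 have idl: "idl q" "idl Q" using q by (auto simp: is_prime_def)
 have xQ: "x ~: Q" using min_overD(3)[OF mo, of Q] q by auto
 let ?W = "C - P"
 have W: "is_mult C ?W" using mult_compl P by blast
 define V0 where "V0 = qt ?W C q x"
 have clq: "clsd ?W C q" using q by (intro clsd_prime) auto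
 have clV0: "clsd ?W C V0" unfolding V0_def using clsd_qt[OF clq W x] .
 have V0: "q <= V0" "x : V0"
  using qt_upper(1)[OF clq W x] qt_upper(2)[OF clq W x one_mem] by (simp_all add: V0_def)
 \<comment> \<open>Descending chain condition for saturated ideals between V0 and Z. A largest Z
   with this property will turn out to be the whole ring, which is the Artinian property of the
   localization modulo V0.\<close>
 define dcc where "dcc Z \<longleftrightarrow> (ALL f::nat => 'r set. (ALL n. clsd ?W C (f n) & V0 <= f n & f n <= Z & f (Suc n) <= f n)
   --> (EX N. ALL n>=N. f n = f N))" for Z
 define F where "F = {Z. clsd ?W C Z & V0 <= Z & dcc Z}"
 have "V0 : F"
 proof -
  have "f n = f 0" if "ALL n. V0 <= f n & f n <= V0" for f :: "nat => 'r set" and n using that by blast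
  then show ?thesis using clV0 unfolding F_def dcc_def by blast
 qed
 moreover have "!!Z. Z : F ==> idl Z" by (auto simp: F_def dest: clsdD)
 ultimately obtain Z where Z: "Z : F" "!!J. J : F ==> Z <= J ==> J = Z" using noeth_max by blast
 have Z': "clsd ?W C Z" "V0 <= Z" "dcc Z" using Z by (auto simp: F_def)
 note clZ = clsdD[OF Z'(1)]
 have ZC: "Z = C"
 proof (rule ccontr)
  assume "Z ~= C"
  moreover have "c : Z" if "1 : Z" "c : C" for c using idl_mult[OF clZ(2) that(2,1)] by simp
  ultimately have "1 : C - Z" using clZ(3) by blast
  then obtain r where "r : max_anns C C Z" using max_anns_above clZ by blast
  then obtain v where v: "v : C - Z" "r = annid C Z v" "prm r"
   using max_anns_prime[OF clZ(1,2)] by (auto simp: max_anns_def)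
  have "Z <= r" using v clZ by (auto simp: annid_def dest: idlD(5))
  then have "K \<union> {x} <= r" using q V0 Z' by blast
  moreover have "r <= P" using v clZ(4)[of _ v] by (auto simp: annid_def)
  ultimately have rP: "r = P" using min_overD(3)[OF mo v(3)] by blast
  \<comment> \<open>The annihilator of v modulo Z is P, so after localization Z1/Z is a
    one-dimensional vector space over the residue field. Hence the chain condition passes from Z to
    Z1, against the maximality of Z.\<close>
  define Z1 where "Z1 = qt ?W C Z v"
  have cl1: "clsd ?W C Z1" unfolding Z1_def using clsd_qt[OF Z'(1) W] v by blast
  have up: "Z <= Z1" "v : Z1"
   using qt_upper(1)[OF Z'(1) W, of v] qt_upper(2)[OF Z'(1) W _ one_mem, of v] v by (simp_all add: Z1_def)
  have "dcc Z1" unfolding dcc_def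
  proof (intro allI impI)
   fix f :: "nat => 'r set"
   assume f: "ALL n. clsd ?W C (f n) & V0 <= f n & f n <= Z1 & f (Suc n) <= f n"
   then have dec: "f n <= f m" if "m <= n" for m n using that by (metis lift_Suc_antimono_le)
   have "clsd ?W C (f n \<inter> Z)" for n
   proof -
    have "clsd ?W C (f n)" using f by blast
    then show ?thesis using Z'(1) idl_Int[of "f n" Z] unfolding clsd_def nzd_on_def by blast
   qed
   then have "EX N. ALL n>=N. f n \<inter> Z = f N \<inter> Z"
    using Z'(3)[unfolded dcc_def, rule_format, of "%n. f n \<inter> Z"] f Z'(2) by blast
   then obtain N where N: "!!n. n \<ge> N ==> f n \<inter> Z = f N \<inter> Z" by blast
   show "EX N. ALL n>=N. f n = f N"
   proof (cases "EX M. f M <= Z")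
    case True
    then obtain M where M: "f M <= Z" by blast
    have sub: "f n <= Z" if "n \<ge> max M N" for n using dec[of M n] M that by auto
    have "f n = f (max M N)" if "n \<ge> max M N" for n
     using N[of n] N[of "max M N"] sub[of n] sub[of "max M N"] that by auto
    then show ?thesis by blast
   next
    \<comment> \<open>Every member of the chain contains some e outside Z, whose coefficient at v is
      a unit at P. So each u in f N is a multiple of e plus an element of f N inside Z, up to
      denominators, and f N and f n agree inside Z.\<close>
    case False
    have "f n = f N" if n: "n \<ge> N" for n
    proof
     show "f n <= f N" using dec n .
     show "f N <= f n"
     proof
      fix u assume u: "u : f N"
      have cn: "clsd ?W C (f n)" and cN: "clsd ?W C (f N)" using f by auto
      obtain e where e: "e : f n" "e ~: Z" using False by blast
      have "e : Z1" "u : Z1" using e u f by blast+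
      then obtain w z c w' z' c' where w: "w : ?W" "z : Z" "c : C" "w * e = z + v * c"
       and w': "w' : ?W" "z' : Z" "c' : C" "w' * u = z' + v * c'"
       unfolding Z1_def by (elim qtE) blast
      have eC: "e : C" "u : C" using \<open>e : Z1\<close> \<open>u : Z1\<close> clsdD(3)[OF cl1] by auto
      have cP: "c ~: P"
      proof
       assume "c : P"
       then have "c * v : Z" using rP v by (auto simp: annid_def)
       then have "w * e : Z" using w idl_add[OF clZ(2), of z "v * c"] by (simp add: mult.commute)
       then show False using clZ(4)[OF w(1) eC(1)] e by blast
      qed
      have "c * (w' * u) - c' * (w * e) = c * z' - c' * z"
       unfolding w(4) w'(4) by (simp add: algebra_simps)
      moreover have "c * z' - c' * z : Z" using idl_lin_diff[OF clZ(2) w(3) w'(3) w'(2) w(2)] .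
      moreover have "(c * w') * u - (c' * w) * e : f N"
       using w w' u e dec[OF n] by (intro idl_lin_diff[OF clsdD(2)[OF cN]]) auto
      ultimately have "(c * w') * u - (c' * w) * e : f N \<inter> Z" by (simp add: mult.assoc)
      then have 1: "(c * w') * u - (c' * w) * e : f n" using N[OF n] by blast
      have "(c' * w) * e : f n" using w w' e by (intro idl_mult[OF clsdD(2)[OF cn]]) auto
      then have "(c * w') * u : f n" using idl_add[OF clsdD(2)[OF cn] 1] by force
      moreover have "c * w' : ?W" using w w' cP P prm_mult_notin[of P c w'] by auto
      ultimately show "u : f n" using clsdD(4)[OF cn] eC by blast
     qed
    qed
    then show ?thesis by blast
   qed
  qed
  then have "Z1 : F" using cl1 up Z' by (auto simp: F_def)
  then have "Z1 = Z" using Z up by blast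
  then show False using up v by blast
 qed
 obtain y where y: "y : Q" "y ~: q" using q by blast
 have yC: "y : C" using y idl by (auto dest: idl_mem)
 have WQ: "is_mult C (C - Q)" using mult_compl q by blast
 have WW: "?W <= C - Q" using q by blast
 \<comment> \<open>The contraction of q + (y^n) from the localization at Q. As x is outside Q it is
   regular modulo Y N; so the stability of Y n + (x) gives Y N = Y (N + 1) + x Y N at P, and
   Nakayama removes the last term.\<close>
 define Y where "Y n = qt (C - Q) C q (y ^ n)" for n
 have clqQ: "clsd (C - Q) C q" using q by (intro clsd_prime) auto
 have yn: "y ^ n : C" for n using yC by auto
 have clY: "clsd (C - Q) C (Y n)" for n unfolding Y_def using clsd_qt[OF clqQ WQ yn] .
 have clYW: "clsd ?W C (Y n)" for n using clY[of n] WW by (auto simp: clsd_def)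
 have qY: "q <= Y n" for n unfolding Y_def using qt_upper(1)[OF clqQ WQ yn] .
 have decY: "Y (Suc n) <= Y n" for n
 proof -
  have "y ^ Suc n * u : Y n" if "u : C" for u
   using qt_upper(2)[OF clqQ WQ yn, of "y * u" n] that yC by (auto simp: Y_def algebra_simps)
  then show ?thesis unfolding Y_def[of "Suc n"] using clY qY by (intro qt_least) auto
 qed
 define f where "f n = qt ?W C (Y n) x" for n
 have "ALL n. clsd ?W C (f n) & V0 <= f n & f n <= Z & f (Suc n) <= f n"
 proof
  fix n
  have "clsd ?W C (f n)" unfolding f_def using clsd_qt[OF clYW W x] .
  then show "clsd ?W C (f n) & V0 <= f n & f n <= Z & f (Suc n) <= f n"
   unfolding f_def V0_def ZC using qt_mono[OF qY] qt_mono[OF decY] clsdD(3) by blast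
 qed
 then obtain N where N: "!!n. n \<ge> N ==> f n = f N" using Z'(3) unfolding dcc_def by blast
 have fN: "f N = f (Suc N)" using N[of "Suc N"] by simp
 have clYY: "clsd ?W (Y N) (Y (Suc N))"
  using clsd_sub[OF clYW clsdD(2)[OF clY] decY clsdD(3)[OF clY]] .
 have "Y N <= qt ?W (Y N) (Y (Suc N)) x"
 proof
  fix v assume v: "v : Y N"
  then have "v : f (Suc N)" using qt_upper(1)[OF clYW W x, of N] fN by (auto simp: f_def)
  then obtain w v1 c where w: "v : C" "w : ?W" "v1 : Y (Suc N)" "c : C" "w * v = v1 + x * c"
   unfolding f_def by (elim qtE)
  have "w * v : Y N" using v w(2) by (intro idl_mult[OF clsdD(2)[OF clY]]) auto
  then have "x * c : Y N" using w decY idl_add_cancel'[OF clsdD(2)[OF clY], of v1 "x * c" N] by auto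
  then have "c : Y N" using clsdD(4)[OF clY] xQ x w by blast
  then show "v : qt ?W (Y N) (Y (Suc N)) x" using v w by (intro qtI)
 qed
 then have eq: "Y N = Y (Suc N)" using nakayama_qt[OF P(1) clYY P(3)] by blast
 have "y ^ N : Y N" using qt_upper(2)[OF clqQ WQ yn, of 1 N] by (auto simp: Y_def)
 then have "y ^ N : qt (C - Q) C q (y ^ Suc N)" using eq by (simp add: Y_def)
 then obtain s a c where s: "s : C - Q" "a : q" "c : C" "s * y ^ N = a + y ^ Suc N * c" by (elim qtE)
 \<comment> \<open>Cancelling y^N in the domain C/q leaves s - yc in q, inside Q; since y is in Q,
   so is s, a contradiction.\<close>
 then have "y ^ N * (s - y * c) = a" by (simp add: algebra_simps)
 then have "y ^ N * (s - y * c) : q" using s by simp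
 then have "s - y * c : q" using prmD(3)[OF q(1) yn, of "s - y * c" N] prm_power[OF q(1) yC] y s yC by auto
 then have "s - y * c : Q" using q by blast
 moreover have "y * c : Q" using y s idlD(5)[OF idl(2)] by auto
 ultimately have "s : Q" using idl_add[OF idl(2), of "s - y * c" "y * c"] by simp
 then show False using s by blast
qed

text \<open>Apply \<open>prime_exists\<close> to the multiplicative set generated by z and the
  complement of P.\<close>

lemma prime_exists_avoid:
 assumes K: "idl K" and P: "prm P" and z: "z : C" and no: "!!w k. w : C - P ==> w * z ^ k ~: K"
 shows "EX Q. prm Q & K <= Q & Q <= P & z ~: Q"
proof -
 let ?W = "{w * z ^ k | w k. w : C - P}"
 have "K \<inter> ?W = {}" using no by blast
 from prime_exists[OF K is_mult_powers[OF mult_compl[OF P] z] this]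
 obtain Q where Q: "prm Q" "K <= Q" "Q \<inter> ?W = {}" by (elim exE conjE)
 have "1 * z ^ 1 : ?W" using prmD(2)[OF P] by blast
 then have "z ~: Q" using Q(3) by auto
 moreover have "Q <= P"
 proof
  fix c assume c: "c : Q"
  then have cC: "c : C" using idl_mem[OF prm_idl[OF Q(1)]] by blast
  have "c * z ^ 0 ~: ?W" using c Q(3) by auto
  then show "c : P" using cC by blast
 qed
 ultimately show ?thesis using Q by blast
qed

text \<open>Induction on the number of generators, relative to an arbitrary base K. All generators
  but one are replaced by elements of a prime Q just below P, and Q becomes minimal over the
  replacements.\<close>

lemma krull_height:
 assumes "min_over C (K \<union> set xs) P" "set xs <= C" "pchain C K m P"
 shows "m <= length xs"
 using assms
proof (induction "length xs" arbitrary: xs P m)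
 case 0
 show ?case
 proof (cases m)
  case (Suc m')
  then obtain Q where Q: "Q \<subset> P" "pchain C K m' Q" using 0 by auto
  then have "Q = P" using min_overD(3)[OF 0(2), of Q] 0(1) pchain_prime pchain_sub by (metis Un_empty_right length_0_conv psubset_imp_subset set_empty)
  then show ?thesis using Q by simp
 qed simp
next
 case (Suc n)
 note mo = Suc.prems(1) and xsC = Suc.prems(2)
 have P: "prm P" "K \<union> set xs <= P" using mo min_overD by blast+
 show ?case
 proof (cases m)
  case (Suc m')
  then obtain Q0 where Q0: "Q0 \<subset> P" "pchain C K m' Q0" using Suc.prems by auto
  \<comment> \<open>Q is chosen maximal among the primes above Q0 and strictly below P. Some
    generator x lies outside Q, and then P is the only prime below P that contains Q and x.\<close>
  define F where "F = {Q. prm Q & Q0 <= Q & Q \<subset> P}"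
  have "Q0 : F" using Q0 pchain_prime by (auto simp: F_def)
  moreover have "!!Q. Q : F ==> idl Q" by (auto simp: F_def is_prime_def)
  ultimately obtain Q where Q: "Q : F" "!!J. J : F ==> Q <= J ==> J = Q" using noeth_max by blast
  have Q': "prm Q" "Q0 <= Q" "Q \<subset> P" "idl Q" using Q by (auto simp: F_def is_prime_def)
  have KQ: "K <= Q" using pchain_sub[OF Q0(2)] Q' by blast
  have "pchain C K m' Q" using pchain_top Q0 Q' by blast
  have "~ set xs <= Q" using min_overD(3)[OF mo Q'(1)] KQ Q' by blast
  then obtain x where x: "x : set xs" "x ~: Q" by blast
  have xC: "x : C" using x xsC by blast
  obtain as bs where asbs: "xs = as @ x # bs" using x split_list by metis
  define zs where "zs = as @ bs"
  have zs: "length zs = n" "set xs = insert x (set zs)" using asbs Suc.hyps(2) by (auto simp: zs_def)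
  have minQ: "r = P" if "prm r" "Q <= r" "x : r" "r <= P" for r
  proof (rule ccontr)
   assume "r ~= P"
   then have "r : F" using that Q' by (auto simp: F_def)
   then have "r = Q" using Q that by blast
   then show False using that x by blast
  qed
  \<comment> \<open>P is minimal over Q + (x), so z is nilpotent modulo Q + (x) in the localization
    at P. The component y in Q of this power replaces z.\<close>
  have "EX y:Q. EX w:C - P. EX k. EX c:C. w * z ^ k = y + x * c" if z: "z : set zs" for z
  proof (rule ccontr)
   assume neg: "~ ?thesis"
   have zC: "z : C" using z zs xsC by auto
   have J: "idl (isum Q ((*) x ` C))" using Q' xC by (intro idl_isum idl_image) auto
   have "w * z ^ k ~: isum Q ((*) x ` C)" if "w : C - P" for w k using neg that by (fastforce simp: isum_def)
   from prime_exists_avoid[OF J P(1) zC this] obtain r where r: "prm r" "isum Q ((*) x ` C) <= r" "r <= P" "z ~: r" by blast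
   have "Q <= r" using r isum_upper1[OF idl_image[OF idl_C xC], of Q] by blast
   moreover have "x : r" using r isum_upper2[OF Q'(4), of "(*) x ` C"] mem_principal[of x] by blast
   ultimately have "r = P" using minQ r by blast
   then show False using P z zs r(4) by auto
  qed
  then obtain y where y: "!!z. z : set zs ==> y z : Q & (EX w:C - P. EX k. EX c:C. w * z ^ k = y z + x * c)" by metis
  define ys where "ys = map y zs"
  have ysQ: "set ys <= Q" using y by (auto simp: ys_def)
  have minP: "r = P" if r: "prm r" "K \<union> set ys <= r" "x : r" "r <= P" for r
  proof -
   have "z : r" if z: "z : set zs" for z
   proof -
    obtain w k c where w: "w : C - P" "c : C" "w * z ^ k = y z + x * c" using y[OF z] by blast
    have "y z : r" using r(2) z by (auto simp: ys_def)
    moreover have "x * c : r" using r w by (auto dest!: prm_idl intro: idlD(5))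
    ultimately have "w * z ^ k : r" unfolding w(3) by (intro idl_add prm_idl r)
    moreover have "z : C" using z zs xsC by auto
    ultimately show ?thesis using w r prmD(3)[OF r(1), of w "z ^ k"] prm_power[OF r(1), of z k] by auto
   qed
   then have "K \<union> set xs <= r" using r zs by auto
   then show ?thesis using min_overD(3)[OF mo] r by blast
  qed
  have "min_over C (K \<union> set ys) Q" unfolding min_over_def
  proof (intro conjI allI impI)
   show "prm Q" "K \<union> set ys <= Q" using Q' KQ ysQ by auto
   fix r assume r: "prm r" "K \<union> set ys <= r" "r <= Q"
   show "r = Q"
   proof (rule ccontr)
    \<comment> \<open>P is minimal over r + (x), because x together with the replacements recovers
      all old generators up to powers. The chain r, Q, P is then excluded by the principal ideal
      theorem.\<close>
    assume ne: "r ~= Q"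
    have "r \<union> {x} <= P" using P x r Q' by auto
    moreover have "r' = P" if "prm r'" "r \<union> {x} <= r'" "r' <= P" for r'
     using that r by (intro minP) auto
    ultimately have "min_over C (r \<union> {x}) P" unfolding min_over_def using P(1) by auto
    then show False using principal_ideal_theorem[of r x P r Q] xC r Q' ne by blast
   qed
  qed
  moreover have "set ys <= C" using ysQ idlD(1)[OF Q'(4)] by blast
  moreover have "n = length ys" using zs by (simp add: ys_def)
  ultimately have "m' <= length ys" using Suc.hyps(1)[of ys Q m'] \<open>pchain C K m' Q\<close> by blast
  then show ?thesis using \<open>n = length ys\<close> \<open>Suc n = length xs\<close> \<open>m = Suc m'\<close> by simp
 qed simp
qed

text \<open>The length of a regular sequence on U/V is bounded by the dimension of every nonzero
  submodule N/V, in the form of an explicit chain of primes above its annihilator. For CM modules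
  this is unmixedness. The first element x lengthens by one the chain found modulo x.\<close>

lemma chain_of_regseq:
 assumes "prm P" "clsd (C - P) U V" "idl N" "V <= N" "N <= U" "N ~= V" "set xs <= P" "regseq (C - P) U V xs"
 shows "pchain C (colon C V N) (length xs) P"
 using assms(2-)
proof (induction xs arbitrary: V N)
 case Nil
 have "colon C V N <= P" using Nil.prems clsdD(4)[OF Nil.prems(1)] by (auto simp: colon_def)
 then show ?case using assms(1) by simp
next
 case (Cons x xs)
 note cl = Cons.prems(1)
 note U = clsdD[OF cl]
 let ?W = "C - P"
 have W: "is_mult C ?W" using mult_compl assms(1) by blast
 have x: "x : P" "nzd_on x U V" using Cons.prems by auto
 have xC: "x : C" using x assms(1) by (auto dest: prm_idl idl_mem)
 define V1 where "V1 = qt ?W U V x"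
 have cl1: "clsd ?W U V1" unfolding V1_def using clsd_qt[OF cl W xC] .
 have V1: "V <= V1" "!!u. u : U ==> x * u : V1" using qt_upper[OF cl W xC] by (auto simp: V1_def)
 \<comment> \<open>The elements carried into N by a power of x. Since x is regular, whatever kills N
   modulo V also kills N', and N' is not contained in V + xU.\<close>
 define N' where "N' = {v : U. EX k. x ^ k * v : N}"
 have pw: "x ^ k * v : N" if "x ^ j * v : N" "j <= k" for j k v
 proof -
  have "x ^ (k - j) * (x ^ j * v) : N" using that Cons.prems(2) xC by (auto intro: idl_mult)
  moreover have "x ^ (k - j) * (x ^ j * v) = x ^ k * v"
   using that by (simp add: mult.assoc[symmetric] power_add[symmetric])
  ultimately show ?thesis by simp
 qed
 have idN: "idl N'" unfolding is_ideal_def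
 proof (intro conjI ballI)
  show "N' <= C" using idlD(1)[OF U(1)] by (auto simp: N'_def)
  show "0 : N'" using U(1) Cons.prems(2) by (auto simp: N'_def dest: idlD(2))
  fix v v' assume "v : N'" "v' : N'"
  then obtain j k where jk: "v : U" "v' : U" "x ^ j * v : N" "x ^ k * v' : N" by (auto simp: N'_def)
  have "x ^ max j k * v + x ^ max j k * v' : N"
   using pw[OF jk(3), of "max j k"] pw[OF jk(4), of "max j k"] idl_add[OF Cons.prems(2)] by auto
  then have "x ^ max j k * (v + v') : N" by (simp add: algebra_simps)
  then show "v + v' : N'" using jk idl_add[OF U(1)] unfolding N'_def by blast
 next
  fix c v assume cv: "c : C" "v : N'"
  then obtain j where j: "v : U" "x ^ j * v : N" by (auto simp: N'_def)
  have "c * (x ^ j * v) : N" using idl_mult[OF Cons.prems(2) cv(1) j(2)] .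
  then have "x ^ j * (c * v) : N" by (simp add: algebra_simps)
  then show "c * v : N'" using j idl_mult[OF U(1) cv(1)] unfolding N'_def by blast
 qed
 have N'U: "N' <= U" by (auto simp: N'_def)
 have NN': "N <= N'" using Cons.prems(4) by (auto simp: N'_def intro!: exI[of _ 0])
 have clN': "clsd ?W N' V" using clsd_sub[OF cl idN _ N'U] NN' Cons.prems(3) by blast
 \<comment> \<open>If xu + v lies in N' with v in V, then u lies in N'. So the inclusion would give
   N' = V + xN' locally, and Nakayama would give N' = V.\<close>
 have notsub: "~ N' <= V1"
 proof
  assume sub: "N' <= V1"
  have "N' <= qt ?W N' V x"
  proof
   fix v assume v: "v : N'"
   then obtain w v0 u where w: "w : ?W" "v0 : V" "u : U" "w * v = v0 + x * u"
    using sub unfolding V1_def by (blast elim: qtE)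
   have "w * v : N'" using v w by (intro idl_mult[OF idN]) auto
   moreover have "v0 : N'" using w NN' Cons.prems(3) by blast
   ultimately have "x * u : N'" using w idl_add_cancel'[OF idN, of v0 "x * u"] by auto
   then obtain k where "x ^ k * (x * u) : N" by (auto simp: N'_def)
   then have "x ^ Suc k * u : N" by (simp add: algebra_simps)
   then have "u : N'" using w unfolding N'_def by blast
   then show "v : qt ?W N' V x" using v w by (intro qtI)
  qed
  then have "N' = V" using nakayama_qt[OF assms(1) clN' x(1)] by blast
  then show False using NN' Cons.prems by blast
 qed
 define N1 where "N1 = isum N' V1"
 have idN1: "idl N1" unfolding N1_def using idN clsdD(2)[OF cl1] by (intro idl_isum)
 have N1: "V1 <= N1" "N' <= N1" "N1 <= U"
  using isum_upper1[OF clsdD(2)[OF cl1]] isum_upper2[OF idN] isum_least[OF U(1) N'U clsdD(3)[OF cl1]]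
  by (auto simp: N1_def)
 have "pchain C (colon C V1 N1) (length xs) P"
  using Cons.IH[OF cl1 idN1 N1(1,3)] N1 notsub Cons.prems by (auto simp: V1_def)
 then obtain Q where Q: "prm Q" "colon C V1 N1 <= Q" "pchain C Q (length xs) P" using pchain_bottom by blast
 have pow: "v : V" if "v : U" "x ^ k * v : V" for k v using that
 proof (induction k)
  case (Suc k)
  have "x ^ k * v : U" using Suc xC U by (auto intro: idl_mult)
  then show ?case using Suc nzd_onD[OF x(2), of "x ^ k * v"] by (auto simp: mult.assoc)
 qed simp
 \<comment> \<open>This produces a prime q above the annihilator of N, inside Q and without x. As Q
   contains x, the pair of q and Q is the additional step of the chain.\<close>
 have "s * x ^ k ~: colon C V N" if "s : C - Q" for s k
 proof
  assume "s * x ^ k : colon C V N"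
  with that have s: "s : C - Q" "s * x ^ k : colon C V N" by blast+
  have sN: "s * v : V" if "v : N" for v
  proof (rule pow)
   show "s * v : U" using that s Cons.prems(4) by (intro idl_mult[OF U(1)]) auto
   show "x ^ k * (s * v) : V" using s that by (auto simp: colon_def algebra_simps)
  qed
  have sN': "s * v : V" if v: "v : N'" for v
  proof -
   obtain j where j: "v : U" "x ^ j * v : N" using v by (auto simp: N'_def)
   have "x ^ j * (s * v) : V" using sN[OF j(2)] by (simp add: algebra_simps)
   then show ?thesis using pow[of "s * v" j] j s idl_mult[OF U(1)] by blast
  qed
  have "s * (a + b) : V1" if ab: "a : N'" "b : V1" for a b
  proof -
   have "s * a : V1" using sN'[OF ab(1)] V1(1) by blast
   moreover have "s * b : V1" using s ab(2) by (intro idl_mult[OF clsdD(2)[OF cl1]]) auto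
   ultimately show ?thesis using idl_add[OF clsdD(2)[OF cl1]] by (simp add: distrib_left)
  qed
  then have "ALL u:N1. s * u : V1" unfolding N1_def isum_def by blast
  then have "s : colon C V1 N1" using s(1) unfolding colon_def by blast
  then show False using s(1) Q(2) by (metis DiffD2 subsetD)
 qed
 from prime_exists_avoid[OF idl_colon[OF U(2) idlD(1)[OF Cons.prems(2)]] Q(1) xC this]
 obtain q where q: "prm q" "colon C V N <= q" "q <= Q" "x ~: q" by blast
 have "x : Q" using Q(2) V1(2) N1(3) xC by (auto simp: colon_def)
 then have "pchain C (colon C V N) 1 Q" using q Q(1) by auto
 then have "pchain C (colon C V N) (1 + length xs) P" using Q(3) by (rule pchain_append)
 then show ?case by simp
qed

lemma chain_of_regseq_sat:
 assumes W: "is_mult C W" and p: "prm p" "W <= C - p" and U: "idl U" "idl V" "V <= U" and ann: "colon C V U <= p"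
  and xs: "set xs <= p" "regseq W U (sat W U V) xs"
 shows "pchain C (colon C V U) (length xs) p"
proof -
 have Wp: "is_mult C (C - p)" using mult_compl p by blast
 have xsC: "set xs <= C" using xs p by (auto dest: prm_idl idl_mem)
 let ?V = "sat (C - p) U V"
 have "regseq (C - p) U ?V xs"
  using regseq_localize[OF W Wp p(2) clsd_sat[OF U(1,2) W] xsC xs(2)] sat_sat[OF W Wp p(2) U] by simp
 moreover have "clsd (C - p) U ?V" using U Wp by (intro clsd_sat)
 moreover have "U ~= ?V"
 proof
  assume "U = ?V"
  then obtain w where "w : C - p" "ALL u:U. w * u : V" using sat_uniform[OF U(1,2,3) Wp] by blast
  then show False using ann by (auto simp: colon_def)
 qed
 ultimately have "pchain C (colon C ?V U) (length xs) p"
  using chain_of_regseq[OF p(1), of U ?V U xs] U xs clsdD(3) by blast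
 moreover have "colon C V U <= colon C ?V U" using sat_upper[OF Wp U(3)] by (auto simp: colon_def)
 ultimately show ?thesis by (rule pchain_anti)
qed

lemma chain_of_regseq_below:
 assumes "is_mult C W" "prm p" "W <= C - p" "clsd W U V" "colon C V U <= p" "set xs <= p" "regseq W U V xs"
 shows "pchain C (colon C V U) (length xs) p"
proof -
 note U = clsdD(1-3)[OF assms(4)]
 have "sat W U V = V" using sat_least[OF assms(4) order_refl] sat_upper[OF assms(1) U(3)] by blast
 then show ?thesis using chain_of_regseq_sat[OF assms(1-3) U assms(5,6)] assms(7) by simp
qed

text \<open>The case of N generated by V and v: depth is at most the dimension of C/ann(v) at
  P.\<close>

lemma chain_of_annid:
 assumes "prm P" "clsd (C - P) U V" "v : U - V" "set xs <= P" "regseq (C - P) U V xs"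
 shows "pchain C (annid C V v) (length xs) P"
proof -
 note U = clsdD[OF assms(2)]
 let ?N = "isum V ((*) v ` C)"
 have v: "v : C" "idl ((*) v ` C)" using assms(3) idl_mem[OF U(1)] idl_image[OF idl_C] by auto
 have "v : ?N" using isum_upper2[OF U(2)] mem_principal by blast
 then have "pchain C (colon C V ?N) (length xs) P"
  using assms(3) by (intro chain_of_regseq[OF assms(1,2) idl_isum[OF U(2) v(2)] isum_upper1[OF v(2)]
   isum_least[OF U(1,3) image_principal_sub[OF U(1)]] _ assms(4,5)]) auto
 moreover have "annid C V v <= colon C V ?N"
 proof
  fix c assume "c : annid C V v"
  then have c: "c : C" "c * v : V" by (auto simp: annid_def)
  have "c * (a + v * b) : V" if "a : V" "b : C" for a b
   using idl_lin[OF U(2) c(1) that(2,1) c(2)] by (simp add: algebra_simps)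
  then show "c : colon C V ?N" using c by (auto simp: colon_def isum_def)
 qed
 ultimately show ?thesis by (rule pchain_anti)
qed

text \<open>Take a longest regular sequence xs in p. Then p lies in an associated prime q of the
  quotient, and the remaining depth n - |xs| yields a chain of that length from q to P. A prime
  above the annihilator and xs that lies strictly below p would end a chain of length |xs| and give
  a total exceeding n.\<close>

lemma cm_localize:
 assumes P: "prm P" "clsd (C - P) U V" and dp: "dpt (C - P) P n U V"
  and dim: "!!m. pchain C (colon C V U) m P ==> m <= n"
  and p: "prm p" "p <= P" "colon C V U <= p"
 shows "EX xs. set xs <= p & regseq (C - P) U V xs & min_over C (colon C V U \<union> set xs) p"
proof -
 let ?W = "C - P"
 have W: "is_mult C ?W" using mult_compl P by blast
 note U = clsdD[OF P(2)]
 have pC: "p <= C" using p by (auto dest: prm_idl idl_mem)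
 define good where "good xs \<longleftrightarrow> set xs <= p & regseq ?W U V xs" for xs
 have bound: "length xs <= n" if "good xs" for xs
 proof (rule dim)
  show "pchain C (colon C V U) (length xs) P"
   using that P p W by (intro chain_of_regseq_below[of ?W]) (auto simp: good_def)
 qed
 have "good []" by (simp add: good_def)
 then obtain xs where xs: "good xs" "!!ys. good ys ==> length ys <= length xs"
  using ex_has_greatest_nat[of good "[]" length "Suc n"] bound by (metis le_imp_less_Suc)
 have xsp: "set xs <= p" "regseq ?W U V xs" using xs by (auto simp: good_def)
 define V' where "V' = quo ?W U V xs"
 have cl': "clsd ?W U V'" unfolding V'_def using clsd_quo[OF P(2) W] xsp pC by blast
 have "~ nzd_on x U V'" if "x : p" for x
 proof
  assume "nzd_on x U V'"
  then have "good (xs @ [x])" using xsp that by (auto simp: good_def regseq_append V'_def)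
  then show False using xs(2) by fastforce
 qed
 then obtain v where v: "v : U - V'" "prm (annid C V' v)" "p <= annid C V' v"
  using no_nzd_killed[of U V' p] clsdD[OF cl'] p prm_idl by blast
 define q where "q = annid C V' v"
 have "dpt ?W P (n - length xs) U V'"
  unfolding V'_def using dpt_quo[OF W prm_idl[OF P(1)] P(2), of xs "n - length xs"] dp xsp p bound[OF xs(1)] by auto
 then obtain zs where zs: "length zs = n - length xs" "set zs <= P" "regseq ?W U V' zs" by (auto simp: dpt_def)
 have chq: "pchain C q (n - length xs) P"
  using chain_of_annid[OF P(1) cl' v(1) zs(2,3)] zs(1) by (simp add: q_def)
 have ann: "colon C V U \<union> set xs <= p" using p xsp by blast
 have "min_over C (colon C V U \<union> set xs) p" unfolding min_over_def
 proof (intro conjI allI impI p(1) ann)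
  fix r assume r: "prm r" "colon C V U \<union> set xs <= r" "r <= p"
  show "r = p"
  proof (rule ccontr)
   assume "r ~= p"
   then have "r \<subset> q" using r v by (auto simp: q_def)
   moreover have "pchain C (colon C V U) (length xs) r"
    using r p P W xsp by (intro chain_of_regseq_below[of ?W]) auto
   ultimately have "pchain C (colon C V U) (Suc (length xs)) q" using v(2) by (auto simp: q_def)
   then have "pchain C (colon C V U) (Suc (length xs) + (n - length xs)) P" using chq by (rule pchain_append)
   then show False using dim[of "Suc (length xs) + (n - length xs)"] bound[OF xs(1)] by auto
  qed
 qed
 then show ?thesis using xsp by blast
qed

end

context comm_subring
begin

lemma quo_sat:
 assumes "is_mult C W" "is_mult C W'" "W <= W'" "clsd W U V" "set xs <= C"
 shows "quo W' U (sat W' U V) xs = sat W' U (quo W U V xs)"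
 using assms(4-)
proof (induction xs arbitrary: V)
 case (Cons x xs)
 then show ?case using qt_sat[OF assms(1-3) Cons.prems(1), of x] clsd_qt[OF Cons.prems(1) assms(1), of x] by auto
qed simp

end

section \<open>Graded rings\<close>

text \<open>The grading is given by the projections \<open>hc k\<close>. Generation in degree one is
  recorded only by its effect on primes, \<open>hc_gen\<close>: a prime that contains the forms of
  degree one contains all components of positive degree.\<close>

locale graded_subring = noeth_subring C for C :: "'r::comm_ring_1 set" +
 fixes hc :: "nat => 'r => 'r"
 assumes hc_mem [simp, intro]: "x : C ==> hc k x : C"
  and hc_add: "hc k (x + y) = hc k x + hc k y"
  and hc_mult: "hc k (x * y) = (\<Sum>i\<le>k. hc i x * hc (k - i) y)"
  and hc_hc: "hc i (hc j x) = (if i = j then hc j x else 0)"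
  and hc_one: "hc 0 1 = 1"
  and hc_sum: "EX n. x = (\<Sum>k\<le>n. hc k x)"
  and hc_gen: "is_prime C P ==> (!!f. f : C ==> f = hc 1 f ==> f : P) ==> x : C ==> hc (Suc k) x : P"
begin

definition gr :: "'r set => bool" where "gr U \<longleftrightarrow> idl U & (ALL x:U. ALL k. hc k x : U)"

definition Hom :: "'r set" where "Hom = {x : C. EX k. hc k x = x}"

definition star :: "'r set => 'r set" where "star P = {x : C. ALL k. hc k x : P}"

lemma grD: "gr U ==> idl U" "gr U ==> x : U ==> hc k x : U"
 by (auto simp: gr_def)

lemma hc_0 [simp]: "hc k 0 = 0"
 using hc_add[of k 0 0] by simp

lemma hc_diff: "hc k (x - y) = hc k x - hc k y"
 using hc_add[of k "x - y" y] by simp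

lemma idl_sum: "idl U ==> (!!i. i : A ==> f i : U) ==> sum f A : U"
 by (induction A rule: infinite_finite_induct) (auto dest: idlD(2) intro: idl_add)

lemma mem_of_hc: "idl U ==> (!!k. hc k x : U) ==> x : U"
 using hc_sum[of x] idl_sum[of U _ "%k. hc k x"] by metis

lemma hc_homog_mult:
 assumes "hc d h = h" shows "hc k (h * y) = (if d <= k then h * hc (k - d) y else 0)"
proof -
 have "hc i h * hc (k - i) y = (if i = d then h * hc (k - d) y else 0)" for i
  using hc_hc[of i d h] assms by auto
 then show ?thesis unfolding hc_mult by (simp add: sum.delta)
qed

lemma hc_homog_mult_add: "hc d h = h ==> hc (d + k) (h * y) = h * hc k y"
 by (simp add: hc_homog_mult)

lemma hc_Hom [simp]: "x : C ==> hc k x : Hom"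
 by (auto simp: Hom_def hc_hc)

lemma Hom_sub: "Hom <= C" and Hom_0: "0 : Hom" and Hom_1: "1 : Hom"
 using hc_one by (auto simp: Hom_def)

lemma hc_mult_homog: "hc a x = x ==> hc b y = y ==> hc (a + b) (x * y) = x * y"
 by (simp add: hc_homog_mult_add)

lemma Hom_mult: "x : Hom ==> y : Hom ==> x * y : Hom"
 unfolding Hom_def using hc_mult_homog by blast

lemma gr_isum_image:
 assumes "gr U" "gr V" "x : Hom" shows "gr (isum V ((*) x ` U))"
proof -
 obtain d where d: "hc d x = x" "x : C" using assms by (auto simp: Hom_def)
 have "hc k (v + x * u) : isum V ((*) x ` U)" if "v : V" "u : U" for k u v
 proof -
  have "hc k (x * u) : (*) x ` U"
  proof (cases "d <= k")
   case True then show ?thesis using assms that d by (auto simp: hc_homog_mult dest: grD)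
  next
   case False
   then show ?thesis using d idlD(2)[OF grD(1)[OF assms(1)]] image_eqI[of 0 "(*) x" 0 U]
    by (simp add: hc_homog_mult)
  qed
  then show ?thesis unfolding hc_add using that assms by (intro isumI) (auto dest: grD)
 qed
 then show ?thesis unfolding gr_def using assms d by (auto simp: isum_def intro!: idl_isum[unfolded isum_def] idl_image dest: grD)
qed

lemma gr_sat:
 assumes "gr U" "gr Z" "is_mult C W" "W <= Hom" shows "gr (sat W U Z)"
proof -
 have "hc k v : sat W U Z" if v: "v : sat W U Z" for k v
 proof -
  obtain w where w: "v : U" "w : W" "w * v : Z" using v by (rule satE)
  obtain d where d: "hc d w = w" using w assms by (auto simp: Hom_def)
  have "hc (d + k) (w * v) : Z" using w assms grD by blast
  then have "w * hc k v : Z" using hc_homog_mult_add[OF d] by simp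
  then show ?thesis using w assms by (intro satI) (auto dest: grD)
 qed
 then show ?thesis using idl_sat assms by (auto simp: gr_def)
qed

lemma gr_qt: "gr U ==> gr V ==> is_mult C W ==> W <= Hom ==> x : Hom ==> gr (qt W U V x)"
 unfolding qt_def by (intro gr_sat gr_isum_image)

lemma gr_quo: "gr U ==> gr V ==> is_mult C W ==> W <= Hom ==> set xs <= Hom ==> gr (quo W U V xs)"
 by (induction xs arbitrary: V) (auto intro: gr_qt)

lemma gr_colon:
 assumes "gr U" "gr V" shows "gr (colon C V U)"
proof -
 have "hc k c * u : V" if c: "c : colon C V U" "u : U" for k c u
 proof -
  have "hc k c * hc j u : V" for j
  proof -
   have "c * hc j u : V" using c assms by (auto simp: colon_def dest: grD)
   then have "hc (j + k) (hc j u * c) : V" using assms by (auto simp: mult.commute dest: grD)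
   moreover have "hc (j + k) (hc j u * c) = hc j u * hc k c"
    by (rule hc_homog_mult_add) (simp add: hc_hc)
   ultimately show ?thesis by (simp add: mult.commute)
  qed
  moreover obtain n where "u = (\<Sum>j\<le>n. hc j u)" using hc_sum by blast
  ultimately have "(\<Sum>j\<le>n. hc k c * hc j u) : V" using assms by (intro idl_sum) (auto dest: grD)
  then show ?thesis using \<open>u = (\<Sum>j\<le>n. hc j u)\<close> by (simp add: sum_distrib_left[symmetric])
 qed
 moreover have "idl (colon C V U)" using assms by (intro idl_colon) (auto dest!: grD(1) dest: idl_mem)
 ultimately show ?thesis by (auto simp: gr_def colon_def)
qed

lemma star_sub: "prm P ==> star P <= P"
 using mem_of_hc[OF prm_idl] unfolding star_def by blast

lemma star_greatest: "gr Q ==> Q <= P ==> Q <= star P"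
 by (auto simp: star_def dest: grD idl_mem)

lemma star_mono: "P <= Q ==> star P <= star Q"
 by (auto simp: star_def)

lemma Hom_star: "prm P ==> x : Hom ==> x : P ==> x : star P"
 by (auto simp: star_def Hom_def) (metis hc_hc idlD(2) prm_idl)

text \<open>For two elements outside \<open>star P\<close> take their lowest components outside P;
  their product is, modulo P, a component of the product.\<close>

lemma star_prime: assumes "prm P" shows "prm (star P)" "gr (star P)"
proof -
 note P = prm_idl[OF assms]
 have idl: "idl (star P)" unfolding is_ideal_def
 proof (intro conjI ballI)
  show "0 : star P" using idlD(2)[OF P] by (auto simp: star_def)
  fix x y assume "x : star P" "y : star P"
  then show "x + y : star P" using idl_add[OF P] by (auto simp: star_def hc_add)
 next
  fix c x assume "c : C" "x : star P"
  then show "c * x : star P" unfolding star_def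
   by (auto simp: hc_mult intro!: idl_sum P idl_mult)
 qed (auto simp: star_def)
 have least: "EX i. hc i x ~: P & (ALL j<i. hc j x : P)" if "x : C" "x ~: star P" for x
  using that exists_least_iff[of "%i. hc i x ~: P"] by (auto simp: star_def)
 have "x : star P \<or> y : star P" if xy: "x : C" "y : C" "x * y : star P" for x y
 proof (rule ccontr)
  assume "~ ?thesis"
  then obtain i j where i: "hc i x ~: P" "ALL k<i. hc k x : P" and j: "hc j y ~: P" "ALL k<j. hc k y : P"
   using least[of x] least[of y] xy by blast
  have "(\<Sum>k\<le>i + j. hc k x * hc (i + j - k) y) : P" using xy by (auto simp: star_def hc_mult)
  then have "hc i x * hc j y + (\<Sum>k\<in>{..i + j} - {i}. hc k x * hc (i + j - k) y) : P"
   by (subst (asm) sum.remove[of _ i]) auto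
  moreover have "(\<Sum>k\<in>{..i + j} - {i}. hc k x * hc (i + j - k) y) : P"
  proof (rule idl_sum[OF P])
   fix k assume k: "k : {..i + j} - {i}"
   show "hc k x * hc (i + j - k) y : P"
   proof (cases "k < i")
    case True then show ?thesis using i xy idlD(5)[OF P] by auto
   next
    case False
    then have "i + j - k < j" using k by auto
    then show ?thesis using j xy idl_mult[OF P] by auto
   qed
  qed
  ultimately have "hc i x * hc j y : P" using idl_add_cancel[OF P] by blast
  then show False using prm_mult_notin[OF assms] i j xy by blast
 qed
 moreover have "1 ~: star P" using star_sub assms by (auto dest: prmD)
 ultimately show "prm (star P)" using idl by (auto simp: is_prime_def)
 have "hc k x : star P" if "x : star P" for x k
  using that idlD(2)[OF P] by (auto simp: star_def hc_hc)
 then show "gr (star P)" using idl by (auto simp: gr_def)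
qed

text \<open>Prime annihilators of elements of graded modules are homogeneous although v need not be.
  Once the lower components of r are known to kill v, a power of the next component kills every
  component of v, and primality removes the power.\<close>

lemma gr_annid:
 assumes "gr U" "gr V" "v : U" "prm (annid C V v)"
 shows "gr (annid C V v)"
proof -
 let ?Q = "annid C V v"
 note V = grD(1)[OF assms(2)]
 have "hc k r : ?Q" if r: "r : ?Q" for k r
 proof (induction k rule: less_induct)
  case (less k)
  have rC: "r : C" using r by (auto simp: annid_def)
  define r' where "r' = r - (\<Sum>i<k. hc i r)"
  have "(\<Sum>i<k. hc i r) : ?Q" using less by (intro idl_sum prm_idl assms(4)) auto
  then have "r' : ?Q" unfolding r'_def using r by (intro idl_diff prm_idl assms(4))
  then have r'v: "r' * v : V" by (auto simp: annid_def)
  have hc_s: "hc j (\<Sum>i<k. hc i r) = (if j < k then hc j r else 0)" for j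
  proof -
   have "hc j (\<Sum>i\<in>A. hc i r) = (\<Sum>i\<in>A. hc j (hc i r))" if "finite A" for A
    using that by (induction A) (auto simp: hc_add)
   then show ?thesis by (simp add: hc_hc sum.delta)
  qed
  have hr': "hc j r' = (if j < k then 0 else hc j r)" for j
   unfolding r'_def hc_diff hc_s by auto
  \<comment> \<open>Compare components of degree k + i in r'v, where r' starts in degree k. All
    terms but one involve components of v of degree below i, which the factor (hc k r)^i kills by
    induction.\<close>
  have key: "hc k r ^ Suc i * hc i v : V" for i
  proof (induction i rule: less_induct)
   case (less i)
   have "hc (k + i) (r' * v) : V" using r'v assms grD by blast
   moreover have "hc (k + i) (r' * v) = (\<Sum>j\<le>k + i. hc j r' * hc (k + i - j) v)" by (rule hc_mult)
   also have "\<dots> = hc k r * hc i v + (\<Sum>j\<in>{..k + i} - {k}. hc j r' * hc (k + i - j) v)"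
    by (subst sum.remove[of _ k]) (auto simp: hr')
   ultimately have "hc k r * hc i v + (\<Sum>j\<in>{..k + i} - {k}. hc j r' * hc (k + i - j) v) : V" by simp
   then have "hc k r ^ i * (hc k r * hc i v + (\<Sum>j\<in>{..k + i} - {k}. hc j r' * hc (k + i - j) v)) : V"
    using rC by (intro idl_mult[OF V]) auto
   then have "hc k r ^ Suc i * hc i v + (\<Sum>j\<in>{..k + i} - {k}. hc k r ^ i * (hc j r' * hc (k + i - j) v)) : V"
    by (simp add: algebra_simps sum_distrib_left)
   moreover have "(\<Sum>j\<in>{..k + i} - {k}. hc k r ^ i * (hc j r' * hc (k + i - j) v)) : V"
   proof (rule idl_sum[OF V])
    fix j assume j: "j : {..k + i} - {k}"
    show "hc k r ^ i * (hc j r' * hc (k + i - j) v) : V"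
    proof (cases "j < k")
     case True then show ?thesis using idlD(2)[OF V] by (simp add: hr')
    next
     case False
     define l where "l = k + i - j"
     have l: "l < i" using j False by (auto simp: l_def)
     have "hc j r' * hc k r ^ (i - Suc l) * (hc k r ^ Suc l * hc l v) : V"
      using less.IH[OF l] rC False by (intro idl_mult[OF V _ less.IH[OF l]]) (auto simp: hr')
     moreover have "hc k r ^ i = hc k r ^ (i - Suc l) * hc k r ^ Suc l"
      using l by (simp only: power_add[symmetric]) simp
     ultimately show ?thesis by (simp add: l_def algebra_simps)
    qed
   qed
   ultimately show ?case using idl_add_cancel[OF V] by blast
  qed
  obtain n where n: "v = (\<Sum>i\<le>n. hc i v)" using hc_sum by blast
  have "hc k r ^ Suc n * hc i v : V" if "i <= n" for i
  proof -
   have "hc k r ^ (n - i) * (hc k r ^ Suc i * hc i v) : V" using rC by (intro idl_mult[OF V _ key]) auto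
   moreover have "hc k r ^ Suc n = hc k r ^ (n - i) * hc k r ^ Suc i"
    using that by (simp only: power_add[symmetric]) simp
   ultimately show ?thesis by (simp add: mult.assoc)
  qed
  then have "(\<Sum>i\<le>n. hc k r ^ Suc n * hc i v) : V" by (intro idl_sum[OF V]) auto
  then have "hc k r ^ Suc n * v : V" using n by (metis sum_distrib_left)
  then have "hc k r ^ Suc n : ?Q" using rC by (auto simp: annid_def)
  then show ?case using prm_power[OF assms(4)] rC by blast
 qed
 then show ?thesis using prm_idl[OF assms(4)] by (auto simp: gr_def)
qed

text \<open>Modulo \<open>star P\<close>, a nonzero element of least width in \<open>P\<close> divides every element of \<open>P\<close> up to
 factors outside \<open>P\<close>: the graded analogue of the Euclidean algorithm in \<open>k[t, 1/t]\<close>.\<close>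

lemma no_prime_above_star:
 assumes P: "prm P" and r: "prm r" "star P <= r" "r <= P" "r ~= star P"
 shows "r = P"
proof -
 let ?Q = "star P"
 note Q = star_prime[OF P]
 note idP = prm_idl[OF P] and idr = prm_idl[OF r(1)] and idQ = prm_idl[OF Q(1)]
 \<comment> \<open>The support of e modulo P; its width plays the part of the degree in the
   Euclidean algorithm.\<close>
 define T where "T e = {k. hc k e ~: P}" for e
 have T0: "e : ?Q \<longleftrightarrow> T e = {}" if "e : C" for e using that by (auto simp: T_def star_def)
 define bad where "bad m \<longleftrightarrow> (EX b:P - ?Q. EX l. T b <= {l..<l + m})" for m
 have ex_bound: "EX m. T e <= {0..<0 + m}" for e
 proof -
  obtain n where n: "e = (\<Sum>k\<le>n. hc k e)" using hc_sum by blast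
  have "hc j e = 0" if "j > n" for j
  proof -
   have "hc j (\<Sum>i\<in>A. hc i e) = (\<Sum>i\<in>A. hc j (hc i e))" if "finite A" for A
    using that by (induction A) (auto simp: hc_add)
   then have "hc j (\<Sum>k\<le>n. hc k e) = (\<Sum>i\<le>n. hc j (hc i e))" by simp
   also have "\<dots> = 0" using that by (intro sum.neutral) (auto simp: hc_hc)
   finally show ?thesis using n by simp
  qed
  then have "T e <= {0..<0 + Suc n}" using idlD(2)[OF idP] by (auto simp: T_def) (metis leI less_Suc_eq_le)
  then show ?thesis by blast
 qed
 have "EX b. b : P - ?Q" using r by blast
 then have "EX m. bad m" using ex_bound unfolding bad_def by blast
 then obtain m where m: "bad m" "!!j. j < m ==> ~ bad j" using exists_least_iff[of bad] by blast
 obtain b l where b: "b : P" "b ~: ?Q" "T b <= {l..<l + m}" using m unfolding bad_def by blast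
 have bC: "b : C" using b idP by (auto dest: idl_mem)
 have "m ~= 0" using b T0[OF bC] by auto
 then obtain m' where m': "m = Suc m'" using not0_implies_Suc by blast
 have top: "l + m' : T b"
 proof (rule ccontr)
  assume "l + m' ~: T b"
  then have "T b <= {l..<l + m'}" using b(3) m' by (auto simp: less_Suc_eq)
  then show False using m(2)[of m'] b m' unfolding bad_def by auto
 qed
 define bt where "bt = hc (l + m') b"
 have bt: "bt : C" "bt ~: P" "hc (l + m') bt = bt" using top bC by (auto simp: bt_def T_def hc_hc)
 have div: "EX s:C - P. EX c:C. s * e - c * b : ?Q" if "e : P" "T e <= {j..<j + n}" for e j n
  using that
 proof (induction n arbitrary: e j)
  case 0
  then have "e : ?Q" using T0[of e] idP by (auto dest: idl_mem)
  then show ?case using prmD(2)[OF P] by (intro bexI[of _ 1] bexI[of _ 0]) auto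
 next
  case (Suc n)
  have eC: "e : C" using Suc.prems idP by (auto dest: idl_mem)
  show ?case
  proof (cases "j + n : T e")
   case False
   then have "T e <= {j..<j + n}" using Suc.prems(2) by (auto simp: less_Suc_eq)
   then show ?thesis using Suc by blast
  next
   case True
   then have "e ~: ?Q" using T0[OF eC] by auto
   then have "bad (Suc n)" using Suc.prems unfolding bad_def by blast
   then have mn: "m' <= n" using m(2)[of "Suc n"] m' by (meson Suc_le_mono not_le)
   define et where "et = hc (j + n) e"
   have et: "et : C" "hc (j + n) et = et" using eC by (auto simp: et_def hc_hc)
   \<comment> \<open>The components in the top degree (l + m') + (j + n) cancel. Since m' <= n, the
     lower end of the support does not move down, so the width drops.\<close>
   define e' where "e' = bt * e - et * b"
   have "e' : P" unfolding e'_def using bt et Suc.prems b by (intro idl_lin_diff[OF idP]) auto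
   moreover have "T e' <= {(l + m') + j..<(l + m') + j + n}"
   proof
    fix k assume "k : T e'"
    then have k: "hc k (bt * e) - hc k (et * b) ~: P" by (auto simp: T_def e'_def hc_diff)
    have 1: "hc k (bt * e) = (if l + m' <= k then bt * hc (k - (l + m')) e else 0)"
     using hc_homog_mult[OF bt(3)] .
    have 2: "hc k (et * b) = (if j + n <= k then et * hc (k - (j + n)) b else 0)"
     using hc_homog_mult[OF et(2)] .
    have "(l + m' <= k & k - (l + m') : T e) \<or> (j + n <= k & k - (j + n) : T b)"
    proof (rule ccontr)
     assume "~ ?thesis"
     then have "hc k (bt * e) : P" "hc k (et * b) : P"
      unfolding 1 2 using idlD(2)[OF idP] bt et by (auto simp: T_def intro: idl_mult[OF idP])
     then show False using k idl_diff[OF idP] by blast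
    qed
    then have bnd: "(l + m') + j <= k & k <= (l + m') + (j + n)"
     using b(3) Suc.prems(2) m' mn by fastforce
    have "k ~= (l + m') + (j + n)"
    proof
     assume "k = (l + m') + (j + n)"
     then have "hc k (bt * e) - hc k (et * b) = 0" unfolding 1 2 by (simp add: bt_def et_def mult.commute add.commute)
     then show False using k idlD(2)[OF idP] by simp
    qed
    then show "k : {(l + m') + j..<(l + m') + j + n}" using bnd by auto
   qed
   ultimately obtain s c where s: "s : C - P" "c : C" "s * e' - c * b : ?Q" using Suc.IH by blast
   have "s * e' - c * b = (s * bt) * e - (s * et + c) * b" by (simp add: e'_def algebra_simps)
   then have "(s * bt) * e - (s * et + c) * b : ?Q" using s by simp
   moreover have "s * bt : C - P" using s bt prm_mult_notin[OF P] by auto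
   moreover have "s * et + c : C" using s et by auto
   ultimately show ?thesis by blast
  qed
 qed
 have div': "EX s:C - P. EX c:C. s * e - c * b : ?Q" if "e : P" for e
  using div[OF that] ex_bound by blast
 have "b : r"
 proof (rule ccontr)
  \<comment> \<open>Each e in r is c b modulo \<open>star P\<close> up to a factor outside P, and c
    lies in r because b does not. So r = br + star P locally, and Nakayama gives r = star P.\<close>
  assume br: "b ~: r"
  have "r <= qt (C - P) r ?Q b"
  proof
   fix e assume e: "e : r"
   then obtain s c where s: "s : C - P" "c : C" "s * e - c * b : ?Q" using div' r by blast
   have "s * e : r" using s e by (intro idl_mult[OF idr]) auto
   moreover have "s * e - c * b : r" using s r by blast
   ultimately have "s * e - (s * e - c * b) : r" by (rule idl_diff[OF idr])
   then have "c * b : r" by (simp add: algebra_simps)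
   then have "c : r" using prmD(3)[OF r(1) s(2) bC] br by blast
   then show "e : qt (C - P) r ?Q b" using e s
    by (intro qtI[of e r s "C - P" "s * e - c * b" ?Q c b]) (auto simp: algebra_simps)
  qed
  moreover have "clsd (C - P) r ?Q"
   using clsd_sub[OF clsd_prime[OF Q(1), of "C - P"] idr r(2) idlD(1)[OF idr]] star_sub[OF P] by blast
  ultimately have "r = ?Q" using nakayama_qt[OF P _ b(1)] by blast
  then show False using r by blast
 qed
 have "P <= r"
 proof
  fix e assume e: "e : P"
  then obtain s c where s: "s : C - P" "c : C" "s * e - c * b : ?Q" using div' by blast
  have "c * b : r" using s \<open>b : r\<close> by (intro idl_mult[OF idr])
  then have "s * e : r" using s r(2) idl_add[OF idr, of "s * e - c * b" "c * b"] by auto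
  then show "e : r" using prmD(3)[OF r(1), of s e] s r(3) e idl_mem[OF idP] by blast
 qed
 then show ?thesis using r by blast
qed

text \<open>An element outside M has a unit in degree zero. Compared from the lowest degree upwards,
  multiplication by it is injective on graded quotients, so these do not change under localization
  at M.\<close>

lemma gr_clsd:
 assumes M: "!!c. c : C - M ==> EX d:C. d * hc 0 c = 1" and gr: "gr U" "gr V" "V <= U"
 shows "clsd (C - M) U V"
proof -
 note U = grD(1)[OF gr(1)] and V = grD(1)[OF gr(2)]
 have "v : V" if w: "w : C - M" and v: "v : U" "w * v : V" for w v
 proof (rule mem_of_hc[OF V])
  obtain d where d: "d : C" "d * hc 0 w = 1" using M[OF w] by blast
  have vC: "v : C" using v U by (auto dest: idl_mem)
  fix k show "hc k v : V"
  proof (induction k rule: less_induct)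
   case (less k)
   have "(\<Sum>i\<le>k. hc i w * hc (k - i) v) : V" using grD(2)[OF gr(2) v(2), of k] by (simp add: hc_mult)
   then have "hc 0 w * hc k v + (\<Sum>i\<in>{..k} - {0}. hc i w * hc (k - i) v) : V"
    by (subst (asm) sum.remove[of _ 0]) auto
   moreover have "(\<Sum>i\<in>{..k} - {0}. hc i w * hc (k - i) v) : V"
    using less w by (intro idl_sum[OF V] idl_mult[OF V]) auto
   ultimately have "hc 0 w * hc k v : V" using idl_add_cancel[OF V] by blast
   then have "d * (hc 0 w * hc k v) : V" by (rule idl_mult[OF V d(1)])
   then show ?case using d by (simp add: mult.assoc[symmetric])
  qed
 qed
 then show ?thesis using U V gr by (auto simp: clsd_def nzd_on_def)
 qed

text \<open>With \<open>Q = star P\<close>, the module is CM at Q by \<open>cm_localize\<close>. To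
  pass from Q to P, a regular sequence of homogeneous elements of Q is chosen, still regular when
  only homogeneous denominators outside P are allowed; one further element b of P completes
  it.\<close>

lemma graded_cm:
 assumes M: "prm M" "!!c. c : C - M ==> EX d:C. d * hc 0 c = 1"
  and gr: "gr U" "gr V" "V <= U" and dp: "dpt (C - M) M n U V"
  and dim: "!!m. pchain C (colon C V U) m M ==> m <= n"
  and P: "prm P" "colon C V U <= P"
 shows "EX xs. set xs <= P & regseq (C - P) U (sat (C - P) U V) xs & min_over C (colon C V U \<union> set xs) P"
proof -
 note U = grD(1)[OF gr(1)] and V = grD(1)[OF gr(2)]
 have WM: "is_mult C (C - M)" and WP: "is_mult C (C - P)" using mult_compl M P by auto
 have clM: "clsd (C - M) U V" by (rule gr_clsd[OF M(2) gr])
 have in_M: "Q <= M" if pQ: "prm Q" "gr Q" for Q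
 proof
  fix c assume c: "c : Q"
  show "c : M"
  proof (rule ccontr)
   assume "c ~: M"
   then obtain d where "d : C" "d * hc 0 c = 1" using M(2)[of c] idl_mem[OF grD(1)[OF pQ(2)] c] by blast
   moreover have "hc 0 c : Q" using c that grD by blast
   ultimately have "1 : Q" using idl_mult[OF prm_idl[OF that(1)]] by metis
   then show False using that by (auto dest: prmD)
  qed
 qed
 let ?K = "colon C V U"
 define Q where "Q = star P"
 have Q: "prm Q" "gr Q" "Q <= P" "?K <= Q" "Q <= M"
  using star_prime[OF P(1)] star_sub[OF P(1)] star_greatest[OF gr_colon[OF gr(1,2)] P(2)] in_M
  by (auto simp: Q_def)
 have WQ: "is_mult C (C - Q)" using mult_compl Q by blast
 obtain ys where ys: "set ys <= Q" "regseq (C - M) U V ys" "min_over C (?K \<union> set ys) Q"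
  using cm_localize[OF M(1) clM dp dim Q(1,5,4)] by blast
 have ysC: "set ys <= C" using ys Q by (auto dest: prm_idl idl_mem)
 show ?thesis
 proof (cases "P = Q")
  case True
  then have "regseq (C - P) U (sat (C - P) U V) ys"
   using regseq_localize[OF WM WP _ clM ysC ys(2)] Q by auto
  then show ?thesis using ys True by blast
 next
  case False
  then obtain b where b: "b : P" "b ~: Q" using Q by blast
  have bC: "b : C" using b P by (auto dest: prm_idl idl_mem)
  \<comment> \<open>If P contained all forms of degree one, it would contain all positive components
    of b, hence also the one of degree zero, and b would lie in \<open>star P\<close>. Powers of f
    serve to equalize degrees in the homogeneous prime avoidance.\<close>
  have "EX f:C. f = hc 1 f & f ~: P"
  proof (rule ccontr)
   assume "~ ?thesis"
   then have pos: "hc (Suc k) x : P" if "x : C" for x k using hc_gen[OF P(1) _ that] by blast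
   have "hc k b : P" for k
   proof (cases k)
    case 0
    obtain n where n: "b = (\<Sum>k\<le>n. hc k b)" using hc_sum by blast
    have "(\<Sum>k\<le>n. hc k b) = hc 0 b + (\<Sum>k\<in>{..n} - {0}. hc k b)" by (subst sum.remove[of _ 0]) auto
    moreover have "(\<Sum>k\<in>{..n} - {0}. hc k b) : P"
    proof (rule idl_sum[OF prm_idl[OF P(1)]])
     fix i assume "i : {..n} - {0}"
     then show "hc i b : P" using pos[OF bC, of "i - 1"] by auto
    qed
    ultimately show ?thesis using idl_add_cancel[OF prm_idl[OF P(1)]] n b(1) 0 by metis
   qed (use pos bC in auto)
   then show False using b bC by (auto simp: Q_def star_def)
  qed
  then obtain f where f: "f : C" "hc 1 f = f" "f ~: P" by auto
  have fpow: "hc k (f ^ k) = f ^ k" for k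
  proof (induction k)
   case (Suc k) then show ?case using hc_homog_mult_add[OF f(2), of k "f ^ k"] by simp
  qed (use hc_one in simp)
  \<comment> \<open>Homogeneous denominators keep saturations graded, and b is not inverted.\<close>
  define W where "W = {w : Hom. w ~: P}"
  have W: "is_mult C W" "W <= Hom" "W <= C - P"
   using Hom_sub Hom_1 Hom_mult prmD(2)[OF P(1)] prm_mult_notin[OF P(1)]
   unfolding W_def is_mult_def by blast+
  define V0 where "V0 = sat W U V"
  have cl0: "clsd W U V0" unfolding V0_def using U V W by (intro clsd_sat)
  have gr0: "gr V0" unfolding V0_def using gr W by (intro gr_sat)
  define good where "good xs \<longleftrightarrow> set xs <= Q \<inter> Hom & regseq W U V0 xs" for xs
  have bound: "length xs <= n" if "good xs" for xs
  proof (rule dim)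
   have "pchain C ?K (length xs) Q"
    using that W Q gr U V by (intro chain_of_regseq_sat[of W]) (auto simp: good_def V0_def)
   then show "pchain C ?K (length xs) M" using pchain_top Q M by blast
  qed
  have "good []" by (simp add: good_def)
  then obtain xs where xs: "good xs" "!!ys. good ys ==> length ys <= length xs"
   using ex_has_greatest_nat[of good "[]" length "Suc n"] bound by (metis le_imp_less_Suc)
  have xs': "set xs <= Q" "set xs <= Hom" "regseq W U V0 xs" "set xs <= C"
   using xs(1) Hom_sub by (auto simp: good_def)
  define V' where "V' = quo W U V0 xs"
  have cl': "clsd W U V'" unfolding V'_def using clsd_quo[OF cl0 W(1) xs'(4)] .
  have gr': "gr V'" unfolding V'_def using gr_quo gr gr0 W xs' by blast
  define F where "F = max_anns C U V'"
  have F: "finite F" "!!q. q : F ==> prm q"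
   using finite_max_anns max_anns_prime clsdD[OF cl'] by (auto simp: F_def)
  have F_ann: "EX v. v : U - V' & q = annid C V' v" if "q : F" for q
   using that unfolding F_def max_anns_def by blast
  have Fgr: "gr q" if "q : F" for q using F_ann[OF that] gr_annid[OF gr(1) gr'] F(2)[OF that] by auto
  have FQ: "q <= Q" if q: "q : F" for q
   unfolding Q_def
  proof (rule star_greatest[OF Fgr[OF q]])
   show "q <= P"
   proof
    fix x assume x: "x : q"
    obtain v where v: "v : U - V'" "q = annid C V' v" using F_ann[OF q] by blast
    have "hc k x : P" for k
    proof (rule ccontr)
     assume "hc k x ~: P"
     moreover have hq: "hc k x : q" using Fgr[OF q] x grD by blast
     ultimately have "hc k x : W" using x q F(2) by (auto simp: W_def dest!: prm_idl intro: hc_Hom idl_mem)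
     moreover have "hc k x * v : V'" using hq v by (auto simp: annid_def)
     ultimately show False using clsdD(4)[OF cl'] v by blast
    qed
    then show "x : P" by (rule mem_of_hc[OF prm_idl[OF P(1)]])
   qed
  qed
  have nz: "nzd_on x U V'" if "x : C" "!!q. q : F ==> x ~: q" for x
   using not_nzd_max_anns[of U V' x] clsdD[OF cl'] that by (auto simp: F_def)
  have wit: "EX h:Hom \<inter> p. h ~: q" if pq: "gr p" "gr q" "~ p <= q" for p q
  proof -
   obtain x where x: "x : p" "x ~: q" using pq by blast
   then obtain k where "hc k x ~: q" using mem_of_hc[OF grD(1)[OF pq(2)]] by blast
   moreover have "x : C" using idl_mem[OF grD(1)[OF pq(1)] x(1)] .
   ultimately show ?thesis using x grD(2)[OF pq(1)] hc_Hom by blast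
  qed
  \<comment> \<open>All primes in F are homogeneous and lie in Q. If none equalled Q, homogeneous
    prime avoidance would prolong the longest sequence xs.\<close>
  have "EX q:F. Q <= q"
  proof (rule ccontr)
   assume neg: "~ ?thesis"
   have "EX y:Hom \<inter> Q. ALL q:F. y ~: q"
   proof (rule prime_avoidance[OF F Hom_sub Hom_0 Hom_1 Hom_mult])
    fix y z assume "y : Hom" "z : Hom"
    then obtain i j where ij: "hc i y = y" "hc j z = z" "y : C" "z : C" by (auto simp: Hom_def)
    have "hc (j + i) (f ^ j * y + f ^ i * z) = f ^ j * y + f ^ i * z"
     using hc_mult_homog[OF fpow ij(1), of j] hc_mult_homog[OF fpow ij(2), of i] by (simp add: hc_add add.commute)
    then have "f ^ j * y + f ^ i * z : Hom" using ij f unfolding Hom_def by blast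
    moreover have "ALL q:F. f ^ j ~: q & f ^ i ~: q"
     using F(2) FQ Q(3) f prm_power by blast
    ultimately show "EX s:C. EX t:C. s * y + t * z : Hom & (ALL q:F. s ~: q & t ~: q)" using f by blast
   qed (use wit Fgr Q neg prm_idl in auto)
   then obtain y where y: "y : Hom" "y : Q" "ALL q:F. y ~: q" by blast
   then have "nzd_on y U V'" using nz Hom_sub by blast
   then have "good (xs @ [y])" using y xs' by (auto simp: good_def regseq_append V'_def)
   then show False using xs(2) by fastforce
  qed
  then have QF: "Q : F" using FQ by (metis subset_antisym)
  then obtain v where v: "v : U - V'" "Q = annid C V' v" using F_ann by blast
  \<comment> \<open>A longer ys would leave positive depth at Q after dividing by xs, but v is
    killed by Q there. With Krull's theorem for ys this makes Q minimal over xs.\<close>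
  have xsys: "length ys <= length xs"
  proof (rule ccontr)
   assume neg: "~ ?thesis"
   let ?W = "C - Q"
   have WQ': "W <= ?W" "C - M <= ?W" using W(3) Q by auto
   have cQ: "clsd ?W U (sat ?W U V)" using U V WQ by (intro clsd_sat)
   have "regseq ?W U (sat ?W U V) ys" using regseq_localize[OF WM WQ WQ'(2) clM ysC ys(2)] .
   then have "dpt ?W Q (length xs + (length ys - length xs)) U (sat ?W U V)"
    using ys neg unfolding dpt_def by (intro exI[of _ ys]) auto
   moreover have "regseq ?W U (sat ?W U V) xs"
    using regseq_localize[OF W(1) WQ WQ'(1) cl0 xs'(4,3)] sat_sat[OF W(1) WQ WQ'(1) U V gr(3)] by (simp add: V0_def)
   ultimately have "dpt ?W Q (length ys - length xs) U (quo ?W U (sat ?W U V) xs)"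
    using dpt_quo[OF WQ prm_idl[OF Q(1)] cQ] xs'(1) by blast
   moreover have "quo ?W U (sat ?W U V) xs = sat ?W U V'"
    using quo_sat[OF W(1) WQ WQ'(1) cl0 xs'(4)] sat_sat[OF W(1) WQ WQ'(1) U V gr(3)] by (simp add: V0_def V'_def)
   moreover obtain j where "length ys - length xs = Suc j" using neg by (metis Suc_diff_Suc not_le)
   ultimately obtain x where x: "x : Q" "nzd_on x U (sat ?W U V')" by (auto simp: dpt_Suc)
   have "x * v : V'" using x v by (auto simp: annid_def)
   then have "x * v : sat ?W U V'" using sat_upper[OF WQ clsdD(3)[OF cl']] by blast
   then have "v : sat ?W U V'" using x v by (auto simp: nzd_on_def)
   then obtain w where "w : ?W" "w * v : V'" by (auto simp: sat_def)
   then show False using v by (auto simp: annid_def)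
  qed
  have minQ: "min_over C (?K \<union> set xs) Q" unfolding min_over_def
  proof (intro conjI allI impI)
   show "prm Q" "?K \<union> set xs <= Q" using Q xs' by auto
   fix r assume r: "prm r" "?K \<union> set xs <= r" "r <= Q"
   show "r = Q"
   proof (rule ccontr)
    assume "r ~= Q"
    have "pchain C ?K (length xs) r"
     using r W Q gr U V xs' by (intro chain_of_regseq_sat[of W]) (auto simp: V0_def)
    then have "pchain C ?K (Suc (length xs)) Q" using r \<open>r ~= Q\<close> Q(1) by auto
    then have "Suc (length xs) <= length ys" using krull_height[OF ys(3) ysC] by blast
    then show False using xsys by simp
   qed
  qed
  have "nzd_on b U V'" using nz[OF bC] b FQ by blast
  then have "regseq W U V0 (xs @ [b])" using xs' by (auto simp: regseq_append V'_def)
  then have "regseq (C - P) U (sat (C - P) U V) (xs @ [b])"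
   using regseq_localize[OF W(1) WP W(3) cl0, of "xs @ [b]"] xs' bC sat_sat[OF W(1) WP W(3) U V gr(3)]
   by (simp add: V0_def)
  \<comment> \<open>For a prime r between, \<open>star r\<close> contains the annihilator and the
    homogeneous xs, so it is Q by minimality. Then r lies above Q, differs from it by b, and equals
    P by \<open>no_prime_above_star\<close>.\<close>
  moreover have "min_over C (?K \<union> set (xs @ [b])) P" unfolding min_over_def
  proof (intro conjI allI impI)
   show "prm P" "?K \<union> set (xs @ [b]) <= P" using P Q xs' b by auto
   fix r assume r: "prm r" "?K \<union> set (xs @ [b]) <= r" "r <= P"
   have "?K <= star r" using star_greatest[OF gr_colon[OF gr(1,2)]] r by blast
   moreover have "set xs <= star r" using r(2) xs'(2) Hom_star[OF r(1)] by (metis Un_iff set_append subset_iff)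
   moreover have "star r <= Q" unfolding Q_def using star_mono[OF r(3)] .
   ultimately have "star r = Q" using min_overD(3)[OF minQ] star_prime[OF r(1)] by blast
   then have "Q <= r" using star_sub[OF r(1)] by blast
   moreover have "r ~= Q" using r b by auto
   ultimately show "r = P" using no_prime_above_star[OF P(1) r(1)] r(3) by (auto simp: Q_def)
  qed
  moreover have "set (xs @ [b]) <= P" using xs' Q b by auto
  ultimately show ?thesis by blast
 qed
qed

end

section \<open>Rees algebras\<close>

inductive_set iprod :: "'a::comm_ring_1 set => 'a set => 'a set" for I J where
 iprodI: "x : I ==> y : J ==> x * y : iprod I J"
| iprod_add: "x : iprod I J ==> y : iprod I J ==> x + y : iprod I J"

primrec ipow :: "'a::comm_ring_1 set => nat => 'a set" where
 "ipow J 0 = UNIV"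
| "ipow J (Suc n) = iprod (ipow J n) J"

text \<open>\<open>RK K J\<close> is \<open>KR[Ju]\<close>; in particular \<open>RS J\<close> below is the Rees algebra \<open>R[Ju]\<close>.\<close>

definition RK :: "'a::comm_ring_1 set => 'a set => 'a poly set" where
 "RK K J = {p. ALL i. coeff p i : iprod K (ipow J i)}"

abbreviation RS :: "'a::comm_ring_1 set => 'a poly set" where
 "RS J \<equiv> RK UNIV J"

text \<open>For \<open>A = RS J\<close> the outer variable is t and the coefficients are polynomials
  in u.\<close>

definition pol :: "'a::comm_ring_1 set => 'a poly set" where
 "pol A = {q. ALL j. coeff q j : A}"

interpretation u: comm_subring "UNIV :: 'a::comm_ring_1 set"
 by unfold_locales auto

lemma iprod_ideal: assumes "u.idl I" "u.idl J" shows "u.idl (iprod I J)"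
proof -
 have "c * x : iprod I J" if "x : iprod I J" for c x
  using that
 proof (induction rule: iprod.induct)
  case (iprodI x y)
  then have "(c * x) * y : iprod I J" using assms(1) by (intro iprod.iprodI) (auto dest: idlD)
  then show ?case by (simp add: mult.assoc)
 qed (auto simp: distrib_left intro: iprod_add)
 moreover have "0 : iprod I J" using iprodI[of 0 I 0 J] assms by (auto dest: idlD)
 ultimately show ?thesis by (auto simp: is_ideal_def intro: iprod_add)
qed

lemma iprod_least: "u.idl Z ==> (!!x y. x : I ==> y : J ==> x * y : Z) ==> iprod I J <= Z"
proof
 fix z assume "u.idl Z" "!!x y. x : I ==> y : J ==> x * y : Z" "z : iprod I J"
 from this(3,1,2) show "z : Z" by (induction rule: iprod.induct) (auto intro: u.idl_add)
qed

lemma iprod_mono: assumes "I <= I'" "J <= J'" shows "iprod I J <= iprod I' J'"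
proof
 fix z assume "z : iprod I J"
 then show "z : iprod I' J'" using assms by (induction rule: iprod.induct) (auto intro: iprod.intros)
qed

lemma iprod_comm: "iprod I J = iprod J I"
proof -
 have "z : iprod J I" if "z : iprod I J" for z and I J :: "'a set"
  using that
 proof (induction rule: iprod.induct)
  case (iprodI x y)
  then show ?case using iprod.iprodI[of y J x I] by (simp add: mult.commute)
 qed (auto intro: iprod_add)
 then show ?thesis by blast
qed

lemma iprod_sub2: assumes "u.idl J" shows "iprod K J <= J"
 using assms by (intro iprod_least) (auto dest: idlD)

lemma iprod_sub1: assumes "u.idl K" shows "iprod K J <= K"
 using iprod_sub2[OF assms, of J] by (simp add: iprod_comm)

lemma iprod_UNIV: assumes "u.idl J" shows "iprod UNIV J = J"
proof
 show "J <= iprod UNIV J" using iprodI[of 1 UNIV _ J] by auto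
qed (use iprod_sub2[OF assms] in blast)

lemma ipow_ideal: "u.idl J ==> u.idl (ipow J n)"
 by (induction n) (auto intro: iprod_ideal)

lemma ipow_mult:
 assumes "u.idl J" "x : ipow J i" "y : ipow J j" shows "x * y : ipow J (i + j)"
 using assms(3)
proof (induction j arbitrary: y)
 case 0 then show ?case using ipow_ideal[OF assms(1), of i] assms(2) by (auto dest: idlD)
next
 case (Suc j)
 have "u.idl {y. x * y : ipow J (i + Suc j)}"
  using ipow_ideal[OF assms(1), of "i + Suc j"] unfolding is_ideal_def
  by (simp add: distrib_left mult.left_commute del: ipow.simps add_Suc_right)
 then have "iprod (ipow J j) J <= {y. x * y : ipow J (i + Suc j)}"
 proof (rule iprod_least)
  fix a b assume "a : ipow J j" "b : J"
  then have "(x * a) * b : ipow J (i + Suc j)" using Suc.IH by (auto intro: iprodI)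
  then show "a * b : {y. x * y : ipow J (i + Suc j)}" by (simp add: mult.assoc)
 qed
 then show ?case using Suc.prems by auto
qed

lemma ipow_Suc_sub: "u.idl J ==> ipow J (Suc n) <= ipow J n"
 using iprod_sub1[OF ipow_ideal] by simp

lemma ipow_mono: "J <= J' ==> ipow J n <= ipow J' n"
 by (induction n) (auto dest: subsetD[OF iprod_mono])

lemma iprod_ipow_mult:
 assumes "u.idl K" "u.idl J" "x : ipow J i" "y : iprod K (ipow J j)"
 shows "x * y : iprod K (ipow J (i + j))"
proof -
 have "u.idl {y. x * y : iprod K (ipow J (i + j))}"
  using iprod_ideal[OF assms(1) ipow_ideal[OF assms(2)], of "i + j"] unfolding is_ideal_def
  by (simp add: distrib_left mult.left_commute)
 then have "iprod K (ipow J j) <= {y. x * y : iprod K (ipow J (i + j))}"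
 proof (rule iprod_least)
  fix a b assume "a : K" "b : ipow J j"
  then have "a * (x * b) : iprod K (ipow J (i + j))" using ipow_mult assms by (intro iprodI) auto
  then show "a * b : {y. x * y : iprod K (ipow J (i + j))}" by (simp add: mult.left_commute)
 qed
 then show ?thesis using assms by auto
qed

lemma RK_iff: "p : RK K J \<longleftrightarrow> (ALL i. coeff p i : iprod K (ipow J i))"
 by (simp add: RK_def)

lemma RS_iff: "u.idl J ==> p : RS J \<longleftrightarrow> (ALL i. coeff p i : ipow J i)"
 by (simp add: RK_def iprod_UNIV ipow_ideal)

lemma RK_mono: assumes "K <= K'" "J <= J'" shows "RK K J <= RK K' J'"
proof -
 have "iprod K (ipow J i) <= iprod K' (ipow J' i)" for i using iprod_mono[OF assms(1) ipow_mono[OF assms(2)]] .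
 then show ?thesis unfolding RK_def by blast
qed

lemma RK_add: "p : RK K J ==> q : RK K J ==> p + q : RK K J"
 by (auto simp: RK_def intro: iprod_add)

lemma idl_sum_univ: "u.idl U ==> (!!i. i : A ==> f i : U) ==> sum f A : U"
 by (induction A rule: infinite_finite_induct) (auto dest: idlD(2) intro: u.idl_add)

lemma RK_mult:
 assumes "u.idl K" "u.idl J" "p : RS J" "q : RK K J"
 shows "p * q : RK K J"
 unfolding RK_iff
proof
 fix n
 have "coeff p i * coeff q (n - i) : iprod K (ipow J n)" if "i <= n" for i
  using iprod_ipow_mult[of K J "coeff p i" i "coeff q (n - i)" "n - i"] assms that
  by (simp add: RS_iff[OF assms(2)] RK_iff[of q])
 then show "coeff (p * q) n : iprod K (ipow J n)"
  unfolding coeff_mult using assms by (intro idl_sum_univ iprod_ideal ipow_ideal) auto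
qed

lemma monom_RK: "u.idl K ==> u.idl J ==> monom r n : RK K J \<longleftrightarrow> r : iprod K (ipow J n)"
 using idlD(2)[OF iprod_ideal[OF _ ipow_ideal]] by (auto simp: RK_iff coeff_monom split: if_splits)

lemma monom_RS: "u.idl J ==> monom r n : RS J \<longleftrightarrow> r : ipow J n"
 by (simp add: monom_RK iprod_UNIV ipow_ideal)

lemma const_RK: "u.idl K ==> u.idl J ==> [:r:] : RK K J \<longleftrightarrow> r : K"
 using monom_RK[of K J r 0] by (simp add: monom_0 iprod_UNIV iprod_comm[of K UNIV])

lemma RS_subring: assumes "u.idl J" shows "comm_subring (RS J)"
proof
 show "1 : RS J" using const_RK[OF u.idl_C assms, of 1] by (simp add: one_pCons)
 show "- p : RS J" if "p : RS J" for p
  using that RS_iff[OF assms] u.idl_uminus[OF ipow_ideal[OF assms]] by auto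
qed (use assms RK_mult[OF u.idl_C assms] RK_add in auto)

lemma RK_ideal:
 assumes "u.idl K" "u.idl J" shows "is_ideal (RS J) (RK K J)"
proof -
 have "RK K J <= RS J" by (intro RK_mono) auto
 moreover have "0 : RK K J" using idlD(2)[OF iprod_ideal[OF assms(1) ipow_ideal[OF assms(2)]]] by (simp add: RK_iff)
 ultimately show ?thesis using RK_add RK_mult[OF assms] by (auto simp: is_ideal_def)
qed

lemma pol_iff: "q : pol A \<longleftrightarrow> (ALL j. coeff q j : A)"
 by (simp add: pol_def)

lemma pol_mono: "A <= B ==> pol A <= pol B"
 by (auto simp: pol_def)

context comm_subring
begin

lemma ideal_sum: "idl U ==> (!!i. i : A ==> f i : U) ==> sum f A : U"
 by (induction A rule: infinite_finite_induct) (auto dest: idlD(2) intro: idl_add)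

lemma pol_subring: "comm_subring (pol C)"
proof
 show "1 : pol C" by (simp add: pol_iff coeff_1)
 show "p * q : pol C" if pq: "p : pol C" "q : pol C" for p q
  unfolding pol_iff coeff_mult
 proof
  fix j show "(\<Sum>i\<le>j. coeff p i * coeff q (j - i)) : C" using pq by (intro ideal_sum[OF idl_C]) (simp add: pol_iff)
 qed
qed (auto simp: pol_iff)

lemma pol_ideal: assumes "idl U" shows "is_ideal (pol C) (pol U)"
 unfolding is_ideal_def
proof (intro conjI ballI)
 show "pol U <= pol C" using pol_mono[OF idlD(1)[OF assms]] .
 fix p q assume pq: "p : pol C" "q : pol U"
 show "p * q : pol U" unfolding pol_iff coeff_mult
 proof
  fix j show "(\<Sum>i\<le>j. coeff p i * coeff q (j - i)) : U"
   using pq by (intro ideal_sum[OF assms] idl_mult[OF assms]) (simp_all add: pol_iff)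
 qed
qed (use idlD(2)[OF assms] idl_add[OF assms] in \<open>simp_all add: pol_iff\<close>)

lemma poly_mem: assumes "idl U" "q : pol U" "x : C" shows "poly q x : U"
proof -
 have "coeff q i * x ^ i : U" for i
  using assms(2) by (intro idlD(5)[OF assms(1) power_mem[OF assms(3)]]) (simp add: pol_iff)
 then show ?thesis unfolding poly_altdef by (intro ideal_sum[OF assms(1)])
qed

end

text \<open>For J generated by a regular sequence, R[Ju]/KR[Ju] is a polynomial ring over R/K
  whenever K contains J. The property retains from this that nonzerodivisors on R/K stay so; in this
  form it passes from J to J + (x).\<close>

definition NZP :: "'a::comm_ring_1 set => bool" where
 "NZP J \<longleftrightarrow> u.idl J & (ALL K c. u.idl K --> J <= K --> nzd_on c UNIV K -->
   (ALL p:RS J. [:c:] * p : RK K J --> p : RK K J))"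

abbreviation shift_lin :: "'a::comm_ring_1 => 'a poly poly" where
 "shift_lin x \<equiv> [:- monom x 1, 1:]"

lemma coeff_shift_lin:
 "coeff (shift_lin x * q) 0 = - (monom x 1 * coeff q 0)"
 "coeff (shift_lin x * q) (Suc j) = coeff q j - monom x 1 * coeff q (Suc j)"
 by (simp_all add: coeff_pCons)

lemma coeff_monom_1_mult: "coeff (monom x 1 * p) (Suc i) = x * coeff p i" "coeff (monom x 1 * p) 0 = 0"
 by (simp_all add: coeff_monom_mult)

text \<open>For K = J the quotient R[Ju]/JR[Ju] is the associated graded ring, and regularity of x
  on it climbs from J^i to J^(i+1).\<close>

lemma NZP_pow:
 assumes "NZP J" "nzd_on x UNIV J" "x * r : ipow J i" shows "r : ipow J i"
 using assms(3)
proof (induction i)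
 case (Suc i)
 have J: "u.idl J" using assms by (simp add: NZP_def)
 have "r : ipow J i" using Suc ipow_Suc_sub[OF J] by blast
 then have m: "monom r i : RS J" by (simp add: monom_RS J)
 have "[:x:] * monom r i : RK J J" using Suc.prems J by (simp add: smult_monom monom_RK iprod_comm[of J])
 then have "monom r i : RK J J" using assms m J unfolding NZP_def by blast
 then show ?case using J by (simp add: monom_RK iprod_comm[of J])
qed simp

text \<open>Compare coefficients of (t - xu)q, starting with the lowest power of t: x times a
  coefficient of q in u-degree i lies in J^(i+1), and x cancels there.\<close>

lemma shift_lin_kernel:
 assumes J: "u.idl J" and nz: "!!i r. x * r : ipow J i ==> r : ipow J i"
  and q: "shift_lin x * q : pol (RS J)"
 shows "q : pol (RK J J)"
proof -
 have "coeff (coeff q j) i : ipow J (Suc i)" for i j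
 proof (induction j arbitrary: i)
  case 0
  have "coeff (coeff (shift_lin x * q) 0) (Suc i) : ipow J (Suc i)" using q unfolding pol_iff RS_iff[OF J] by blast
  then have "- (x * coeff (coeff q 0) i) : ipow J (Suc i)"
   unfolding coeff_shift_lin coeff_minus coeff_monom_1_mult .
  then have "x * coeff (coeff q 0) i : ipow J (Suc i)" using u.idl_uminus[OF ipow_ideal[OF J]] by (metis minus_minus)
  then show ?case by (rule nz)
 next
  case (Suc j)
  have "coeff (coeff (shift_lin x * q) (Suc j)) (Suc i) : ipow J (Suc i)" using q unfolding pol_iff RS_iff[OF J] by blast
  then have "coeff (coeff q j) (Suc i) - x * coeff (coeff q (Suc j)) i : ipow J (Suc i)"
   unfolding coeff_shift_lin coeff_diff coeff_monom_1_mult .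
  moreover have "coeff (coeff q j) (Suc i) : ipow J (Suc i)" using Suc.IH[of "Suc i"] ipow_Suc_sub[OF J, of "Suc i"] by blast
  ultimately have "coeff (coeff q j) (Suc i) - (coeff (coeff q j) (Suc i) - x * coeff (coeff q (Suc j)) i) : ipow J (Suc i)"
   using u.idl_diff[OF ipow_ideal[OF J]] by blast
  then have "x * coeff (coeff q (Suc j)) i : ipow J (Suc i)" by (simp del: ipow.simps)
  then show ?case by (rule nz)
 qed
 then show ?thesis by (simp add: pol_iff RK_iff iprod_comm[of J])
qed

text \<open>Division by t - xu is carried out in R[u,t], and \<open>shift_lin_kernel\<close> places
  the quotient in JR[Ju,t]. So the kernel of R[Ju,t] -> R[(J,x)u], t going to xu, is (t -
  xu)JR[Ju,t].\<close>

lemma eval_kernel: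
 assumes J: "u.idl J" and nz: "!!i r. x * r : ipow J i ==> r : ipow J i"
  and q: "q : pol (RS J)" "poly q (monom x 1) = 0"
 shows "EX q':pol (RK J J). q = shift_lin x * q'"
proof -
 obtain q' where "q = shift_lin x * q'" using q(2) by (auto simp: poly_eq_0_iff_dvd dvd_def)
 then show ?thesis using shift_lin_kernel[OF J nz, where q = q'] q(1) by blast
qed

lemma monom_1_RK:
 assumes "u.idl K" "u.idl J" "x : K" "p : RK J J"
 shows "monom x 1 * p : RK K J"
 unfolding RK_iff
proof
 fix i
 show "coeff (monom x 1 * p) i : iprod K (ipow J i)"
 proof (cases i)
  case 0 show ?thesis unfolding 0 coeff_monom_1_mult
   by (rule idlD(2)[OF iprod_ideal[OF assms(1) ipow_ideal[OF assms(2)]]])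
 next
  case (Suc j)
  have "coeff p j : ipow J (Suc j)" using assms(4) by (simp add: RK_iff iprod_comm[of J])
  then show ?thesis unfolding Suc coeff_monom_1_mult using assms(3) by (intro iprodI)
 qed
qed

lemma shift_lin_RK:
 assumes "u.idl K" "u.idl J" "J <= K" "x : K" "q : pol (RK J J)"
 shows "shift_lin x * q : pol (RK K J)"
 unfolding pol_iff
proof
 interpret RS: comm_subring "RS J" using RS_subring assms by blast
 note idl = RK_ideal[OF assms(1,2)]
 have 1: "coeff q j : RK K J" for j using assms(5) RK_mono[OF assms(3) order_refl] by (auto simp: pol_iff)
 have 2: "monom x 1 * coeff q j : RK K J" for j using monom_1_RK[OF assms(1,2,4)] assms(5) by (auto simp: pol_iff)
 fix j show "coeff (shift_lin x * q) j : RK K J"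
  by (cases j) (simp_all only: coeff_shift_lin RS.idl_uminus[OF idl 2] RS.idl_diff[OF idl 1 2])
qed

definition adj :: "'a::comm_ring_1 set => 'a => 'a set" where
 "adj J x = isum J ((*) x ` UNIV)"

lemma adj_ideal: "u.idl J ==> u.idl (adj J x)"
 unfolding adj_def by (intro u.idl_isum u.idl_image) auto

lemma adj_upper: assumes "u.idl J" shows "J <= adj J x" "x : adj J x"
 using u.isum_upper1[OF u.idl_image[OF u.idl_C], of x J] u.isum_upper2[OF assms, of "(*) x ` UNIV"]
  u.mem_principal[of x] by (auto simp: adj_def)

lemma adjE: assumes "r : adj J x" obtains s c where "s : J" "r = s + x * c"
 using assms by (auto simp: adj_def isum_def)

lemma eval_mem:
 assumes "u.idl K" "u.idl J" "q : pol (RK K J)"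
 shows "poly q (monom x 1) : RK K (adj J x)"
proof -
 interpret RS: comm_subring "RS (adj J x)" using RS_subring adj_ideal assms by blast
 have "pol (RK K J) <= pol (RK K (adj J x))" using adj_upper[OF assms(2)] by (intro pol_mono RK_mono) auto
 moreover have "monom x 1 : RS (adj J x)"
  using adj_upper[OF assms(2)] adj_ideal[OF assms(2)] by (subst monom_RS) (auto simp: iprod_UNIV)
 ultimately show ?thesis using RS.poly_mem[OF RK_ideal[OF assms(1) adj_ideal[OF assms(2)]]] assms(3) by blast
qed

lemma eval_surj_RS:
 assumes J: "u.idl J" and s: "s : ipow (adj J x) n"
 shows "EX q:pol (RS J). poly q (monom x 1) = monom s n"
 using s
proof (induction n arbitrary: s)
 case 0
 have "[:[:s:]:] : pol (RS J)" using const_RK[OF u.idl_C J, of s] idlD(2)[OF RK_ideal[OF u.idl_C J]]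
  by (auto simp: pol_iff coeff_pCons split: nat.splits)
 moreover have "poly [:[:s:]:] (monom x 1) = monom s 0" by (simp add: monom_0)
 ultimately show ?case by blast
next
 case (Suc n)
 interpret RS: comm_subring "RS J" using RS_subring J by blast
 interpret P: comm_subring "pol (RS J)" using RS.pol_subring .
 define Z where "Z = {s. EX q:pol (RS J). poly q (monom x 1) = monom s (Suc n)}"
 have "s : Z" using Suc.prems[unfolded ipow.simps]
 proof (induction rule: iprod.induct)
  case (iprodI a b)
  obtain q where q: "q : pol (RS J)" "poly q (monom x 1) = monom a n" using Suc.IH iprodI by blast
  obtain j c where j: "j : J" "b = j + x * c" using iprodI by (elim adjE)
  have "monom j 1 : RS J" "[:c:] : RS J" using j J by (auto simp: monom_RS iprod_UNIV const_RK)
  then have "[:monom j 1, [:c:]:] : pol (RS J)" using RS.zero_mem by (auto simp: pol_iff coeff_pCons split: nat.splits)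
  then have "q * [:monom j 1, [:c:]:] : pol (RS J)" using q by blast
  moreover have "poly (q * [:monom j 1, [:c:]:]) (monom x 1) = monom (a * b) (Suc n)"
   using j q by (simp add: mult_monom[symmetric] monom_altdef algebra_simps smult_add_left add_monom[symmetric])
  ultimately show ?case unfolding Z_def by blast
 next
  case (iprod_add a b)
  then obtain q q' where "q : pol (RS J)" "poly q (monom x 1) = monom a (Suc n)"
   "q' : pol (RS J)" "poly q' (monom x 1) = monom b (Suc n)" unfolding Z_def by blast
  then show ?case unfolding Z_def by (intro CollectI bexI[of _ "q + q'"]) (auto simp: add_monom)
 qed
 then show ?case by (simp add: Z_def)
qed

lemma eval_surj:
 assumes K: "u.idl K" and J: "u.idl J" and p: "p : RK K (adj J x)"
 shows "EX q:pol (RK K J). poly q (monom x 1) = p"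
proof -
 interpret RS: comm_subring "RS J" using RS_subring J by blast
 interpret P: comm_subring "pol (RS J)" using RS.pol_subring .
 have idl: "P.idl (pol (RK K J))" using RS.pol_ideal[OF RK_ideal[OF K J]] .
 define Z where "Z = {p. EX q:pol (RK K J). poly q (monom x 1) = p}"
 have add: "a + b : Z" if "a : Z" "b : Z" for a b
  using that P.idl_add[OF idl] unfolding Z_def by (auto simp: poly_add[symmetric] simp del: poly_add)
 have mon: "monom s n : Z" if "s : iprod K (ipow (adj J x) n)" for s n
  using that
 proof (induction rule: iprod.induct)
  case (iprodI k s)
  obtain q where q: "q : pol (RS J)" "poly q (monom x 1) = monom s n" using eval_surj_RS[OF J] iprodI by blast
  have "[:[:k:]:] : pol (RK K J)" using const_RK[OF K J, of k] iprodI idlD(2)[OF RK_ideal[OF K J]]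
   by (auto simp: pol_iff coeff_pCons split: nat.splits)
  then have "q * [:[:k:]:] : pol (RK K J)" using P.idl_mult[OF idl q(1)] by blast
  moreover have "poly (q * [:[:k:]:]) (monom x 1) = monom (k * s) n" using q by (simp add: smult_monom)
  ultimately show ?case unfolding Z_def by blast
 next
  case (iprod_add a b) then show ?case using add by (simp add: add_monom[symmetric])
 qed
 have "(\<Sum>i\<in>A. monom (coeff p i) i) : Z" if "finite A" for A
  using that
 proof (induction A)
  case empty then show ?case using idlD(2)[OF idl] unfolding Z_def by force
 next
  case (insert i A) then show ?case using add mon p by (auto simp: RK_iff)
 qed
 then have "p : Z" using poly_as_sum_of_monoms[of p] by (metis finite_atMost)
 then show ?thesis by (simp add: Z_def)
qed

text \<open>For K containing J and x, the kernel of the evaluation lies in KR[Ju,t]. Hence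
  R[(J,x)u]/KR[(J,x)u] is the polynomial ring in t over R[Ju]/KR[Ju].\<close>

lemma eval_RK_iff:
 assumes J: "NZP J" and x: "nzd_on x UNIV J" and K: "u.idl K" "adj J x <= K" and q: "q : pol (RS J)"
 shows "poly q (monom x 1) : RK K (adj J x) \<longleftrightarrow> q : pol (RK K J)"
proof
 have idJ: "u.idl J" using J by (simp add: NZP_def)
 interpret RS: comm_subring "RS J" using RS_subring idJ by blast
 interpret P: comm_subring "pol (RS J)" using RS.pol_subring .
 have idl: "P.idl (pol (RK K J))" using RS.pol_ideal[OF RK_ideal[OF K(1) idJ]] .
 assume "poly q (monom x 1) : RK K (adj J x)"
 then obtain k where k: "k : pol (RK K J)" "poly k (monom x 1) = poly q (monom x 1)"
  using eval_surj[OF K(1) idJ] by blast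
 then have "q - k : pol (RS J)" using q idlD(1)[OF idl] by auto
 moreover have "poly (q - k) (monom x 1) = 0" using k by simp
 ultimately obtain q' where q': "q' : pol (RK J J)" "q - k = shift_lin x * q'"
  using eval_kernel[OF idJ NZP_pow[OF J x]] by blast
 have "q - k : pol (RK K J)" unfolding q'(2) using adj_upper[OF idJ, of x] K q'(1) idJ by (intro shift_lin_RK) auto
 then show "q : pol (RK K J)" using P.idl_add[OF idl _ k(1), of "q - k"] by simp
qed (use eval_mem[OF K(1)] J in \<open>auto simp: NZP_def\<close>)

lemma NZP_zero: "NZP {0::'a::comm_ring_1}"
proof -
 have pow: "ipow {0::'a} (Suc n) = {0}" for n
  using iprod_sub2[of "{0::'a}" "ipow {0} n"] idlD(2)[OF ipow_ideal[of "{0::'a}" "Suc n"]] by auto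
 have "p : RK K {0}" if K: "u.idl K" "nzd_on c UNIV K" and p: "p : RS {0}" "[:c:] * p : RK K {0}"
  for K :: "'a set" and c p
  unfolding RK_iff
 proof
  fix i
  show "coeff p i : iprod K (ipow {0} i)"
  proof (cases i)
   case 0
   have "c * coeff p 0 : iprod K (ipow {0} 0)" using p(2) by (simp add: RK_iff) (metis ipow.simps(1))
   then show ?thesis using K 0 by (auto simp: iprod_comm[of K] iprod_UNIV nzd_on_def)
  next
   case (Suc j)
   then have "coeff p i = 0" using p(1) RS_iff[of "{0::'a}" p] pow[of j] by (metis singletonD u.idl_zero)
   then show ?thesis using idlD(2)[OF iprod_ideal[OF K(1) ipow_ideal]] by auto
  qed
 qed
 then show ?thesis by (auto simp: NZP_def)
qed

lemma NZP_adj: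
 assumes J: "NZP J" and x: "nzd_on x UNIV J"
 shows "NZP (adj J x)"
proof -
 have idJ: "u.idl J" using J by (simp add: NZP_def)
 have "p : RK K (adj J x)"
  if K: "u.idl K" "adj J x <= K" "nzd_on c UNIV K" and p: "p : RS (adj J x)" "[:c:] * p : RK K (adj J x)" for K c p
 proof -
  obtain q where q: "q : pol (RS J)" "poly q (monom x 1) = p" using eval_surj[OF u.idl_C idJ p(1)] by blast
  have "[:c:] : RS J" using const_RK[OF u.idl_C idJ] by blast
  then have "[:[:c:]:] * q : pol (RS J)" using q RK_mult[OF u.idl_C idJ, of "[:c:]"] by (auto simp: pol_iff)
  moreover have "poly ([:[:c:]:] * q) (monom x 1) : RK K (adj J x)" using p q by simp
  ultimately have "[:[:c:]:] * q : pol (RK K J)" using eval_RK_iff[OF J x K(1,2)] by blast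
  then have "[:c:] * coeff q j : RK K J" for j by (auto simp: pol_iff)
  moreover have "J <= K" using adj_upper[OF idJ] K by blast
  ultimately have "q : pol (RK K J)" using J K q unfolding NZP_def pol_iff by blast
  then show ?thesis using eval_mem[OF K(1) idJ] q by blast
 qed
 then show ?thesis using adj_ideal[OF idJ] by (auto simp: NZP_def)
qed

text \<open>Hilbert's basis theorem by the ideals \<open>lc n I\<close> of leading coefficients in
  degree n. They increase with n and with I, and nested ideals with the same \<open>lc n\<close> for
  all n are equal.\<close>

lemma noetherian_pol:
 assumes "noeth_subring C" shows "noeth_subring (pol C)"
proof -
 interpret C: noeth_subring C by (rule assms)
 interpret P: comm_subring "pol C" by (rule C.pol_subring)
 define lc where "lc n I = {coeff q n | q. q : I & (ALL i>n. coeff q i = 0)}" for n and I :: "'a poly set"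
 have lc_idl: "C.idl (lc n I)" if I: "P.idl I" for n I
  unfolding is_ideal_def
 proof (intro conjI ballI)
  show "lc n I <= C" using idlD(1)[OF I] by (auto simp: lc_def pol_iff)
  show "0 : lc n I" using idlD(2)[OF I] by (force simp: lc_def)
  fix a b assume "a : lc n I" "b : lc n I"
  then obtain p q where "p : I" "q : I" "a = coeff p n" "b = coeff q n" "ALL i>n. coeff p i = 0" "ALL i>n. coeff q i = 0"
   by (auto simp: lc_def)
  then show "a + b : lc n I" unfolding lc_def using P.idl_add[OF I]
   by (intro CollectI exI[of _ "p + q"]) auto
 next
  fix c a assume "c : C" "a : lc n I"
  then obtain p where p: "p : I" "a = coeff p n" "ALL i>n. coeff p i = 0" by (auto simp: lc_def)
  have "[:c:] : pol C" using \<open>c : C\<close> by (auto simp: pol_iff coeff_pCons split: nat.splits)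
  then have "[:c:] * p : I" using P.idl_mult[OF I] p by blast
  then show "c * a : lc n I" unfolding lc_def using p
   by (intro CollectI exI[of _ "[:c:] * p"]) auto
 qed
 have lc_mono: "I <= I' ==> lc n I <= lc n I'" for n I I' by (auto simp: lc_def)
 have t: "[:0, 1:] : pol C" by (auto simp: pol_iff coeff_pCons split: nat.splits)
 have lc_Suc: "lc n I <= lc (Suc n) I" if I: "P.idl I" for n I
 proof
  fix a assume "a : lc n I"
  then obtain p where p: "p : I" "a = coeff p n" "ALL i>n. coeff p i = 0" by (auto simp: lc_def)
  have "[:0, 1:] * p : I" using P.idl_mult[OF I t p(1)] .
  then have "pCons 0 p : I" by simp
  moreover have "ALL i>Suc n. coeff (pCons 0 p) i = 0" using p(3) by (auto simp: coeff_pCons split: nat.splits)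
  ultimately show "a : lc (Suc n) I" unfolding lc_def using p(2)
   by (intro CollectI exI[of _ "pCons 0 p"]) auto
 qed
 have lc_le: "lc n I <= lc k I" if "P.idl I" "n <= k" for n k I
  using that(2) lc_Suc[OF that(1)] by (rule lift_Suc_mono_le[rotated])
 have eqI: "I' = I" if I: "P.idl I" "P.idl I'" "I <= I'" "!!n. lc n I' = lc n I" for I I'
 proof -
  have "q : I" if "q : I'" "ALL i>=n. coeff q i = 0" for q n
   using that
  proof (induction n arbitrary: q)
   case 0
   then have "q = 0" by (intro poly_eqI) simp
   then show ?case using idlD(2)[OF I(1)] by simp
  next
   case (Suc n)
   have "coeff q n : lc n I'" using Suc.prems by (auto simp: lc_def)
   then have "coeff q n : lc n I" using I(4) by simp
   then obtain p where p: "p : I" "coeff q n = coeff p n" "ALL i>n. coeff p i = 0" by (auto simp: lc_def)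
   have "coeff (q - p) i = 0" if "i \<ge> n" for i using that p Suc.prems(2) by (cases "i = n") auto
   moreover have "q - p : I'" using P.idl_diff[OF I(2) Suc.prems(1)] p I(3) by blast
   ultimately have "q - p : I" using Suc.IH by blast
   then show ?case using P.idl_add[OF I(1) _ p(1)] by force
  qed
  moreover have "EX n. ALL i>=n. coeff q i = 0" for q :: "'a poly"
   using coeff_eq_0[of q] by (intro exI[of _ "Suc (degree q)"]) auto
  ultimately show ?thesis using I(3) by blast
 qed
 show ?thesis
 proof unfold_locales
  fix F :: "'a poly set set" assume F: "F ~= {}" "!!I. I : F ==> P.idl I"
  then obtain I1 where "I1 : F" by blast
  \<comment> \<open>A is maximal among the leading ideals in all degrees of all members of F,
    attained at degree N. Above it degrees n >= N are constant, and the finitely many degrees below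
    N are stabilized one after another.\<close>
  then have "lc 0 I1 : {lc n I | n I. I : F}" by blast
  moreover have "C.idl A" if "A : {lc n I | n I. I : F}" for A using that F lc_idl by blast
  ultimately obtain A where A: "A : {lc n I | n I. I : F}" "!!B. B : {lc n I | n I. I : F} ==> A <= B ==> B = A"
   by (rule C.noeth_max) (assumption | rule that)+
  then obtain N I0 where N: "A = lc N I0" "I0 : F" by blast
  have "EX I:F. I0 <= I & (ALL J:F. I <= J --> (ALL n<k. lc n J = lc n I))" for k
  proof (induction k)
   case 0 then show ?case using N by blast
  next
   case (Suc k)
   then obtain I where I: "I : F" "I0 <= I" "ALL J:F. I <= J --> (ALL n<k. lc n J = lc n I)" by blast
   let ?G = "{lc k J | J. J : F & I <= J}"
   have "lc k I : ?G" using I by blast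
   moreover have "C.idl A" if "A : ?G" for A using that F lc_idl by blast
   ultimately obtain A' where A': "A' : ?G" "!!B. B : ?G ==> A' <= B ==> B = A'" by (rule C.noeth_max) (assumption | rule that)+
   then obtain I' where I': "I' : F" "I <= I'" "A' = lc k I'" by blast
   have "lc n J = lc n I'" if J: "J : F" "I' <= J" "n < Suc k" for J n
   proof (cases "n = k")
    case True
    have "lc k J : ?G" using J I' by blast
    moreover have "A' <= lc k J" using lc_mono[OF J(2)] I'(3) by simp
    ultimately have "lc k J = A'" by (rule A'(2))
    then show ?thesis using I'(3) True by simp
   next
    case False then show ?thesis using I(3) J I' by (metis less_SucE subset_trans)
   qed
   moreover have "I0 <= I'" using I' I(2) by blast
   ultimately show ?case by (intro bexI[OF _ I'(1)]) simp
  qed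
  from this[of N] obtain I
   where I: "I : F" "I0 <= I" "ALL J:F. I <= J --> (ALL n<N. lc n J = lc n I)" by (elim bexE conjE)
  have "J = I" if J: "J : F" "I <= J" for J
  proof (rule eqI)
   have const: "lc n Y = A" if "n \<ge> N" "Y : F" "I0 <= Y" for n Y
   proof (rule A(2))
    show "A <= lc n Y" using lc_mono[OF that(3), of N] lc_le[OF F(2)[OF that(2)] that(1)] N by blast
   qed (use that in blast)
   show "lc n J = lc n I" for n
   proof (cases "n < N")
    case True then show ?thesis using I(3) J by blast
   next
    case False
    have "I0 <= J" using I(2) J(2) by blast
    then show ?thesis using const[of n J] const[of n I] False I J by auto
   qed
  qed (use J I F in auto)
  then show "EX I:F. ALL J:F. I <= J --> J = I" by (intro bexI[OF _ I(1)]) simp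
 qed
qed

lemma noetherian_image:
 assumes "noeth_subring A" and C: "C = \<phi> ` A"
  and \<phi>: "!!x y. x : A ==> y : A ==> \<phi> (x + y) = \<phi> x + \<phi> y" "!!x y. x : A ==> y : A ==> \<phi> (x * y) = \<phi> x * \<phi> y" "\<phi> 1 = 1"
 shows "noeth_subring C"
proof -
 interpret A: noeth_subring A by (rule assms)
 have 0: "\<phi> 0 = 0" using \<phi>(1)[of 0 0] by simp
 have minus: "\<phi> (- x) = - \<phi> x" if "x : A" for x
  using \<phi>(1)[of x "- x"] that 0 by (simp add: eq_neg_iff_add_eq_0 add.commute)
 interpret C: comm_subring C
 proof
  show "1 : C" using C \<phi>(3) A.one_mem by (metis imageI)
  show "x + y : C" "x * y : C" if "x : C" "y : C" for x y
   using that unfolding C by (auto simp: \<phi>(1,2)[symmetric])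
  show "- x : C" if "x : C" for x using that unfolding C by (auto simp: minus[symmetric])
 qed
 show ?thesis
 proof unfold_locales
  fix F assume F: "F ~= {}" "!!I. I : F ==> C.idl I"
  define pre where "pre I = {x : A. \<phi> x : I}" for I
  have pre: "A.idl (pre I)" if "C.idl I" for I
   unfolding is_ideal_def pre_def
   using idlD(2)[OF that] C.idl_add[OF that] C.idl_mult[OF that] C by (auto simp: 0 \<phi>(1,2))
  have im: "\<phi> ` pre I = I" if "C.idl I" for I using idlD(1)[OF that] C by (auto simp: pre_def)
  obtain I1 where "I1 : F" using F by blast
  then have "pre I1 : pre ` F" by blast
  moreover have "!!Z. Z : pre ` F ==> A.idl Z" using F pre by blast
  ultimately obtain Z where Z: "Z : pre ` F" "!!Y. Y : pre ` F ==> Z <= Y ==> Y = Z" by (rule A.noeth_max) (assumption | rule that)+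
  then obtain I where I: "I : F" "Z = pre I" by blast
  have "J = I" if "J : F" "I <= J" for J
  proof -
   have "pre I <= pre J" using that by (auto simp: pre_def)
   moreover have "pre J : pre ` F" using that by blast
   ultimately have "pre J = pre I" using Z(2)[of "pre J"] I(2) by simp
   then show ?thesis using im[OF F(2)[OF I(1)]] im[OF F(2)[OF that(1)]] by simp
  qed
  then show "EX I:F. ALL J:F. I <= J --> J = I" by (intro bexI[OF _ I(1)]) simp
 qed
qed

lemma (in comm_subring) clsd_one: "idl U ==> idl V ==> V <= U ==> clsd {1} U V"
 by (auto simp: clsd_def nzd_on_def)

text \<open>The ideals generated by a regular sequence of length l in the maximal ideal, built by
  adjoining one element at a time.\<close>

inductive rideal :: "'a::comm_ring_1 set => nat => 'a set => bool" for \<mm> where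
 rideal_0: "rideal \<mm> 0 {0}"
| rideal_Suc: "rideal \<mm> l J ==> x : \<mm> ==> nzd_on x UNIV J ==> rideal \<mm> (Suc l) (adj J x)"

text \<open>The maximal homogeneous ideal of R[Ju]; \<open>MM\<close> is the corresponding ideal of
  R[Ju,t].\<close>

definition MR :: "'a::comm_ring_1 set => 'a set => 'a poly set" where
 "MR \<mm> J = {p : RS J. coeff p 0 : \<mm>}"

definition MM :: "'a::comm_ring_1 set => 'a set => 'a poly poly set" where
 "MM \<mm> J = {q : pol (RS J). coeff q 0 : MR \<mm> J}"

lemma rideal_NZP: "rideal \<mm> l J ==> NZP J"
 by (induction rule: rideal.induct) (auto intro: NZP_zero NZP_adj)

lemma NZP_idl: "NZP J ==> u.idl J"
 by (simp add: NZP_def)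

lemma RS_zero: "RS {0::'a::comm_ring_1} = range (%r. [:r:])"
proof -
 have pow: "ipow {0::'a} (Suc n) = {0}" for n
  using iprod_sub2[of "{0::'a}" "ipow {0} n"] idlD(2)[OF ipow_ideal[of "{0::'a}" "Suc n"]] by auto
 have "p = [:coeff p 0:]" if "p : RS {0::'a}" for p
 proof (intro poly_eqI)
  fix n show "coeff p n = coeff [:coeff p 0:] n"
  proof (cases n)
   case (Suc j) then show ?thesis using that RS_iff[of "{0::'a}" p] pow[of j] by (simp del: ipow.simps) (metis singletonD)
  qed simp
 qed
 moreover have "[:r:] : RS {0::'a}" for r using const_RK[of UNIV "{0::'a}" r] by simp
 ultimately show ?thesis by blast
qed

lemma rideal_noetherian:
 assumes "noeth_subring (UNIV :: 'a::comm_ring_1 set)" "rideal \<mm> l (J :: 'a set)"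
 shows "noeth_subring (RS J)"
 using assms(2)
proof (induction rule: rideal.induct)
 case rideal_0
 show ?case by (rule noetherian_image[OF assms(1) RS_zero]) (auto simp: one_pCons)
next
 case (rideal_Suc l J x)
 have J: "u.idl J" using NZP_idl rideal_NZP rideal_Suc by blast
 have "RS (adj J x) = (%q. poly q (monom x 1)) ` pol (RS J)"
  using eval_mem[OF u.idl_C J] eval_surj[OF u.idl_C J] by blast
 then show ?case by (rule noetherian_image[OF noetherian_pol[OF rideal_Suc.IH]]) auto
qed

text \<open>The variable t is regular, and taking constant terms identifies the quotient by t with
  U/V, so the sequence t, xs works.\<close>

lemma dpt_pol:
 assumes A: "comm_subring A" and U: "is_ideal A U" and V: "is_ideal A V" "V <= U" and M: "M <= A" "0 : M"
  and dp: "dpt {1} M n U V"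
 shows "dpt {1} {q : pol A. coeff q 0 : M} (Suc n) (pol U) (pol V)"
proof -
 interpret A: comm_subring A by (rule A)
 interpret P: comm_subring "pol A" by (rule A.pol_subring)
 define t where "t = [:0, 1 :: 'a:]"
 have t: "t : pol A" "coeff t 0 = 0" by (auto simp: t_def pol_iff coeff_pCons split: nat.splits)
 note pU = A.pol_ideal[OF U] and pV = A.pol_ideal[OF V(1)]
 have sub: "pol V <= pol U" using pol_mono V by blast
 have cl: "P.clsd {1} (pol U) (pol V)" using P.clsd_one[OF pU pV sub] .
 have nz: "nzd_on t (pol U) (pol V)" unfolding nzd_on_def
 proof safe
  fix q assume q: "t * q : pol V"
  have "coeff q j : V" for j using q[unfolded pol_iff, rule_format, of "Suc j"] by (simp add: t_def)
  then show "q : pol V" by (simp add: pol_iff)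
 qed
 obtain xs where xs: "length xs = n" "set xs <= M" "regseq {1} U V xs" using dp by (auto simp: dpt_def)
 have "regseq {1} (pol U) (qt {1} (pol U) (pol V) t) (map (%x. [:x:]) xs) \<longleftrightarrow> regseq {1} U V xs"
 proof (rule P.regseq_corr[where \<phi> = "%q. coeff q 0", OF A P.mult_one A.mult_one])
  show "list_all2 (%x x'. x : pol A & x' : A & (ALL u:pol U. coeff (x * u) 0 = x' * coeff u 0)) (map (%x. [:x:]) xs) xs"
  proof (rule list_all2_all_nthI)
   fix i assume i: "i < length (map (%x. [:x:]) xs)"
   then have "xs ! i : A" using xs(2) M nth_mem by (metis length_map subsetD)
   then show "map (%x. [:x:]) xs ! i : pol A & xs ! i : A & (ALL u:pol U. coeff (map (%x. [:x:]) xs ! i * u) 0 = xs ! i * coeff u 0)"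
    using i by (auto simp: pol_iff coeff_pCons coeff_mult split: nat.splits)
  qed simp
  show "P.clsd {1} (pol U) (qt {1} (pol U) (pol V) t)" using P.clsd_qt[OF cl P.mult_one t(1)] .
  show "A.clsd {1} U V" using A.clsd_one[OF U V] .
  show "EX w:{1}. EX u:pol U. w * u' - coeff u 0 : V" if "u' : U" for u'
   using that idlD(2)[OF U] idlD(2)[OF V(1)]
   by (intro bexI[of _ 1] bexI[of _ "[:u':]"]) (auto simp: pol_iff coeff_pCons split: nat.splits)
  show "coeff u 0 : V \<longleftrightarrow> u : qt {1} (pol U) (pol V) t" if u: "u : pol U" for u
  proof
   assume v: "coeff u 0 : V"
   obtain a r where r: "u = pCons a r" by (cases u)
   have "coeff r j : U" for j using u[unfolded pol_iff r, rule_format, of "Suc j"] by simp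
   then have "r : pol U" by (simp add: pol_iff)
   moreover have "[:a:] : pol V" using v r idlD(2)[OF V(1)] by (auto simp: pol_iff coeff_pCons split: nat.splits)
   ultimately show "u : qt {1} (pol U) (pol V) t" using u r
    by (intro qtI[of u "pol U" 1 "{1}" "[:a:]" "pol V" r]) (auto simp: t_def)
  next
   assume "u : qt {1} (pol U) (pol V) t"
   then obtain w v r where "w = 1" "v : pol V" "w * u = v + t * r" by (auto elim: qtE)
   then have "coeff u 0 = coeff v 0" by (simp add: t_def)
   then show "coeff u 0 : V" using \<open>v : pol V\<close> by (simp add: pol_iff)
  qed
 qed (auto simp: pol_iff)
 then have "regseq {1} (pol U) (pol V) (t # map (%x. [:x:]) xs)" using xs nz by simp
 moreover have "set (t # map (%x. [:x:]) xs) <= {q : pol A. coeff q 0 : M}"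
  using xs(2) M t by (auto simp: pol_iff coeff_pCons split: nat.splits)
 ultimately show ?thesis unfolding dpt_def using xs(1) by (intro exI[of _ "t # map (%x. [:x:]) xs"]) auto
qed

lemma dpt_hom:
 assumes C: "comm_subring C" "comm_subring C'"
  and \<phi>: "!!x y. x : C ==> y : C ==> \<phi> (x + y) = \<phi> x + \<phi> y" "!!x y. x : C ==> y : C ==> \<phi> (x * y) = \<phi> x * \<phi> y"
  and idl: "is_ideal C U" "is_ideal C V" "V <= U" "is_ideal C' U'" "is_ideal C' V'" "V' <= U'"
  and U': "U' = \<phi> ` U" and ker: "!!u. u : U ==> \<phi> u : V' \<longleftrightarrow> u : V"
  and A: "A <= C" "A' <= C'" "\<phi> ` A = A'" and "\<phi> 1 = 1"
 shows "dpt {1} A n U V \<longleftrightarrow> dpt {1} A' n U' V'"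
proof -
 interpret C: comm_subring C by (rule C)
 interpret C': comm_subring C' by (rule C)
 have UC: "U <= C" using idlD(1)[OF idl(1)] .
 have corr: "regseq {1} U V xs \<longleftrightarrow> regseq {1} U' V' (map \<phi> xs)" if xs: "set xs <= A" for xs
 proof (rule C.regseq_corr[where \<phi> = \<phi>, OF C(2) C.mult_one C'.mult_one])
  show "list_all2 (%x x'. x : C & x' : C' & (ALL u:U. \<phi> (x * u) = x' * \<phi> u)) xs (map \<phi> xs)"
  proof (rule list_all2_all_nthI)
   fix i assume i: "i < length xs"
   then have "xs ! i : A" using xs nth_mem by blast
   then show "xs ! i : C & map \<phi> xs ! i : C' & (ALL u:U. \<phi> (xs ! i * u) = map \<phi> xs ! i * \<phi> u)"
    using i A UC \<phi>(2)[of "xs ! i"] by (auto simp: subset_iff)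
  qed simp
  show "C.clsd {1} U V" using C.clsd_one idl by blast
  show "C'.clsd {1} U' V'" using C'.clsd_one idl by blast
  show "EX w:{1}. EX u:U. w * u' - \<phi> u : V'" if "u' : U'" for u'
  proof -
   obtain u where "u : U" "u' = \<phi> u" using \<open>u' : U'\<close> U' by blast
   then show ?thesis using idlD(2)[OF idl(5)] by (intro bexI[of _ 1] bexI[of _ u]) auto
  qed
  show "\<phi> (u + v) = \<phi> u + \<phi> v" if "u : U" "v : U" for u v using that UC \<phi>(1) by blast
 qed (use U' UC ker in auto)
 show ?thesis
 proof
  assume "dpt {1} A n U V"
  then obtain xs where "length xs = n" "set xs <= A" "regseq {1} U V xs" by (auto simp: dpt_def)
  then show "dpt {1} A' n U' V'" using corr A unfolding dpt_def by (intro exI[of _ "map \<phi> xs"]) auto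
 next
  assume "dpt {1} A' n U' V'"
  then obtain xs' where xs': "length xs' = n" "set xs' <= A'" "regseq {1} U' V' xs'" by (auto simp: dpt_def)
  define xs where "xs = map (inv_into A \<phi>) xs'"
  have "map \<phi> xs = xs'" unfolding xs_def map_map using xs' A(3) by (intro map_idI) (auto simp: f_inv_into_f)
  moreover have "set xs <= A" unfolding xs_def using xs' A(3) by (auto intro!: inv_into_into)
  ultimately show "dpt {1} A n U V" unfolding dpt_def using corr xs' by (intro exI[of _ xs]) (metis length_map)
 qed
qed

lemma coeff_eval_0: "coeff (poly q (monom x 1)) 0 = coeff (coeff q 0) 0"
proof (cases q)
 case (pCons a r) then show ?thesis using coeff_monom_1_mult(2)[of x "poly r (monom x 1)"] by simp
qed

lemma dpt_eval:
 assumes J: "u.idl J" and V: "is_ideal (RS (adj J x)) V" "is_ideal (pol (RS J)) V'"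
  and ker: "!!q. q : pol (RS J) ==> poly q (monom x 1) : V \<longleftrightarrow> q : V'"
  and dp: "dpt {1} (MM \<mm> J) n (pol (RS J)) V'"
 shows "dpt {1} (MR \<mm> (adj J x)) n (RS (adj J x)) V"
proof -
 interpret RS: comm_subring "RS J" using RS_subring J by blast
 interpret R1: comm_subring "RS (adj J x)" using RS_subring adj_ideal J by blast
 interpret P: comm_subring "pol (RS J)" by (rule RS.pol_subring)
 have im: "RS (adj J x) = (%q. poly q (monom x 1)) ` pol (RS J)"
  using eval_mem[OF u.idl_C J] eval_surj[OF u.idl_C J] by blast
 have "(%q. poly q (monom x 1)) ` MM \<mm> J = MR \<mm> (adj J x)"
 proof
  show "(%q. poly q (monom x 1)) ` MM \<mm> J <= MR \<mm> (adj J x)"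
   unfolding MM_def MR_def im by (auto simp: coeff_eval_0 simp del: One_nat_def)
  show "MR \<mm> (adj J x) <= (%q. poly q (monom x 1)) ` MM \<mm> J"
  proof
   fix p assume p: "p : MR \<mm> (adj J x)"
   then obtain q where q: "q : pol (RS J)" "p = poly q (monom x 1)" using im by (auto simp: MR_def)
   moreover have "coeff (coeff q 0) 0 : \<mm>" using p q coeff_eval_0[of q x] by (auto simp: MR_def)
   ultimately show "p : (%q. poly q (monom x 1)) ` MM \<mm> J" by (auto simp: MM_def MR_def pol_iff)
  qed
 qed
 then show ?thesis
  using dpt_hom[OF P.comm_subring_axioms R1.comm_subring_axioms _ _ P.idl_C V(2) idlD(1)[OF V(2)]
    R1.idl_C V(1) idlD(1)[OF V(1)] im ker, of "MM \<mm> J" "MR \<mm> (adj J x)" n] dp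
  by (auto simp: MM_def MR_def)
qed

lemma dpt_pol_RS:
 assumes "u.idl J" "0 : \<mm>" "is_ideal (RS J) V" "dpt {1} (MR \<mm> J) n (RS J) V"
 shows "dpt {1} (MM \<mm> J) (Suc n) (pol (RS J)) (pol V)"
proof -
 interpret RS: comm_subring "RS J" using RS_subring assms by blast
 show ?thesis using dpt_pol[OF RS.comm_subring_axioms RS.idl_C assms(3) idlD(1)[OF assms(3)], of "MR \<mm> J" n] assms
  RS.zero_mem unfolding MM_def by (auto simp: MR_def)
qed

text \<open>R[Ju]/KR[Ju] is a polynomial ring in l variables over R/K; \<open>eval_RK_iff\<close>
  exposes one variable per element of the sequence, and each adds one to the depth.\<close>

lemma dpt_rideal_RK:
 assumes "rideal \<mm> l J" "0 : \<mm>" "u.idl K" "J <= K" "dpt {1} \<mm> e UNIV K"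
 shows "dpt {1} (MR \<mm> J) (e + l) (RS J) (RK K J)"
 using assms
proof (induction rule: rideal.induct)
 case rideal_0
 interpret RS: comm_subring "RS {0::'a}" using RS_subring by blast
 have RK: "is_ideal (RS {0}) (RK K {0})" using RK_ideal rideal_0 by blast
 have "dpt {1} \<mm> e UNIV K \<longleftrightarrow> dpt {1} (MR \<mm> {0}) e (RS {0}) (RK K {0})"
 proof (rule dpt_hom[where \<phi> = "%r. [:r:]", OF u.comm_subring_axioms RS.comm_subring_axioms])
  show "(%r. [:r:]) ` \<mm> = MR \<mm> {0}" unfolding MR_def RS_zero by auto
  show "[:u:] : RK K {0} \<longleftrightarrow> u : K" for u using const_RK[OF rideal_0(2), of "{0}"] by simp
 qed (use RS_zero RK rideal_0 idlD(1)[OF RK] in \<open>auto simp: MR_def one_pCons\<close>)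
 then show ?case using rideal_0 by simp
next
 case (rideal_Suc l J x)
 have J: "NZP J" "u.idl J" using NZP_idl rideal_NZP rideal_Suc by blast+
 have JK: "J <= K" using adj_upper[OF J(2)] rideal_Suc.prems by blast
 interpret RS: comm_subring "RS J" using RS_subring J by blast
 note K = RK_ideal[OF \<open>u.idl K\<close> J(2)]
 have "dpt {1} (MR \<mm> J) (e + l) (RS J) (RK K J)" using rideal_Suc JK by blast
 then have "dpt {1} (MM \<mm> J) (Suc (e + l)) (pol (RS J)) (pol (RK K J))"
  using dpt_pol_RS[OF J(2) \<open>0 : \<mm>\<close> K] by blast
 then have "dpt {1} (MR \<mm> (adj J x)) (Suc (e + l)) (RS (adj J x)) (RK K (adj J x))"
  using dpt_eval[OF J(2) RK_ideal[OF \<open>u.idl K\<close> adj_ideal[OF J(2)]] RS.pol_ideal[OF K]]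
   eval_RK_iff[OF J(1) rideal_Suc(3) \<open>u.idl K\<close>] rideal_Suc.prems by blast
 then show ?case by simp
qed

lemma monom_mult_RK:
 assumes "u.idl K" "u.idl J" "!!k. k : K ==> c * k : J" "p : RK K J"
 shows "monom c 1 * p : RS J"
 unfolding RS_iff[OF assms(2)]
proof
 fix i
 show "coeff (monom c 1 * p) i : ipow J i"
 proof (cases i)
  case (Suc j)
  have "u.idl {r. c * r : ipow J (Suc j)}"
   using ipow_ideal[OF assms(2), of "Suc j"] unfolding is_ideal_def by (simp add: distrib_left mult.left_commute)
  moreover have "c * (k * s) : ipow J (Suc j)" if "k : K" "s : ipow J j" for k s
   using iprodI[OF that(2) assms(3)[OF that(1)]] by (simp add: algebra_simps)
  ultimately have "iprod K (ipow J j) <= {r. c * r : ipow J (Suc j)}" by (intro iprod_least) auto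
  then have "c * coeff p j : ipow J (Suc j)" using assms(4) by (auto simp: RK_iff)
  then show ?thesis unfolding Suc coeff_monom_1_mult .
 qed simp
qed

lemma shift_lin_RK_RS:
 assumes "u.idl K" "u.idl J" "!!k. k : K ==> c * k : J" "q : pol (RK K J)"
 shows "shift_lin c * q : pol (RS J)"
proof -
 interpret RS: comm_subring "RS J" using RS_subring assms by blast
 have 1: "coeff q j : RS J" for j using assms(4) idlD(1)[OF RK_ideal[OF assms(1,2)]] by (auto simp: pol_iff)
 have 2: "monom c 1 * coeff q j : RS J" for j using monom_mult_RK[OF assms(1-3)] assms(4) by (auto simp: pol_iff)
 have "coeff (shift_lin c * q) j : RS J" for j
  by (cases j) (simp_all only: coeff_shift_lin RS.uminus_mem[OF 2] RS.diff_mem[OF 1 2])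
 then show ?thesis by (simp add: pol_iff)
qed

text \<open>The image of \<open>(L\<^sub>1)\<close> in \<open>R[Ju,t]\<close>.\<close>

definition lin_ker :: "'a::comm_ring_1 => 'a set => 'a set => 'a poly poly set" where
 "lin_ker c K J = (*) (shift_lin c) ` pol (RK K J)"

lemma lin_ker_ideal:
 assumes "u.idl K" "u.idl J" "!!k. k : K ==> c * k : J"
 shows "is_ideal (pol (RS J)) (lin_ker c K J)"
proof -
 interpret RS: comm_subring "RS J" using RS_subring assms by blast
 interpret P: comm_subring "pol (RS J)" by (rule RS.pol_subring)
 have idl: "P.idl (pol (RK K J))" using RS.pol_ideal[OF RK_ideal[OF assms(1,2)]] .
 show ?thesis unfolding is_ideal_def lin_ker_def
 proof (intro conjI ballI)
  show "(*) (shift_lin c) ` pol (RK K J) <= pol (RS J)" using shift_lin_RK_RS[OF assms] by blast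
  show "0 : (*) (shift_lin c) ` pol (RK K J)" using idlD(2)[OF idl] by force
 next
  fix p q assume "p : (*) (shift_lin c) ` pol (RK K J)" "q : (*) (shift_lin c) ` pol (RK K J)"
  then show "p + q : (*) (shift_lin c) ` pol (RK K J)" using P.idl_add[OF idl]
   by (auto simp only: image_iff) (metis distrib_left)
 next
  fix p q assume "p : pol (RS J)" "q : (*) (shift_lin c) ` pol (RK K J)"
  then show "p * q : (*) (shift_lin c) ` pol (RK K J)" using P.idl_mult[OF idl]
   by (auto simp only: image_iff) (metis mult.left_commute)
 qed
qed

lemma MM_ideal: assumes "u.idl \<mm>" "u.idl J" shows "is_ideal (pol (RS J)) (MM \<mm> J)"
proof -
 interpret RS: comm_subring "RS J" using RS_subring assms by blast
 interpret P: comm_subring "pol (RS J)" by (rule RS.pol_subring)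
 show ?thesis unfolding is_ideal_def MM_def MR_def
  using idlD(2)[OF assms(1)] u.idl_add[OF assms(1)] u.idl_mult[OF assms(1)]
  by (auto simp: coeff_mult pol_iff intro: P.mult_mem[unfolded pol_iff, rule_format, simplified coeff_mult])
qed

text \<open>Multiplication by t - cu, injective over a domain, identifies KR[Ju,t] with
  \<open>lin_ker c K J\<close>. The depth of the former comes from the first depth lemma, that of
  the quotient by the latter from the second.\<close>

lemma dpt_lin_ker:
 fixes c :: "'a::idom"
 assumes N: "noeth_subring (pol (RS J))" and m: "u.idl \<mm>"
  and K: "u.idl K" "u.idl J" "!!k. k : K ==> c * k : J"
  and dp: "dpt {1} (MM \<mm> J) (Suc n) (pol (RS J)) {0}" "dpt {1} (MM \<mm> J) n (pol (RS J)) (pol (RK K J))"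
 shows "dpt {1} (MM \<mm> J) n (pol (RS J)) (lin_ker c K J)"
proof -
 interpret RS: comm_subring "RS J" using RS_subring K by blast
 interpret P: noeth_subring "pol (RS J)" by (rule N)
 have idl: "P.idl (pol (RK K J))" using RS.pol_ideal[OF RK_ideal[OF K(1,2)]] .
 note LK = lin_ker_ideal[OF K]
 have 0: "{0} <= pol (RS J)" "{0} <= pol (RK K J)" "{0} <= lin_ker c K J"
  using idlD(2)[OF idl] idlD(2)[OF LK] P.zero_mem by auto
 have cl: "P.clsd {1} (pol (RS J)) {0}" "P.clsd {1} (pol (RS J)) (pol (RK K J))" "P.clsd {1} (pol (RS J)) (lin_ker c K J)"
  using P.clsd_one[OF P.idl_C] P.idl_zero 0 idl LK idlD(1)[OF idl] idlD(1)[OF LK] by auto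
 note MMi = MM_ideal[OF m K(2)]
 have "dpt {1} (MM \<mm> J) (Suc n) (pol (RK K J)) {0}"
  using P.depth_lemma_sub[OF P.mult_one MMi cl(1,2) 0(2) dp] .
 then obtain xs where xs: "length xs = Suc n" "set xs <= MM \<mm> J" "regseq {1} (pol (RK K J)) {0} xs" by (auto simp: dpt_def)
 have "regseq {1} (pol (RK K J)) {0} xs \<longleftrightarrow> regseq {1} (lin_ker c K J) {0} xs"
 proof (rule P.regseq_corr[where \<phi> = "(*) (shift_lin c)", OF P.comm_subring_axioms P.mult_one P.mult_one])
  show "list_all2 (%x x'. x : pol (RS J) & x' : pol (RS J) & (ALL u:pol (RK K J). shift_lin c * (x * u) = x' * (shift_lin c * u))) xs xs"
  proof (rule list_all2_all_nthI)
   fix i assume "i < length xs"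
   then have "xs ! i : pol (RS J)" using xs(2) idlD(1)[OF MMi] nth_mem by blast
   then show "xs ! i : pol (RS J) & xs ! i : pol (RS J) & (ALL u:pol (RK K J). shift_lin c * (xs ! i * u) = xs ! i * (shift_lin c * u))"
    by (auto simp only: mult.left_commute)
  qed simp
  show "P.clsd {1} (pol (RK K J)) {0}" "P.clsd {1} (lin_ker c K J) {0}"
   using P.clsd_one P.idl_zero 0 idl LK by auto
  show "EX w:{1}. EX u:pol (RK K J). w * u' - shift_lin c * u : {0}" if "u' : lin_ker c K J" for u'
   using that unfolding lin_ker_def by auto
  show "shift_lin c * u : lin_ker c K J" if "u : pol (RK K J)" for u using that by (simp only: lin_ker_def) blast
  show "shift_lin c * u : {0} \<longleftrightarrow> u : {0}" for u by (simp del: mult_pCons_left)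
  show "shift_lin c * (u + v) = shift_lin c * u + shift_lin c * v" for u v by (rule distrib_left)
  show "EX w':{1}. ALL u:pol (RK K J). shift_lin c * (w * u) = w' * (shift_lin c * u)" if "w : {1}" for w
   using that by simp
  show "EX w:{1}. ALL u:pol (RK K J). shift_lin c * (w * u) = w' * (shift_lin c * u)" if "w' : {1}" for w'
   using that by simp
 qed
 then have "dpt {1} (MM \<mm> J) (Suc n) (lin_ker c K J) {0}" using xs by (auto simp: dpt_def)
 moreover have "dpt {1} (MM \<mm> J) n (pol (RS J)) {0}" using dpt_mono[OF dp(1)] by simp
 ultimately show ?thesis using P.depth_lemma_quot[OF P.mult_one MMi cl(1,3) 0(3)] by blast
qed

lemma rideal_quot_dpt:
 assumes N: "noeth_subring (UNIV :: 'a::comm_ring_1 set)" and m: "u.idl (\<mm> :: 'a set)"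
  and dp: "dpt {1} \<mm> d UNIV {0}" and r: "rideal \<mm> l J" "l <= d"
 shows "dpt {1} \<mm> (d - l) UNIV J"
 using r
proof (induction rule: rideal.induct)
 case (rideal_Suc l J x)
 interpret U: noeth_subring "UNIV :: 'a set" by (rule N)
 have J: "u.idl J" using NZP_idl rideal_NZP rideal_Suc by blast
 have "dpt {1} \<mm> (Suc (d - Suc l)) UNIV J" using rideal_Suc by (simp add: Suc_diff_Suc)
 then have "dpt {1} \<mm> (d - Suc l) UNIV (qt {1} UNIV J x)"
  using U.dpt_inv[OF u.mult_one m u.clsd_one[OF u.idl_C J]] rideal_Suc by blast
 moreover have "qt {1} UNIV J x = adj J x" unfolding qt_def adj_def sat_def by simp
 ultimately show ?case by simp
qed (use dp in simp)

text \<open>Induction along R[(J,x)u] = R[Ju,t]/(t - xu)JR[Ju,t]. The Rees algebra of the zero ideal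
  is R itself, of depth d and not d + 1, so l > 0 is assumed and the first step, where the kernel is
  zero, is separate.\<close>

lemma dpt_rideal_RS:
 assumes N: "noeth_subring (UNIV :: 'a::idom set)" and m: "u.idl (\<mm> :: 'a set)"
  and dp: "dpt {1} \<mm> d UNIV {0}" and r: "rideal \<mm> l J" "0 < l" "l <= d"
 shows "dpt {1} (MR \<mm> J) (Suc d) (RS J) {0}"
 using r
proof (induction rule: rideal.induct)
 case (rideal_Suc l J x)
 have J: "NZP J" "u.idl J" using NZP_idl rideal_NZP rideal_Suc by blast+
 have m0: "0 : \<mm>" using idlD(2)[OF m] .
 interpret RS: comm_subring "RS J" using RS_subring J by blast
 interpret R1: comm_subring "RS (adj J x)" using RS_subring adj_ideal J by blast
 interpret P: noeth_subring "pol (RS J)" using noetherian_pol rideal_noetherian[OF N] rideal_Suc by blast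
 have pol0: "pol {0} = {0 :: 'a poly poly}" by (auto simp: pol_iff poly_eq_iff)
 have RSz: "dpt {1} (MM \<mm> J) (Suc e) (pol (RS J)) {0}" if "dpt {1} (MR \<mm> J) e (RS J) {0}" for e
  using dpt_pol_RS[OF J(2) m0 RS.idl_zero that] pol0 by simp
 have xJ: "x * k : J" if "k : J" for k using u.idl_mult[OF J(2)] that by blast
 have ker: "dpt {1} (MM \<mm> J) (Suc d) (pol (RS J)) (lin_ker x J J)"
 proof (cases "l = 0")
  case True
  then have J0: "J = {0}" using rideal_Suc.hyps(1) by (auto elim: rideal.cases)
  have "RK {0} {0} = {0 :: 'a poly}"
   using iprod_sub1[of "{0::'a}"] idlD(2)[OF iprod_ideal[OF u.idl_zero ipow_ideal[OF u.idl_zero]]]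
   by (auto simp: RK_iff poly_eq_iff) blast
  then have lk: "lin_ker x J J = {0}" by (simp add: lin_ker_def J0 pol0)
  have "RK {0} J = {0}" using \<open>RK {0} {0} = {0}\<close> J0 by simp
  then have "dpt {1} (MR \<mm> J) d (RS J) {0}"
   using dpt_rideal_RK[OF rideal_Suc.hyps(1) m0 u.idl_zero, of d] dp J0 True by simp
  then show ?thesis using RSz lk by simp
 next
  case False
  have "dpt {1} (MR \<mm> J) (Suc d) (RS J) {0}" using rideal_Suc False by simp
  then have 1: "dpt {1} (MM \<mm> J) (Suc (Suc d)) (pol (RS J)) {0}" by (rule RSz)
  have "dpt {1} \<mm> (d - l) UNIV J" using rideal_quot_dpt[OF N m dp] rideal_Suc by simp
  then have "dpt {1} (MR \<mm> J) (d - l + l) (RS J) (RK J J)"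
   using dpt_rideal_RK[OF rideal_Suc.hyps(1) m0 J(2)] by blast
  then have "dpt {1} (MM \<mm> J) (Suc d) (pol (RS J)) (pol (RK J J))"
   using dpt_pol_RS[OF J(2) m0 RK_ideal[OF J(2,2)]] rideal_Suc.prems by force
  then show ?thesis using dpt_lin_ker[OF P.noeth_subring_axioms m J(2,2) xJ 1] by blast
 qed
 have "q : lin_ker x J J \<longleftrightarrow> poly q (monom x 1) = 0" if q: "q : pol (RS J)" for q
 proof
  assume "poly q (monom x 1) = 0"
  then show "q : lin_ker x J J" using eval_kernel[OF J(2) NZP_pow[OF J(1) rideal_Suc(3)] q] by (auto simp only: lin_ker_def)
 qed (auto simp: lin_ker_def)
 then show ?case
  using dpt_eval[OF J(2) R1.idl_zero lin_ker_ideal[OF J(2,2) xJ] _ ker] by blast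
qed simp

text \<open>R[Ju,t] has depth at least d + 2, and R[Ju,t]/KR[Ju,t] at least (d - l) + l + 1 = d + 1,
  so \<open>dpt_lin_ker\<close> applies. For l = 0 the ideals J and K vanish and only R[t]
  remains.\<close>

theorem dpt_sym:
 fixes c :: "'a::idom"
 assumes N: "noeth_subring (UNIV :: 'a set)" and m: "u.idl \<mm>"
  and dp: "dpt {1} \<mm> d UNIV {0}" and r: "rideal \<mm> l J" "l <= d"
  and K: "K = {k. c * k : J}" and "c ~= 0" and dK: "dpt {1} \<mm> (d - l) UNIV K"
 shows "dpt {1} (MM \<mm> J) (Suc d) (pol (RS J)) (lin_ker c K J)"
proof -
 have J: "NZP J" "u.idl J" using NZP_idl rideal_NZP r by blast+
 have m0: "0 : \<mm>" using idlD(2)[OF m] .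
 interpret RS: comm_subring "RS J" using RS_subring J by blast
 interpret P: noeth_subring "pol (RS J)" using noetherian_pol rideal_noetherian[OF N r(1)] by blast
 have pol0: "pol {0} = {0 :: 'a poly poly}" by (auto simp: pol_iff poly_eq_iff)
 have RSz: "dpt {1} (MM \<mm> J) (Suc e) (pol (RS J)) {0}" if "dpt {1} (MR \<mm> J) e (RS J) {0}" for e
  using dpt_pol_RS[OF J(2) m0 RS.idl_zero that] pol0 by simp
 have idK: "u.idl K" using J(2) unfolding K is_ideal_def by (simp add: distrib_left mult.left_commute)
 show ?thesis
 proof (cases "l = 0")
  case True
  then have J0: "J = {0}" using r by (auto elim: rideal.cases)
  have RK0: "RK {0} {0} = {0 :: 'a poly}"
   using iprod_sub1[of "{0::'a}"] idlD(2)[OF iprod_ideal[OF u.idl_zero ipow_ideal[OF u.idl_zero]]]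
   by (auto simp: RK_iff poly_eq_iff) blast
  have K0: "K = {0}" using J0 K \<open>c ~= 0\<close> by auto
  have lk: "lin_ker c K J = {0}" by (simp add: lin_ker_def J0 K0 RK0 pol0)
  have "dpt {1} (MR \<mm> J) d (RS J) {0}"
   using dpt_rideal_RK[OF r(1) m0 u.idl_zero, of d] dp J0 True RK0 by simp
  then show ?thesis using RSz lk by simp
 next
  case False
  have 1: "dpt {1} (MM \<mm> J) (Suc (Suc d)) (pol (RS J)) {0}"
   using RSz dpt_rideal_RS[OF N m dp r(1)] r(2) False by blast
  have "J <= K" using u.idl_mult[OF J(2)] K by blast
  then have "dpt {1} (MR \<mm> J) (d - l + l) (RS J) (RK K J)"
   using dpt_rideal_RK[OF r(1) m0 idK _ dK] by blast
  then have "dpt {1} (MM \<mm> J) (Suc d) (pol (RS J)) (pol (RK K J))"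
   using dpt_pol_RS[OF J(2) m0 RK_ideal[OF idK J(2)]] r(2) by force
  then show ?thesis using dpt_lin_ker[OF P.noeth_subring_axioms m idK J(2) _ 1] K by blast
 qed
qed

section \<open>Ideals of linear type\<close>

text \<open>The subring of R[u] x B generated by the pairs (r, \<iota> r), (ru, \<l> r) for r in J,
  and (0, z) for z in L. It is the graph of a correspondence between R[Ju] and B modulo L, the
  inverse of Sym J -> R[Ju].\<close>

inductive_set lift_rel :: "('a::comm_ring_1 => 'b::comm_ring_1) => ('a => 'b) => 'b set => 'a set => ('a poly \<times> 'b) set"
 for \<iota> \<l> L J where
 lift_const: "([:r:], \<iota> r) : lift_rel \<iota> \<l> L J"
| lift_lin: "r : J ==> (monom r 1, \<l> r) : lift_rel \<iota> \<l> L J"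
| lift_ker: "z : L ==> (0, z) : lift_rel \<iota> \<l> L J"
| lift_add: "(p, b) : lift_rel \<iota> \<l> L J ==> (p', b') : lift_rel \<iota> \<l> L J ==> (p + p', b + b') : lift_rel \<iota> \<l> L J"
| lift_mult: "(p, b) : lift_rel \<iota> \<l> L J ==> (p', b') : lift_rel \<iota> \<l> L J ==> (p * p', b * b') : lift_rel \<iota> \<l> L J"

text \<open>\<open>\<l>\<close> plays the role of the map \<open>J --> Sym J\<close>, which is linear only modulo \<open>L\<close>.\<close>

locale linear_lift = comm_subring B for B :: "'b::comm_ring_1 set" +
 fixes L :: "'b set" and \<iota> \<l> :: "'a::comm_ring_1 => 'b" and J0 :: "'a set"
 assumes L: "is_ideal B L" and J0: "u.idl J0"
  and \<iota>: "\<iota> r : B" "\<iota> (r + s) = \<iota> r + \<iota> s" "\<iota> (r * s) = \<iota> r * \<iota> s" "\<iota> 1 = 1"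
  and \<l>: "r : J0 ==> \<l> r : B" "r : J0 ==> s : J0 ==> \<l> (r + s) - (\<l> r + \<l> s) : L"
   "r : J0 ==> \<l> (r * c) - \<iota> c * \<l> r : L"
begin

abbreviation "G \<equiv> lift_rel \<iota> \<l> L"

lemma \<iota>_0: "\<iota> 0 = 0"
 using \<iota>(2)[of 0 0] by simp

lemma \<iota>_minus: "\<iota> (- r) = - \<iota> r"
 using \<iota>(2)[of r "- r"] by (simp add: \<iota>_0 eq_neg_iff_add_eq_0 add.commute)

lemma G_0: "(0, 0) : G J"
 using lift_ker[of 0 L \<iota> \<l> J] idlD(2)[OF L] by simp

lemma G_uminus: assumes "(p, b) : G J" shows "(- p, - b) : G J"
 using lift_mult[OF lift_const[of "- 1"] assms] by (simp add: \<iota>_minus \<iota>)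

lemma G_diff: "(p, b) : G J ==> (p', b') : G J ==> (p - p', b - b') : G J"
 using lift_add[of p b \<iota> \<l> L J "- p'" "- b'"] G_uminus by simp

lemma G_sum: "finite A ==> (!!i. i : A ==> (f i, h i) : G J) ==> (sum f A, sum h A) : G J"
 by (induction A rule: finite_induct) (auto intro: G_0 lift_add)

lemma G_sub:
 assumes "(p, b) : G J" "u.idl J" "J <= J0" shows "p : RS J" "b : B"
proof -
 interpret RS: comm_subring "RS J" using RS_subring assms by blast
 have "p : RS J & b : B" using assms(1)
 proof (induction rule: lift_rel.induct)
  case (lift_lin r) then show ?case using assms \<l> by (auto simp: monom_RS iprod_UNIV)
 qed (use assms(2) \<iota> idlD(1)[OF L] const_RK[OF u.idl_C assms(2)] RS.zero_mem in auto)
 then show "p : RS J" "b : B" by auto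
qed

lemma G_surj_monom: assumes "u.idl J" "s : ipow J i" shows "EX b. (monom s i, b) : G J"
 using assms(2)
proof (induction i arbitrary: s)
 case 0 then show ?case using lift_const[of s \<iota> \<l> L J] by (auto simp: monom_0)
next
 case (Suc i)
 show ?case using Suc.prems[unfolded ipow.simps]
 proof (induction rule: iprod.induct)
  case (iprodI x y)
  then obtain b where "(monom x i, b) : G J" using Suc.IH by blast
  from lift_mult[OF this lift_lin[OF iprodI(2)]] show ?case by (auto simp: mult_monom)
 next
  case (iprod_add x y) then show ?case by (auto simp: add_monom[symmetric] intro: lift_add)
 qed
qed

text \<open>The element y represents t. Because y satisfies the relations ky = \<l>(ck) modulo L for
  k in K, it acts on lifts of elements of KR[Ju] as multiplication by cu.\<close>

lemma G_surj_monom2: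
 assumes J: "u.idl J" and cK: "!!k. k : K ==> c * k : J" and JJ: "J <= J0"
  and y: "!!k. k : K ==> \<l> (c * k) - \<iota> k * y : L" and s: "s : iprod K (ipow J i)"
 shows "EX b b'. (monom s i, b) : G J & (monom (c * s) (Suc i), b') : G J & b' - b * y : L"
 using s
proof (induction rule: iprod.induct)
 case (iprodI k s)
 obtain b where b: "(monom s i, b) : G J" using G_surj_monom[OF J] iprodI by blast
 have "(monom (k * s) i, \<iota> k * b) : G J" using lift_mult[OF lift_const[of k] b] by (simp add: smult_monom)
 moreover have "(monom (c * (k * s)) (Suc i), \<l> (c * k) * b) : G J"
  using lift_mult[OF lift_lin[OF cK[OF iprodI(1)]] b] by (simp add: mult_monom mult.assoc)
 moreover have "\<l> (c * k) * b - \<iota> k * b * y : L"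
 proof -
  have "b * (\<l> (c * k) - \<iota> k * y) : L" using y iprodI G_sub(2)[OF b J JJ] by (intro idl_mult[OF L]) auto
  then show ?thesis by (simp add: algebra_simps)
 qed
 ultimately show ?case by blast
next
 case (iprod_add s t)
 then obtain b b' d d' where *: "(monom s i, b) : G J" "(monom (c * s) (Suc i), b') : G J" "b' - b * y : L"
  "(monom t i, d) : G J" "(monom (c * t) (Suc i), d') : G J" "d' - d * y : L" by blast
 have "(monom (s + t) i, b + d) : G J" using lift_add[OF *(1,4)] by (simp add: add_monom)
 moreover have "(monom (c * (s + t)) (Suc i), b' + d') : G J" using lift_add[OF *(2,5)] by (simp add: add_monom distrib_left)
 moreover have "(b' + d') - (b + d) * y : L" using idl_add[OF L *(3,6)] by (simp add: algebra_simps)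
 ultimately show ?case by blast
qed

lemma G_surj_RK:
 assumes J: "u.idl J" and cK: "!!k. k : K ==> c * k : J" and JJ: "J <= J0"
  and y: "!!k. k : K ==> \<l> (c * k) - \<iota> k * y : L" and p: "p : RK K J"
 shows "EX b b'. (p, b) : G J & (monom c 1 * p, b') : G J & b' - b * y : L"
proof -
 have "EX b b'. ((\<Sum>i\<in>A. monom (coeff p i) i), b) : G J & (monom c 1 * (\<Sum>i\<in>A. monom (coeff p i) i), b') : G J & b' - b * y : L"
  if "finite A" for A
  using that
 proof (induction A)
  case empty then show ?case using G_0 idlD(2)[OF L] by (intro exI[of _ 0]) auto
 next
  case (insert i A)
  have "coeff p i : iprod K (ipow J i)" using p by (simp add: RK_iff)
  from G_surj_monom2[OF J cK JJ y this] obtain d d' where d: "(monom (coeff p i) i, d) : G J"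
   "(monom (c * coeff p i) (Suc i), d') : G J" "d' - d * y : L" by blast
  obtain b b' where b: "((\<Sum>i\<in>A. monom (coeff p i) i), b) : G J"
   "(monom c 1 * (\<Sum>i\<in>A. monom (coeff p i) i), b') : G J" "b' - b * y : L" using insert by blast
  have "(\<Sum>i\<in>insert i A. monom (coeff p i) i) = monom (coeff p i) i + (\<Sum>i\<in>A. monom (coeff p i) i)"
   using insert.hyps by simp
  moreover have "monom c 1 * (monom (coeff p i) i + (\<Sum>i\<in>A. monom (coeff p i) i)) =
   monom (c * coeff p i) (Suc i) + monom c 1 * (\<Sum>i\<in>A. monom (coeff p i) i)" by (simp add: distrib_left mult_monom)
  moreover have "(d' + b') - (d + b) * y : L" using idl_add[OF L d(3) b(3)] by (simp add: algebra_simps)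
  ultimately show ?case using lift_add[OF d(1) b(1)] lift_add[OF d(2) b(2)]
   by (intro exI[of _ "d + b"] exI[of _ "d' + b'"]) simp
 qed
 from this[of "{..degree p}"] show ?thesis by (simp only: poly_as_sum_of_monoms finite_atMost)
qed

text \<open>The correspondence is a map from R[Ju] to B modulo L; this is the linear type of
  J.\<close>

definition lin_type :: "'a set => bool" where
 "lin_type J \<longleftrightarrow> (ALL b. (0, b) : G J --> b : L)"

lemma lin_typeD:
 assumes "lin_type J" "(p, b) : G J" "(p, b') : G J" shows "b - b' : L"
 using G_diff[OF assms(2,3)] assms(1) by (simp add: lin_type_def)

text \<open>The coefficients of (t - cu)\<kappa> are \<kappa>_(i-1) - cu \<kappa>_i. Lifting them
  with y in place of cu makes the sum for \<beta>(y) telescope modulo L.\<close>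

lemma lift_shift_lin:
 assumes J: "u.idl J" and cK: "!!k. k : K ==> c * k : J" and JJ: "J <= J0"
  and y: "!!k. k : K ==> \<l> (c * k) - \<iota> k * y : L" "y : B"
  and lt: "lin_type J" and \<kappa>: "\<kappa> : pol (RK K J)"
  and \<beta>: "!!i. (coeff (shift_lin c * \<kappa>) i, coeff \<beta> i) : G J"
 shows "poly \<beta> y : L"
proof -
 have "EX b b'. (coeff \<kappa> i, b) : G J & (monom c 1 * coeff \<kappa> i, b') : G J & b' - b * y : L &
   (coeff \<kappa> i = 0 --> b = 0 & b' = 0)" for i
 proof (cases "coeff \<kappa> i = 0")
  case True then show ?thesis using G_0 idlD(2)[OF L] by (intro exI[of _ 0]) auto
 next
  case False
  then show ?thesis using G_surj_RK[OF J cK JJ y(1), where p = "coeff \<kappa> i"] \<kappa> by (auto simp: pol_iff)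
 qed
 then obtain u u' where u: "!!i. (coeff \<kappa> i, u i) : G J" "!!i. (monom c 1 * coeff \<kappa> i, u' i) : G J"
  "!!i. u' i - u i * y : L" "!!i. coeff \<kappa> i = 0 ==> u i = 0" by metis
 \<comment> \<open>Linear type compares coefficient i of \<beta> with the lift u (i - 1) - u' i, and
   u' i agrees with u i * y modulo L, so e i lies in L.\<close>
 define e where "e i = coeff \<beta> i - (if i = 0 then 0 else u (i - 1)) + u i * y" for i
 have "e i : L" for i
 proof -
  have "coeff \<beta> i - ((if i = 0 then 0 else u (i - 1)) - u' i) : L"
  proof (cases i)
   case 0
   have "(coeff (shift_lin c * \<kappa>) 0, - u' 0) : G J" unfolding coeff_shift_lin using G_uminus[OF u(2)[of 0]] .
   from lin_typeD[OF lt \<beta>[of 0] this] show ?thesis using 0 by simp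
  next
   case (Suc j)
   have "(coeff (shift_lin c * \<kappa>) (Suc j), u j - u' (Suc j)) : G J"
    unfolding coeff_shift_lin using G_diff[OF u(1)[of j] u(2)[of "Suc j"]] .
   then show ?thesis using lin_typeD[OF lt \<beta>[of "Suc j"]] Suc by simp
  qed
  from idl_diff[OF L this u(3)[of i]] show ?thesis by (simp add: e_def algebra_simps)
 qed
 moreover have "e i * y ^ i : L" if "e i : L" for i using that y(2) idlD(5)[OF L] by auto
 ultimately have "(\<Sum>i\<le>n. e i * y ^ i) : L" for n by (intro ideal_sum[OF L]) auto
 moreover have "(\<Sum>i\<le>n. e i * y ^ i) = (\<Sum>i\<le>n. coeff \<beta> i * y ^ i) + u n * y ^ Suc n" for n
  by (induction n) (auto simp: e_def algebra_simps)
 \<comment> \<open>Beyond both degrees the boundary term vanishes, since the lift of a zero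
   coefficient was chosen to be zero, and the partial sum is all of \<beta>(y).\<close>
 moreover define n where "n = max (degree \<beta>) (Suc (degree \<kappa>))"
 moreover have "u n = 0" by (rule u(4)) (auto simp: n_def intro!: coeff_eq_0)
 moreover have "(\<Sum>i\<le>n. coeff \<beta> i * y ^ i) = poly \<beta> y"
  unfolding poly_altdef by (rule sum.mono_neutral_right) (auto simp: n_def intro: coeff_eq_0 le_degree)
 ultimately show ?thesis by (metis add.right_neutral mult_zero_left)
qed

lemma lin_type_zero: "lin_type {0}"
proof -
 have l0: "\<l> 0 : L" using \<l>(3)[of 0 0] idlD(2)[OF J0] by (simp add: \<iota>_0)
 have "EX r. p = [:r:] & b - \<iota> r : L" if "(p, b) : G {0}" for p b
  using that
 proof (induction rule: lift_rel.induct)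
  case (lift_const r) then show ?case using idlD(2)[OF L] by (intro exI[of _ r]) simp
 next
  case (lift_lin r) then show ?case using l0 by (intro exI[of _ 0]) (simp add: \<iota>_0)
 next
  case (lift_ker z) then show ?case by (intro exI[of _ 0]) (simp add: \<iota>_0)
 next
  case (lift_add p b p' b')
  then obtain r s where "p = [:r:]" "b - \<iota> r : L" "p' = [:s:]" "b' - \<iota> s : L" by blast
  then show ?case using idl_add[OF L, of "b - \<iota> r" "b' - \<iota> s"] by (intro exI[of _ "r + s"]) (simp add: \<iota> algebra_simps)
 next
  case (lift_mult p b p' b')
  then obtain r s where rs: "p = [:r:]" "b - \<iota> r : L" "p' = [:s:]" "b' - \<iota> s : L" by blast
  have "b' : B" using G_sub(2)[OF lift_mult(2)] idlD(2)[OF J0] by simp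
  then have "b' * (b - \<iota> r) + \<iota> r * (b' - \<iota> s) : L" using idl_lin[OF L] \<iota> rs by blast
  then show ?case using rs by (intro exI[of _ "r * s"]) (simp add: \<iota> algebra_simps)
 qed
 then have "b : L" if "(0, b) : G {0}" for b
  using that \<iota>_0 by (metis diff_zero pCons_eq_0_iff)
 then show ?thesis by (simp add: lin_type_def)
qed

lemma poly_in_B: "(!!i. coeff \<beta> i : B) ==> y : B ==> poly \<beta> y : B"
 unfolding poly_altdef by (intro ideal_sum[OF idl_C]) auto

text \<open>Every pair for J + (x) arises from polynomials q and \<beta> with corresponding
  coefficients for J, evaluated at t = xu and t = \<l> x. If q(xu) = 0, then q = (t - xu)\<kappa>
  with \<kappa> in JR[Ju,t], and \<open>lift_shift_lin\<close> with c = x and K = J applies.\<close>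

lemma lin_type_adj:
 assumes J: "NZP J" and x: "nzd_on x UNIV J" and JJ: "adj J x <= J0" and lt: "lin_type J"
 shows "lin_type (adj J x)"
proof -
 have idJ: "u.idl J" using NZP_idl J .
 have JJ': "J <= J0" "x : J0" using adj_upper[OF idJ] JJ by auto
 define y where "y = \<l> x"
 have yB: "y : B" using \<l>(1) JJ' by (simp add: y_def)
 have coB: "coeff \<beta> i : B" if "ALL i. (coeff q i, coeff \<beta> i) : G J" for q \<beta> i
  using that G_sub(2)[OF _ idJ JJ'(1)] by blast
 have "EX q \<beta>. (ALL i. (coeff q i, coeff \<beta> i) : G J) & poly q (monom x 1) = p & b - poly \<beta> y : L"
  if "(p, b) : G (adj J x)" for p b
  using that
 proof (induction rule: lift_rel.induct)
  case (lift_const r)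
  show ?case using G_0 lift_rel.lift_const[of r \<iota> \<l> L J] idlD(2)[OF L]
   by (intro exI[of _ "[:[:r:]:]"] exI[of _ "[:\<iota> r:]"]) (auto simp: coeff_pCons split: nat.splits)
 next
  case (lift_lin r)
  then obtain j c where j: "j : J" "r = j + x * c" by (elim adjE)
  have "x * c : J0" using JJ'(2) idlD(5)[OF J0] by blast
  then have "\<l> r - (\<l> j + \<l> (x * c)) : L" unfolding j(2) using \<l>(2) j JJ' by blast
  from idl_add[OF L this \<l>(3)[OF JJ'(2), of c]] have "\<l> r - (\<l> j + \<iota> c * y) : L" by (simp add: y_def algebra_simps)
  then have "\<l> r - poly [:\<l> j, \<iota> c:] y : L" by (simp add: mult.commute)
  moreover have "poly [:monom j 1, [:c:]:] (monom x 1) = monom r 1"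
   by (simp add: j(2) add_monom[symmetric] smult_monom mult.commute)
  moreover have "ALL i. (coeff [:monom j 1, [:c:]:] i, coeff [:\<l> j, \<iota> c:] i) : G J"
   using G_0 lift_rel.lift_const[of c \<iota> \<l> L J] lift_rel.lift_lin[OF j(1), where \<l> = \<l> and \<iota> = \<iota> and L = L]
   by (auto simp: coeff_pCons split: nat.splits)
  ultimately show ?case by blast
 next
  case (lift_ker z) then show ?case using G_0 by (intro exI[of _ 0] exI[of _ 0]) auto
 next
  case (lift_add p b p' b')
  then obtain q \<beta> q' \<beta>' where *: "ALL i. (coeff q i, coeff \<beta> i) : G J" "poly q (monom x 1) = p" "b - poly \<beta> y : L"
   "ALL i. (coeff q' i, coeff \<beta>' i) : G J" "poly q' (monom x 1) = p'" "b' - poly \<beta>' y : L" by blast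
  have "(b + b') - poly (\<beta> + \<beta>') y : L" using idl_add[OF L *(3,6)] by (simp add: algebra_simps)
  moreover have "ALL i. (coeff (q + q') i, coeff (\<beta> + \<beta>') i) : G J" using * lift_rel.lift_add by fastforce
  moreover have "poly (q + q') (monom x 1) = p + p'" using * by simp
  ultimately show ?case by blast
 next
  case (lift_mult p b p' b')
  then obtain q \<beta> q' \<beta>' where *: "ALL i. (coeff q i, coeff \<beta> i) : G J" "poly q (monom x 1) = p" "b - poly \<beta> y : L"
   "ALL i. (coeff q' i, coeff \<beta>' i) : G J" "poly q' (monom x 1) = p'" "b' - poly \<beta>' y : L" by blast
  have "b' : B" using G_sub(2)[OF lift_mult(2) adj_ideal[OF idJ] JJ] .
  then have "b' * (b - poly \<beta> y) + poly \<beta> y * (b' - poly \<beta>' y) : L"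
   using idl_lin[OF L] poly_in_B[OF coB[OF *(1)] yB] * by blast
  then have "b * b' - poly (\<beta> * \<beta>') y : L" by (simp add: algebra_simps)
  moreover have "ALL i. (coeff (q * q') i, coeff (\<beta> * \<beta>') i) : G J"
   unfolding coeff_mult using * by (intro allI G_sum) (auto intro: lift_rel.lift_mult)
  moreover have "poly (q * q') (monom x 1) = p * p'" using * by simp
  ultimately show ?case by blast
 qed
 moreover have "b : L" if *: "ALL i. (coeff q i, coeff \<beta> i) : G J" "poly q (monom x 1) = 0" "b - poly \<beta> y : L" for b q \<beta>
 proof -
  have "q : pol (RS J)" using * G_sub(1)[OF _ idJ JJ'(1)] by (auto simp: pol_iff)
  then obtain \<kappa> where \<kappa>: "\<kappa> : pol (RK J J)" "q = shift_lin x * \<kappa>" using eval_kernel[OF idJ NZP_pow[OF J x]] * by blast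
  have "poly \<beta> y : L"
  proof (rule lift_shift_lin[OF idJ _ JJ'(1) _ yB lt \<kappa>(1)])
   show "x * k : J" if "k : J" for k using that u.idl_mult[OF idJ] by blast
   show "\<l> (x * k) - \<iota> k * y : L" for k using \<l>(3)[OF JJ'(2)] by (simp add: y_def)
   show "(coeff (shift_lin x * \<kappa>) i, coeff \<beta> i) : G J" for i using *(1) \<kappa>(2) by simp
  qed
  from idl_add[OF L *(3) this] show ?thesis by simp
 qed
 ultimately show ?thesis unfolding lin_type_def by blast
qed

lemma lin_type_rideal: "rideal \<mm> l J ==> J <= J0 ==> lin_type J"
proof (induction rule: rideal.induct)
 case (rideal_Suc l J x)
 then have "NZP J" using rideal_NZP by blast
 then show ?case using rideal_Suc lin_type_adj adj_upper(1)[OF NZP_idl] by blast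
qed (rule lin_type_zero)

end

section \<open>Polynomial rings\<close>

lemma mpoly_induct [case_names single add]:
 assumes "!!e r. P (single e r)" "!!p q. P p ==> P q ==> P (p + q)"
 shows "P (p :: ('x \<Rightarrow>\<^sub>0 'c::comm_monoid_add))"
proof (induction p rule: update_induct)
 case const
 have "P (single undefined 0)" by (rule assms)
 then show ?case by simp
next
 case (update f k v)
 have "Poly_Mapping.update k v f = f + single k v"
  using update(1) by (intro poly_mapping_eqI) (auto simp: lookup_update lookup_add lookup_single when_def in_keys_iff)
 then show ?case using assms update by metis
qed

lemma single_decomp: "p = (\<Sum>e\<in>keys p. single e (lookup p e))"
proof (rule poly_mapping_eqI)
 fix e
 show "lookup p e = lookup (\<Sum>e\<in>keys p. single e (lookup p e)) e"
  by (simp add: lookup_sum lookup_single when_def sum.delta in_keys_iff)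
qed

definition mev :: "('a::comm_ring_1 => 'c::comm_ring_1) => (nat => 'c) => 'a mpolynomial => 'c" where
 "mev h z p = (\<Sum>e\<in>keys p. h (lookup p e) * (\<Prod>i\<in>keys e. z i ^ lookup e i))"

definition mvar :: "nat => 'a::comm_ring_1 mpolynomial" where
 "mvar i = single (single i 1) 1"

locale coeff_hom =
 fixes h :: "'a::comm_ring_1 => 'c::comm_ring_1"
 assumes h_add: "h (r + s) = h r + h s" and h_mult: "h (r * s) = h r * h s" and h_one: "h 1 = 1"
begin

lemma h_0 [simp]: "h 0 = 0" using h_add[of 0 0] by simp

lemma mev_superset:
 assumes "finite S" "keys p <= S"
 shows "mev h z p = (\<Sum>e\<in>S. h (lookup p e) * (\<Prod>i\<in>keys e. z i ^ lookup e i))"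
 unfolding mev_def using assms by (intro sum.mono_neutral_left) (auto simp: in_keys_iff)

lemma mev_add: "mev h z (p + q) = mev h z p + mev h z q"
proof -
 let ?S = "keys p \<union> keys q"
 have "keys (p + q) <= ?S" by (rule Poly_Mapping.keys_add)
 then show ?thesis
  using mev_superset[of ?S p z] mev_superset[of ?S q z] mev_superset[of ?S "p + q" z]
  by (simp add: lookup_add h_add distrib_right sum.distrib)
qed

lemma mev_single: "mev h z (single e r) = h r * (\<Prod>i\<in>keys e. z i ^ lookup e i)"
 using mev_superset[of "{e}" "single e r" z] by simp

lemma mon_add:
 "(\<Prod>i\<in>keys (e + f). z i ^ lookup (e + f) i) =
  (\<Prod>i\<in>keys e. z i ^ lookup e i) * (\<Prod>i\<in>keys f. (z i :: 'c) ^ lookup f i)"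
proof -
 let ?S = "keys e \<union> keys f"
 have *: "(\<Prod>i\<in>keys d. z i ^ lookup d i) = (\<Prod>i\<in>?S. z i ^ lookup d i)"
  if "keys d <= ?S" for d
  using that by (intro prod.mono_neutral_left) (auto simp: in_keys_iff)
 show ?thesis using *[of e] *[of f] *[of "e + f"] Poly_Mapping.keys_add[of e f]
  by (simp add: lookup_add power_add prod.distrib)
qed

lemma mev_mult: "mev h z (p * q) = mev h z p * mev h z q"
proof (induction p rule: mpoly_induct)
 case (single e r)
 show ?case
 proof (induction q rule: mpoly_induct)
  case (single f s)
  show ?case by (simp only: mult_single mev_single mon_add h_mult) (simp add: algebra_simps)
 qed (simp add: distrib_left mev_add)
qed (simp add: distrib_right mev_add)

lemma mev_const [simp]: "mev h z (mconst r) = h r"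
 by (simp add: mconst_def mev_single)

lemma mev_var [simp]: "mev h z (mvar i) = z i"
 by (simp add: mvar_def mev_single h_one)

lemma mev_one [simp]: "mev h z 1 = 1"
 using mev_const[of z 1] by (simp add: mconst_def h_one)

end

definition MP :: "nat => 'a::comm_ring_1 mpolynomial set" where
 "MP n = {p. ALL e:keys p. keys e <= {1..n}}"

lemma MP_subring: "comm_subring (MP n)"
proof
 show "1 : MP n" by (auto simp: MP_def)
 show "x + y : MP n" if "x : MP n" "y : MP n" for x y :: "'a mpolynomial"
  using that Poly_Mapping.keys_add[of x y] unfolding MP_def by blast
 show "x * y : MP n" if xy: "x : MP n" "y : MP n" for x y :: "'a mpolynomial"
  unfolding MP_def
 proof safe
  fix e i assume e: "e : keys (x * y)" "i : keys e"
  then obtain a b where "e = a + b" "a : keys x" "b : keys y" using keys_mult[of x y] by blast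
  then have "i : keys a \<or> i : keys b" using e Poly_Mapping.keys_add[of a b] by blast
  then show "i : {1..n}" using xy \<open>a : keys x\<close> \<open>b : keys y\<close> unfolding MP_def by blast
 qed
qed (auto simp: MP_def)

lemma mconst_MP [simp]: "mconst r : MP n"
 by (auto simp: MP_def mconst_def split: if_splits)

lemma mvar_MP [simp]: "i : {1..n} ==> mvar i : MP n"
 by (auto simp: mvar_def MP_def split: if_splits)

lemma mconst_hom:
 "mconst (r + s) = mconst r + mconst s" "mconst (r * s) = mconst r * mconst s" "mconst 1 = 1" "mconst 0 = 0"
 by (simp_all add: mconst_def single_add mult_single)

lemma MP_induct [consumes 1, case_names const var add mult]:
 assumes p: "p : MP n" and const: "!!r. P (mconst r)" and var: "!!i. i : {1..n} ==> P (mvar i)"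
  and add: "!!p q. p : MP n ==> q : MP n ==> P p ==> P q ==> P (p + q)"
  and mult: "!!p q. p : MP n ==> q : MP n ==> P p ==> P q ==> P (p * q)"
 shows "P p"
proof -
 interpret MP: comm_subring "MP n :: 'a mpolynomial set" by (rule MP_subring)
 have vpow: "mvar k ^ v = (single (single k v) 1 :: 'a mpolynomial)" for k v
  by (induction v) (simp_all add: mvar_def mult_single single_add[symmetric])
 have Ppow: "x ^ v : MP n & P (x ^ v)" if "x : MP n" "P x" for x v
  by (induction v) (use that mult const[of 1] MP.one_mem in \<open>auto simp: mconst_hom\<close>)
 have mon: "keys e <= {1..n} ==> single e r : MP n & P (single e r)" for e r
 proof (induction e arbitrary: r rule: update_induct)
  case const then show ?case using assms(2)[of r] mconst_MP[of r n] by (simp add: mconst_def)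
 next
  case (update f k v)
  have e: "Poly_Mapping.update k v f = f + single k v"
   using update(1) by (intro poly_mapping_eqI) (auto simp: lookup_update lookup_add lookup_single when_def in_keys_iff)
  have k: "k : {1..n}" "keys f <= {1..n}" using update by (auto simp: keys_update)
  have "single (Poly_Mapping.update k v f) r = single f r * mvar k ^ v"
   unfolding e vpow mult_single by simp
  then show ?case using update.IH[OF k(2)] Ppow[OF mvar_MP[OF k(1)] var[OF k(1)]] mult MP.mult_mem by metis
 qed
 have "(\<Sum>e\<in>A. single e (lookup p e)) : MP n & P (\<Sum>e\<in>A. single e (lookup p e))"
  if "finite A" "A <= keys p" for A
  using that
 proof (induction A)
  case empty
  then show ?case using const[of 0] MP.zero_mem by (simp add: mconst_hom)
 next
  case (insert e A)
  have "keys e <= {1..n}" using p insert.prems unfolding MP_def by blast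
  from mon[OF this, of "lookup p e"] insert
  show ?case using add MP.add_mem by simp
 qed
 then show ?thesis using single_decomp[of p] by (metis finite_keys order_refl)
qed

definition hcp :: "nat => 'a::comm_ring_1 mpolynomial => 'a mpolynomial" where
 "hcp k p = (\<Sum>e\<in>{e : keys p. mdegree e = k}. single e (lookup p e))"

lemma lookup_hcp: "lookup (hcp k p) e = (if mdegree e = k then lookup p e else 0)"
proof -
 have "lookup (hcp k p) e =
   (\<Sum>d\<in>{d : keys p. mdegree d = k}. if d = e then lookup p d else 0)"
  by (simp add: hcp_def lookup_sum lookup_single when_def)
 also have "\<dots> = (if e : {d : keys p. mdegree d = k} then lookup p e else 0)"
  by (subst sum.delta) auto
 finally show ?thesis by (auto simp: in_keys_iff)
qed

lemma mdegree_superset: "finite S ==> keys e <= S ==> mdegree e = (\<Sum>i\<in>S. lookup e i)"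
 unfolding mdegree_def by (intro sum.mono_neutral_left) (auto simp: in_keys_iff)

lemma mdegree_add: "mdegree (e + f) = mdegree e + mdegree f"
proof -
 let ?S = "keys e \<union> keys f"
 have "keys (e + f) <= ?S" by (rule Poly_Mapping.keys_add)
 then show ?thesis using mdegree_superset[of ?S e] mdegree_superset[of ?S f] mdegree_superset[of ?S "e + f"]
  by (simp add: lookup_add sum.distrib)
qed

lemma mdegree_single [simp]: "mdegree (single i k) = k"
 using mdegree_superset[of "{i}" "single i k"] by simp

lemma mdegree_0 [simp]: "mdegree 0 = 0"
 by (simp add: mdegree_def)

lemma mdegree_eq_0: "mdegree e = 0 \<longleftrightarrow> e = 0"
proof
 assume "mdegree e = 0"
 then have "ALL i. lookup e i = 0" unfolding mdegree_def by (auto simp: in_keys_iff)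
 then show "e = 0" by (intro poly_mapping_eqI) simp
qed simp

lemma hcp_add: "hcp k (p + q) = hcp k p + hcp k q"
 by (rule poly_mapping_eqI) (simp add: lookup_hcp lookup_add)

lemma hcp_single: "hcp k (single e r) = (if mdegree e = k then single e r else 0)"
 by (rule poly_mapping_eqI) (simp add: lookup_hcp lookup_single when_def)

lemma hcp_mult: "hcp k (p * q) = (\<Sum>i\<le>k. hcp i p * hcp (k - i) q)"
proof (induction p rule: mpoly_induct)
 case (single e r)
 show ?case
 proof (induction q rule: mpoly_induct)
  case (single f s)
  have "(\<Sum>i\<le>k. hcp i (single e r) * hcp (k - i) (single f s)) =
    (\<Sum>i\<le>k. if i = mdegree e then single e r * hcp (k - mdegree e) (single f s) else 0)"
   by (intro sum.cong) (auto simp: hcp_single)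
  also have "\<dots> = (if mdegree e <= k then single e r * hcp (k - mdegree e) (single f s) else 0)"
   by (subst sum.delta) auto
  also have "\<dots> = hcp k (single e r * single f s)"
   by (auto simp: hcp_single mult_single mdegree_add)
  finally show ?case by simp
 qed (simp add: distrib_left hcp_add sum.distrib)
qed (simp add: distrib_right hcp_add sum.distrib)

lemma hcp_MP: "p : MP n ==> hcp k p : MP n"
 unfolding MP_def by (auto simp: in_keys_iff lookup_hcp split: if_splits)

lemma hcp_sum: "EX n. p = (\<Sum>k\<le>n. hcp k p)"
proof
 show "p = (\<Sum>k\<le>Max (mdegree ` keys p). hcp k p)"
 proof (rule poly_mapping_eqI)
  fix e
  have "(\<Sum>k\<le>Max (mdegree ` keys p). lookup (hcp k p) e) =
    (\<Sum>k\<le>Max (mdegree ` keys p). if k = mdegree e then lookup p e else 0)"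
   by (intro sum.cong) (auto simp: lookup_hcp)
  also have "\<dots> = (if mdegree e <= Max (mdegree ` keys p) then lookup p e else 0)"
   by (subst sum.delta) auto
  also have "\<dots> = lookup p e" by (auto simp: in_keys_iff intro!: Max_ge)
  finally show "lookup p e = lookup (\<Sum>k\<le>Max (mdegree ` keys p). hcp k p) e"
   by (simp add: lookup_sum)
 qed
qed

lemma noetherian_MP:
 assumes "noeth_subring (UNIV :: 'a::comm_ring_1 set)"
 shows "noeth_subring (MP n :: 'a mpolynomial set)"
proof (induction n)
 case 0
 have "p = mconst (lookup p 0)" if "p : MP 0" for p :: "'a mpolynomial"
  using that by (intro poly_mapping_eqI) (auto simp: MP_def mconst_def lookup_single when_def in_keys_iff)
 then have "MP 0 = range (mconst :: 'a => _)" using mconst_MP by blast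
 then show ?case by (rule noetherian_image[OF assms]) (auto simp: mconst_hom)
next
 case (Suc n)
 interpret M: comm_subring "MP n :: 'a mpolynomial set" by (rule MP_subring)
 interpret M': comm_subring "MP (Suc n) :: 'a mpolynomial set" by (rule MP_subring)
 interpret P: comm_subring "pol (MP n :: 'a mpolynomial set)" by (rule M.pol_subring)
 let ?v = "mvar (Suc n) :: 'a mpolynomial"
 have MM: "MP n <= (MP (Suc n) :: 'a mpolynomial set)" unfolding MP_def by fastforce
 have const_pol: "[:p:] : pol (MP n)" if "p : MP n" for p :: "'a mpolynomial"
  using that M.zero_mem by (auto simp: pol_iff coeff_pCons split: nat.splits)
 have "EX q:pol (MP n). poly q ?v = p" if "p : MP (Suc n)" for p
  using that
 proof (induction p rule: MP_induct)
  case (const r) show ?case using const_pol[of "mconst r"] by (intro bexI[of _ "[:mconst r:]"]) auto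
 next
  case (var i)
  show ?case
  proof (cases "i = Suc n")
   case True
   have "[:0, 1:] : pol (MP n :: 'a mpolynomial set)" by (auto simp: pol_iff coeff_pCons split: nat.splits)
   then show ?thesis using True by (intro bexI[of _ "[:0, 1:]"]) auto
  next
   case False
   then have "mvar i : MP n" using var by (intro mvar_MP) auto
   then show ?thesis using const_pol by (intro bexI[of _ "[:mvar i:]"]) auto
  qed
 next
  case (add p q) then show ?case by (metis P.add_mem poly_add)
 next
  case (mult p q) then show ?case by (metis P.mult_mem poly_mult)
 qed
 moreover have "poly q ?v : MP (Suc n)" if "q : pol (MP n)" for q
  using M'.poly_mem[OF M'.idl_C, of q ?v] that pol_mono[OF MM] by (auto intro: mvar_MP)
 ultimately have "MP (Suc n) = (%q. poly q ?v) ` pol (MP n)" by blast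
 then show ?case by (rule noetherian_image[OF noetherian_pol[OF Suc.IH]]) auto
qed

lemma graded_MP:
 assumes "noeth_subring (UNIV :: 'a::comm_ring_1 set)"
 shows "graded_subring (MP n :: 'a mpolynomial set) hcp"
proof -
 interpret N: noeth_subring "MP n :: 'a mpolynomial set" by (rule noetherian_MP[OF assms])
 show ?thesis
 proof
  show "hcp i (hcp j x) = (if i = j then hcp j x else 0)" for i j and x :: "'a mpolynomial"
   by (rule poly_mapping_eqI) (simp add: lookup_hcp)
  show "hcp 0 1 = (1 :: 'a mpolynomial)"
   using hcp_single[of 0 0 "1 :: 'a"] by simp
  fix P and x :: "'a mpolynomial" and k
  assume P: "N.prm P" "!!f. f : MP n ==> f = hcp 1 f ==> f : P" and x: "x : MP n"
  note idP = N.prm_idl[OF P(1)]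
  have "single e r : P" if e: "e : keys x" "mdegree e = Suc k" for e r
  proof -
   have "e ~= 0" using e by auto
   then obtain i where i: "i : keys e" by (metis all_not_in_conv keys_eq_empty)
   then have iK: "i : {1..n}" using x e unfolding MP_def by blast
   define f where "f = e - single i 1"
   have ef: "e = single i 1 + f"
    using i by (intro poly_mapping_eqI) (auto simp: f_def lookup_add lookup_minus lookup_single when_def in_keys_iff)
   have "keys f <= keys e"
    by (auto simp: ef in_keys_iff lookup_add)
   then have "single f r : MP n" using x e unfolding MP_def by (auto split: if_splits)
   moreover have "hcp 1 (mvar i) = (mvar i :: 'a mpolynomial)" by (simp add: mvar_def hcp_single)
   then have "mvar i : P" using P(2)[of "mvar i"] mvar_MP[OF iK] by simp
   ultimately have "single f r * mvar i : P" using N.idl_mult[OF idP] by blast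
   then show ?thesis by (simp add: mvar_def mult_single ef add.commute)
  qed
  then show "hcp (Suc k) x : P" unfolding hcp_def by (intro N.ideal_sum[OF idP]) auto
 qed (auto simp: hcp_MP hcp_add hcp_mult hcp_sum)
qed

lemma hcp_0: "hcp 0 p = mconst (lookup p 0)"
 by (rule poly_mapping_eqI) (auto simp: lookup_hcp mconst_def lookup_single when_def mdegree_eq_0)

section \<open>Subsets of a type as ring records\<close>

abbreviation tcr :: "'r::comm_ring_1 set => 'r ring" where
 "tcr C \<equiv> ring_of_type_algebra\<lparr>carrier := C\<rparr>"

lemma ring_of_type_algebra_simps [simp]:
 "x \<otimes>\<^bsub>ring_of_type_algebra\<^esub> y = x * y" "x \<oplus>\<^bsub>ring_of_type_algebra\<^esub> y = x + y"
 "\<zero>\<^bsub>ring_of_type_algebra\<^esub> = 0" "\<one>\<^bsub>ring_of_type_algebra\<^esub> = 1" "carrier ring_of_type_algebra = UNIV"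
 by (simp_all add: ring_of_type_algebra_def)

lemma tcr_simps [simp]:
 "carrier (tcr C) = C" "x \<otimes>\<^bsub>tcr C\<^esub> y = x * y" "x \<oplus>\<^bsub>tcr C\<^esub> y = x + y" "\<zero>\<^bsub>tcr C\<^esub> = 0" "\<one>\<^bsub>tcr C\<^esub> = 1"
 by (simp_all add: ring_of_type_algebra_def)

lemma tcr_UNIV: "ring_of_type_algebra = tcr UNIV"
 by (simp add: ring_of_type_algebra_def)

lemma mpoly_ring_tcr: "mpoly_ring n = tcr (MP n)"
 by (simp add: mpoly_ring_def MP_def)

context comm_subring
begin

lemma cring_tcr: "cring (tcr C)"
proof (intro cringI abelian_groupI comm_monoidI)
 show "EX y:carrier (tcr C). y \<oplus>\<^bsub>tcr C\<^esub> x = \<zero>\<^bsub>tcr C\<^esub>" if "x : carrier (tcr C)" for x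
  using that by (intro bexI[of _ "- x"]) auto
qed (auto simp: algebra_simps)

lemma a_inv_tcr: "x : C ==> \<ominus>\<^bsub>tcr C\<^esub> x = - x"
proof -
 interpret R: cring "tcr C" by (rule cring_tcr)
 assume "x : C"
 then show ?thesis using R.minus_equality[of "- x" x] by simp
qed

lemma ideal_tcr: "ideal I (tcr C) \<longleftrightarrow> idl I"
proof
 interpret R: cring "tcr C" by (rule cring_tcr)
 assume "ideal I (tcr C)"
 then interpret I: ideal I "tcr C" .
 show "idl I" unfolding is_ideal_def
  using I.a_subset I.zero_closed I.a_closed I.I_l_closed unfolding tcr_simps by blast
next
 interpret R: cring "tcr C" by (rule cring_tcr)
 assume I: "idl I"
 show "ideal I (tcr C)"
 proof (rule idealI)
  show "ring (tcr C)" by (rule R.ring_axioms)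
  show "subgroup I (add_monoid (tcr C))"
  proof (rule R.add.subgroupI)
   show "I <= carrier (tcr C)" "I ~= {}" using I by (auto dest: idlD)
   show "\<ominus>\<^bsub>tcr C\<^esub> a : I" if "a : I" for a using that a_inv_tcr idl_uminus[OF I] idl_mem[OF I] by simp
   show "a \<oplus>\<^bsub>tcr C\<^esub> b : I" if "a : I" "b : I" for a b using that idl_add[OF I] by simp
  qed
 qed (use idl_mult[OF I] idlD(5)[OF I] in auto)
qed

lemma genideal_tcr: "Idl\<^bsub>tcr C\<^esub> S = \<Inter>{I. idl I & S <= I}"
 by (simp add: genideal_def ideal_tcr)

lemma primeideal_tcr: "primeideal P (tcr C) \<longleftrightarrow> prm P"
proof
 assume "primeideal P (tcr C)"
 then interpret P: primeideal P "tcr C" .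
 have P: "idl P" using P.ideal_axioms by (simp add: ideal_tcr)
 moreover have "1 ~: P" using P.I_notcarr idlD(1)[OF P] idl_mult[OF P, of _ 1] by auto
 ultimately show "prm P" using P.I_prime by (auto simp: is_prime_def)
next
 assume P: "prm P"
 have "carrier (tcr C) ~= P" using prmD(2)[OF P] by auto
 moreover have "ideal P (tcr C)" using prm_idl[OF P] by (simp add: ideal_tcr)
 ultimately show "primeideal P (tcr C)" using prmD(3)[OF P] cring_tcr
  by (intro primeidealI) auto
qed

end

lemma noetherian_tcr:
 assumes "comm_subring C" shows "noetherian_ring (tcr C) \<longleftrightarrow> noeth_subring C"
proof
 interpret C: comm_subring C by (rule assms)
 assume "noetherian_ring (tcr C)"
 then interpret N: noetherian_ring "tcr C" .
 show "noeth_subring C"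
 proof
  fix F assume F: "F ~= {}" "!!I. I : F ==> C.idl I"
  show "EX I:F. ALL J:F. I <= J --> J = I"
  proof (rule subset_Zorn_nonempty[OF F(1)])
   fix \<C> assume ch: "\<C> ~= {}" "subset.chain F \<C>"
   have "subset.chain {I. ideal I (tcr C)} \<C>"
    using ch(2) F(2) unfolding pred_on.chain_def by (auto simp: C.ideal_tcr)
   then have "\<Union>\<C> \<in> \<C>" using N.ideal_chain_is_trivial[OF ch(1)] by blast
   then show "\<Union>\<C> \<in> F" using ch(2) unfolding pred_on.chain_def by blast
  qed
 qed
next
 interpret C: comm_subring C by (rule assms)
 interpret R: cring "tcr C" by (rule C.cring_tcr)
 assume "noeth_subring C"
 then interpret N: noeth_subring C .
 show "noetherian_ring (tcr C)"
 proof (rule R.trivial_ideal_chain_imp_noetherian)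
  fix \<C> assume ch: "\<C> ~= {}" "subset.chain {I. ideal I (tcr C)} \<C>"
  then have idl: "C.idl I" if "I : \<C>" for I using that unfolding pred_on.chain_def by (auto simp: C.ideal_tcr)
  have "EX I:\<C>. ALL J:\<C>. I <= J --> J = I" by (rule N.noeth[OF ch(1)]) (rule idl)
  then obtain M where M: "M : \<C>" "ALL J:\<C>. M <= J --> J = M" by (elim bexE)
  have "J <= M" if "J : \<C>" for J
  proof -
   have "J <= M \<or> M <= J" using ch(2) M(1) that unfolding pred_on.chain_def by blast
   then show ?thesis using M(2) that by auto
  qed
  then have "\<Union>\<C> = M" using M(1) by blast
  then show "\<Union>\<C> \<in> \<C>" using M(1) by simp
 qed
qed

section \<open>Symmetric algebras of almost complete intersections\<close>

lemma idl_genid: "u.idl (range (%co. \<Sum>i\<in>A. co i * (b i :: 'a::comm_ring_1)))"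
 unfolding is_ideal_def
proof (intro conjI ballI)
 show "0 : range (%co. \<Sum>i\<in>A. co i * b i)" by (rule range_eqI[of _ _ "%_. 0"]) simp
 fix x y assume "x : range (%co. \<Sum>i\<in>A. co i * b i)" "y : range (%co. \<Sum>i\<in>A. co i * b i)"
 then obtain u v where "x = (\<Sum>i\<in>A. u i * b i)" "y = (\<Sum>i\<in>A. v i * b i)" by blast
 then show "x + y : range (%co. \<Sum>i\<in>A. co i * b i)"
  by (intro range_eqI[of _ _ "%i. u i + v i"]) (simp add: distrib_right sum.distrib)
next
 fix c x assume "x : range (%co. \<Sum>i\<in>A. co i * b i)"
 then obtain u where "x = (\<Sum>i\<in>A. u i * b i)" by blast
 then show "c * x : range (%co. \<Sum>i\<in>A. co i * b i)"
  by (intro range_eqI[of _ _ "%i. c * u i"]) (simp add: sum_distrib_left mult.assoc)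
qed simp

definition genid :: "nat => (nat => 'a::comm_ring_1) => 'a set" where
 "genid n a = range (%co. \<Sum>i\<in>{1..n}. co i * a i)"

definition lform :: "nat => (nat => 'a::comm_ring_1) => 'a mpolynomial" where
 "lform n co = (\<Sum>i\<in>{1..n}. mconst (co i) * mvar i)"

lemma genid_mem: assumes "i : {1..n}" shows "a i : genid n a"
proof -
 have "a i = (\<Sum>j\<in>{1..n}. (if j = i then 1 else 0) * a j)"
  using assms by (simp add: if_distrib[of "%x. x * _"] sum.delta cong: if_cong)
 then show ?thesis unfolding genid_def by (intro range_eqI[where x = "%j. if j = i then 1 else 0"]) simp
qed

lemma genid_least: "u.idl I ==> a ` {1..n} <= I ==> genid n a <= I"
 unfolding genid_def by (auto intro!: idl_sum_univ u.idl_mult)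

lemma lform_MP: "n <= k ==> lform n co : MP k"
proof -
 interpret comm_subring "MP k :: 'a mpolynomial set" by (rule MP_subring)
 assume "n <= k"
 then show ?thesis unfolding lform_def by (intro ideal_sum[OF idl_C]) auto
qed

lemma lform_diff: "lform n u - lform n v = lform n (%i. u i - v i)"
proof -
 have "mconst (r - s) = mconst r - (mconst s :: 'a mpolynomial)" for r s :: 'a by (simp add: mconst_def single_diff)
 then show ?thesis by (simp add: lform_def sum_subtractf left_diff_distrib)
qed

lemma lform_add: "lform n u + lform n v = lform n (%i. u i + v i)"
 by (simp add: lform_def sum.distrib distrib_right mconst_hom)

lemma lform_smult: "mconst r * lform n v = lform n (%i. r * v i)"
 by (simp add: lform_def sum_distrib_left mult.assoc mconst_hom)

lemma mvar_lform:
 assumes "i : {1..n}"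
 shows "mvar i = (lform n (%j. if j = i then 1 else 0) :: 'a::comm_ring_1 mpolynomial)"
proof -
 have "(\<Sum>j\<in>{1..n}. mconst (if j = i then 1 else 0 :: 'a) * mvar j) = (\<Sum>j\<in>{1..n}. if j = i then mvar i else 0)"
  by (intro sum.cong) (auto simp: mconst_hom)
 also have "\<dots> = mvar i" using assms by simp
 finally show ?thesis by (simp only: lform_def)
qed

lemma degree_one_lform:
 assumes "p : MP n" "ALL e:keys p. mdegree e = 1"
 shows "EX co. p = lform n co"
proof
 define f where "f i = single (single i (1 :: nat)) (lookup p (single i 1))" for i
 have inj: "inj_on (%i. single i (1 :: nat)) {1..n}" by (auto simp: inj_on_def dest: arg_cong[where f = keys])
 have "keys p <= (%i. single i 1) ` {1..n}"
 proof
  fix e assume e: "e : keys p"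
  then have d: "mdegree e = 1" "keys e <= {1..n}" using assms unfolding MP_def by blast+
  then have "e ~= 0" by auto
  then obtain i where i: "i : keys e" by (metis all_not_in_conv keys_eq_empty)
  define f where "f = e - single i 1"
  have "e = single i 1 + f"
   using i by (intro poly_mapping_eqI) (auto simp: f_def lookup_add lookup_minus lookup_single when_def in_keys_iff)
  moreover from this have "mdegree f = 0" using d mdegree_add[of "single i 1" f] by simp
  ultimately have "e = single i 1" by (simp add: mdegree_eq_0)
  then show "e : (%i. single i 1) ` {1..n}" using i d by blast
 qed
 then have "p = (\<Sum>e\<in>(%i. single i 1) ` {1..n}. single e (lookup p e))"
  by (subst single_decomp[of p], intro sum.mono_neutral_left) (auto simp: in_keys_iff)
 also have "\<dots> = (\<Sum>i\<in>{1..n}. single (single i 1) (lookup p (single i 1)))"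
  using sum.reindex[OF inj] by simp
 also have "\<dots> = lform n (%i. lookup p (single i 1))"
  by (simp add: lform_def mconst_def mvar_def mult_single)
 finally show "p = lform n (%i. lookup p (single i 1))" .
qed

lemma keys_lform: assumes "e : keys (lform n co)" shows "mdegree e = 1"
proof -
 have "e : (\<Union>i\<in>{1..n}. keys (single (single i (1::nat)) (co i)))"
  using assms keys_sum[of "%i. single (single i (1::nat)) (co i)" "{1..n}"]
  by (auto simp: lform_def mconst_def mvar_def mult_single)
 then show ?thesis by (auto split: if_splits)
qed

lemma lookup_mult_0: "lookup (p * q) 0 = lookup p 0 * lookup (q :: 'a::comm_ring_1 mpolynomial) 0"
proof -
 have "mconst (lookup (p * q) 0) = mconst (lookup p 0 * lookup q 0)"
  using hcp_mult[of 0 p q] by (simp add: hcp_0 mconst_hom)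
 then show ?thesis by (metis mconst_def inj_single injD lookup_single_eq)
qed

lemma lookup_mvar_0 [simp]: "lookup (mvar i) 0 = 0"
 by (auto simp: mvar_def lookup_single when_def) (metis mdegree_0 mdegree_single zero_neq_one One_nat_def)

lemma lookup_mconst_0 [simp]: "lookup (mconst r) 0 = r"
 by (simp add: mconst_def)

lemma rideal_regseq:
 "regseq {1} UNIV {0} xs ==> set xs <= \<mm> ==> rideal \<mm> (length xs) (quo {1} UNIV {0} xs)"
proof (induction xs rule: rev_induct)
 case (snoc x xs)
 have "qt {1} UNIV J x = adj J x" for J by (simp add: qt_def adj_def sat_def)
 then have "quo {1} UNIV {0} (xs @ [x]) = adj (quo {1} UNIV {0} xs) x" by (simp add: quo_append)
 then show ?case using snoc by (auto simp: regseq_append intro: rideal_Suc)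
qed (auto intro: rideal_0)

text \<open>The Cohen--Macaulay property in elementary form: depth at least d and no chain of primes
  longer than d.\<close>

locale cm_domain =
 fixes d :: nat and \<mm> :: "'a::idom set"
 assumes N: "noeth_subring (UNIV :: 'a set)"
  and m: "u.prm \<mm>" and unit: "r ~: \<mm> ==> EX s. s * r = 1"
  and dp: "dpt {1} \<mm> d UNIV {0}" and dim: "pchain UNIV {0} n \<mm> ==> n <= d"
begin

sublocale U: noeth_subring "UNIV :: 'a set" by (rule N)

lemma m_idl: "u.idl \<mm>" using u.prm_idl m .

lemma regseq_chain:
 assumes "u.prm (Q :: 'a set)" "set ys <= Q" "regseq {1} UNIV {0} ys" shows "pchain UNIV {0} (length ys) Q"
proof -
 have "c = 0" if "ALL u. c * u = 0" for c :: 'a using that[rule_format, of 1] by simp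
 then have "colon UNIV {0} UNIV <= Q" using idlD(2)[OF u.prm_idl[OF assms(1)]] unfolding colon_def by blast
 then have "pchain UNIV (colon UNIV {0} UNIV) (length ys) Q"
  using U.chain_of_regseq_below[OF u.mult_one assms(1) _ u.clsd_one] assms u.idl_C u.idl_zero prmD(2)[OF assms(1)] by auto
 moreover have "{0} <= colon UNIV {0 :: 'a} UNIV" by (auto simp: colon_def)
 ultimately show ?thesis by (rule pchain_anti)
qed

end

text \<open>J has two systems of generators, a_1, ..., a_g and the regular sequence xs; the first
  presents Sym I, the second carries the inductions. Conditions (a), (b), (c) are condensed into
  \<open>dK\<close>, the depth of R/K.\<close>

locale aci = cm_domain d \<mm> for a :: "nat => 'a::idom" and g d \<mm> and xs :: "'a list" +
 assumes xs: "set xs <= \<mm>" "regseq {1} UNIV {0} xs" and J_eq: "quo {1} UNIV {0} xs = genid g a"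
  and c: "a (Suc g) ~: genid g a"
  and dK: "dpt {1} \<mm> (d - length xs) UNIV {k. a (Suc g) * k : genid g a}"
begin

text \<open>\<open>LI\<close>, \<open>LL\<close> and \<open>MB\<close> are \<open>(L\<^sub>1)\<close>, \<open>L\<close> and the maximal homogeneous ideal of \<open>B\<close>.\<close>

definition "B = (MP (Suc g) :: 'a mpolynomial set)"
definition "J = genid g a"
definition "cc = a (Suc g)"
definition "K = {k. cc * k : J}"
definition "\<psi> = mev (%r. [:[:r:]:]) (%i. if i <= g then [:monom (a i) 1:] else [:0, 1:])"
definition "LI = \<Inter>{I. is_ideal B I & {lform (Suc g) co | co. (\<Sum>i\<in>{1..Suc g}. co i * a i) = 0} <= I}"
definition "LL = {b : B. poly (\<psi> b) (monom cc 1) = 0}"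
definition "MB = {b : B. lookup b 0 : \<mm>}"

sublocale G: graded_subring B hcp
 unfolding B_def by (rule graded_MP[OF N])

sublocale H: coeff_hom "%r :: 'a. [:[:r:]:]"
 by unfold_locales (auto simp: one_pCons)

lemma J_idl: "u.idl J" unfolding J_def genid_def by (rule idl_genid)

lemma K_idl: "u.idl K"
 using J_idl unfolding K_def is_ideal_def by (simp add: distrib_left mult.left_commute)

lemma J_sub_K: "J <= K"
 using u.idl_mult[OF J_idl] by (auto simp: K_def)

lemma rideal_J: "rideal \<mm> (length xs) J"
 using rideal_regseq[OF xs(2,1)] J_eq by (simp add: J_def)

lemma NZP_J: "NZP J" using rideal_NZP rideal_J by blast

lemma psi_add: "\<psi> (p + q) = \<psi> p + \<psi> q" and psi_mult: "\<psi> (p * q) = \<psi> p * \<psi> q"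
 and psi_const [simp]: "\<psi> (mconst r) = [:[:r:]:]" and psi_one [simp]: "\<psi> 1 = 1"
 and psi_var: "i <= g ==> \<psi> (mvar i) = [:monom (a i) 1:]" "\<psi> (mvar (Suc g)) = [:0, 1:]"
 by (simp_all add: \<psi>_def H.mev_add H.mev_mult del: One_nat_def)

lemma psi_0 [simp]: "\<psi> 0 = 0" using psi_add[of 0 0] by (metis add_cancel_left_left add_0)

lemma const_B [simp]: "mconst r : B" and var_B: "i : {1..Suc g} ==> mvar i : B"
 unfolding B_def by (rule mconst_MP, rule mvar_MP)

lemma m_len: "length xs <= d"
 using dim regseq_chain[OF m xs] by blast

lemma RS_J_sub: "comm_subring (RS J)" "comm_subring (pol (RS J))"
 using RS_subring[OF J_idl] comm_subring.pol_subring by auto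

lemma const_pol: "p : RS J ==> [:p:] : pol (RS J)"
 using comm_subring.zero_mem[OF RS_J_sub(1)] by (auto simp: pol_iff coeff_pCons split: nat.splits)

lemma t_pol: "[:0, 1:] : pol (RS J)"
 using comm_subring.zero_mem[OF RS_J_sub(1)] comm_subring.one_mem[OF RS_J_sub(1)]
 by (auto simp: pol_iff coeff_pCons split: nat.splits)

lemma psi_mem: "b : B ==> \<psi> b : pol (RS J)"
 unfolding B_def
proof (induction b rule: MP_induct)
 case (const r) then show ?case using const_pol const_RK[OF u.idl_C J_idl] by simp
next
 case (var i)
 show ?case
 proof (cases "i <= g")
  case True
  then have "a i : J" using var genid_mem[of i g a] by (auto simp: J_def)
  then have "monom (a i) 1 : RS J" using J_idl by (simp add: monom_RS iprod_UNIV)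
  then show ?thesis using const_pol True by (simp add: psi_var)
 next
  case False
  then have "i = Suc g" using var by simp
  then show ?thesis using t_pol by (simp add: psi_var)
 qed
qed (simp_all add: psi_add psi_mult comm_subring.add_mem[OF RS_J_sub(2)] comm_subring.mult_mem[OF RS_J_sub(2)])

lemma psi_lform: "\<psi> (lform (Suc g) co) = [:monom (\<Sum>i\<in>{1..g}. co i * a i) 1, [:co (Suc g):]:]"
proof -
 have s: "\<psi> (\<Sum>i\<in>A. f i) = (\<Sum>i\<in>A. \<psi> (f i))" if "finite A" for f and A :: "nat set"
  using that by (induction A) (simp_all add: psi_add)
 have "{1..Suc g} = insert (Suc g) {1..g}" by auto
 then have "lform (Suc g) co = mconst (co (Suc g)) * mvar (Suc g) + (\<Sum>i\<in>{1..g}. mconst (co i) * mvar i)"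
  unfolding lform_def by simp
 then have "\<psi> (lform (Suc g) co) = [:[:co (Suc g):]:] * [:0, 1:] + (\<Sum>i\<in>{1..g}. [:[:co i:]:] * \<psi> (mvar i))"
  by (simp add: psi_add psi_mult s psi_var)
 also have "(\<Sum>i\<in>{1..g}. [:[:co i:]:] * \<psi> (mvar i)) = (\<Sum>i\<in>{1..g}. [:monom (co i * a i) 1:])"
  by (intro sum.cong) (auto simp: psi_var smult_monom)
 also have "\<dots> = [:monom (\<Sum>i\<in>{1..g}. co i * a i) 1:]"
 proof -
  have "(\<Sum>i\<in>A. [:monom (co i * a i) 1:]) = [:monom (\<Sum>i\<in>A. co i * a i) 1:]" if "finite A" for A
   using that by (induction A) (simp_all add: add_monom)
  then show ?thesis by simp
 qed
 finally show ?thesis by simp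
qed

lemma psi_surj_1: assumes "r : J" shows "EX b:B. \<psi> b = [:monom r 1:]"
proof -
 obtain co where co: "r = (\<Sum>i\<in>{1..g}. co i * a i)" using assms by (auto simp: J_def genid_def)
 define co' where "co' i = (if i <= g then co i else 0)" for i
 have "\<psi> (lform (Suc g) co') = [:monom r 1:]" unfolding psi_lform co co'_def by simp
 then show ?thesis using lform_MP[of "Suc g" "Suc g" co'] by (auto simp: B_def)
qed

lemma psi_surj: assumes "q : pol (RS J)" shows "EX b:B. \<psi> b = q"
proof -
 define Z where "Z = {q. EX b:B. \<psi> b = q}"
 have add: "p + q : Z" if "p : Z" "q : Z" for p q
  using that psi_add unfolding Z_def by (force intro: G.add_mem)
 have mult: "p * q : Z" if "p : Z" "q : Z" for p q
  using that psi_mult unfolding Z_def by (force intro: G.mult_mem)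
 have const: "[:[:r:]:] : Z" for r unfolding Z_def using psi_const const_B by blast
 have "[:0, 1:] : Z" unfolding Z_def using psi_var(2) var_B[of "Suc g"] by auto
 have mon: "[:monom s i:] : Z" if "s : ipow J i" for s i
  using that
 proof (induction i arbitrary: s)
  case 0 then show ?case using const[of s] by (simp add: monom_0)
 next
  case (Suc i)
  from Suc.prems[unfolded ipow.simps] show ?case
  proof (induction rule: iprod.induct)
   case (iprodI x y)
   have "[:monom y 1:] : Z" using psi_surj_1[OF iprodI(2)] by (auto simp: Z_def)
   then have "[:monom x i:] * [:monom y 1:] : Z" using mult Suc.IH iprodI by blast
   moreover have "[:monom x i:] * [:monom y 1:] = [:monom (x * y) (Suc i):]" by (simp add: mult_monom)
   ultimately show ?case by simp
  next
   case (iprod_add x y) then show ?case using add by (fastforce simp: add_monom)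
  qed
 qed
 have RSZ: "[:p:] : Z" if p: "p : RS J" for p
 proof -
  have "[:(\<Sum>i\<in>A. monom (coeff p i) i):] : Z" if "finite A" for A
   using that
  proof (induction A)
   case empty then show ?case using const[of 0] by simp
  next
   case (insert i A)
   have "[:monom (coeff p i) i:] + [:(\<Sum>i\<in>A. monom (coeff p i) i):] : Z"
    using insert p mon by (intro add) (auto simp: RS_iff[OF J_idl])
   then show ?case using insert by simp
  qed
  from this[of "{..degree p}"] show ?thesis by (simp add: poly_as_sum_of_monoms)
 qed
 have "q : Z" using assms
 proof (induction q)
  case 0 then show ?case using const[of 0] by simp
 next
  case (pCons p q)
  have "p : RS J" using pCons.prems[unfolded pol_iff, rule_format, of 0] by simp
  have "coeff q j : RS J" for j using pCons.prems[unfolded pol_iff, rule_format, of "Suc j"] by simp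
  then have "q : Z" using pCons.IH by (simp add: pol_iff)
  then have "[:p:] + [:0, 1:] * q : Z" using add mult RSZ[OF \<open>p : RS J\<close>] \<open>[:0, 1:] : Z\<close> by blast
  then show ?case by simp
 qed
 then show ?thesis by (simp add: Z_def)
qed

lemma psi_image: "\<psi> ` B = pol (RS J)"
 using psi_mem psi_surj by blast

lemma psi_00: "b : B ==> coeff (coeff (\<psi> b) 0) 0 = lookup b 0"
 unfolding B_def
proof (induction b rule: MP_induct)
 case (var i)
 then show ?case by (cases "i <= g") (auto simp: psi_var le_Suc_eq)
qed (simp_all add: psi_add psi_mult lookup_add lookup_mult_0 coeff_mult_0)

lemma ker_idl: "is_ideal B {b : B. \<psi> b : Z}" if "is_ideal (pol (RS J)) Z"
 using that idlD[OF that] psi_mem unfolding is_ideal_def[of B]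
 by (auto simp: psi_add psi_mult)

lemma LK_idl: "is_ideal (pol (RS J)) (lin_ker cc K J)"
 by (rule lin_ker_ideal[OF K_idl J_idl]) (simp add: K_def)

lemma LI_idl: "is_ideal B LI"
proof -
 have "B : {I. is_ideal B I & {lform (Suc g) co | co. (\<Sum>i\<in>{1..Suc g}. co i * a i) = 0} <= I}"
  using lform_MP[of "Suc g" "Suc g"] by (auto simp: B_def G.idl_C[unfolded B_def])
 then show ?thesis unfolding LI_def by (intro G.idl_Inter) auto
qed

lemma lform_LI: "(\<Sum>i\<in>{1..Suc g}. co i * a i) = 0 ==> lform (Suc g) co : LI"
 unfolding LI_def by blast

text \<open>The last coefficient k of a syzygy satisfies ck in J, and the form is sent to k(t -
  cu).\<close>

lemma LI_sub: "LI <= {b : B. \<psi> b : lin_ker cc K J}"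
proof -
 have "\<psi> (lform (Suc g) co) : lin_ker cc K J" if "(\<Sum>i\<in>{1..Suc g}. co i * a i) = 0" for co
 proof -
  define k where "k = co (Suc g)"
  have s: "(\<Sum>i\<in>{1..g}. co i * a i) + k * cc = 0" using that by (simp add: k_def cc_def)
  then have e: "(\<Sum>i\<in>{1..g}. co i * a i) = - (cc * k)" by (simp add: eq_neg_iff_add_eq_0 mult.commute)
  have "(\<Sum>i\<in>{1..g}. co i * a i) : J" by (auto simp: J_def genid_def)
  then have "cc * k : J" using u.idl_uminus[OF J_idl] e by fastforce
  then have "[:[:k:]:] : pol (RK K J)"
   using const_RK[OF K_idl J_idl, of k] idlD(2)[OF RK_ideal[OF K_idl J_idl]]
   by (auto simp: K_def pol_iff coeff_pCons split: nat.splits)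
  moreover have "\<psi> (lform (Suc g) co) = shift_lin cc * [:[:k:]:]"
   unfolding psi_lform e by (simp add: k_def smult_monom minus_monom mult.commute)
  ultimately show ?thesis by (simp only: lin_ker_def) blast
 qed
 then show ?thesis unfolding LI_def using ker_idl[OF LK_idl] lform_MP[of "Suc g" "Suc g"] by (intro Inter_lower) (auto simp: B_def)
qed

text \<open>A linear form in T_1, ..., T_g with value r. Another choice of coefficients changes it
  by a syzygy, that is, by an element of \<open>LI\<close>.\<close>

definition \<l> :: "'a => 'a mpolynomial" where
 "\<l> r = lform (Suc g) (%i. if i <= g then (SOME co. r = (\<Sum>i\<in>{1..g}. co i * a i)) i else 0)"

lemma \<l>_lform: assumes "r : J" shows "EX co. \<l> r = lform (Suc g) co & co (Suc g) = 0 & (\<Sum>i\<in>{1..Suc g}. co i * a i) = r"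
proof -
 have "EX co. r = (\<Sum>i\<in>{1..g}. co i * a i)" using assms by (auto simp: J_def genid_def)
 from someI_ex[OF this] show ?thesis unfolding \<l>_def
  by (intro exI[of _ "%i. if i <= g then (SOME co. r = (\<Sum>i\<in>{1..g}. co i * a i)) i else 0"]) simp
qed

sublocale L: linear_lift B LI mconst \<l> J
proof
 show "is_ideal B LI" "u.idl J" by (rule LI_idl, rule J_idl)
 show "\<l> r : B" for r unfolding \<l>_def B_def by (rule lform_MP) simp
 show "\<l> (r + s) - (\<l> r + \<l> s) : LI" if rs: "r : J" "s : J" for r s
 proof -
  obtain u where u: "\<l> r = lform (Suc g) u" "(\<Sum>i\<in>{1..Suc g}. u i * a i) = r" using \<l>_lform[OF rs(1)] by blast
  obtain v where v: "\<l> s = lform (Suc g) v" "(\<Sum>i\<in>{1..Suc g}. v i * a i) = s" using \<l>_lform[OF rs(2)] by blast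
  obtain w where w: "\<l> (r + s) = lform (Suc g) w" "(\<Sum>i\<in>{1..Suc g}. w i * a i) = r + s"
   using \<l>_lform[OF u.idl_add[OF J_idl rs]] by blast
  have "(\<Sum>i\<in>{1..Suc g}. (w i - (u i + v i)) * a i) = 0"
   unfolding left_diff_distrib distrib_right sum_subtractf sum.distrib u(2) v(2) w(2) by simp
  then show ?thesis unfolding u(1) v(1) w(1) lform_add lform_diff by (rule lform_LI)
 qed
 show "\<l> (r * c) - mconst c * \<l> r : LI" if r: "r : J" for r c
 proof -
  have "r * c : J" using u.idl_mult[OF J_idl _ r, of c] by (simp add: mult.commute)
  from \<l>_lform[OF this] obtain w where w: "\<l> (r * c) = lform (Suc g) w" "(\<Sum>i\<in>{1..Suc g}. w i * a i) = r * c" by blast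
  obtain u where u: "\<l> r = lform (Suc g) u" "(\<Sum>i\<in>{1..Suc g}. u i * a i) = r" using \<l>_lform[OF r] by blast
  have "(\<Sum>i\<in>{1..Suc g}. (w i - c * u i) * a i) = 0"
   unfolding left_diff_distrib sum_subtractf mult.assoc sum_distrib_left[symmetric] u(2) w(2) by (simp add: mult.commute)
  then show ?thesis unfolding u(1) w(1) lform_smult lform_diff by (rule lform_LI)
 qed
qed (auto simp: mconst_hom)

text \<open>Modulo \<open>LI\<close>, b is a polynomial in the last variable whose coefficients lift
  those of \<psi> b as a polynomial in t.\<close>

lemma lift_coeffs:
 assumes "b : B"
 shows "EX \<beta>. (ALL i. (coeff (\<psi> b) i, coeff \<beta> i) : L.G J) & b - poly \<beta> (mvar (Suc g)) : LI"
proof -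
 let ?T = "mvar (Suc g) :: 'a mpolynomial"
 have TB: "?T : B" using var_B by simp
 have z: "0 : LI" using idlD(2)[OF LI_idl] .
 show ?thesis using assms unfolding B_def
 proof (induction b rule: MP_induct)
  case (const r)
  show ?case using L.G_0 lift_const[of r mconst \<l> LI J] z
   by (intro exI[of _ "[:mconst r:]"]) (auto simp: coeff_pCons split: nat.splits)
 next
  case (var i)
  show ?case
  proof (cases "i <= g")
   case True
   have ai: "a i : J" using genid_mem[of i g a] var True by (simp add: J_def)
   obtain co where co: "\<l> (a i) = lform (Suc g) co" "(\<Sum>i\<in>{1..Suc g}. co i * a i) = a i" using \<l>_lform[OF ai] by blast
   have "(\<Sum>j\<in>{1..Suc g}. ((if j = i then 1 else 0) - co j) * a j) = 0"
    unfolding left_diff_distrib sum_subtractf co(2) using var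
    by (simp add: if_distrib[of "%x. x * _"] sum.delta cong: if_cong)
   then have "mvar i - \<l> (a i) : LI" unfolding co(1) mvar_lform[OF var] lform_diff by (rule lform_LI)
   then show ?thesis using L.G_0 lift_lin[OF ai, where \<l> = \<l> and \<iota> = mconst and L = LI] True
    by (intro exI[of _ "[:\<l> (a i):]"]) (auto simp: psi_var coeff_pCons split: nat.splits)
  next
   case False
   then have "i = Suc g" using var by simp
   then show ?thesis using L.G_0 lift_const[of 1 mconst \<l> LI J] z
    by (intro exI[of _ "[:0, 1:]"]) (auto simp: psi_var coeff_pCons mconst_hom one_pCons split: nat.splits)
  qed
 next
  case (add p q)
  then obtain \<beta> \<beta>' where *: "ALL i. (coeff (\<psi> p) i, coeff \<beta> i) : L.G J" "p - poly \<beta> ?T : LI"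
   "ALL i. (coeff (\<psi> q) i, coeff \<beta>' i) : L.G J" "q - poly \<beta>' ?T : LI" by blast
  have "(p + q) - poly (\<beta> + \<beta>') ?T : LI" using G.idl_add[OF LI_idl *(2,4)] by (simp add: algebra_simps)
  moreover have "ALL i. (coeff (\<psi> (p + q)) i, coeff (\<beta> + \<beta>') i) : L.G J"
   using * lift_add unfolding psi_add coeff_add by blast
  ultimately show ?case by blast
 next
  case (mult p q)
  then obtain \<beta> \<beta>' where *: "ALL i. (coeff (\<psi> p) i, coeff \<beta> i) : L.G J" "p - poly \<beta> ?T : LI"
   "ALL i. (coeff (\<psi> q) i, coeff \<beta>' i) : L.G J" "q - poly \<beta>' ?T : LI" by blast
  have "poly \<beta> ?T : B" using L.G_sub(2)[OF _ J_idl order_refl] *(1) by (intro L.poly_in_B TB) blast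
  moreover have "q : B" using mult by (simp add: B_def)
  ultimately have "q * (p - poly \<beta> ?T) + poly \<beta> ?T * (q - poly \<beta>' ?T) : LI" using G.idl_lin[OF LI_idl] * by blast
  then have "p * q - poly (\<beta> * \<beta>') ?T : LI" by (simp add: algebra_simps)
  moreover have "ALL i. (coeff (\<psi> (p * q)) i, coeff (\<beta> * \<beta>') i) : L.G J"
   unfolding psi_mult coeff_mult using * by (intro allI L.G_sum) (auto intro: lift_mult)
  ultimately show ?case by blast
 qed
qed

text \<open>If \<psi> b = (t - cu)\<kappa>, \<open>lift_shift_lin\<close> is applied with the last
  variable as y. The relations it asks for, \<l>(ck) - k T_(g+1) in \<open>LI\<close>, are syzygies,
  and J is of linear type because xs generates it.\<close>

lemma LI_eq: "LI = {b : B. \<psi> b : lin_ker cc K J}"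
proof
 show "{b : B. \<psi> b : lin_ker cc K J} <= LI"
 proof safe
  fix b assume b: "b : B" "\<psi> b : lin_ker cc K J"
  then obtain \<kappa> where \<kappa>: "\<kappa> : pol (RK K J)" "\<psi> b = shift_lin cc * \<kappa>" by (auto simp only: lin_ker_def)
  obtain \<beta> where \<beta>: "ALL i. (coeff (\<psi> b) i, coeff \<beta> i) : L.G J" "b - poly \<beta> (mvar (Suc g)) : LI" using lift_coeffs[OF b(1)] by blast
  have "poly \<beta> (mvar (Suc g)) : LI"
  proof (rule L.lift_shift_lin[OF J_idl _ order_refl _ _ L.lin_type_rideal[OF rideal_J order_refl] \<kappa>(1)])
   show "cc * k : J" if "k : K" for k using that by (simp add: K_def)
   show "mvar (Suc g) : B" using var_B by simp
   show "(coeff (shift_lin cc * \<kappa>) i, coeff \<beta> i) : L.G J" for i using \<beta>(1) \<kappa>(2) by simp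
   show "\<l> (cc * k) - mconst k * mvar (Suc g) : LI" if "k : K" for k
   proof -
    have "cc * k : J" using that by (simp add: K_def)
    then obtain co where co: "\<l> (cc * k) = lform (Suc g) co" "(\<Sum>i\<in>{1..Suc g}. co i * a i) = cc * k" using \<l>_lform by blast
    have "(\<Sum>j\<in>{1..Suc g}. (co j - k * (if j = Suc g then 1 else 0)) * a j) = 0"
     unfolding left_diff_distrib sum_subtractf co(2)
     by (simp add: if_distrib[of "%x. x * _"] if_distrib[of "%x. _ * x"] sum.delta cc_def mult.commute cong: if_cong)
    then show ?thesis unfolding co(1) mvar_lform[of "Suc g" "Suc g", simplified] lform_smult lform_diff by (rule lform_LI)
   qed
  qed
  from G.idl_add[OF LI_idl \<beta>(2) this] show "b : LI" by simp
 qed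
qed (rule LI_sub)

end

lemma hcp_homog: "(!!e. e : keys p ==> mdegree e = n) ==> hcp k p = (if k = n then p else 0)"
 by (intro poly_mapping_eqI) (auto simp: lookup_hcp in_keys_iff)

lemma lookup_lform_0: "lookup (lform n co) 0 = 0"
 unfolding lform_def lookup_sum lookup_mult_0 lookup_mvar_0 by simp

section \<open>Grading, depth and dimension of Sym I\<close>

context aci
begin

definition "\<rho> b = poly (\<psi> b) (monom cc 1)"

lemma rho_add: "\<rho> (p + q) = \<rho> p + \<rho> q" and rho_mult: "\<rho> (p * q) = \<rho> p * \<rho> q"
 and rho_const [simp]: "\<rho> (mconst r) = [:r:]" and rho_one [simp]: "\<rho> 1 = 1" and rho_zero [simp]: "\<rho> 0 = 0"
 by (simp_all add: \<rho>_def psi_add psi_mult)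

lemma rho_var: "i : {1..Suc g} ==> \<rho> (mvar i) = monom (a i) 1"
 by (cases "i = Suc g") (auto simp: \<rho>_def psi_var cc_def)

lemma rho_sum: "\<rho> (sum f A) = (\<Sum>i\<in>A. \<rho> (f i))"
 by (induction A rule: infinite_finite_induct) (simp_all add: rho_add)

lemma LL_eq: "LL = {b : B. \<rho> b = 0}"
 by (simp add: LL_def \<rho>_def)

lemma rho_hcp: "b : B ==> \<rho> (hcp k b) = monom (coeff (\<rho> b) k) k"
 unfolding B_def
proof (induction b arbitrary: k rule: MP_induct)
 case (const r)
 have "hcp k (mconst r) = (if k = 0 then mconst r else 0)" by (simp add: mconst_def hcp_single)
 then show ?case by (cases k) (simp_all add: monom_0 coeff_pCons)
next
 case (var i)
 have "hcp k (mvar i) = (if k = 1 then mvar i else 0 :: 'a mpolynomial)" by (auto simp: mvar_def hcp_single)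
 then show ?case using var by (auto simp: rho_var)
next
 case (add p q) then show ?case by (simp add: hcp_add rho_add add_monom)
next
 case (mult p q)
 have s: "monom (\<Sum>i\<in>A. f i) k = (\<Sum>i\<in>A. monom (f i) k)" for f :: "nat => 'a" and A
  by (induction A rule: infinite_finite_induct) (simp_all flip: add_monom)
 show ?case unfolding hcp_mult rho_sum rho_mult coeff_mult s
  by (intro sum.cong) (simp_all add: mult mult_monom)
qed

lemma LL_prime: "is_prime B LL"
 unfolding is_prime_def is_ideal_def LL_eq by (auto simp: rho_add rho_mult)

lemma LL_gr: "G.gr LL"
 unfolding G.gr_def using prmD(1)[OF LL_prime] by (auto simp: LL_eq rho_hcp)

lemma LI_gr: "G.gr LI"
proof -
 let ?Z = "{b : LI. ALL k. hcp k b : LI}"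
 have "is_ideal B ?Z" unfolding is_ideal_def
  using idlD(1,2)[OF LI_idl] G.idl_add[OF LI_idl] G.idl_mult[OF LI_idl]
  by (auto simp: hcp_add hcp_mult intro!: G.idl_sum[OF LI_idl])
 moreover have "lform (Suc g) co : ?Z" if "(\<Sum>i\<in>{1..Suc g}. co i * a i) = 0" for co
  using lform_LI[OF that] idlD(2)[OF LI_idl] hcp_homog[of "lform (Suc g) co" 1] keys_lform[of _ "Suc g" co] by auto
 ultimately have "LI <= ?Z" by (subst LI_def) (intro Inter_lower, blast)
 then show ?thesis using LI_idl by (auto simp: G.gr_def)
qed

lemma LI_sub_LL: "LI <= LL"
 by (auto simp: LI_eq LL_def lin_ker_def)

lemma MB_prime: "is_prime B MB"
 using idlD[OF m_idl] prmD[OF m]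
 unfolding is_prime_def is_ideal_def MB_def by (auto simp: lookup_add lookup_mult_0 lookup_one)

lemma MB_maxl: "is_maxl B MB"
 unfolding is_maxl_def
proof (intro conjI MB_prime ballI)
 fix c assume c: "c : B - MB"
 then obtain s where "s * lookup c 0 = 1" using unit by (auto simp: MB_def)
 then have "1 - c * mconst s : MB" using c idlD(2)[OF m_idl]
  by (auto simp: MB_def lookup_minus lookup_mult_0 lookup_one mult.commute)
 then show "EX d:B. 1 - c * d : MB" using const_B by blast
qed

lemma MB_unit: assumes "c : B - MB" shows "EX d:B. d * hcp 0 c = 1"
proof -
 obtain s where "s * lookup c 0 = 1" using unit assms by (auto simp: MB_def)
 then have "mconst s * hcp 0 c = 1" by (simp add: hcp_0 flip: mconst_hom)
 then show ?thesis using const_B by blast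
qed

lemma LL_sub_MB: "LL <= MB"
proof
 fix b assume b: "b : LL"
 then have "coeff (coeff (\<psi> b) 0) 0 = 0" using coeff_eval_0[of "\<psi> b" cc] by (simp add: LL_def)
 then show "b : MB" using b psi_00[of b] idlD(2)[OF m_idl] by (auto simp: MB_def LL_def)
qed

lemma cc_nz: "cc ~= 0"
 using c idlD(2)[OF J_idl] by (auto simp: cc_def J_def)

lemma psi_MB: "\<psi> ` MB = MM \<mm> J"
proof
 show "\<psi> ` MB <= MM \<mm> J" using psi_mem psi_00 by (auto simp: MB_def MM_def MR_def pol_iff)
 show "MM \<mm> J <= \<psi> ` MB"
 proof
  fix q assume q: "q : MM \<mm> J"
  then obtain b where "b : B" "\<psi> b = q" using psi_surj unfolding MM_def by blast
  then show "q : \<psi> ` MB" using q psi_00[of b] by (auto simp: MB_def MM_def MR_def)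
 qed
qed

lemma dpt_S: "dpt {1} MB (Suc d) B LI"
proof -
 have "dpt {1} (MM \<mm> J) (Suc d) (pol (RS J)) (lin_ker cc K J)"
  using dK cc_nz unfolding K_def
  by (intro dpt_sym) (auto simp: N m_idl dp rideal_J[unfolded J_def] m_len J_def cc_def)
 moreover have "\<psi> u : lin_ker cc K J \<longleftrightarrow> u : LI" if "u : B" for u using that LI_eq by blast
 ultimately show ?thesis
  by (intro dpt_hom[THEN iffD2, of B "pol (RS J)" \<psi> B LI "pol (RS J)" "lin_ker cc K J" MB "MM \<mm> J"])
   (simp_all add: G.comm_subring_axioms RS_J_sub psi_add psi_mult LI_idl LK_idl psi_image psi_MB MB_def[THEN equalityD1, THEN subset_trans]
    idlD(1)[OF LI_idl] idlD(1)[OF LK_idl] comm_subring.idl_C[OF RS_J_sub(2)] idlD(1)[OF prmD(1)[OF MB_prime]]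
    idlD(1)[OF MM_ideal[OF m_idl J_idl]])
qed

text \<open>xs followed by zs is a system of parameters: a smaller prime Q containing it would end a
  chain of length d, and the maximal ideal would end one of length d + 1.\<close>

lemma min_over_params:
 assumes zs: "set zs <= \<mm>" "length zs = d - length xs" "regseq {1} UNIV J zs"
  and Q: "u.prm Q" "Q <= \<mm>" "set xs <= Q" "set zs <= Q"
 shows "Q = \<mm>"
proof (rule ccontr)
 assume "Q ~= \<mm>"
 moreover have "pchain UNIV {0} (length (xs @ zs)) Q"
  using Q zs xs J_eq by (intro regseq_chain) (auto simp: regseq_append J_def)
 ultimately have "pchain UNIV {0} (Suc d) \<mm>" using zs(2) m_len m Q(2) by auto
 then show False using dim by fastforce
qed

lemma J_least: assumes "u.idl I" "set xs <= I" shows "J <= I"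
proof -
 have "quo {1} UNIV {0} xs <= I"
  by (rule u.quo_least[OF u.clsd_one u.mult_one _ u.clsd_one])
   (use assms idlD[OF assms(1)] in auto)
 then show ?thesis by (simp add: J_eq J_def)
qed

lemma xs_J: "set xs <= J"
 using u.quo_upper_smult[OF u.clsd_one[OF u.idl_C u.idl_zero] u.mult_one, of xs _ 1] J_eq
 by (auto simp: J_def)

lemma MB_sub:
 assumes P: "is_prime B P" and "!!r. r : \<mm> ==> mconst r : P" "!!i. i : {1..Suc g} ==> mvar i : P"
 shows "MB <= P"
proof
 fix b assume b: "b : MB"
 note idl = prmD(1)[OF P]
 have "f : P" if f: "f : B" "f = hcp 1 f" for f
 proof -
  have "mdegree e = 1" if "e : keys f" for e
   using that f(2) lookup_hcp[of 1 f e] by (auto simp: in_keys_iff split: if_splits)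
  then obtain co where "f = lform (Suc g) co" using degree_one_lform f(1) unfolding B_def by blast
  then show ?thesis using assms(3) G.idl_mult[OF idl const_B] unfolding lform_def by (auto intro!: G.idl_sum[OF idl] simp del: sum.cl_ivl_Suc)
 qed
 then have "hcp (Suc k) b : P" for k using G.hc_gen[OF P] b by (auto simp: MB_def)
 moreover have "hcp 0 b : P" using b assms(2) by (simp add: hcp_0 MB_def)
 ultimately have "hcp k b : P" for k by (cases k) auto
 then show "b : P" using G.mem_of_hc[OF idl] by blast
qed

text \<open>Krull's theorem for d + 1 elements over which the maximal homogeneous ideal is minimal.
  They are built from linear forms over xs and c, interlaced with xs itself, and from a system of
  parameters zs modulo J.\<close>

lemma dim_S: assumes "pchain B LI n MB" shows "n <= Suc d"
proof -
 let ?l = "length xs" and ?s = "%co. \<Sum>i\<in>{1..Suc g}. co i * a i"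
 have "dpt {1} \<mm> (d - ?l) UNIV J"
  by (rule rideal_quot_dpt[OF N m_idl dp rideal_J m_len])
 then obtain zs where zs: "set zs <= \<mm>" "length zs = d - ?l" "regseq {1} UNIV J zs" unfolding dpt_def by blast
 \<comment> \<open>The elements x_0, ..., x_(l-1), c, which generate I; below, v i is a linear form
   with value u i.\<close>
 define u where "u i = (if i < ?l then xs ! i else cc)" for i
 have "EX co. ?s co = u i" for i
 proof (cases "i < ?l")
  case True
  then have "u i : J" using xs_J by (auto simp: u_def)
  then show ?thesis using \<l>_lform by blast
 next
  case False
  then show ?thesis
   by (intro exI[of _ "%i. if i = Suc g then 1 else 0"]) (simp add: u_def cc_def if_distrib[of "%x. x * _"] sum.delta cong: if_cong)
 qed
 then obtain co where co: "?s (co i) = u i" for i by metis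
 define v where "v i = lform (Suc g) (co i)" for i
 \<comment> \<open>The elements v_0, the l differences v_(i+1) - u_i, and the d - l elements of zs:
   together 1 + l + (d - l) = d + 1.\<close>
 define es where "es = v 0 # map (%i. v (Suc i) - mconst (u i)) [0..<?l] @ map mconst zs"
 have vMB: "v i : MB" for i
  using lform_MP[of "Suc g" "Suc g" "co i"] idlD(2)[OF m_idl]
  by (simp add: MB_def B_def v_def lookup_lform_0)
 have mMB: "mconst r : MB" if "r : \<mm>" for r using that by (simp add: MB_def)
 note MBi = prmD(1)[OF MB_prime]
 have esMB: "set es <= MB"
  using vMB mMB zs(1) subsetD[OF xs(1) nth_mem] G.idl_diff[OF MBi] by (auto simp: es_def u_def)
 have rel: "mconst (u i) * v j - mconst (u j) * v i : LI" for i j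
  unfolding v_def lform_smult lform_diff
  by (rule lform_LI) (simp only: left_diff_distrib sum_subtractf mult.assoc co flip: sum_distrib_left, simp add: mult.commute)
 have "min_over B (LI \<union> set es) MB"
  unfolding min_over_def
 proof (intro conjI allI impI MB_prime)
  show "LI \<union> set es <= MB" using esMB LI_sub_LL LL_sub_MB by blast
  fix P assume P: "is_prime B P" "LI \<union> set es <= P" "P <= MB"
  note Pi = prmD(1)[OF P(1)]
  have uB: "mconst (u i) : B" and vB: "v i : B" for i using vMB by (auto simp: MB_def)
  have e: "v (Suc i) - mconst (u i) : P" if "i < ?l" for i using P(2) that by (auto simp: es_def)
  \<comment> \<open>The relation u_i v_(i+1) - u_(i+1) v_i and v_i in P put u_i or v_(i+1) into P;
    their difference is in P, so both are.\<close>
  have step: "mconst (u i) : P & v (Suc i) : P" if i: "i < ?l" "v i : P" for i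
  proof -
   have "mconst (u (Suc i)) * v i : P" using G.idl_mult[OF Pi uB i(2)] .
   then have "mconst (u i) * v (Suc i) : P" using G.idl_add_cancel[OF Pi, of "mconst (u i) * v (Suc i) - mconst (u (Suc i)) * v i" "mconst (u (Suc i)) * v i"]
    using rel[of i "Suc i"] P(2) G.idl_add[OF Pi] by (metis Un_subset_iff diff_add_cancel subsetD)
   then have "mconst (u i) : P \<or> v (Suc i) : P" using prmD(3)[OF P(1) uB vB] by blast
   then show ?thesis using e[OF i(1)] G.idl_diff[OF Pi, of "v (Suc i)" "v (Suc i) - mconst (u i)"] G.idl_add[OF Pi, of "v (Suc i) - mconst (u i)" "mconst (u i)"]
    by auto
  qed
  have vP: "i <= ?l ==> v i : P" for i
  proof (induction i)
   case 0 then show ?case using P(2) by (auto simp: es_def)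
  qed (use step in auto)
  define Q where "Q = {r. mconst r : P}"
  have Q: "u.prm Q" using prmD[OF P(1)] idlD[OF Pi]
   unfolding Q_def is_prime_def is_ideal_def by (auto simp: mconst_hom)
  have "Q <= \<mm>" using P(3) by (auto simp: Q_def MB_def)
  moreover have "set xs <= Q"
  proof
   fix x assume "x : set xs"
   then obtain i where "i < ?l" "x = u i" by (auto simp: in_set_conv_nth u_def)
   then show "x : Q" using step vP by (simp add: Q_def)
  qed
  moreover have "set zs <= Q" using P(2) by (auto simp: es_def Q_def)
  ultimately have Qm: "Q = \<mm>" using min_over_params[OF zs Q] by blast
  \<comment> \<open>The values of linear forms in P. It is an ideal containing xs, hence J. Two
    forms with the same value differ by a syzygy, so every variable is in P.\<close>
  define Z where "Z = {r. EX co. ?s co = r & lform (Suc g) co : P}"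
  have "u.idl Z" unfolding is_ideal_def
  proof (intro conjI ballI)
   show "0 : Z" using idlD(2)[OF Pi] unfolding Z_def by (intro CollectI exI[of _ "%_. 0"]) (simp add: lform_def mconst_hom)
   fix x y assume "x : Z" "y : Z"
   then obtain p q where pq: "?s p = x" "lform (Suc g) p : P" "?s q = y" "lform (Suc g) q : P" unfolding Z_def by blast
   have "lform (Suc g) (%i. p i + q i) : P" using G.idl_add[OF Pi pq(2,4)] by (simp only: lform_add)
   moreover have "?s (%i. p i + q i) = x + y" by (simp only: distrib_right sum.distrib pq)
   ultimately show "x + y : Z" unfolding Z_def by (intro CollectI exI[of _ "%i. p i + q i"] conjI)
  next
   fix r x assume "x : Z"
   then obtain p where pq: "?s p = x" "lform (Suc g) p : P" unfolding Z_def by blast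
   have "lform (Suc g) (%i. r * p i) : P" using G.idl_mult[OF Pi const_B[of r] pq(2)] by (simp only: lform_smult)
   moreover have "?s (%i. r * p i) = r * x" by (simp only: mult.assoc pq flip: sum_distrib_left)
   ultimately show "r * x : Z" unfolding Z_def by (intro CollectI exI[of _ "%i. r * p i"] conjI)
  qed simp
  moreover have "set xs <= Z"
  proof
   fix x assume "x : set xs"
   then obtain i where "i < ?l" "x = u i" by (auto simp: in_set_conv_nth u_def)
   then show "x : Z" using vP[of i] co unfolding Z_def v_def by auto
  qed
  ultimately have JZ: "J <= Z" by (rule J_least)
  have lin: "lform (Suc g) p : P" if "lform (Suc g) q : P" "?s p = ?s q" for p q
  proof -
   have "lform (Suc g) p - lform (Suc g) q : LI" unfolding lform_diff
    by (rule lform_LI) (simp only: left_diff_distrib sum_subtractf that, simp)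
   then show ?thesis using G.idl_add[OF Pi _ that(1)] P(2) by fastforce
  qed
  have "mvar i : P" if i: "i : {1..Suc g}" for i
  proof -
   let ?d = "%j. if j = i then 1 else 0 :: 'a"
   have s: "?s ?d = a i" using i by (simp add: if_distrib[of "%x. x * _"] sum.delta cong: if_cong)
   have "EX q. lform (Suc g) q : P & ?s q = a i"
   proof (cases "i = Suc g")
    case True
    then show ?thesis using vP[of ?l] co[of ?l] by (intro exI[of _ "co ?l"]) (simp add: v_def u_def cc_def)
   next
    case False
    then have "a i : J" using genid_mem[of i g a] i by (auto simp: J_def)
    then show ?thesis using JZ unfolding Z_def by blast
   qed
   then show ?thesis using lin s mvar_lform[OF i] by metis
  qed
  moreover have "mconst r : P" if "r : \<mm>" for r using that Qm by (auto simp: Q_def)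
  ultimately show "P = MB" using MB_sub[OF P(1)] P(3) by blast
 qed
 from G.krull_height[OF this _ assms] esMB have "n <= length es" by (auto simp: MB_def)
 also have "\<dots> = Suc d" using m_len zs(2) by (simp add: es_def)
 finally show ?thesis .
qed

end

lemma lookup_mult_sum:
 fixes p q :: "'a::comm_ring_1 mpolynomial"
 shows "lookup (p * q) h = (\<Sum>(e, f)\<in>keys p \<times> keys q.
   if e + f = h then lookup p e * lookup q f else 0)"
proof -
 let ?c = "lookup"
 have "p * q = (\<Sum>e\<in>keys p. single e (?c p e)) * (\<Sum>f\<in>keys q. single f (?c q f))"
  using single_decomp[of p] single_decomp[of q] by simp
 also have "\<dots> = (\<Sum>(e, f)\<in>keys p \<times> keys q. single (e + f) (?c p e * ?c q f))"
  by (simp add: sum_product sum.cartesian_product mult_single)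
 finally show ?thesis
  by (simp add: lookup_sum case_prod_unfold lookup_single when_def)
qed

lemma keys_add_nat: "keys (e + f :: nat \<Rightarrow>\<^sub>0 nat) = keys e \<union> keys f"
 by (auto simp: in_keys_iff lookup_add)

lemma sum_in:
 assumes "0 : Z" "!!x y. x : Z ==> y : Z ==> x + y : Z" "!!i. i : A ==> f i : Z"
 shows "sum f A : (Z :: 'b::comm_monoid_add set)"
 using assms by (induction A rule: infinite_finite_induct) auto

section \<open>The module T and the primes generated by the maximal ideal and some variables\<close>

context aci
begin

lemma gr_B: "G.gr B"
 by (simp add: G.gr_def)

lemma LI_sub_colon: assumes "U <= B" shows "LI <= colon B LI U"
proof
 fix x assume x: "x : LI"
 then have "x * u : LI" if "u : U" for u
  using G.idl_mult[OF LI_idl, of u x] that assms by (auto simp: mult.commute)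
 then show "x : colon B LI U" using x idlD(1)[OF LI_idl] by (auto simp: colon_def)
qed

lemma colon_LI_B: "colon B LI B = LI"
proof
 show "colon B LI B <= LI" using G.one_mem unfolding colon_def by (metis (mono_tags, lifting) mem_Collect_eq mult.right_neutral subsetI)
qed (rule LI_sub_colon[OF order_refl])

lemma MB_mult: "is_mult B (B - MB)"
 by (rule G.mult_compl[OF MB_prime])

lemma one_MB: "{1} <= B - MB"
 using MB_mult by (auto simp: is_mult_def)

lemma clsd_MB: "G.gr U ==> G.gr V ==> V <= U ==> G.clsd (B - MB) U V"
 by (rule G.gr_clsd[OF MB_unit])

lemma sat_MB: "G.gr U ==> G.gr V ==> V <= U ==> sat (B - MB) U V = V"
 using G.sat_least[OF clsd_MB order_refl] G.sat_upper[OF MB_mult] by blast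

lemma dpt_local:
 assumes "G.gr U" "G.gr V" "V <= U" shows "dpt {1} MB n U V \<longleftrightarrow> dpt (B - MB) MB n U V"
proof
 assume "dpt {1} MB n U V"
 then show "dpt (B - MB) MB n U V"
  unfolding dpt_def using G.regseq_localize[OF G.mult_one MB_mult one_MB G.clsd_one[OF _ _ assms(3)]] sat_MB[OF assms]
   G.grD(1)[OF assms(1)] G.grD(1)[OF assms(2)] idlD(1)[OF prmD(1)[OF MB_prime]] by (metis subset_trans)
next
 assume "dpt (B - MB) MB n U V"
 then show "dpt {1} MB n U V"
  using G.dpt_global[OF MB_maxl G.grD(1)[OF assms(1)] G.grD(1)[OF assms(2)] assms(3)] sat_MB[OF assms] by simp
qed

lemma S_cm:
 assumes "is_prime B P" "LI <= P"
 shows "EX ys. set ys <= P & regseq (B - P) B (sat (B - P) B LI) ys & min_over B (LI \<union> set ys) P"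
 using G.graded_cm[OF MB_prime MB_unit gr_B LI_gr idlD(1)[OF LI_idl] _ _ assms(1), of "Suc d"]
  dpt_S dpt_local[OF gr_B LI_gr idlD(1)[OF LI_idl]] dim_S assms(2) by (simp add: colon_LI_B)

text \<open>T is a nonzero submodule of S, so its dimension is at least the depth d + 1 of
  S.\<close>

lemma T_chain: "LI ~= LL ==> pchain B (colon B LI LL) (Suc d) MB"
proof -
 assume ne: "LI ~= LL"
 obtain ys where "length ys = Suc d" "set ys <= MB" "regseq (B - MB) B LI ys"
  using dpt_S dpt_local[OF gr_B LI_gr idlD(1)[OF LI_idl]] by (auto simp: dpt_def)
 then show ?thesis
  using G.chain_of_regseq[OF MB_prime clsd_MB[OF gr_B LI_gr idlD(1)[OF LI_idl]] G.grD(1)[OF LL_gr] LI_sub_LL] ne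
   idlD(1)[OF G.grD(1)[OF LL_gr]] by metis
qed

lemma LL_sub_B: "LL <= B"
 by (auto simp: LL_eq)

lemma T_dim: "pchain B (colon B LI LL) n MB ==> n <= Suc d"
 by (rule dim_S, rule pchain_anti[OF _ LI_sub_colon[OF LL_sub_B]])

lemma MB_idl: "is_ideal B MB"
 using prmD(1)[OF MB_prime] .

lemma T_dpt: "dpt {1} MB (Suc d) LL LI \<longleftrightarrow> dpt {1} MB d B LL"
proof -
 note cl = G.clsd_one[OF G.idl_C LI_idl idlD(1)[OF LI_idl]]
  G.clsd_one[OF G.idl_C G.grD(1)[OF LL_gr] LL_sub_B]
 show ?thesis
  using G.depth_lemma_sub[OF G.mult_one MB_idl cl LI_sub_LL dpt_S]
   G.depth_lemma_quot[OF G.mult_one MB_idl cl LI_sub_LL dpt_mono[OF dpt_S, of d]] by auto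
qed

lemma T_cm:
 assumes "dpt {1} MB d B LL" "is_prime B P" "colon B LI LL <= P"
 shows "EX ys. set ys <= P & regseq (B - P) LL (sat (B - P) LL LI) ys & min_over B (colon B LI LL \<union> set ys) P"
 using G.graded_cm[OF MB_prime MB_unit LL_gr LI_gr LI_sub_LL _ T_dim assms(2,3)]
  T_dpt assms(1) dpt_local[OF LL_gr LI_gr LI_sub_LL] by simp

lemma rees_subring: "comm_subring (\<rho> ` B)"
proof
 show "1 : \<rho> ` B" by (rule image_eqI[of _ _ 1]) simp_all
 fix x y assume "x : \<rho> ` B" "y : \<rho> ` B"
 then obtain b c where *: "b : B" "c : B" "x = \<rho> b" "y = \<rho> c" by blast
 then show "x + y : \<rho> ` B" "x * y : \<rho> ` B"
  using imageI[of "b + c" B \<rho>] imageI[of "b * c" B \<rho>] by (simp_all add: rho_add rho_mult)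
next
 fix x assume "x : \<rho> ` B"
 then obtain b where *: "b : B" "x = \<rho> b" by blast
 moreover have "\<rho> (- b) = - \<rho> b" using rho_add[of "- b" b] by (simp add: eq_neg_iff_add_eq_0)
 ultimately show "- x : \<rho> ` B" by (metis G.uminus_mem image_eqI)
qed

text \<open>The ideal generated by the maximal ideal of R and the variables with index in S,
  described by coefficients.\<close>

definition "PS S = {b : B. ALL e. keys e \<inter> S = {} --> lookup b e : \<mm>}"

text \<open>The coefficient of a product at the sum of the largest exponents whose coefficients avoid
 \<open>\<mm>\<close> avoids \<open>\<mm>\<close>.\<close>

lemma PS_prime: "is_prime B (PS S)"
proof -
 let ?c = "lookup" and ?K = keys
 have "?c (c * b) h : \<mm>" if "b : PS S" "?K h \<inter> S = {}" for b c h
  unfolding lookup_mult_sum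
  using that idlD[OF m_idl] by (intro idl_sum_univ[OF m_idl]) (auto simp: PS_def keys_add_nat Int_Un_distrib2)
 then have "c * b : PS S" if "c : B" "b : PS S" for b c
  using that unfolding PS_def by blast
 then have "is_ideal B (PS S)"
  using idlD[OF m_idl] by (auto simp: is_ideal_def PS_def lookup_add)
 moreover have "1 ~: PS S" using prmD(2)[OF m] by (auto simp: PS_def lookup_one when_def intro!: exI[of _ 0])
 moreover have "p * q ~: PS S" if p: "p : B" "p ~: PS S" and q: "q : B" "q ~: PS S" for p q
 proof
  assume pq: "p * q : PS S"
  define bad where "bad p = {e : ?K p. ?K e \<inter> S = {} & ?c p e ~: \<mm>}" for p :: "'a mpolynomial"
  have fin: "finite (bad p)" for p by (simp add: bad_def)
  have ne: "bad p ~= {}" if "p : B" "p ~: PS S" for p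
   using that idlD(2)[OF m_idl] by (auto simp: PS_def bad_def in_keys_iff)
  \<comment> \<open>The maximum is for the linear order on exponent vectors, which is compatible
    with addition; so e0 + f0 has no other decomposition into bad exponents.\<close>
  define e0 where "e0 = Max (bad p)"
  define f0 where "f0 = Max (bad q)"
  have e0: "e0 : bad p" "f0 : bad q" unfolding e0_def f0_def using Max_in[OF fin ne[OF p]] Max_in[OF fin ne[OF q]] .
  have le: "e : bad p ==> e <= e0" "f : bad q ==> f <= f0" for e f by (simp_all add: e0_def f0_def fin)
  let ?t = "%(e, f). if e + f = e0 + f0 then ?c p e * ?c q f else 0"
  have S: "?K (e0 + f0) \<inter> S = {}" using e0 by (auto simp: keys_add_nat bad_def)
  have "?c (p * q) (e0 + f0) = ?t (e0, f0) + sum ?t (?K p \<times> ?K q - {(e0, f0)})"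
   unfolding lookup_mult_sum using e0 by (intro sum.remove) (auto simp: bad_def)
  moreover have "sum ?t (?K p \<times> ?K q - {(e0, f0)}) : \<mm>"
  proof (rule idl_sum_univ[OF m_idl])
   fix z assume z: "z : ?K p \<times> ?K q - {(e0, f0)}"
   obtain e f where zef: "z = (e, f)" by (cases z)
   have "?c p e * ?c q f : \<mm>" if "e + f = e0 + f0"
   proof -
   have ef: "e : ?K p" "f : ?K q" "e = e0 --> f ~= f0" "e + f = e0 + f0" using z zef that by auto
   have "?K e \<inter> S = {}" "?K f \<inter> S = {}" using S unfolding ef(4)[symmetric] keys_add_nat by auto
   moreover have "~ (e : bad p & f : bad q)"
   proof
    assume "e : bad p & f : bad q"
    then have "e <= e0" "f <= f0" using le by auto
    then show False using ef(3,4) add_less_le_mono[of e e0 f f0] by (cases "e = e0") (auto simp: le_less)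
   qed
   ultimately have "?c p e : \<mm> \<or> ?c q f : \<mm>" using ef by (auto simp: bad_def)
   then show ?thesis using idlD(4,5)[OF m_idl] by blast
   qed
   then show "?t z : \<mm>" using idlD(2)[OF m_idl] zef by auto
  qed
  moreover have "?c (p * q) (e0 + f0) : \<mm>" using pq S by (auto simp: PS_def)
  ultimately have "?t (e0, f0) : \<mm>"
   using u.idl_add_cancel[OF m_idl, of "?t (e0, f0)" "sum ?t (?K p \<times> ?K q - {(e0, f0)})"] by (simp only:)
  then have "?c p e0 * ?c q f0 : \<mm>" by simp
  then show False using e0 prmD(3)[OF m, of "?c p e0" "?c q f0"] by (auto simp: bad_def)
 qed
 ultimately show ?thesis unfolding is_prime_def by blast
qed

definition "mB = PS {}"

lemma mB_iff: "b : mB \<longleftrightarrow> b : B & (ALL e. lookup b e : \<mm>)"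
 by (simp add: mB_def PS_def)

lemma mB_prime: "is_prime B mB" unfolding mB_def by (rule PS_prime)

lemma mB_const: "r : \<mm> ==> mconst r : mB"
 using idlD(2)[OF m_idl] const_B[of r] by (simp add: mB_iff mconst_def lookup_single when_def)

lemma mB_add:
 assumes "0 : Z" "!!x y. x : Z ==> y : Z ==> x + y : Z" "!!r c. r : \<mm> ==> c : B ==> mconst r * c : Z"
 shows "mB <= Z"
proof
 fix b assume b: "b : mB"
 have "single e (lookup b e) : Z" if e: "e : keys b" for e
 proof -
  have "single e (1 :: 'a) : B" using b e by (auto simp: mB_iff B_def MP_def)
  then have "mconst (lookup b e) * single e 1 : Z" using assms(3) b by (simp add: mB_iff)
  then show ?thesis by (simp add: mconst_def mult_single)
 qed
 then have "(\<Sum>e\<in>keys b. single e (lookup b e)) : Z"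
  by (intro sum_in) (simp_all add: assms)
 then show "b : Z" by (metis single_decomp)
qed

lemma mB_least: "is_ideal B Z ==> (!!r. r : \<mm> ==> mconst r : Z) ==> mB <= Z"
 by (rule mB_add) (auto simp: is_ideal_def mult.commute)

lemma mB_act:
 assumes "is_ideal B Z" "!!r. r : \<mm> ==> mconst r * b : Z" "c : mB"
 shows "c * b : Z"
proof -
 have "is_ideal B {c : B. c * b : Z}" using idlD[OF assms(1)] unfolding is_ideal_def by (auto simp: distrib_right mult.assoc)
 then have "mB <= {c : B. c * b : Z}" by (rule mB_least) (simp add: assms(2))
 then show ?thesis using assms(3) by blast
qed

lemma mB_sub_MB: "mB <= MB"
 by (auto simp: mB_iff MB_def)

text \<open>Together with Krull's theorem this bounds chains between \<open>mB\<close> and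
  \<open>MB\<close> by the number g + 1 of variables.\<close>

lemma min_over_mB: "min_over B (mB \<union> mvar ` {1..Suc g}) MB"
 unfolding min_over_def
proof (intro conjI MB_prime)
 show "mB \<union> mvar ` {1..Suc g} <= MB" using mB_sub_MB idlD(2)[OF m_idl] by (auto simp: MB_def B_def intro!: mvar_MP)
 show "ALL Q. is_prime B Q --> mB \<union> mvar ` {1..Suc g} <= Q --> Q <= MB --> Q = MB"
  using MB_sub mB_const by blast
qed

text \<open>Above \<open>mB\<close> the variables are adjoined one by one, which gives g + 1 steps;
  the step from P to \<open>mB\<close> is one more.\<close>

lemma PS_chain: "is_prime B P ==> P \<subset> mB ==> pchain B P (Suc (Suc g)) MB"
proof -
 assume P: "is_prime B P" "P \<subset> mB"
 have "pchain B P (Suc k) (PS {1..k})" if "k <= Suc g" for k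
  using that
 proof (induction k)
  case 0
  then show ?case using P PS_prime[of "{}"] by (auto simp: mB_def)
 next
  case (Suc k)
  have sub: "PS {1..k} <= PS {1..Suc k}" unfolding PS_def by (auto; fastforce)
  have k: "Suc k : {1..Suc g}" using Suc.prems by auto
  have "lookup (mvar (Suc k) :: 'a mpolynomial) (single (Suc k) 1) = 1" by (simp add: mvar_def)
  then have "mvar (Suc k) ~: PS {1..k}" using prmD(2)[OF m] unfolding PS_def
   by (auto intro!: exI[of _ "single (Suc k) 1"])
  moreover have "mvar (Suc k) : PS {1..Suc k}" using var_B[OF k] idlD(2)[OF m_idl]
   by (auto simp: PS_def mvar_def lookup_single when_def)
  ultimately have "PS {1..k} \<subset> PS {1..Suc k}" using sub by blast
  then show ?case using Suc PS_prime[of "{1..Suc k}"] by (simp only: pchain.simps(2)[of B P "Suc k"]) (meson Suc_leD)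
 qed
 from this[of "Suc g"] have "pchain B P (Suc (Suc g)) (PS {1..Suc g})" by blast
 moreover have "PS {1..Suc g} <= MB" by (auto simp: PS_def MB_def)
 ultimately show ?thesis using pchain_top[OF _ _ MB_prime] by blast
qed

text \<open>The preimage in B of the intersection of T with the extension of the maximal ideal to
  S.\<close>

definition "NB = LL \<inter> isum mB LI"

lemma ipow_power: "x : I ==> x ^ n : ipow I n"
 by (induction n) (auto simp: power_Suc2 simp del: power_Suc intro: iprodI)

text \<open>\<psi> b = (t - cu)\<eta> with \<eta> in R[u,t], since cu is a root. A high power of x
  moves \<eta> into KR[Ju,t], so x^n b maps into \<open>lin_ker\<close>.\<close>

lemma LL_torsion:
 assumes b: "b : LL" and x: "x : J" shows "EX n. mconst (x ^ n) * b : LI"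
proof -
 obtain \<eta> where \<eta>: "\<psi> b = shift_lin cc * \<eta>" using b by (auto simp: LL_def poly_eq_0_iff_dvd dvd_def)
 \<comment> \<open>Larger than every u-degree i occurring in \<eta>, so that x^n lies in J^(i+1),
   which is contained in KJ^i.\<close>
 define n where "n = Suc (Max ((%j. degree (coeff \<eta> j)) ` {..degree \<eta>}))"
 have n: "degree (coeff \<eta> j) < n" for j
 proof (cases "j <= degree \<eta>")
  case True
  then have "degree (coeff \<eta> j) <= Max ((%j. degree (coeff \<eta> j)) ` {..degree \<eta>})" by (intro Max_ge) auto
  then show ?thesis by (simp add: n_def)
 qed (simp add: coeff_eq_0 n_def)
 have "x ^ n * coeff (coeff \<eta> j) i : iprod K (ipow J i)" for i j
 proof (cases "i < n")
  case True
  have "x ^ n : ipow J (Suc i)" using ipow_power[OF x, of "Suc i"] True u.idl_mult[OF ipow_ideal[OF J_idl, of "Suc i"] UNIV_I, of "x ^ Suc i" "x ^ (n - Suc i)"]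
   by (simp del: power_Suc ipow.simps flip: power_add)
  moreover have "ipow J (Suc i) <= iprod K (ipow J i)" using iprod_mono[OF J_sub_K order_refl, of "ipow J i"] by (simp add: iprod_comm[of J])
  ultimately show ?thesis using idlD(5)[OF iprod_ideal[OF K_idl ipow_ideal[OF J_idl]]] by blast
 next
  case False
  then have "coeff (coeff \<eta> j) i = 0" using n[of j] by (intro coeff_eq_0) simp
  then show ?thesis using idlD(2)[OF iprod_ideal[OF K_idl ipow_ideal[OF J_idl]]] by simp
 qed
 then have "[:[:x ^ n:]:] * \<eta> : pol (RK K J)" by (simp add: pol_iff RK_def)
 moreover have "\<psi> (mconst (x ^ n) * b) = shift_lin cc * ([:[:x ^ n:]:] * \<eta>)" by (simp only: psi_mult psi_const \<eta> mult.left_commute)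
 ultimately have "\<psi> (mconst (x ^ n) * b) : lin_ker cc K J" unfolding lin_ker_def by blast
 moreover have "mconst (x ^ n) * b : B" using LL_sub_B b G.mult_mem[OF const_B] by blast
 ultimately have "mconst (x ^ n) * b : LI" by (simp add: LI_eq)
 then show ?thesis by (rule exI)
qed

end

section \<open>The m-primary case with nonzero dimension\<close>

locale aci_primary = aci a g d \<mm> xs for a :: "nat => 'a::idom" and g d \<mm> xs +
 assumes len: "length xs = d" "g = d" and d_pos: "0 < d"
begin

text \<open>Here xs is itself a system of parameters, so the maximal ideal is the only prime above
  J.\<close>

lemma m_nil: assumes r: "r : \<mm>" shows "EX n. r ^ n : J"
proof (rule ccontr)
 assume neg: "~ ?thesis"
 have "is_mult UNIV (range ((^) r))"
  unfolding is_mult_def using rangeI[of "(^) r" 0] by (auto simp flip: power_add)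
 moreover have "J \<inter> range ((^) r) = {}" using neg by auto
 ultimately have "EX Q. u.prm Q & J <= Q & Q \<inter> range ((^) r) = {}" by (rule U.prime_exists[OF J_idl])
 then obtain Q where Q: "u.prm Q" "J <= Q" "Q \<inter> range ((^) r) = {}" by (elim exE conjE)
 have "Q <= \<mm>"
 proof
  fix x assume "x : Q"
  then show "x : \<mm>" using unit[of x] idlD(4)[OF prmD(1)[OF Q(1)], of _ x] prmD(2)[OF Q(1)] by (metis UNIV_I)
 qed
 then have "Q = \<mm>" using min_over_params[of "[]" Q] Q xs_J len by auto
 then show False using r Q(3) power_one_right by (metis disjoint_iff rangeI)
qed

lemma mconst_power: "mconst (r ^ n) = (mconst r ^ n :: 'a mpolynomial)"
 by (induction n) (simp_all add: mconst_hom)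

text \<open>Powers of elements of J kill b, and powers of elements of the maximal ideal lie in
  J.\<close>

lemma prime_torsion:
 assumes Q: "is_prime B Q" and "b : LL" and nQ: "!!c. c : B ==> c * b : LI ==> c : Q" shows "mB <= Q"
proof (rule mB_least[OF prmD(1)[OF Q]])
 fix r assume "r : \<mm>"
 then obtain k where "r ^ k : J" using m_nil by blast
 from LL_torsion[OF assms(2) this] obtain n where "mconst (r ^ (k * n)) * b : LI" by (auto simp: power_mult)
 then have "mconst r ^ (k * n) : Q" using nQ const_B mconst_power by metis
 then show "mconst r : Q" using G.prm_power[OF Q] by simp
qed

text \<open>Otherwise f lies in an associated prime Q of T, which contains \<open>mB\<close> by
  torsion, strictly because of f. Unmixedness of S gives a chain of length d + 1 from Q to
  \<open>MB\<close>; preceded by \<open>mB\<close> it has length d + 2, against the bound g + 1 = d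
  + 1.\<close>

lemma nzd_T:
 assumes f: "f : B" "f ~: mB" and b: "b : LL" "f * b : LI"
 shows "b : LI"
proof (rule ccontr)
 assume "b ~: LI"
 note LLi = G.grD(1)[OF LL_gr]
 from G.max_anns_above[OF LLi LI_idl, of b] \<open>b ~: LI\<close> b(1) obtain Q where Q: "Q : max_anns B LL LI" "annid B LI b <= Q" by blast
 then obtain v where v: "v : LL" "v ~: LI" "Q = annid B LI v" by (auto simp: max_anns_def)
 have Qp: "is_prime B Q" using G.max_anns_prime[OF LLi LI_idl Q(1)] .
 have Qg: "G.gr Q" using G.gr_annid[OF LL_gr LI_gr v(1)] Qp v(3) by simp
 have QM: "Q <= MB"
 proof
  fix q assume q: "q : Q"
  show "q : MB"
  proof (rule ccontr)
   assume "q ~: MB"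
   then obtain e where "e : B" "e * hcp 0 q = 1" using MB_unit[of q] q idlD(1)[OF prmD(1)[OF Qp]] by blast
   then show False using G.idl_mult[OF prmD(1)[OF Qp]] G.grD(2)[OF Qg q, of 0] prmD(2)[OF Qp] by metis
  qed
 qed
 have "mB <= Q" by (rule prime_torsion[OF Qp v(1)]) (simp add: v(3) annid_def)
 moreover have "f : Q" using Q(2) f b by (auto simp: annid_def)
 ultimately have "pchain B mB (Suc 0) Q" using f(2) Qp mB_prime by auto
 moreover obtain ys where ys: "length ys = Suc d" "set ys <= MB" "regseq (B - MB) B LI ys"
  using dpt_S dpt_local[OF gr_B LI_gr idlD(1)[OF LI_idl]] by (auto simp: dpt_def)
 have "pchain B Q (Suc d) MB"
  using G.chain_of_annid[OF MB_prime clsd_MB[OF gr_B LI_gr idlD(1)[OF LI_idl]] _ ys(2,3), of v] v LL_sub_B ys(1) by auto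
 ultimately have "pchain B mB (Suc 0 + Suc d) MB" by (rule pchain_append)
 moreover have "set (map mvar [1..<Suc (Suc g)]) = mvar ` {1..Suc g}"
  by (simp only: set_map set_upt atLeastLessThanSuc_atLeastAtMost)
 ultimately have "Suc 0 + Suc d <= length (map (mvar :: nat => 'a mpolynomial) [1..<Suc (Suc g)])"
  using G.krull_height[of mB "map mvar [1..<Suc (Suc g)]" MB] min_over_mB var_B by (metis image_subset_iff)
 then have "Suc d <= g" by (simp del: upt_Suc)
 then show False using len by simp
qed

text \<open>A nonzero constant of the maximal ideal shows that \<open>LL\<close> is not
  \<open>mB\<close>. If \<open>LL\<close> were strictly inside, \<open>PS_chain\<close> would give a
  chain of length g + 2 = d + 2 above \<open>LI\<close>.\<close>

lemma LL_not_sub_mB: "EX f:LL. f ~: mB"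
proof (rule ccontr)
 assume "~ ?thesis"
 moreover have "LL ~= mB"
 proof
  assume eq: "LL = mB"
  have "mconst (xs ! 0) : LL" unfolding eq using xs(1) len d_pos by (intro mB_const) auto
  then have "xs ! 0 = 0" by (simp add: LL_eq)
  moreover have "nzd_on (xs ! 0) UNIV {0}" using xs(2) len d_pos by (cases xs) auto
  ultimately show False using nzd_onD[of "xs ! 0" UNIV "{0}" 1] by simp
 qed
 ultimately have "pchain B LL (Suc (Suc g)) MB" using PS_chain[OF LL_prime] by blast
 then show False using dim_S[OF pchain_anti[OF _ LI_sub_LL]] len by fastforce
qed

lemma NB_decomp: assumes "b : NB" shows "EX c:LL \<inter> mB. b - c : LI"
proof -
 obtain c l where *: "c : mB" "l : LI" "b = c + l" using assms by (auto simp: NB_def elim!: isumE)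
 moreover have "c : LL" using G.idl_add_cancel[OF prmD(1)[OF LL_prime], of c l] assms * LI_sub_LL by (auto simp: NB_def)
 ultimately show ?thesis by (intro bexI[of _ c]) auto
qed

text \<open>A nilpotent element lies in the prime \<open>LL\<close>; outside \<open>mB\<close> it is
  regular on T, hence zero in S. Conversely, if a prime above \<open>LI\<close> omits an element of
  T, it contains the annihilator of that element and so \<open>mB\<close>; thus elements of both T
  and \<open>mB\<close> lie in all primes above \<open>LI\<close>.\<close>

lemma nilpotent_iff:
 assumes "b : B" shows "(EX n. b ^ n : LI) \<longleftrightarrow> b : NB"
proof
 assume "EX n. b ^ n : LI"
 then obtain n where n: "b ^ n : LI" by blast
 have bL: "b : LL" using n LI_sub_LL G.prm_power[OF LL_prime assms] by blast
 have "b : mB \<or> b : LI"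
 proof (cases "b : mB")
  case False
  have "b ^ n : LI ==> b : LI" for n
  proof (induction n)
   case 0
   then show ?case using prmD(2)[OF LL_prime] LI_sub_LL by auto
  next
   case (Suc n)
   show ?case
   proof (cases n)
    case (Suc m)
    have "b ^ n : LL" unfolding Suc power_Suc2 using G.idl_mult[OF prmD(1)[OF LL_prime] _ bL] assms by simp
    from nzd_T[OF assms False this] Suc.prems Suc.IH show ?thesis by simp
   qed (use Suc.prems in simp)
  qed
  then show ?thesis using n by blast
 qed simp
 then show "b : NB" using bL G.isum_upper1[OF LI_idl] G.isum_upper2[OF prmD(1)[OF mB_prime]] by (auto simp: NB_def)
next
 assume b: "b : NB"
 show "EX n. b ^ n : LI"
 proof (rule ccontr)
  assume neg: "~ ?thesis"
  have "is_mult B (range ((^) b))" unfolding is_mult_def using assms rangeI[of "(^) b" 0] by (auto simp flip: power_add)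
  moreover have "LI \<inter> range ((^) b) = {}" using neg by auto
  ultimately have "EX Q. is_prime B Q & LI <= Q & Q \<inter> range ((^) b) = {}" by (rule G.prime_exists[OF LI_idl])
  then obtain Q where Q: "is_prime B Q" "LI <= Q" "Q \<inter> range ((^) b) = {}" by (elim exE conjE)
  have bQ: "b ~: Q" using Q(3) power_one_right by (metis disjoint_iff rangeI)
  obtain c where c: "c : LL" "c : mB" "b - c : LI" using NB_decomp[OF b] by blast
  have "c ~: Q" using c(3) Q(2) bQ G.idl_add[OF prmD(1)[OF Q(1)], of "b - c" c] by auto
  moreover from this have "mB <= Q" using Q(2) c(1) LL_sub_B prmD(3)[OF Q(1)] by (intro prime_torsion[OF Q(1) c(1)]) blast
  ultimately show False using c(2) by blast
 qed
qed

text \<open>The factors from \<open>mB\<close> are replaced by constants one at a time, with the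
  ideal Y adjusted to the remaining factors.\<close>

lemma mB_prod:
 assumes "is_ideal B Y" "!!rs y. length rs = length bs ==> set rs <= \<mm> ==> y : Y ==> mconst (prod_list rs) * y : LI"
  and "set bs <= mB" "y : Y"
 shows "prod_list bs * y : LI"
 using assms
proof (induction bs arbitrary: Y y)
 case Nil
 then show ?case using Nil.prems(2)[of "[]"] by (simp add: mconst_hom)
next
 case (Cons c bs)
 let ?Y = "{z : B. ALL rs. length rs = length bs --> set rs <= \<mm> --> mconst (prod_list rs) * z : LI}"
 have Y: "is_ideal B ?Y" using idlD[OF LI_idl] unfolding is_ideal_def by (auto simp: distrib_left mult.left_commute)
 have "c * y : ?Y"
 proof (rule mB_act[OF Y])
  fix r assume r: "r : \<mm>"
  have "mconst (prod_list rs) * (mconst r * y) : LI" if "length rs = length bs" "set rs <= \<mm>" for rs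
   using Cons.prems(2)[of "r # rs" y] that r Cons.prems(4) by (simp add: mconst_hom algebra_simps)
  moreover have "mconst r * y : B" using Cons.prems(1,4) idlD(1) G.mult_mem[OF const_B] by blast
  ultimately show "mconst r * y : ?Y" by blast
 qed (use Cons.prems in simp)
 from Cons.IH[OF Y _ _ this] Cons.prems(3) show ?case by (simp add: mult.left_commute mult.assoc)
qed

text \<open>Fix f in T outside \<open>mB\<close>, regular on T. Multiplication of constants by f
  lands in N, so N^s = 0 gives f^s m^s T = 0 and f^s cancels. Conversely, an s-fold product from N
  times f lies in m^s T, and f cancels because s > 0 keeps the product in T.\<close>

lemma nilpotency:
 assumes "0 < s"
 shows "(ALL bs. length bs = s --> set bs <= NB --> prod_list bs : LI) \<longleftrightarrow>
  (ALL rs. length rs = s --> set rs <= \<mm> --> (ALL b:LL. mconst (prod_list rs) * b : LI))" (is "?L \<longleftrightarrow> ?R")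
proof -
 obtain f where f: "f : LL" "f ~: mB" using LL_not_sub_mB by blast
 have fB: "f : B" using f(1) LL_sub_B by blast
 note LLi = prmD(1)[OF LL_prime]
 show ?thesis
 proof (intro iffI allI impI ballI)
  fix rs b assume L: ?L and rs: "length rs = s" "set rs <= \<mm>" and b: "b : LL"
  have "f * mconst r : NB" if "r : \<mm>" for r
   using G.idl_mult[OF prmD(1)[OF mB_prime] fB mB_const[OF that]] G.idl_mult[OF LLi const_B f(1), of r]
    G.isum_upper1[OF LI_idl, of mB] by (auto simp: NB_def mult.commute)
  then have "prod_list (map (%r. f * mconst r) rs) : LI" using L[rule_format, of "map (%r. f * mconst r) rs"] rs by auto
  moreover have "prod_list (map (%r. f * mconst r) rs) = f ^ s * mconst (prod_list rs)"
   unfolding rs(1)[symmetric] by (induction rs) (simp_all add: mconst_hom algebra_simps)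
  ultimately have "f ^ s * (mconst (prod_list rs) * b) : LI"
   using idlD(5)[OF LI_idl, of b "f ^ s * mconst (prod_list rs)"] b LL_sub_B by (auto simp: mult.assoc)
  moreover have "f ^ s ~: mB" using f(2) G.prm_power[OF mB_prime fB] by blast
  ultimately show "mconst (prod_list rs) * b : LI"
   using nzd_T[of "f ^ s"] fB G.idl_mult[OF LLi const_B b] by simp
 next
  fix bs assume R: ?R and bs: "length bs = s" "set bs <= NB"
  have "EX cs. length cs = length bs & set cs <= LL \<inter> mB & prod_list bs - prod_list cs : LI" using bs(2)
  proof (induction bs)
   case (Cons b bs)
   then obtain cs where cs: "length cs = length bs" "set cs <= LL \<inter> mB" "prod_list bs - prod_list cs : LI" by auto
   obtain c where c: "c : LL \<inter> mB" "b - c : LI" using NB_decomp Cons.prems by fastforce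
   have "b : B" using Cons.prems LL_sub_B by (auto simp: NB_def)
   moreover have "prod_list cs : B" using cs(2) by (induction cs) (use LL_sub_B in auto)
   ultimately have "b * (prod_list bs - prod_list cs) + prod_list cs * (b - c) : LI" using G.idl_lin[OF LI_idl _ _ cs(3) c(2)] by blast
   then show ?case using cs c by (intro exI[of _ "c # cs"]) (simp add: algebra_simps)
  qed (use idlD(2)[OF LI_idl] in auto)
  then obtain cs where cs: "length cs = s" "set cs <= LL \<inter> mB" "prod_list bs - prod_list cs : LI" using bs(1) by auto
  have csL: "prod_list cs : LL"
  proof (cases cs)
   case (Cons c cs')
   have "prod_list cs' : B" using cs(2) unfolding Cons by (induction cs') (use LL_sub_B in auto)
   then show ?thesis using G.idl_mult[OF LLi, of "prod_list cs'" c] cs(2) Cons by (simp add: mult.commute)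
  qed (use assms cs(1) in simp)
  have "prod_list cs * f : LI"
   by (rule mB_prod[OF LLi]) (use R cs f in auto)
  then have "prod_list cs : LI" using nzd_T[OF fB f(2) csL] by (simp add: mult.commute)
  from G.idl_add[OF LI_idl cs(3) this] show "prod_list bs : LI" by simp
 qed
qed

end

section \<open>Localization\<close>

text \<open>\<open>A\<close> is the localization at \<open>W\<close> of the image of \<open>C\<close> under \<open>h\<close>; for \<open>W = {1}\<close> it is the
 quotient of \<open>C\<close> by \<open>L\<close>.\<close>

locale loc_pres = comm_subring C + R?: cring A
 for C :: "'r::comm_ring_1 set" and A :: "('c, 'm) ring_scheme" (structure) +
 fixes L W :: "'r set" and h :: "'r => 'c"
 assumes W_mult: "is_mult C W" and L_sub: "L <= C"
  and h_closed [simp]: "c : C ==> h c : carrier A"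
  and h_add: "b : C ==> c : C ==> h (b + c) = h b \<oplus> h c"
  and h_mult: "b : C ==> c : C ==> h (b * c) = h b \<otimes> h c"
  and h_one: "h 1 = \<one>"
  and h_unit: "w : W ==> h w : Units A"
  and h_surj: "\<alpha> : carrier A ==> EX w:W. EX c:C. h w \<otimes> \<alpha> = h c"
  and h_ker: "c : C ==> h c = \<zero> \<longleftrightarrow> c : L"
begin

lemma W_C: "w : W ==> w : C" and W_1: "1 : W" and W_m: "w : W ==> v : W ==> w * v : W"
 using W_mult by (auto simp: is_mult_def)

lemma h_zero: "h 0 = \<zero>"
proof -
 have "h 0 \<oplus> h 0 = h 0 \<oplus> \<zero>" using h_add[of 0 0] by simp
 then show ?thesis by (simp del: R.r_zero)
qed

lemma h_uminus: "c : C ==> h (- c) = \<ominus> h c"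
 using h_add[of "- c" c] by (simp add: h_zero R.minus_equality)

lemma h_diff: "b : C ==> c : C ==> h (b - c) = h b \<ominus> h c"
 using h_add[of b "- c"] by (simp add: h_uminus R.minus_eq)

lemma h_eq: "b : C ==> c : C ==> h b = h c \<longleftrightarrow> b - c : L"
 using h_ker[of "b - c"] by (simp add: h_diff)

lemma L_idl: "idl L"
proof -
 have "L = {c : C. h c = \<zero>}" using h_ker L_sub by blast
 then show ?thesis by (auto simp: is_ideal_def h_zero h_add h_mult)
qed

lemma unit_mem: assumes "ideal I A" "w : W" "x : carrier A" "h w \<otimes> x : I" shows "x : I"
proof -
 obtain v where v: "v : carrier A" "v \<otimes> h w = \<one>" using h_unit[OF assms(2)] unfolding Units_def by blast
 have "v \<otimes> (h w \<otimes> x) : I" using ideal.I_l_closed[OF assms(1,4) v(1)] .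
 then show ?thesis using v assms(3) W_C[OF assms(2)] by (simp flip: R.m_assoc)
qed

definition "pre I = {c : C. h c : I}"
definition "ext p = {\<alpha> : carrier A. EX w:W. EX c:p. h w \<otimes> \<alpha> = h c}"

lemma extI: "\<alpha> : carrier A ==> w : W ==> c : p ==> h w \<otimes> \<alpha> = h c ==> \<alpha> : ext p"
 unfolding ext_def by blast

lemma pre_mono: "I <= I' ==> pre I <= pre I'" and ext_mono: "p <= p' ==> ext p <= ext p'"
 unfolding pre_def ext_def by blast+

lemma pre_idl: assumes "ideal I A" shows "idl (pre I)" "L <= pre I"
proof -
 interpret I: ideal I A by fact
 show "idl (pre I)" by (auto simp: is_ideal_def pre_def h_zero h_add h_mult I.I_l_closed)
 show "L <= pre I"
 proof
  fix x assume x: "x : L"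
  then have "h x = \<zero>" using h_ker L_sub by blast
  then show "x : pre I" using x L_sub I.zero_closed by (auto simp: pre_def)
 qed
qed

lemma pre_prime: assumes "primeideal Q A" shows "prm (pre Q)" "pre Q \<inter> W = {}"
proof -
 interpret Q: primeideal Q A by fact
 have 1: "\<one> ~: Q" using Q.I_notcarr Q.one_imp_carrier by blast
 show "prm (pre Q)" using pre_idl[OF Q.is_ideal] 1 Q.I_prime unfolding is_prime_def by (auto simp: pre_def h_one h_mult)
 have "w ~: pre Q" if "w : W" for w using unit_mem[OF Q.is_ideal that, of \<one>] 1 W_C[OF that] by (auto simp: pre_def)
 then show "pre Q \<inter> W = {}" by blast
qed

lemma ext_pre: assumes "ideal I A" shows "ext (pre I) = I"
proof
 interpret I: ideal I A by fact
 show "ext (pre I) <= I" using unit_mem[OF assms] by (auto simp: ext_def pre_def)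
 show "I <= ext (pre I)"
 proof
  fix x assume x: "x : I"
  then obtain w c where wc: "w : W" "c : C" "h w \<otimes> x = h c" using h_surj[OF I.Icarr[OF x]] by blast
  then have "h c : I" using I.I_l_closed[OF x, of "h w"] W_C[of w] by simp
  then show "x : ext (pre I)" using x wc by (auto simp: ext_def pre_def)
 qed
qed

lemma ext_ideal: assumes I: "idl I" shows "ideal (ext I) A"
proof (rule idealI)
 show "ring A" by (rule R.ring_axioms)
 have *: "h w \<otimes> x = h c ==> h (w * v) \<otimes> (x \<oplus> y) = h (v * c + w * e)"
  if "h v \<otimes> y = h e" "w : C" "v : C" "c : C" "e : C" "x : carrier A" "y : carrier A" for w v c e x y
 proof -
  assume x: "h w \<otimes> x = h c"
  have "h (w * v) \<otimes> (x \<oplus> y) = h v \<otimes> (h w \<otimes> x) \<oplus> h w \<otimes> (h v \<otimes> y)" using that(2-) by (simp add: h_mult R.m_ac R.r_distr)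
  then show ?thesis using that x by (simp add: h_mult h_add)
 qed
 show "subgroup (ext I) (add_monoid A)"
 proof (rule R.add.subgroupI)
  show "ext I <= carrier A" by (auto simp: ext_def)
  have "\<zero> : ext I" unfolding ext_def using W_1 idlD(2)[OF I]
   by (intro CollectI conjI bexI[of _ 1] bexI[of _ 0]) (simp_all add: h_one h_zero)
  then show "ext I ~= {}" by blast
  show "\<ominus> x : ext I" if x: "x : ext I" for x
  proof -
   obtain w c where wc: "x : carrier A" "w : W" "c : I" "h w \<otimes> x = h c" using x by (auto simp: ext_def)
   then have "h w \<otimes> (\<ominus> x) = h (- c)" using idl_mem[OF I] W_C by (simp add: h_uminus R.r_minus)
   then show ?thesis using wc idl_uminus[OF I] by (auto simp: ext_def)
  qed
  show "x \<oplus> y : ext I" if xy: "x : ext I" "y : ext I" for x y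
  proof -
   obtain w c v e where wc: "x : carrier A" "w : W" "c : I" "h w \<otimes> x = h c" "y : carrier A" "v : W" "e : I" "h v \<otimes> y = h e"
    using xy unfolding ext_def by auto
   then have "h (w * v) \<otimes> (x \<oplus> y) = h (v * c + w * e)" using * idl_mem[OF I] W_C by simp
   then show ?thesis using wc W_m idl_lin[OF I] W_C by (intro extI[of _ "w * v" "v * c + w * e"]) auto
  qed
 qed
 show xr: "r \<otimes> x : ext I" if x: "x : ext I" "r : carrier A" for x r
 proof -
  obtain w c where wc: "x : carrier A" "w : W" "c : I" "h w \<otimes> x = h c" using x by (auto simp: ext_def)
  obtain v e where ve: "v : W" "e : C" "h v \<otimes> r = h e" using h_surj x(2) by blast
  have "h (v * w) \<otimes> (r \<otimes> x) = (h v \<otimes> r) \<otimes> (h w \<otimes> x)" using wc(1,2) ve(1) x(2) W_C by (simp add: h_mult R.m_ac)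
  also have "\<dots> = h (e * c)" using wc ve idl_mem[OF I] by (simp add: h_mult)
  finally show ?thesis using wc ve W_m idl_mult[OF I] x(2) by (intro extI[of _ "v * w" "e * c"]) auto
 qed
 show "x \<otimes> r : ext I" if x: "x : ext I" "r : carrier A" for x r
  using xr[OF x] x by (simp add: R.m_comm ext_def)
qed

lemma pre_ext:
 assumes p: "prm p" "L <= p" "p \<inter> W = {}" shows "pre (ext p) = p"
proof
 show "p <= pre (ext p)" using idl_mem[OF prm_idl[OF p(1)]] W_1 h_one by (force simp: pre_def ext_def)
 show "pre (ext p) <= p"
 proof
  fix x assume "x : pre (ext p)"
  then obtain w c where wc: "x : C" "w : W" "c : p" "h w \<otimes> h x = h c" by (auto simp: pre_def ext_def)
  then have "w * x - c : L" using W_C idl_mem[OF prm_idl[OF p(1)]] by (simp add: h_mult flip: h_eq)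
  then have "w * x : p" using p(2) wc(3) idl_add[OF prm_idl[OF p(1)], of "w * x - c" c] by auto
  then show "x : p" using prmD(3)[OF p(1)] wc W_C p(3) by blast
 qed
qed

lemma ext_prime:
 assumes p: "prm p" "L <= p" "p \<inter> W = {}" shows "primeideal (ext p) A"
proof (rule primeidealI)
 note pi = prm_idl[OF p(1)]
 interpret E: ideal "ext p" A by (rule ext_ideal[OF pi])
 show "ideal (ext p) A" "cring A" by unfold_locales
 show "carrier A ~= ext p"
 proof
  assume "carrier A = ext p"
  then have "1 : pre (ext p)" using h_closed[of 1] by (auto simp: pre_def)
  then show False using pre_ext[OF p] prmD(2)[OF p(1)] by simp
 qed
 fix x y assume xy: "x : carrier A" "y : carrier A" "x \<otimes> y : ext p"
 obtain w c where wc: "w : W" "c : C" "h w \<otimes> x = h c" using h_surj xy(1) by blast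
 obtain v e where ve: "v : W" "e : C" "h v \<otimes> y = h e" using h_surj xy(2) by blast
 have "h (c * e) = (h w \<otimes> x) \<otimes> (h v \<otimes> y)" using wc ve by (simp add: h_mult)
 also have "\<dots> = h (w * v) \<otimes> (x \<otimes> y)" using wc(1) ve(1) xy W_C by (simp add: h_mult R.m_ac)
 finally have "h (c * e) : ext p" using E.I_l_closed[OF xy(3), of "h (w * v)"] wc ve W_C by simp
 then have "c * e : p" using pre_ext[OF p] wc ve by (auto simp: pre_def)
 then have "c : p \<or> e : p" using prmD(3)[OF p(1)] wc ve by blast
 then show "x : ext p \<or> y : ext p" using wc ve xy unfolding ext_def by blast
qed

lemma pchain_pre: assumes P: "prime_chain A n P" shows "pchain C L n (pre (P n))" "pre (P n) \<inter> W = {}"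
proof -
 have pr: "primeideal (P i) A" if "i <= n" for i using P that by (simp add: prime_chain_def)
 have "pchain C L i (pre (P i))" if "i <= n" for i using that
 proof (induction i)
  case 0
  then show ?case using pre_prime(1)[OF pr[of 0]] pre_idl(2) pr[of 0] by (simp add: primeideal_def)
 next
  case (Suc i)
  have "P i \<subset> P (Suc i)" using P Suc.prems by (simp add: prime_chain_def)
  moreover have "ideal (P i) A" "ideal (P (Suc i)) A" using pr Suc.prems by (simp_all add: primeideal_def)
  ultimately have "pre (P i) \<subset> pre (P (Suc i))"
   by (auto simp: psubset_eq pre_mono dest: arg_cong[of _ _ ext] simp: ext_pre)
  then show ?case using Suc pre_prime(1)[OF pr] by auto
 qed
 then show "pchain C L n (pre (P n))" "pre (P n) \<inter> W = {}" using pre_prime(2)[OF pr[of n]] by simp_all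
qed

lemma pchain_ext:
 "pchain C L n Q ==> Q \<inter> W = {} ==> EX P. prime_chain A n P & P n = ext Q"
 proof (induction n arbitrary: Q)
  case 0
  then show ?case by (intro exI[of _ "%_. ext Q"]) (auto simp: prime_chain_def intro: ext_prime)
 next
  case (Suc n)
  from Suc.prems(1) obtain Q' where Q': "prm Q" "Q' \<subset> Q" "pchain C L n Q'" by auto
  have LQ: "L <= Q" "L <= Q'" "prm Q'" using Q' pchain_sub[OF Q'(3)] pchain_prime[OF Q'(3)] by auto
  obtain P where P: "prime_chain A n P" "P n = ext Q'" using Suc.IH[OF Q'(3)] Q'(2) Suc.prems(2) by blast
  have "pre (ext Q) = Q" "pre (ext Q') = Q'" using pre_ext Q' LQ Suc.prems(2) by blast+
  then have "ext Q' \<subset> ext Q" using Q'(2) by (auto simp: psubset_eq ext_mono dest: arg_cong[of _ _ pre])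
  moreover have "primeideal (ext Q) A" using ext_prime Q'(1) LQ Suc.prems(2) by blast
  ultimately have "prime_chain A (Suc n) (P(Suc n := ext Q))" using P
   by (auto simp: prime_chain_def less_Suc_eq le_Suc_eq)
  then show ?case by (metis fun_upd_same)
 qed

lemma krull_dim_eq: "krull_dim A = Sup {enat n | n Q. pchain C L n Q & Q \<inter> W = {}}"
 unfolding krull_dim_def using pchain_pre pchain_ext by (intro arg_cong[of _ _ Sup]) blast

text \<open>Quotients of A have the same kind of presentation, so the dimension of a module, defined
  by the quotient by its annihilator, is again read off from primes of C.\<close>

lemma quot_pres: assumes I: "ideal I A" shows "loc_pres C (A Quot I) (pre I) W (%c. I +> h c)"
proof -
 interpret I: ideal I A by fact
 interpret Q: cring "A Quot I" by (rule I.quotient_is_cring) unfold_locales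
 interpret H: ring_hom_cring A "A Quot I" "(+>) I" by (rule I.rcos_ring_hom_cring) unfold_locales
 have zero: "x : carrier A ==> I +> x = \<zero>\<^bsub>A Quot I\<^esub> \<longleftrightarrow> x : I" for x
  using I.rcos_const_imp_mem[of x] I.a_rcos_const[of x] unfolding FactRing_def by (simp, blast)
 show ?thesis
 proof
  fix w assume w: "w : W"
  then obtain v where "v : carrier A" "v \<otimes> h w = \<one>" using h_unit[OF w] unfolding Units_def by blast
  then have "(I +> v) \<otimes>\<^bsub>A Quot I\<^esub> (I +> h w) = \<one>\<^bsub>A Quot I\<^esub>" "I +> v : carrier (A Quot I)" "I +> h w : carrier (A Quot I)"
   using w W_C by (simp_all flip: H.hom_mult)
  then show "I +> h w : Units (A Quot I)" using Q.m_comm unfolding Units_def by auto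
 next
  fix \<alpha> assume "\<alpha> : carrier (A Quot I)"
  then obtain x where x: "x : carrier A" "\<alpha> = I +> x" unfolding FactRing_def partial_object.simps A_RCOSETS_def' by blast
  then obtain w c where "w : W" "c : C" "h w \<otimes> x = h c" using h_surj[OF x(1)] by blast
  then show "EX w:W. EX c:C. (I +> h w) \<otimes>\<^bsub>A Quot I\<^esub> \<alpha> = I +> h c"
   using x W_C by (metis H.hom_mult h_closed)
 next
  show "pre I <= C" by (auto simp: pre_def)
 qed (use W_mult zero in \<open>auto simp: pre_def h_add h_mult h_one H.hom_closed\<close>)
qed

end

lemma regseq_nth:
 "regseq W U V xs \<longleftrightarrow> (ALL i<length xs. nzd_on (xs ! i) U (quo W U V (take i xs)))"
proof (induction xs rule: rev_induct)
 case (snoc x xs)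
 then show ?case by (auto simp: regseq_append nth_append less_Suc_eq)
qed simp

lemma span_least: "submodule N A M ==> G <= N ==> span_module A M G <= N"
 and span_upper: "G <= span_module A M G"
 unfolding span_module_def by blast+

text \<open>M is presented as the localization at W of U/V, with f as the canonical map.\<close>

locale loc_mod = loc_pres C A L W h + Md?: module A M
 for C :: "'r::comm_ring_1 set" and A :: "('c, 'm) ring_scheme" (structure) and L W :: "'r set" and h :: "'r => 'c"
  and M :: "('c, 'd, 'k) module_scheme" (structure) +
 fixes U V :: "'r set" and f :: "'r => 'd"
 assumes U_idl: "idl U" and V_sub: "V <= U"
  and f_closed [simp]: "u : U ==> f u : carrier M"
  and f_add: "u : U ==> v : U ==> f (u + v) = f u \<oplus>\<^bsub>M\<^esub> f v"
  and f_smult: "c : C ==> u : U ==> f (c * u) = h c \<odot>\<^bsub>M\<^esub> f u"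
  and f_surj: "m : carrier M ==> EX w:W. EX u:U. h w \<odot>\<^bsub>M\<^esub> m = f u"
  and f_ker: "u : U ==> f u = \<zero>\<^bsub>M\<^esub> \<longleftrightarrow> u : V"
begin

lemma U_C: "u : U ==> u : C" and U_0: "0 : U"
 and U_add: "u : U ==> v : U ==> u + v : U" and U_mult: "c : C ==> u : U ==> c * u : U"
 using idlD[OF U_idl] by auto

lemma f_zero: "f 0 = \<zero>\<^bsub>M\<^esub>"
 using f_smult[of 0 0] U_0 by (simp add: h_zero)

lemma f_uminus: "u : U ==> f (- u) = \<ominus>\<^bsub>M\<^esub> f u"
 using f_add[of "- u" u] idl_uminus[OF U_idl] by (simp add: f_zero M.minus_equality)

lemma f_eq: assumes "u : U" "v : U" shows "f u = f v \<longleftrightarrow> u - v : V"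
proof -
 have uv: "u - v : U" using idl_diff[OF U_idl] assms by simp
 have "f u = f (u - v) \<oplus>\<^bsub>M\<^esub> f v" using f_add[OF uv assms(2)] by simp
 then have "f u = f v \<longleftrightarrow> f (u - v) = \<zero>\<^bsub>M\<^esub>" using f_closed[OF uv] f_closed[OF assms(2)] M.add.r_cancel_one by simp
 then show ?thesis using f_ker[OF uv] by simp
qed

lemma smult_mem:
 assumes N: "submodule N A M" and w: "w : W" and m: "m : carrier M" "h w \<odot>\<^bsub>M\<^esub> m : N" shows "m : N"
proof -
 obtain v where v: "v : carrier A" "v \<otimes> h w = \<one>" using h_unit[OF w] unfolding Units_def by blast
 have "v \<odot>\<^bsub>M\<^esub> (h w \<odot>\<^bsub>M\<^esub> m) : N" using Md.submoduleE(4)[OF N v(1) m(2)] .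
 then show ?thesis using v m(1) W_C[OF w] by (simp flip: Md.smult_assoc1)
qed

definition "preM N = {u : U. f u : N}"
definition "extM Z = {m : carrier M. EX w:W. EX u:Z. h w \<odot>\<^bsub>M\<^esub> m = f u}"

lemma preM_clsd: assumes N: "submodule N A M" shows "clsd W U (preM N)" "V <= preM N"
proof -
 have z: "\<zero>\<^bsub>M\<^esub> : N" using subgroup.one_closed[OF submodule.axioms(1)[OF N]] by simp
 have "idl (preM N)" using U_C U_0 U_add U_mult z Md.submoduleE(4,5)[OF N]
  by (auto simp: is_ideal_def preM_def f_zero f_add f_smult)
 then show "clsd W U (preM N)"
  using U_idl smult_mem[OF N] W_C by (auto simp: clsd_def nzd_on_def preM_def f_smult)
 show "V <= preM N" using z f_ker V_sub by (auto simp: preM_def) (metis subsetD)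
qed

lemma V_clsd: "clsd W U V"
proof -
 have "preM {\<zero>\<^bsub>M\<^esub>} = V" using f_ker V_sub by (auto simp: preM_def)
 then show ?thesis using preM_clsd(1)[OF Md.submoduleI[of "{\<zero>\<^bsub>M\<^esub>}"]] by simp
qed

lemma extM_submodule: assumes Z: "clsd W U Z" shows "submodule (extM Z) A M"
proof (rule Md.submoduleI)
 note Zi = clsdD(2)[OF Z] and ZU = subsetD[OF clsdD(3)[OF Z]]
 show "extM Z <= carrier M" by (auto simp: extM_def)
 show "\<zero>\<^bsub>M\<^esub> : extM Z" unfolding extM_def using W_1 idlD(2)[OF Zi]
  by (intro CollectI conjI bexI[of _ 1] bexI[of _ 0]) (simp_all add: f_zero)
 show "\<ominus>\<^bsub>M\<^esub> m : extM Z" if m: "m : extM Z" for m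
 proof -
  obtain w u where wu: "m : carrier M" "w : W" "u : Z" "h w \<odot>\<^bsub>M\<^esub> m = f u" using m by (auto simp: extM_def)
  then have "h w \<odot>\<^bsub>M\<^esub> (\<ominus>\<^bsub>M\<^esub> m) = f (- u)" using W_C ZU by (simp add: f_uminus Md.smult_r_minus)
  then show ?thesis using wu idl_uminus[OF Zi] by (auto simp: extM_def)
 qed
 show "m \<oplus>\<^bsub>M\<^esub> n : extM Z" if mn: "m : extM Z" "n : extM Z" for m n
 proof -
  obtain w u v x where wu: "m : carrier M" "w : W" "u : Z" "h w \<odot>\<^bsub>M\<^esub> m = f u"
    "n : carrier M" "v : W" "x : Z" "h v \<odot>\<^bsub>M\<^esub> n = f x"
   using mn unfolding extM_def by auto
  have cl: "w : C" "v : C" "u : U" "x : U" using wu W_C ZU by auto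
  have "h (w * v) \<odot>\<^bsub>M\<^esub> (m \<oplus>\<^bsub>M\<^esub> n) = h (v * w) \<odot>\<^bsub>M\<^esub> m \<oplus>\<^bsub>M\<^esub> h (w * v) \<odot>\<^bsub>M\<^esub> n"
   using wu(1,5) cl by (simp add: Md.smult_r_distr mult.commute)
  also have "\<dots> = h v \<odot>\<^bsub>M\<^esub> (h w \<odot>\<^bsub>M\<^esub> m) \<oplus>\<^bsub>M\<^esub> h w \<odot>\<^bsub>M\<^esub> (h v \<odot>\<^bsub>M\<^esub> n)"
   using wu(1,5) cl by (simp add: h_mult Md.smult_assoc1)
  also have "\<dots> = f (v * u + w * x)" using wu cl U_mult by (simp add: f_smult f_add)
  finally have "h (w * v) \<odot>\<^bsub>M\<^esub> (m \<oplus>\<^bsub>M\<^esub> n) = f (v * u + w * x)" .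
  moreover have "v * u + w * x : Z" "w * v : W" using idl_lin[OF Zi cl(2,1)] wu W_m by auto
  ultimately show ?thesis using wu(1,5) unfolding extM_def by blast
 qed
 show "\<alpha> \<odot>\<^bsub>M\<^esub> m : extM Z" if m: "\<alpha> : carrier A" "m : extM Z" for \<alpha> m
 proof -
  obtain w u where wu: "m : carrier M" "w : W" "u : Z" "h w \<odot>\<^bsub>M\<^esub> m = f u" using m by (auto simp: extM_def)
  obtain v c where vc: "v : W" "c : C" "h v \<otimes> \<alpha> = h c" using h_surj m(1) by blast
  have cl: "w : C" "v : C" "u : U" using wu vc W_C ZU by auto
  have "h (v * w) \<odot>\<^bsub>M\<^esub> (\<alpha> \<odot>\<^bsub>M\<^esub> m) = (h v \<otimes> \<alpha> \<otimes> h w) \<odot>\<^bsub>M\<^esub> m"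
   using wu(1) cl m(1) by (simp add: h_mult R.m_ac flip: Md.smult_assoc1)
  also have "\<dots> = f (c * u)" using wu(1,4) vc(2,3) cl by (simp add: Md.smult_assoc1 f_smult)
  finally show ?thesis using wu vc idl_mult[OF Zi] W_m m(1) unfolding extM_def by (intro CollectI conjI bexI[of _ "v * w"] bexI[of _ "c * u"]) auto
 qed
qed

text \<open>x is a numerator of \<alpha>. Ideal products and regular sequences on M depend on
  numerators only.\<close>

definition "rep \<alpha> x \<longleftrightarrow> \<alpha> : carrier A & x : C & (EX w:W. h w \<otimes> \<alpha> = h x)"

lemma repsD:
 assumes "list_all2 rep \<alpha>s xs"
 shows "set xs <= C" "set \<alpha>s <= carrier A" "length \<alpha>s = length xs"
  "x : set xs ==> EX \<alpha>:set \<alpha>s. rep \<alpha> x" "\<alpha> : set \<alpha>s ==> EX x:set xs. rep \<alpha> x"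
 using assms by (induction rule: list_all2_induct) (auto simp: rep_def)

lemma zero_submodule: "submodule {\<zero>\<^bsub>M\<^esub>} A M"
 by (intro Md.submoduleI) auto

lemma smult_zero: "w : W ==> m : carrier M ==> h w \<odot>\<^bsub>M\<^esub> m = \<zero>\<^bsub>M\<^esub> ==> m = \<zero>\<^bsub>M\<^esub>"
 using smult_mem[OF zero_submodule] by simp

lemma ideal_smult_iff:
 assumes reps: "list_all2 rep \<alpha>s xs" and m: "m : carrier M" "w : W" "u : U" "h w \<odot>\<^bsub>M\<^esub> m = f u"
 shows "m : ideal_smult A M (set \<alpha>s) (carrier M) \<longleftrightarrow> u : quo W U V xs"
proof
 let ?G = "{\<alpha> \<odot>\<^bsub>M\<^esub> v | \<alpha> v. \<alpha> : set \<alpha>s & v : carrier M}"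
 note xC = repsD(1)[OF reps]
 note cl = clsd_quo[OF V_clsd W_mult xC]
 have sub: "?G <= extM (quo W U V xs)"
 proof safe
  fix \<alpha> v assume \<alpha>: "\<alpha> : set \<alpha>s" and v: "v : carrier M"
  then obtain x where x: "x : set xs" "rep \<alpha> x" using repsD(5)[OF reps] by blast
  then obtain w where w: "w : W" "h w \<otimes> \<alpha> = h x" "\<alpha> : carrier A" "x : C" by (auto simp: rep_def)
  obtain y u where u: "y : W" "u : U" "h y \<odot>\<^bsub>M\<^esub> v = f u" using f_surj v by blast
  have "h (w * y) \<odot>\<^bsub>M\<^esub> (\<alpha> \<odot>\<^bsub>M\<^esub> v) = (h w \<otimes> \<alpha> \<otimes> h y) \<odot>\<^bsub>M\<^esub> v"
   using w(1,3) u(1) v W_C by (simp add: h_mult R.m_ac flip: Md.smult_assoc1)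
  also have "\<dots> = f (x * u)" using w u v W_C by (simp add: Md.smult_assoc1 f_smult)
  finally show "\<alpha> \<odot>\<^bsub>M\<^esub> v : extM (quo W U V xs)"
   using w u v W_m quo_upper_smult[OF V_clsd W_mult xC x(1) u(2)] unfolding extM_def
   by (intro CollectI conjI bexI[of _ "w * y"] bexI[of _ "x * u"]) auto
 qed
 assume "m : ideal_smult A M (set \<alpha>s) (carrier M)"
 then have "m : extM (quo W U V xs)" using span_least[OF extM_submodule[OF cl] sub] by (auto simp: ideal_smult_def)
 then obtain v q where vq: "v : W" "q : quo W U V xs" "h v \<odot>\<^bsub>M\<^esub> m = f q" by (auto simp: extM_def)
 have vw: "v : C" "w : C" "q : U" using vq(1,2) m(2) W_C subsetD[OF clsdD(3)[OF cl]] by auto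
 have "f (v * u) = f (w * q)"
  using m vq(3) vw by (simp add: f_smult flip: m(4) vq(3)) (simp add: R.m_comm flip: Md.smult_assoc1)
 then have "v * u - w * q : quo W U V xs" using f_eq[of "v * u" "w * q"] m(3) vw U_mult quo_upper[OF V_clsd W_mult xC] by auto
 then have "v * u : quo W U V xs" using idl_add[OF clsdD(2)[OF cl], of "v * u - w * q" "w * q"] idl_mult[OF clsdD(2)[OF cl] vw(2) vq(2)] by simp
 then show "u : quo W U V xs" using clsdD(4)[OF cl vq(1) m(3)] by blast
next
 let ?G = "{\<alpha> \<odot>\<^bsub>M\<^esub> v | \<alpha> v. \<alpha> : set \<alpha>s & v : carrier M}"
 note xC = repsD(1)[OF reps]
 have sm: "submodule (span_module A M ?G) A M"
 proof -
  have G: "?G <= carrier M" using repsD(2)[OF reps] by auto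
  have "span_module A M ?G <= carrier M" using span_least[OF Md.carrier_is_submodule G] .
  then show ?thesis
   by (intro Md.submoduleI)
    (auto simp: span_module_def dest: Md.submoduleE(3,4,5) intro: subgroup.one_closed[OF submodule.axioms(1), of _ A M, simplified])
 qed
 assume u: "u : quo W U V xs"
 have "quo W U V xs <= preM (span_module A M ?G)"
 proof (rule quo_least[OF V_clsd W_mult xC preM_clsd(1)[OF sm] preM_clsd(2)[OF sm]])
  fix x v assume x: "x : set xs" and v: "v : U"
  then obtain \<alpha> where "\<alpha> : set \<alpha>s" "rep \<alpha> x" using repsD(4)[OF reps] by blast
  then obtain w where w: "w : W" "h w \<otimes> \<alpha> = h x" "\<alpha> : carrier A" "x : C" "\<alpha> : set \<alpha>s" by (auto simp: rep_def)
  have "\<alpha> \<odot>\<^bsub>M\<^esub> f v : ?G" using w(5) f_closed[OF v] by blast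
  then have "\<alpha> \<odot>\<^bsub>M\<^esub> f v : span_module A M ?G" by (rule subsetD[OF span_upper])
  then have "h w \<odot>\<^bsub>M\<^esub> (\<alpha> \<odot>\<^bsub>M\<^esub> f v) : span_module A M ?G" using Md.submoduleE(4)[OF sm] W_C w(1) by simp
  then have "f (x * v) : span_module A M ?G" using w(2-4) W_C[OF w(1)] v by (simp add: f_smult flip: Md.smult_assoc1)
  then show "x * v : preM (span_module A M ?G)" using U_mult w(4) v by (simp add: preM_def)
 qed
 then have "h w \<odot>\<^bsub>M\<^esub> m : span_module A M ?G" using u m(4) by (auto simp: preM_def)
 then show "m : ideal_smult A M (set \<alpha>s) (carrier M)" using smult_mem[OF sm m(2,1)] by (simp add: ideal_smult_def)
qed

lemma regular_sequence_iff:
 assumes reps: "list_all2 rep \<alpha>s xs"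
 shows "regular_sequence A M \<alpha>s \<longleftrightarrow> regseq W U V xs & quo W U V xs ~= U"
proof -
 note xC = repsD(1)[OF reps] and \<alpha>C = repsD(2)[OF reps] and len = repsD(3)[OF reps]
 have tk: "list_all2 rep (take i \<alpha>s) (take i xs)" for i using reps by simp
 have nz: "(ALL v:carrier M. \<alpha>s ! i \<odot>\<^bsub>M\<^esub> v : ideal_smult A M (set (take i \<alpha>s)) (carrier M) -->
   v : ideal_smult A M (set (take i \<alpha>s)) (carrier M)) \<longleftrightarrow> nzd_on (xs ! i) U (quo W U V (take i xs))" if i: "i < length xs" for i
 proof -
  have "rep (\<alpha>s ! i) (xs ! i)" using reps i by (simp add: list_all2_conv_all_nth)
  then obtain w where w: "w : W" "h w \<otimes> \<alpha>s ! i = h (xs ! i)" "\<alpha>s ! i : carrier A" "xs ! i : C" by (auto simp: rep_def)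
  have key: "\<alpha>s ! i \<odot>\<^bsub>M\<^esub> v : ideal_smult A M (set (take i \<alpha>s)) (carrier M) \<longleftrightarrow> xs ! i * u : quo W U V (take i xs)"
   if v: "v : carrier M" "y : W" "u : U" "h y \<odot>\<^bsub>M\<^esub> v = f u" for v y u
  proof (rule ideal_smult_iff[OF tk])
   show "\<alpha>s ! i \<odot>\<^bsub>M\<^esub> v : carrier M" "w * y : W" "xs ! i * u : U" using w v W_m U_mult by auto
   have "h (w * y) \<odot>\<^bsub>M\<^esub> (\<alpha>s ! i \<odot>\<^bsub>M\<^esub> v) = (h w \<otimes> \<alpha>s ! i \<otimes> h y) \<odot>\<^bsub>M\<^esub> v"
    using w(1,3) v(1,2) W_C by (simp add: h_mult R.m_ac flip: Md.smult_assoc1)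
   also have "\<dots> = f (xs ! i * u)" using w v W_C by (simp add: Md.smult_assoc1 f_smult)
   finally show "h (w * y) \<odot>\<^bsub>M\<^esub> (\<alpha>s ! i \<odot>\<^bsub>M\<^esub> v) = f (xs ! i * u)" .
  qed
  show ?thesis
  proof
   assume L: "ALL v:carrier M. \<alpha>s ! i \<odot>\<^bsub>M\<^esub> v : ideal_smult A M (set (take i \<alpha>s)) (carrier M) -->
    v : ideal_smult A M (set (take i \<alpha>s)) (carrier M)"
   have "u : quo W U V (take i xs)" if u: "u : U" "xs ! i * u : quo W U V (take i xs)" for u
   proof -
    have *: "h 1 \<odot>\<^bsub>M\<^esub> f u = f u" using u(1) by (simp add: h_one)
    show ?thesis using key[OF f_closed W_1 u(1) *] ideal_smult_iff[OF tk f_closed W_1 u(1) *] u L f_closed[OF u(1)] by blast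
   qed
   then show "nzd_on (xs ! i) U (quo W U V (take i xs))" by (simp add: nzd_on_def)
  next
   assume R: "nzd_on (xs ! i) U (quo W U V (take i xs))"
   show "ALL v:carrier M. \<alpha>s ! i \<odot>\<^bsub>M\<^esub> v : ideal_smult A M (set (take i \<alpha>s)) (carrier M) -->
    v : ideal_smult A M (set (take i \<alpha>s)) (carrier M)"
   proof
    fix v assume v: "v : carrier M"
    then obtain y u where "y : W" "u : U" "h y \<odot>\<^bsub>M\<^esub> v = f u" using f_surj by blast
    from key[OF v this] ideal_smult_iff[OF tk v this] nzd_onD[OF R this(2)]
    show "\<alpha>s ! i \<odot>\<^bsub>M\<^esub> v : ideal_smult A M (set (take i \<alpha>s)) (carrier M) -->
     v : ideal_smult A M (set (take i \<alpha>s)) (carrier M)" by blast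
   qed
  qed
 qed
 have "ideal_smult A M (set \<alpha>s) (carrier M) = carrier M \<longleftrightarrow> quo W U V xs = U"
 proof -
  have "ideal_smult A M (set \<alpha>s) (carrier M) <= carrier M" unfolding ideal_smult_def
   using \<alpha>C by (intro span_least Md.carrier_is_submodule) auto
  moreover have "quo W U V xs <= U" using clsdD(3)[OF clsd_quo[OF V_clsd W_mult xC]] .
  moreover have "u : quo W U V xs \<longleftrightarrow> f u : ideal_smult A M (set \<alpha>s) (carrier M)" if "u : U" for u
   using ideal_smult_iff[OF reps _ W_1 that, of "f u"] that by (simp add: h_one)
  moreover have "m : ideal_smult A M (set \<alpha>s) (carrier M)" if "m : carrier M" "U <= quo W U V xs" for m
   using ideal_smult_iff[OF reps that(1)] f_surj[OF that(1)] that(2) by blast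
  ultimately show ?thesis by (metis f_closed subsetI subset_antisym)
 qed
 then show ?thesis unfolding regular_sequence_def regseq_nth[of W U V] using nz \<alpha>C len by auto
qed

lemma depth_eq:
 assumes I: "ideal I A"
 shows "depth A I M = Sup {enat (length xs) | xs. set xs <= pre I & regseq W U V xs & quo W U V xs ~= U}"
proof -
 have 1: "EX xs. set xs <= pre I & list_all2 rep \<alpha>s xs" if "set \<alpha>s <= I" for \<alpha>s
  using that
 proof (induction \<alpha>s)
  case (Cons \<alpha> \<alpha>s)
  then obtain xs where xs: "set xs <= pre I" "list_all2 rep \<alpha>s xs" by auto
  have \<alpha>: "\<alpha> : carrier A" "\<alpha> : I" using ideal.Icarr[OF I] Cons.prems by auto
  then obtain w x where w: "w : W" "x : C" "h w \<otimes> \<alpha> = h x" using h_surj by blast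
  then have "h x : I" using ideal.I_l_closed[OF I \<alpha>(2), of "h w"] W_C by simp
  moreover have "rep \<alpha> x" using w \<alpha> by (auto simp: rep_def)
  ultimately show ?case using xs w by (intro exI[of _ "x # xs"]) (simp add: pre_def)
 qed auto
 have 2: "list_all2 rep (map h xs) xs" if "set xs <= pre I" for xs
  using that W_1 by (auto simp: list_all2_conv_all_nth rep_def pre_def h_one intro!: bexI[of _ 1] dest: subsetD[OF _ nth_mem])
 have "{enat (length \<alpha>s) | \<alpha>s. set \<alpha>s <= I & regular_sequence A M \<alpha>s} =
  {enat (length xs) | xs. set xs <= pre I & regseq W U V xs & quo W U V xs ~= U}" (is "?L = ?R")
 proof
  show "?L <= ?R"
  proof safe
   fix \<alpha>s assume "set \<alpha>s <= I" and rs: "regular_sequence A M \<alpha>s"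
   then obtain xs where xs: "set xs <= pre I" "list_all2 rep \<alpha>s xs" using 1 by blast
   then show "EX xs. enat (length \<alpha>s) = enat (length xs) & set xs <= pre I & regseq W U V xs & quo W U V xs ~= U"
    using regular_sequence_iff[OF xs(2)] rs list_all2_lengthD[OF xs(2)] by blast
  qed
  show "?R <= ?L"
  proof
   fix e assume "e : ?R"
   then obtain xs where xs: "e = enat (length xs)" "set xs <= pre I" "regseq W U V xs" "quo W U V xs ~= U" by blast
   then show "e : ?L"
    using regular_sequence_iff[OF 2[OF xs(2)]] by (intro CollectI exI[of _ "map h xs"]) (auto simp: pre_def)
  qed
 qed
 then show ?thesis by (simp only: depth_def)
qed

lemma annihilator_pre: "pre (annihilator A M) = colon C V U"
proof -
 have "(ALL m:carrier M. h c \<odot>\<^bsub>M\<^esub> m = \<zero>\<^bsub>M\<^esub>) \<longleftrightarrow> (ALL u:U. c * u : V)" if c: "c : C" for c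
 proof
  assume "ALL m:carrier M. h c \<odot>\<^bsub>M\<^esub> m = \<zero>\<^bsub>M\<^esub>"
  then show "ALL u:U. c * u : V" using c f_ker U_mult by (metis f_closed f_smult)
 next
  assume R: "ALL u:U. c * u : V"
  show "ALL m:carrier M. h c \<odot>\<^bsub>M\<^esub> m = \<zero>\<^bsub>M\<^esub>"
  proof
   fix m assume m: "m : carrier M"
   then obtain w u where wu: "w : W" "u : U" "h w \<odot>\<^bsub>M\<^esub> m = f u" using f_surj by blast
   have "h w \<odot>\<^bsub>M\<^esub> (h c \<odot>\<^bsub>M\<^esub> m) = h c \<odot>\<^bsub>M\<^esub> f u"
    unfolding wu(3)[symmetric] using c m W_C[OF wu(1)] by (simp add: R.m_comm flip: Md.smult_assoc1)
   also have "\<dots> = f (c * u)" using f_smult[OF c wu(2)] by simp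
   also have "\<dots> = \<zero>\<^bsub>M\<^esub>" using R wu(2) f_ker U_mult[OF c] by blast
   finally show "h c \<odot>\<^bsub>M\<^esub> m = \<zero>\<^bsub>M\<^esub>" using smult_zero[OF wu(1)] m c by simp
  qed
 qed
 then show ?thesis by (auto simp: pre_def annihilator_def colon_def)
qed

lemma annihilator_ideal: "ideal (annihilator A M) A"
 by (rule idealI, rule R.ring_axioms, rule R.add.subgroupI)
  (auto simp: annihilator_def Md.smult_l_distr Md.smult_l_minus Md.smult_assoc1 R.m_comm intro: exI[of _ \<zero>])

lemma module_dim_eq: "module_dim A M = Sup {enat n | n Q. pchain C (colon C V U) n Q & Q \<inter> W = {}}"
 unfolding module_dim_def loc_pres.krull_dim_eq[OF quot_pres[OF annihilator_ideal]] annihilator_pre ..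

lemma carrier_zero_iff: "carrier M = {\<zero>\<^bsub>M\<^esub>} \<longleftrightarrow> V = U"
proof
 assume "carrier M = {\<zero>\<^bsub>M\<^esub>}"
 then show "V = U" using f_ker f_closed V_sub by blast
next
 assume VU: "V = U"
 have "m = \<zero>\<^bsub>M\<^esub>" if m: "m : carrier M" for m
 proof -
  obtain w u where "w : W" "u : U" "h w \<odot>\<^bsub>M\<^esub> m = f u" using f_surj m by blast
  then show ?thesis using smult_zero[of w m] m f_ker VU by auto
 qed
 then show "carrier M = {\<zero>\<^bsub>M\<^esub>}" by auto
qed

end

text \<open>If all lengths stayed below n, the supremum would be at most n - 1; and truncation turns
  a longer sequence into one of length n.\<close>

lemma dpt_Sup: "enat n <= Sup {enat (length xs) | xs. set xs <= P & regseq W U V xs} \<longleftrightarrow> dpt W P n U V"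
proof
 let ?X = "{enat (length xs) | xs. set xs <= P & regseq W U V xs}"
 assume le: "enat n <= Sup ?X"
 show "dpt W P n U V"
 proof (rule ccontr)
  assume neg: "~ dpt W P n U V"
  then obtain m where m: "n = Suc m" by (cases n) auto
  have "length xs <= m" if "set xs <= P" "regseq W U V xs" for xs
  proof (rule ccontr)
   assume "~ length xs <= m"
   moreover have "dpt W P (length xs) U V" using that by (auto simp: dpt_def)
   ultimately show False using neg dpt_mono[of W P "length xs" U V n] m by simp
  qed
  then have "Sup ?X <= enat m" by (intro Sup_least) auto
  with le have "enat n <= enat m" by order
  then show False using m by simp
 qed
next
 assume "dpt W P n U V"
 then obtain xs where "n = length xs" "set xs <= P" "regseq W U V xs" by (auto simp: dpt_def)
 then show "enat n <= Sup {enat (length xs) | xs. set xs <= P & regseq W U V xs}" by (intro Sup_upper) blast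
qed

section \<open>Quotients of C and their localizations at a prime\<close>

locale pres = Q: loc_pres C A L "{1}" h
 for C :: "'r::comm_ring_1 set" and A :: "('c, 'm) ring_scheme" (structure) and L :: "'r set" and h :: "'r => 'c"
begin

abbreviation "Md U \<equiv> self_module A\<lparr>carrier := h ` U\<rparr>"

lemma carrier_eq: "carrier A = h ` C"
proof
 show "carrier A <= h ` C"
 proof
  fix x assume "x : carrier A"
  with Q.h_surj obtain c where "c : C" "h 1 \<otimes> x = h c" by blast
  then show "x : h ` C" using \<open>x : carrier A\<close> by (simp add: Q.h_one)
 qed
qed auto

lemma Md_C: "Md C = self_module A"
 by (simp add: scalar_module_def carrier_eq)

lemma h_mem: "is_ideal C U ==> L <= U ==> c : C ==> h c : h ` U \<longleftrightarrow> c : U"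
proof safe
 fix u assume U: "is_ideal C U" "L <= U" "c : C" "h c = h u" "u : U"
 then have "c - u : U" using Q.h_eq[of c u] Q.idl_mem[OF U(1)] by auto
 then show "c : U" using Q.idl_add[OF U(1) _ U(5)] by fastforce
qed auto

end

locale quot_at = pres C A L h
 for C :: "'r::comm_ring_1 set" and A :: "('c, 'm) ring_scheme" (structure) and L :: "'r set" and h :: "'r => 'c" +
 fixes P :: "'r set"
 assumes P_prime: "is_prime C P" and L_P: "L <= P"
begin

abbreviation "W \<equiv> C - P"
abbreviation "W' \<equiv> carrier A - h ` P"
text \<open>The fraction u/w, named by representatives in C.\<close>

abbreviation "k U u w \<equiv> frac A (Md U) W' (h u) (h w)"

definition "good U \<longleftrightarrow> is_ideal C U & L <= U"

lemma goodD: assumes "good U" shows "is_ideal C U" "L <= U" "U <= C" "0 : U" "u : U ==> u : C"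
  "u : U ==> v : U ==> u + v : U" "u : U ==> v : U ==> u - v : U"  "c : C ==> u : U ==> c * u : U" "u : U ==> - u : U"
 using assms idlD[of C U] Q.idl_diff[of U] Q.idl_uminus[of U] by (auto simp: good_def)

lemma good_C: "good C"
 using Q.L_sub by (simp add: good_def)

lemma good_P: "good P"
 using L_P P_prime by (simp add: good_def is_prime_def)

lemma W'_eq: "W' = h ` W"
proof -
 have "h c : h ` P \<longleftrightarrow> c : P" if "c : C" for c using h_mem[OF goodD(1,2)[OF good_P] that] .
 then show ?thesis unfolding carrier_eq by auto
qed

lemma W_mult: "is_mult C W"
 by (rule Q.mult_compl[OF P_prime])

lemma W_facts: "1 : W" "w : W ==> v : W ==> w * v : W" "w : W ==> w : C"
 using W_mult by (auto simp: is_mult_def)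

abbreviation "V U \<equiv> sat W U L"

lemma V_clsd: assumes "good U" shows "Q.clsd W U (V U)"
 using Q.clsd_sat[OF goodD(1)[OF assms] Q.L_idl W_mult] .

lemma V_facts: assumes "good U" shows "is_ideal C (V U)" "V U <= U" "L <= V U"
 "w : W ==> u : U ==> w * u : V U ==> u : V U"
 using Q.clsdD[OF V_clsd[OF assms]] Q.sat_upper[OF W_mult goodD(2)[OF assms]] by auto

lemma k_mem:
 assumes U: "good U" and uw: "u : U" "w : W" "u' : U" "w' : W"
 shows "(h u', h w') : k U u w \<longleftrightarrow> w' * u - w * u' : V U"
proof -
 have C: "u : C" "w : C" "u' : C" "w' : C" using uw goodD(5)[OF U] by auto
 have "(h u', h w') : k U u w \<longleftrightarrow> (EX v:W. h v \<otimes> (h w' \<otimes> h u) = h v \<otimes> (h w \<otimes> h u'))"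
  unfolding frac_def using uw W'_eq by (auto simp: scalar_module_def)
 also have "\<dots> \<longleftrightarrow> (EX v:W. v * (w' * u - w * u') : L)"
  using C by (intro bex_cong refl) (simp add: Q.h_eq right_diff_distrib flip: Q.h_mult)
 also have "\<dots> \<longleftrightarrow> w' * u - w * u' : V U" using uw goodD(7,8)[OF U] by (auto simp: sat_def)
 finally show ?thesis .
qed

lemma k_elem:
 assumes U: "good U" and y: "y : k U u w" shows "EX u':U. EX w':W. y = (h u', h w')"
proof -
 have "fst y : h ` U" "snd y : h ` W" using y W'_eq by (auto simp: frac_def scalar_module_def)
 then show ?thesis by (cases y) auto
qed

lemma k_eq:
 assumes U: "good U" and uw: "u : U" "w : W" "u' : U" "w' : W"
 shows "k U u w = k U u' w' \<longleftrightarrow> w' * u - w * u' : V U"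
proof
 note Vi = V_facts(1)[OF U]
 assume "k U u w = k U u' w'"
 moreover have "(h u', h w') : k U u' w'" using k_mem[OF U uw(3,4,3,4)] idlD(2)[OF Vi] by (simp add: mult.commute)
 ultimately show "w' * u - w * u' : V U" using k_mem[OF U uw] by simp
next
 note Vi = V_facts(1)[OF U]
 assume e: "w' * u - w * u' : V U"
 have trans: "w3 * u1 - w1 * u3 : V U"
  if "w2 * u1 - w1 * u2 : V U" "w3 * u2 - w2 * u3 : V U" "w1 : W" "w2 : W" "w3 : W" "u1 : U" "u3 : U" for u1 w1 u2 w2 u3 w3
 proof -
  have "w3 * (w2 * u1 - w1 * u2) + w1 * (w3 * u2 - w2 * u3) : V U" using Q.idl_lin[OF Vi _ _ that(1,2)] that W_facts(3) by blast
  then have "w2 * (w3 * u1 - w1 * u3) : V U" by (simp add: algebra_simps)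
  then show ?thesis using V_facts(4)[OF U that(4)] goodD(7,8)[OF U] that W_facts(3) by blast
 qed
 have sym: "w * u' - w' * u : V U" using Q.idl_uminus[OF Vi e] by simp
 show "k U u w = k U u' w'"
 proof (rule subset_antisym; rule subsetI)
  fix y assume y: "y : k U u w"
  then obtain x v where x: "x : U" "v : W" "y = (h x, h v)" using k_elem[OF U] by blast
  then have "v * u - w * x : V U" using y k_mem[OF U uw(1,2) x(1,2)] by simp
  then have "v * u' - w' * x : V U" using trans[OF sym] uw x by blast
  then show "y : k U u' w'" using k_mem[OF U uw(3,4) x(1,2)] x(3) by simp
 next
  fix y assume y: "y : k U u' w'"
  then obtain x v where x: "x : U" "v : W" "y = (h x, h v)" using k_elem[OF U] by blast
  then have "v * u' - w' * x : V U" using y k_mem[OF U uw(3,4) x(1,2)] by simp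
  then have "v * u - w * x : V U" using trans[OF e] uw x by blast
  then show "y : k U u w" using k_mem[OF U uw(1,2) x(1,2)] x(3) by simp
 qed
qed

lemma k_self: "good U ==> u : U ==> w : W ==> (h u, h w) : k U u w"
 using k_mem[of U u w u w] V_facts(1)[of U] idlD(2) by (simp add: mult.commute)

lemma k_memD: "good U ==> u : U ==> w : W ==> y : k U u w
  ==> EX u':U. EX w':W. y = (h u', h w') & w' * u - w * u' : V U"
 using k_elem k_mem by metis

text \<open>\<open>frac_add\<close> and \<open>frac_smult\<close> are unions over all
  representatives; being well defined means that all members of the union coincide.\<close>

lemma UN2_const:
 assumes "x0 : S1" "y0 : S2" "!!x s y t. (x, s) : S1 ==> (y, t) : S2 ==> F x s y t = Z"
 shows "(\<Union>(x, s)\<in>S1. \<Union>(y, t)\<in>S2. F x s y t) = Z"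
proof (rule SUP_eq_const)
 fix p assume p: "p : S1"
 have "(\<Union>(y, t)\<in>S2. F (fst p) (snd p) y t) = Z"
  by (rule SUP_eq_const) (use assms p in auto)
 then show "(case p of (x, s) => \<Union>(y, t)\<in>S2. F x s y t) = Z" by (simp add: case_prod_unfold)
qed (use assms in blast)

lemma k_add:
 assumes U: "good U" and uw: "u : U" "w : W" "u' : U" "w' : W"
 shows "frac_add A (Md U) W' (k U u w) (k U u' w') = k U (w' * u + w * u') (w * w')"
 unfolding frac_add_def
proof (rule UN2_const[OF k_self[OF U uw(1,2)] k_self[OF U uw(3,4)]])
 fix x s y t assume "(x, s) : k U u w" "(y, t) : k U u' w'"
 then obtain u1 w1 u2 w2 where 1: "u1 : U" "w1 : W" "x = h u1" "s = h w1" "w1 * u - w * u1 : V U"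
  and 2: "u2 : U" "w2 : W" "y = h u2" "t = h w2" "w2 * u' - w' * u2 : V U"
  using k_memD[OF U] uw by (metis prod.inject)
 have C: "u : C" "w : C" "u' : C" "w' : C" "u1 : C" "w1 : C" "u2 : C" "w2 : C" using uw 1 2 goodD(5)[OF U] by auto
 have "frac A (Md U) W' (t \<odot>\<^bsub>Md U\<^esub> x \<oplus>\<^bsub>Md U\<^esub> s \<odot>\<^bsub>Md U\<^esub> y) (s \<otimes> t) = k U (w2 * u1 + w1 * u2) (w1 * w2)"
  using 1(3,4) 2(3,4) C by (simp add: scalar_module_def Q.h_add Q.h_mult)
 also have "\<dots> = k U (w' * u + w * u') (w * w')"
 proof (subst k_eq[OF U])
  have "(- (w' * w2)) * (w1 * u - w * u1) + (- (w * w1)) * (w2 * u' - w' * u2) : V U"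
   using Q.idl_lin[OF V_facts(1)[OF U] _ _ 1(5) 2(5), of "- (w' * w2)" "- (w * w1)"] C by simp
  then show "w * w' * (w2 * u1 + w1 * u2) - w1 * w2 * (w' * u + w * u') : V U" by (simp add: algebra_simps)
 qed (use uw 1 2 C W_facts goodD(6,8)[OF U] in auto)
 finally show "frac A (Md U) W' (t \<odot>\<^bsub>Md U\<^esub> x \<oplus>\<^bsub>Md U\<^esub> s \<odot>\<^bsub>Md U\<^esub> y) (s \<otimes> t) = k U (w' * u + w * u') (w * w')" .
qed

lemma k_smult:
 assumes U: "good U" and uw: "c : C" "w : W" "u : U" "v : W"
 shows "frac_smult A (Md U) W' (k C c w) (k U u v) = k U (c * u) (w * v)"
 unfolding frac_smult_def
proof (rule UN2_const[OF k_self[OF good_C uw(1,2)] k_self[OF U uw(3,4)]])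
 fix x s y t assume "(x, s) : k C c w" "(y, t) : k U u v"
 then obtain c1 w1 u2 v2 where 1: "c1 : C" "w1 : W" "x = h c1" "s = h w1" "w1 * c - w * c1 : V C"
  and 2: "u2 : U" "v2 : W" "y = h u2" "t = h v2" "v2 * u - v * u2 : V U"
  using k_memD[OF U] k_memD[OF good_C] uw by (metis prod.inject)
 have C: "u : C" "w : C" "v : C" "u2 : C" "w1 : C" "v2 : C" using uw 1 2 goodD(5)[OF U] by auto
 have "frac A (Md U) W' (x \<odot>\<^bsub>Md U\<^esub> y) (s \<otimes> t) = k U (c1 * u2) (w1 * v2)"
  using 1(1,3,4) 2(3,4) C by (simp add: scalar_module_def Q.h_mult)
 also have "\<dots> = k U (c * u) (w * v)"
 proof (subst k_eq[OF U])
  obtain z where z: "z : W" "z * (w1 * c - w * c1) : L" using 1(5) by (auto simp: sat_def)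
  have vu: "v2 * u : U" using goodD(8)[OF U] C uw(3) by blast
  have "z * ((w1 * c - w * c1) * (v2 * u)) : L" using Q.idl_mult[OF Q.L_idl _ z(2), of "v2 * u"] C by (simp add: mult_ac)
  moreover have "(w1 * c - w * c1) * (v2 * u) : U" using goodD(8)[OF U _ vu] C uw(1) 1(1) by auto
  ultimately have "(w1 * c - w * c1) * (v2 * u) : V U" using z(1) by (auto simp: sat_def)
  then have "(- 1) * ((w1 * c - w * c1) * (v2 * u)) + (- (w * c1)) * (v2 * u - v * u2) : V U"
   using Q.idl_lin[OF V_facts(1)[OF U], of "- 1" "- (w * c1)"] 2(5) C 1(1) by simp
  then show "w * v * (c1 * u2) - w1 * v2 * (c * u) : V U" by (simp add: algebra_simps)
 qed (use uw 1 2 C W_facts goodD(6,8)[OF U] in auto)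
 finally show "frac A (Md U) W' (x \<odot>\<^bsub>Md U\<^esub> y) (s \<otimes> t) = k U (c * u) (w * v)" .
qed

lemma k_in: "u : U ==> w : W ==> k U u w : {k U u w | u w. u : U & w : W}"
 by blast

lemma k_cancel: "good U ==> u : U ==> w : W ==> v : W ==> k U (v * u) (v * w) = k U u w"
 using k_eq[of U "v * u" "v * w" u w] goodD(8)[of U v u] W_facts V_facts(1)[of U] idlD(2) by (auto simp: algebra_simps)

lemma loc_module_simps:
 assumes U: "good U"
 shows "carrier (loc_module A W' (Md U)) = {k U u w | u w. u : U & w : W}"
  "\<zero>\<^bsub>loc_module A W' (Md U)\<^esub> = k U 0 1"
  "(\<oplus>\<^bsub>loc_module A W' (Md U)\<^esub>) = frac_add A (Md U) W'"
  "(\<odot>\<^bsub>loc_module A W' (Md U)\<^esub>) = frac_smult A (Md U) W'"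
 unfolding loc_module_def by (auto simp: W'_eq scalar_module_def Q.h_one Q.h_zero)

lemma loc_ring_simps:
 "carrier (loc_ring A W') = {k C c w | c w. c : C & w : W}"
 "\<zero>\<^bsub>loc_ring A W'\<^esub> = k C 0 1" "\<one>\<^bsub>loc_ring A W'\<^esub> = k C 1 1"
 "(\<oplus>\<^bsub>loc_ring A W'\<^esub>) = frac_add A (Md C) W'"
 "(\<otimes>\<^bsub>loc_ring A W'\<^esub>) = frac_smult A (Md C) W'"
 unfolding loc_ring_def Md_C by (auto simp: W'_eq Q.h_one Q.h_zero) (auto simp: carrier_eq)

lemma loc_group:
 fixes G :: "(('c \<times> 'c) set, 'z) ring_scheme"
 assumes U: "good U" and G: "carrier G = {k U u w | u w. u : U & w : W}" "\<zero>\<^bsub>G\<^esub> = k U 0 1" "(\<oplus>\<^bsub>G\<^esub>) = frac_add A (Md U) W'"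
 shows "abelian_group G"
proof (rule abelian_groupI)
 note uU = goodD[OF U]
 fix x y assume "x : carrier G" "y : carrier G"
 then obtain u w u' w' where xy: "u : U" "w : W" "x = k U u w" "u' : U" "w' : W" "y = k U u' w'" unfolding G by auto
 show "x \<oplus>\<^bsub>G\<^esub> y : carrier G" unfolding G xy k_add[OF U xy(1,2,4,5)] using xy uU(6,8) W_facts by (intro k_in) simp_all
 show "x \<oplus>\<^bsub>G\<^esub> y = y \<oplus>\<^bsub>G\<^esub> x" unfolding G using xy by (simp add: k_add[OF U] algebra_simps)
 fix z assume "z : carrier G"
 then obtain u'' w'' where z: "u'' : U" "w'' : W" "z = k U u'' w''" unfolding G by auto
 show "x \<oplus>\<^bsub>G\<^esub> y \<oplus>\<^bsub>G\<^esub> z = x \<oplus>\<^bsub>G\<^esub> (y \<oplus>\<^bsub>G\<^esub> z)"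
  unfolding G using xy z uU(6,8) W_facts by (simp add: k_add[OF U]) (simp add: algebra_simps)
next
 note uU = goodD[OF U]
 show "\<zero>\<^bsub>G\<^esub> : carrier G" unfolding G using uU W_facts(1) by blast
 fix x assume "x : carrier G"
 then obtain u w where x: "u : U" "w : W" "x = k U u w" unfolding G by auto
 show "\<zero>\<^bsub>G\<^esub> \<oplus>\<^bsub>G\<^esub> x = x" unfolding G using x uU(4) W_facts(1) by (simp add: k_add[OF U])
 have "k U (- u) w \<oplus>\<^bsub>G\<^esub> x = k U 0 (w * w)" unfolding G using x uU(9) by (simp add: k_add[OF U])
 also have "\<dots> = \<zero>\<^bsub>G\<^esub>" unfolding G using k_cancel[OF U uU(4) W_facts(1), of "w * w"] x W_facts(2) by simp
 finally show "EX y:carrier G. y \<oplus>\<^bsub>G\<^esub> x = \<zero>\<^bsub>G\<^esub>" unfolding G using x uU(9) by blast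
qed

lemma loc_cring: "cring (loc_ring A W')" (is "cring ?G")
proof (rule cringI)
 show "abelian_group ?G" by (rule loc_group[OF good_C]) (rule loc_ring_simps)+
 show "comm_monoid ?G"
 proof (rule comm_monoidI)
  show "\<one>\<^bsub>?G\<^esub> : carrier ?G" unfolding loc_ring_simps using W_facts(1) by blast
 next
  fix x assume "x : carrier ?G"
  then show "\<one>\<^bsub>?G\<^esub> \<otimes>\<^bsub>?G\<^esub> x = x" unfolding loc_ring_simps using W_facts(1) by (auto simp: k_smult[OF good_C])
 next
  fix x y z assume "x : carrier ?G" "y : carrier ?G" "z : carrier ?G"
  then obtain c w c' w' c'' w'' where *: "x = k C c w" "c : C" "w : W" "y = k C c' w'" "c' : C" "w' : W" "z = k C c'' w''" "c'' : C" "w'' : W"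
   unfolding loc_ring_simps by auto
  show "x \<otimes>\<^bsub>?G\<^esub> y \<otimes>\<^bsub>?G\<^esub> z = x \<otimes>\<^bsub>?G\<^esub> (y \<otimes>\<^bsub>?G\<^esub> z)"
   unfolding loc_ring_simps using * W_facts by (simp add: k_smult[OF good_C] mult_ac)
 next
  fix x y assume "x : carrier ?G" "y : carrier ?G"
  then obtain c w c' w' where *: "x = k C c w" "c : C" "w : W" "y = k C c' w'" "c' : C" "w' : W"
   unfolding loc_ring_simps by auto
  show "x \<otimes>\<^bsub>?G\<^esub> y = y \<otimes>\<^bsub>?G\<^esub> x" unfolding loc_ring_simps using * by (simp add: k_smult[OF good_C] mult_ac)
  show "x \<otimes>\<^bsub>?G\<^esub> y : carrier ?G" unfolding loc_ring_simps *(1,4) k_smult[OF good_C *(2,3,5,6)] using * W_facts by (intro k_in) simp_all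
 qed
next
 fix x y z assume "x : carrier ?G" "y : carrier ?G" "z : carrier ?G"
 then obtain c w c' w' c'' w'' where *: "x = k C c w" "c : C" "w : W" "y = k C c' w'" "c' : C" "w' : W" "z = k C c'' w''" "c'' : C" "w'' : W"
  unfolding loc_ring_simps by auto
 have "(x \<oplus>\<^bsub>?G\<^esub> y) \<otimes>\<^bsub>?G\<^esub> z = k C ((w' * c + w * c') * c'') (w * w' * w'')"
  unfolding loc_ring_simps using * W_facts by (simp add: k_smult[OF good_C] k_add[OF good_C])
 also have "\<dots> = k C (w'' * ((w' * c + w * c') * c'')) (w'' * (w * w' * w''))"
  using * W_facts by (intro k_cancel[OF good_C, symmetric]) auto
 also have "\<dots> = x \<otimes>\<^bsub>?G\<^esub> z \<oplus>\<^bsub>?G\<^esub> y \<otimes>\<^bsub>?G\<^esub> z"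
  unfolding loc_ring_simps using * W_facts by (simp add: k_smult[OF good_C] k_add[OF good_C]) (simp add: algebra_simps)
 finally show "(x \<oplus>\<^bsub>?G\<^esub> y) \<otimes>\<^bsub>?G\<^esub> z = x \<otimes>\<^bsub>?G\<^esub> z \<oplus>\<^bsub>?G\<^esub> y \<otimes>\<^bsub>?G\<^esub> z" .
qed

lemma module_loc: assumes U: "good U" shows "module (loc_ring A W') (loc_module A W' (Md U))" (is "module ?G ?M")
proof (rule moduleI)
 note uU = goodD[OF U]
 show "cring ?G" by (rule loc_cring)
 show "abelian_group ?M" by (rule loc_group[OF U]) (rule loc_module_simps[OF U])+
 note [simp] = k_smult[OF U] k_add[OF U] k_smult[OF good_C] k_add[OF good_C]
 {
  fix a x assume "a : carrier ?G" "x : carrier ?M"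
  then obtain c w u v where ax: "a = k C c w" "c : C" "w : W" "x = k U u v" "u : U" "v : W"
   unfolding loc_ring_simps loc_module_simps[OF U] by auto
  show "a \<odot>\<^bsub>?M\<^esub> x : carrier ?M" unfolding loc_module_simps[OF U] ax(1,4) k_smult[OF U ax(2,3,5,6)] using ax uU(8) W_facts by (intro k_in) simp_all
  {
   fix b assume "b : carrier ?G"
   then obtain c' w' where b: "b = k C c' w'" "c' : C" "w' : W" unfolding loc_ring_simps by auto
   show "(a \<otimes>\<^bsub>?G\<^esub> b) \<odot>\<^bsub>?M\<^esub> x = a \<odot>\<^bsub>?M\<^esub> (b \<odot>\<^bsub>?M\<^esub> x)"
    unfolding loc_ring_simps loc_module_simps[OF U] using ax b W_facts uU(8) by (simp add: mult_ac)
   have "(a \<oplus>\<^bsub>?G\<^esub> b) \<odot>\<^bsub>?M\<^esub> x = k U ((w' * c + w * c') * u) (w * w' * v)"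
    unfolding loc_ring_simps loc_module_simps[OF U] using ax b W_facts by simp
   also have "\<dots> = k U (v * ((w' * c + w * c') * u)) (v * (w * w' * v))"
    using ax b W_facts uU(8) by (intro k_cancel[OF U, symmetric]) auto
   also have "\<dots> = a \<odot>\<^bsub>?M\<^esub> x \<oplus>\<^bsub>?M\<^esub> b \<odot>\<^bsub>?M\<^esub> x"
    unfolding loc_module_simps[OF U] using ax b W_facts uU(8) by simp (simp add: algebra_simps)
   finally show "(a \<oplus>\<^bsub>?G\<^esub> b) \<odot>\<^bsub>?M\<^esub> x = a \<odot>\<^bsub>?M\<^esub> x \<oplus>\<^bsub>?M\<^esub> b \<odot>\<^bsub>?M\<^esub> x" .
  next
   fix y assume "y : carrier ?M"
   then obtain u' v' where y: "y = k U u' v'" "u' : U" "v' : W" unfolding loc_module_simps[OF U] by auto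
   have "a \<odot>\<^bsub>?M\<^esub> (x \<oplus>\<^bsub>?M\<^esub> y) = k U (c * (v' * u + v * u')) (w * (v * v'))"
    unfolding loc_module_simps[OF U] using ax y W_facts uU(6,8) by simp
   also have "\<dots> = k U (w * (c * (v' * u + v * u'))) (w * (w * (v * v')))"
    using ax y W_facts uU(6,8) by (intro k_cancel[OF U, symmetric]) auto
   also have "\<dots> = a \<odot>\<^bsub>?M\<^esub> x \<oplus>\<^bsub>?M\<^esub> a \<odot>\<^bsub>?M\<^esub> y"
    unfolding loc_module_simps[OF U] using ax y W_facts uU(8) by simp (simp add: algebra_simps)
   finally show "a \<odot>\<^bsub>?M\<^esub> (x \<oplus>\<^bsub>?M\<^esub> y) = a \<odot>\<^bsub>?M\<^esub> x \<oplus>\<^bsub>?M\<^esub> a \<odot>\<^bsub>?M\<^esub> y" .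
  }
 }
 fix x assume "x : carrier ?M"
 then show "\<one>\<^bsub>?G\<^esub> \<odot>\<^bsub>?M\<^esub> x = x" unfolding loc_ring_simps loc_module_simps[OF U] using W_facts(1) by auto
qed

lemma loc_mod_loc:
 assumes U: "good U"
 shows "loc_mod C (loc_ring A W') (V C) W (%c. k C c 1) (loc_module A W' (Md U)) U (V U) (%u. k U u 1)"
proof -
 interpret G: cring "loc_ring A W'" by (rule loc_cring)
 interpret M: module "loc_ring A W'" "loc_module A W' (Md U)" by (rule module_loc[OF U])
 note uU = goodD[OF U] and [simp] = k_smult[OF U] k_add[OF U] k_smult[OF good_C] k_add[OF good_C]
 have surj: "EX w:W. EX u:U'. frac_smult A (Md U') W' (k C w 1) x = k U' u 1"
  if U': "good U'" and x: "x : {k U' u w | u w. u : U' & w : W}" for U' x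
 proof -
  obtain u w where uw: "u : U'" "w : W" "x = k U' u w" using x by blast
  then have "frac_smult A (Md U') W' (k C w 1) x = k U' u 1"
   using k_smult[OF U' W_facts(3) W_facts(1) uw(1,2)] k_cancel[OF U' uw(1) W_facts(1) uw(2)] by simp
  then show ?thesis using uw by blast
 qed
 show ?thesis
 proof
  show "is_mult C W" by (rule W_mult)
  show "V C <= C" "V U <= U" "is_ideal C U" using V_facts[OF good_C] V_facts[OF U] uU(1) by auto
  show "k C w 1 : Units (loc_ring A W')" if w: "w : W" for w
  proof -
   have "k C w w = k C 1 1" using k_cancel[OF good_C _ W_facts(1) w, of 1] by simp
   then have "k C 1 w \<otimes>\<^bsub>loc_ring A W'\<^esub> k C w 1 = \<one>\<^bsub>loc_ring A W'\<^esub>" "k C w 1 \<otimes>\<^bsub>loc_ring A W'\<^esub> k C 1 w = \<one>\<^bsub>loc_ring A W'\<^esub>"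
    using w W_facts unfolding loc_ring_simps by simp_all
   moreover have "k C 1 w : carrier (loc_ring A W')" "k C w 1 : carrier (loc_ring A W')"
    using w W_facts unfolding loc_ring_simps by blast+
   ultimately show ?thesis unfolding Units_def by blast
  qed
  show "EX w:W. EX c:C. k C w 1 \<otimes>\<^bsub>loc_ring A W'\<^esub> \<alpha> = k C c 1" if "\<alpha> : carrier (loc_ring A W')" for \<alpha>
   using surj[OF good_C] that unfolding loc_ring_simps by blast
  show "EX w:W. EX u:U. k C w 1 \<odot>\<^bsub>loc_module A W' (Md U)\<^esub> m = k U u 1" if "m : carrier (loc_module A W' (Md U))" for m
   using surj[OF U] that unfolding loc_module_simps[OF U] by blast
  show "k C c 1 = \<zero>\<^bsub>loc_ring A W'\<^esub> \<longleftrightarrow> c : V C" if "c : C" for c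
   unfolding loc_ring_simps using k_eq[OF good_C that W_facts(1) goodD(4)[OF good_C] W_facts(1)] by simp
  show "k U u 1 = \<zero>\<^bsub>loc_module A W' (Md U)\<^esub> \<longleftrightarrow> u : V U" if "u : U" for u
   unfolding loc_module_simps[OF U] using k_eq[OF U that W_facts(1) uU(4) W_facts(1)] by simp
  show "k C c 1 : carrier (loc_ring A W')" if "c : C" for c unfolding loc_ring_simps using that W_facts(1) by (rule k_in)
  show "k U u 1 : carrier (loc_module A W' (Md U))" if "u : U" for u unfolding loc_module_simps[OF U] using that W_facts(1) by (rule k_in)
 qed (unfold loc_ring_simps loc_module_simps[OF U], use W_facts(1) uU(6,8) in \<open>simp_all add: k_in\<close>)
qed

lemma loc_max_eq: "loc_max_ideal A (h ` P) = loc_pres.ext (loc_ring A W') W (%c. k C c 1) P"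
proof -
 interpret LP: loc_mod C "loc_ring A W'" "V C" W "%c. k C c 1" "loc_module A W' (Md C)" C "V C" "%u. k C u 1"
  by (rule loc_mod_loc[OF good_C])
 note gP = goodD[OF good_P]
 have "x : LP.ext P \<longleftrightarrow> (EX p:P. EX w:W. x = k C p w)" for x
 proof
  assume "x : LP.ext P"
  then obtain w c where wc: "x : carrier (loc_ring A W')" "w : W" "c : P" "k C w 1 \<otimes>\<^bsub>loc_ring A W'\<^esub> x = k C c 1"
   by (auto simp: LP.ext_def)
  obtain b v where x: "x = k C b v" "b : C" "v : W" using wc(1) unfolding loc_ring_simps by blast
  have "k C (w * b) (1 * v) = k C c 1" using wc(4) k_smult[OF good_C W_facts(3)[OF wc(2)] W_facts(1) x(2,3)] unfolding x(1) loc_ring_simps by simp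
  then have "1 * (w * b) - (1 * v) * c : V C"
   using k_eq[OF good_C _ _ _ W_facts(1), of "w * b" "1 * v" c] wc x gP(5) W_facts by simp
  then obtain z where z: "z : W" "z * (w * b - v * c) : P" using L_P by (auto simp: sat_def)
  have "w * b - v * c : C"
   using Q.diff_mem[OF Q.mult_mem[OF W_facts(3)[OF wc(2)] x(2)] Q.mult_mem[OF W_facts(3)[OF x(3)] gP(5)[OF wc(3)]]] .
  then have "w * b - v * c : P" using prmD(3)[OF P_prime _ _ z(2)] z(1) by blast
  moreover have "v * c : P" using gP(8) x(3) wc(3) by blast
  ultimately have "w * b : P" using gP(6)[of "w * b - v * c" "v * c"] by simp
  then have "b : P" using prmD(3)[OF P_prime, of w b] wc(2) x(2) by blast
  then show "EX p:P. EX w:W. x = k C p w" using x by blast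
 next
  assume "EX p:P. EX w:W. x = k C p w"
  then obtain p w where p: "p : P" "w : W" "x = k C p w" by blast
  have "k C w 1 \<otimes>\<^bsub>loc_ring A W'\<^esub> x = k C (w * p) (1 * w)" using k_smult[OF good_C W_facts(3)[OF p(2)] W_facts(1) gP(5)[OF p(1)] p(2)]
   unfolding p(3) loc_ring_simps by simp
  also have "\<dots> = k C p 1" using k_cancel[OF good_C gP(5)[OF p(1)] W_facts(1) p(2)] by simp
  finally have "k C w 1 \<otimes>\<^bsub>loc_ring A W'\<^esub> x = k C p 1" .
  moreover have "x : carrier (loc_ring A W')" unfolding loc_ring_simps p(3) using gP(5)[OF p(1)] p(2) by (rule k_in)
  ultimately show "x : LP.ext P" by (intro LP.extI[OF _ p(2,1)])
 qed
 moreover have "loc_max_ideal A (h ` P) = {x. EX p:P. EX w:W. x = k C p w}"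
  unfolding loc_max_ideal_def Md_C W'_eq by blast
 ultimately show ?thesis by (simp only: set_eq_iff mem_Collect_eq simp_thms)
qed

text \<open>Depth is read off from numerators, dimension from chains of primes of C that lie above
  the annihilator of U/L and end at P.\<close>

lemma cm_local_iff:
 assumes N: "noeth_subring C" and U: "good U"
 shows "cm_local (loc_ring A W') (loc_max_ideal A (h ` P)) (loc_module A W' (Md U)) \<longleftrightarrow>
  V U = U \<or> Sup {enat (length xs) | xs. set xs <= P & regseq W U (V U) xs} = Sup {enat n | n. pchain C (colon C L U) n P}"
proof -
 interpret N: noeth_subring C by (rule N)
 interpret LP: loc_mod C "loc_ring A W'" "V C" W "%c. k C c 1" "loc_module A W' (Md U)" U "V U" "%u. k U u 1"
  by (rule loc_mod_loc[OF U])
 have VP: "V C <= P" using L_P prmD(3)[OF P_prime] by (fastforce simp: sat_def)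
 have pre: "LP.pre (LP.ext P) = P" using LP.pre_ext[OF P_prime VP] by blast
 have dep: "depth (loc_ring A W') (loc_max_ideal A (h ` P)) (loc_module A W' (Md U)) =
   Sup {enat (length xs) | xs. set xs <= P & regseq W U (V U) xs & quo W U (V U) xs ~= U}"
  using LP.depth_eq[OF LP.ext_ideal[OF goodD(1)[OF good_P]]] by (simp only: loc_max_eq pre)
 \<comment> \<open>Properness of the last quotient, demanded by \<open>regular_sequence\<close>:
   Nakayama gives a proper Z above V U that absorbs PU.\<close>
 have quo: "quo W U (V U) xs ~= U" if ne: "V U ~= U" "set xs <= P" for xs
 proof -
  obtain Z where Z: "Q.clsd W U Z" "V U <= Z" "Z ~= U" "ALL p:P. ALL u:U. p * u : Z"
   using N.nakayama[OF P_prime V_clsd[OF U] ne(1)] by blast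
  have "quo W U (V U) xs <= Z" using Q.quo_least[OF V_clsd[OF U] W_mult _ Z(1,2)] ne(2) Z(4) goodD(5)[OF good_P] by blast
  then show ?thesis using Z(3) Q.clsdD(3)[OF Z(1)] by blast
 qed
 \<comment> \<open>The annihilator commutes with localization: if c kills U locally,
   \<open>sat_uniform\<close> for L + cU gives a single w outside P with wc in the annihilator of
   U/L.\<close>
 have colon: "colon C (V U) U <= q" if q: "is_prime C q" "q <= P" "colon C L U <= q" for q
 proof
  fix c assume c: "c : colon C (V U) U"
  then have cC: "c : C" by (simp add: colon_def)
  let ?Y = "isum L ((*) c ` U)"
  have Y: "is_ideal C ?Y" "L <= ?Y" using Q.idl_isum[OF Q.L_idl Q.idl_image[OF goodD(1)[OF U] cC]] Q.isum_upper1[OF Q.idl_image[OF goodD(1)[OF U] cC]] by auto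
  have "?Y <= sat W ?Y L"
  proof
   fix y assume y: "y : ?Y"
   then obtain l u where lu: "l : L" "u : U" "y = l + c * u" by (auto elim!: isumE)
   obtain w where w: "w : W" "w * (c * u) : L" using c lu(2) by (auto simp: colon_def sat_def)
   have "w * y : L" unfolding lu(3) distrib_left using w Q.idl_add[OF Q.L_idl] Q.idl_mult[OF Q.L_idl _ lu(1)] by auto
   then show "y : sat W ?Y L" using y w(1) by (auto simp: sat_def)
  qed
  then obtain w where w: "w : W" "ALL y:?Y. w * y : L" using N.sat_uniform[OF Y(1) Q.L_idl Y(2) W_mult] by blast
  have "(w * c) * u : L" if "u : U" for u
   using w(2) Q.isum_upper2[OF Q.L_idl, of "(*) c ` U"] that by (auto simp: mult.assoc)
  then have "w * c : q" using q(3) w(1) cC by (auto simp: colon_def)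
  then show "c : q" using prmD(3)[OF q(1), of w c] w(1) cC q(2) by blast
 qed
 have "(EX Q. pchain C (colon C (V U) U) n Q & Q \<inter> W = {}) \<longleftrightarrow> pchain C (colon C L U) n P" for n
 proof
  assume "EX Q. pchain C (colon C (V U) U) n Q & Q \<inter> W = {}"
  then obtain q where q: "pchain C (colon C (V U) U) n q" "q \<inter> W = {}" by blast
  have "q <= C" using idlD(1)[OF prmD(1)[OF pchain_prime[OF q(1)]]] .
  moreover have "colon C L U <= colon C (V U) U" using V_facts(3)[OF U] by (auto simp: colon_def)
  ultimately show "pchain C (colon C L U) n P" using pchain_top[OF pchain_anti[OF q(1)] _ P_prime] q(2) by blast
 next
  assume P: "pchain C (colon C L U) n P"
  then obtain q where q: "is_prime C q" "colon C L U <= q" "pchain C q n P" using pchain_bottom by blast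
  have "pchain C (colon C (V U) U) n P" using pchain_anti[OF q(3) colon[OF q(1) pchain_sub[OF q(3)] q(2)]] .
  then show "EX Q. pchain C (colon C (V U) U) n Q & Q \<inter> W = {}" by blast
 qed
 then have dim: "module_dim (loc_ring A W') (loc_module A W' (Md U)) = Sup {enat n | n. pchain C (colon C L U) n P}"
  unfolding LP.module_dim_eq by (intro arg_cong[of _ _ Sup]) blast
 show ?thesis
 proof (cases "V U = U")
  case False
  then have "{enat (length xs) | xs. set xs <= P & regseq W U (V U) xs & quo W U (V U) xs ~= U} =
   {enat (length xs) | xs. set xs <= P & regseq W U (V U) xs}" using quo by blast
  then show ?thesis unfolding cm_local_def dep dim LP.carrier_zero_iff using False by simp
 qed (simp add: cm_local_def LP.carrier_zero_iff)
qed

text \<open>Regular sequences are bounded by chains, chains by the length of ys through Krull's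
  theorem, and ys is itself regular. If the annihilator is not inside P, the localization is
  zero.\<close>

lemma cm_localI:
 assumes N: "noeth_subring C" and U: "good U"
  and seq: "colon C L U <= P ==> EX ys. set ys <= P & regseq W U (V U) ys & min_over C (colon C L U \<union> set ys) P"
 shows "cm_local (loc_ring A W') (loc_max_ideal A (h ` P)) (loc_module A W' (Md U))"
proof (cases "colon C L U <= P")
 case True
 interpret N: noeth_subring C by (rule N)
 let ?X = "{enat (length xs) | xs. set xs <= P & regseq W U (V U) xs}" and ?Y = "{enat n | n. pchain C (colon C L U) n P}"
 obtain ys where ys: "set ys <= P" "regseq W U (V U) ys" "min_over C (colon C L U \<union> set ys) P" using seq True by blast
 have "?X <= ?Y"
  using N.chain_of_regseq_sat[OF W_mult P_prime order_refl goodD(1)[OF U] Q.L_idl goodD(2)[OF U] True] by blast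
 then have "Sup ?X <= Sup ?Y" by (rule Sup_subset_mono)
 moreover have "Sup ?Y <= enat (length ys)"
  using N.krull_height[OF ys(3) subset_trans[OF ys(1) goodD(3)[OF good_P]]] by (intro Sup_least) auto
 moreover have "enat (length ys) <= Sup ?X" using ys by (intro Sup_upper) blast
 ultimately have "Sup ?X = Sup ?Y" by order
 then show ?thesis using cm_local_iff[OF N U] by blast
next
 case False
 then obtain c where "c : W" "ALL u:U. c * u : L" by (auto simp: colon_def)
 then have "V U = U" using V_facts(2)[OF U] by (auto simp: sat_def)
 then show ?thesis using cm_local_iff[OF N U] by blast
qed

lemma cm_localD:
 assumes N: "noeth_subring C" and U: "good U" "V U ~= U"
  and cm: "cm_local (loc_ring A W') (loc_max_ideal A (h ` P)) (loc_module A W' (Md U))"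
  and n: "pchain C (colon C L U) n P" "!!m. pchain C (colon C L U) m P ==> m <= n"
 shows "dpt W P n U (V U)"
proof -
 let ?X = "{enat (length xs) | xs. set xs <= P & regseq W U (V U) xs}" and ?Y = "{enat n | n. pchain C (colon C L U) n P}"
 have "enat n <= Sup ?Y" using n(1) by (intro Sup_upper) blast
 moreover have "Sup ?X = Sup ?Y" using cm_local_iff[OF N U(1)] U(2) cm by blast
 ultimately show ?thesis using dpt_Sup[of n P W U "V U"] by simp
qed

end

lemma scalar_module_simps [simp]:
 "carrier (scalar_module h A) = carrier A" "\<zero>\<^bsub>scalar_module h A\<^esub> = \<zero>\<^bsub>A\<^esub>" "(\<oplus>\<^bsub>scalar_module h A\<^esub>) = (\<oplus>\<^bsub>A\<^esub>)"
 "x \<odot>\<^bsub>scalar_module h A\<^esub> y = h x \<otimes>\<^bsub>A\<^esub> y"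
 by (simp_all add: scalar_module_def)

lemma scalar_module_module:
 assumes "cring A" "cring D" "h : ring_hom A D" "ideal T D"
 shows "module A (scalar_module h D\<lparr>carrier := T\<rparr>)"
proof -
 interpret A: cring A by fact
 interpret D: cring D by fact
 interpret T: ideal T D by fact
 note hm = ring_hom_closed[OF assms(3)] ring_hom_mult[OF assms(3)] ring_hom_add[OF assms(3)] ring_hom_one[OF assms(3)]
 show ?thesis
 proof (rule moduleI)
  show "abelian_group (scalar_module h D\<lparr>carrier := T\<rparr>)"
  proof (rule abelian_groupI)
   show "EX y:carrier (scalar_module h D\<lparr>carrier := T\<rparr>). y \<oplus>\<^bsub>scalar_module h D\<lparr>carrier := T\<rparr>\<^esub> x = \<zero>\<^bsub>scalar_module h D\<lparr>carrier := T\<rparr>\<^esub>"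
    if "x : carrier (scalar_module h D\<lparr>carrier := T\<rparr>)" for x
    using that T.Icarr[of x] D.l_neg[of x] by (auto intro!: bexI[of _ "\<ominus>\<^bsub>D\<^esub> x"])
  qed (use T.Icarr in \<open>auto simp: D.a_ac\<close>)
 qed (use T.Icarr in \<open>auto simp: hm A.cring_axioms T.I_l_closed D.l_distr D.r_distr D.m_assoc intro: assms(1)\<close>)
qed

section \<open>Images of ideals and the Cohen--Macaulay property of quotients\<close>

context pres
begin

lemma pre_image: "is_ideal C U ==> L <= U ==> Q.pre (h ` U) = U"
 using h_mem Q.idl_mem by (auto simp: Q.pre_def)

lemma image_pre: "I <= carrier A ==> h ` Q.pre I = I"
 using carrier_eq by (auto simp: Q.pre_def)

lemma ideal_image:
 assumes "is_ideal C U" shows "ideal (h ` U) A"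
proof -
 have "Q.ext U = h ` U"
 proof
  show "h ` U <= Q.ext U" using Q.idl_mem[OF assms] by (auto simp: Q.ext_def Q.h_one)
  show "Q.ext U <= h ` U" by (auto simp: Q.ext_def Q.h_one)
 qed
 then show ?thesis using Q.ext_ideal[OF assms] by simp
qed

definition "gen G = \<Inter>{I. is_ideal C I & G <= I}"

lemma gen_idl: "G <= C ==> is_ideal C (gen G)" and gen_upper: "G <= gen G"
 and gen_least: "is_ideal C I ==> G <= I ==> gen G <= I"
 unfolding gen_def by (auto intro!: Q.idl_Inter)

lemma Idl_image: assumes "G <= C" shows "Idl (h ` G) = h ` gen (G \<union> L)"
proof
 have GL: "G \<union> L <= C" using assms Q.L_sub by blast
 show "Idl (h ` G) <= h ` gen (G \<union> L)"
  using gen_upper[of "G \<union> L"] by (intro Q.R.genideal_minimal ideal_image gen_idl[OF GL]) auto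
 have sub: "h ` G <= carrier A" using assms by auto
 have "gen (G \<union> L) <= Q.pre (Idl (h ` G))"
  using Q.pre_idl[OF Q.R.genideal_ideal[OF sub]] Q.R.genideal_self[OF sub] assms
  by (intro gen_least) (auto simp: Q.pre_def)
 then show "h ` gen (G \<union> L) <= Idl (h ` G)" by (auto simp: Q.pre_def)
qed

lemma L_idl: "is_ideal C L" by (rule Q.L_idl)

lemma noetherian: assumes "noeth_subring C" shows "noetherian_ring A"
proof (rule Q.R.noetherian_ringI)
 interpret T: noetherian_ring "tcr C" using noetherian_tcr Q.comm_subring_axioms assms by blast
 fix I assume I: "ideal I A"
 then have "ideal (Q.pre I) (tcr C)" using Q.pre_idl Q.ideal_tcr by blast
 from T.finetely_gen[OF this] obtain G where "G <= carrier (tcr C)" and G': "finite G" "Q.pre I = Idl\<^bsub>tcr C\<^esub> G" by blast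
 then have G: "G <= C" "finite G" "Q.pre I = Idl\<^bsub>tcr C\<^esub> G" by simp_all
 have "gen (G \<union> L) = Q.pre I"
 proof
  have "G <= Q.pre I" using G T.genideal_self by auto
  then show "gen (G \<union> L) <= Q.pre I" using Q.pre_idl[OF I] by (intro gen_least) auto
  show "Q.pre I <= gen (G \<union> L)" unfolding G(3) Q.genideal_tcr
   using gen_idl[of "G \<union> L"] gen_upper[of "G \<union> L"] G(1) Q.L_sub by blast
 qed
 then have "Idl (h ` G) = I" using Idl_image[OF G(1)] image_pre I by (simp add: ideal.axioms(1) additive_subgroup.a_subset)
 then show "EX G<=carrier A. finite G & I = Idl G" using G by (intro exI[of _ "h ` G"]) auto
qed

lemma mod_pres:
 assumes U: "is_ideal C U" "L <= U" shows "loc_mod C A L {1} h (Md U) U L h"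
proof -
 interpret M: module A "Md U"
  by (rule scalar_module_module) (use Q.R.cring_axioms ideal_image[OF U(1)] in \<open>auto intro: ring_hom_memI\<close>)
 show ?thesis
  by unfold_locales (use U Q.idl_mem[OF U(1)] in \<open>auto simp: Q.h_add Q.h_mult Q.h_one Q.h_ker\<close>)
qed

lemma fin_gen:
 assumes N: "noeth_subring C" and U: "is_ideal C U" "L <= U" shows "finitely_generated A (Md U)"
proof -
 interpret T: noetherian_ring "tcr C" using noetherian_tcr Q.comm_subring_axioms N by blast
 interpret M: loc_mod C A L "{1}" h "Md U" U L h by (rule mod_pres[OF U])
 have "ideal U (tcr C)" using U Q.ideal_tcr by blast
 from T.finetely_gen[OF this] obtain G where "G <= carrier (tcr C)" and G': "finite G" "U = Idl\<^bsub>tcr C\<^esub> G" by blast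
 then have G: "G <= C" "finite G" "U = Idl\<^bsub>tcr C\<^esub> G" by simp_all
 have GU: "G <= U" using G T.genideal_self by auto
 have "N = h ` U" if N: "submodule N A (Md U)" "h ` G <= N" for N
 proof
  show "N <= h ` U" using M.Md.submoduleE(1)[OF N(1)] by simp
  have "G <= M.preM N" using N(2) GU by (auto simp: M.preM_def)
  then have "Idl\<^bsub>tcr C\<^esub> G <= M.preM N"
   unfolding Q.genideal_tcr using Q.clsdD(2)[OF M.preM_clsd(1)[OF N(1)]] by (intro Inter_lower) simp
  then have "U <= M.preM N" using G(3) by simp
  then show "h ` U <= N" by (auto simp: M.preM_def)
 qed
 moreover have "submodule (h ` U) A (Md U)" using M.Md.carrier_is_submodule by simp
 ultimately have "span_module A (Md U) (h ` G) = h ` U" using GU unfolding span_module_def by blast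
 then show ?thesis unfolding finitely_generated_def using G(2) GU by (intro exI[of _ "h ` G"]) auto
qed

lemma maximal_image:
 assumes P: "is_maxl C P" "L <= P" shows "maximalideal (h ` P) A"
proof (rule maximalidealI)
 have Pp: "is_prime C P" using P(1) by (simp add: is_maxl_def)
 note Pi = prmD(1)[OF Pp]
 show "ideal (h ` P) A" by (rule ideal_image[OF Pi])
 show "carrier A ~= h ` P" using h_mem[OF Pi P(2), of 1] prmD(2)[OF Pp] by (metis Q.h_closed Q.one_mem)
 fix I assume I: "ideal I A" "h ` P <= I" "I <= carrier A"
 show "I = h ` P \<or> I = carrier A"
 proof (cases "I <= h ` P")
  case False
  then obtain x where x: "x : I" "x ~: h ` P" by blast
  then obtain c where "c : C" "x = h c" using carrier_eq I(3) by auto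
  with x have c: "c : C" "h c : I" "c ~: P" by auto
  then obtain e where e: "e : C" "1 - c * e : P" using P(1) by (auto simp: is_maxl_def)
  have "h (e * c) : I" using ideal.I_l_closed[OF I(1) c(2), of "h e"] e c by (simp add: Q.h_mult)
  moreover have "h (1 - c * e) : I" using I(2) e(2) by blast
  ultimately have "h ((1 - c * e) + e * c) : I"
   using Q.h_add[of "1 - c * e" "e * c"] c(1) e(1) additive_subgroup.a_closed[OF ideal.axioms(1)[OF I(1)]] by simp
  then have "\<one> : I" by (simp add: mult.commute Q.h_one)
  then show ?thesis using ideal.one_imp_carrier[OF I(1)] by blast
 qed (use I in blast)
qed

lemma quot_at: "is_prime C P ==> L <= P ==> quot_at C A L h P"
 by (simp add: quot_at_def quot_at_axioms_def pres_axioms)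

lemma CM_I:
 assumes N: "noeth_subring C" and U: "is_ideal C U" "L <= U"
  and seq: "!!P. is_prime C P ==> colon C L U <= P ==>
   EX ys. set ys <= P & regseq (C - P) U (sat (C - P) U L) ys & min_over C (colon C L U \<union> set ys) P"
 shows "cohen_macaulay_module A (Md U)"
 unfolding cohen_macaulay_module_def
proof (intro conjI allI impI)
 show "noetherian_ring A" by (rule noetherian[OF N])
 show "module A (Md U)" using mod_pres[OF U] by (simp add: loc_mod_def)
 show "finitely_generated A (Md U)" by (rule fin_gen[OF N U])
 fix P' assume P': "maximalideal P' A"
 then interpret P': maximalideal P' A .
 have pr: "primeideal P' A" using Q.R.maximalideal_prime[OF P'] .
 define P where "P = Q.pre P'"
 have P: "is_prime C P" "L <= P" using Q.pre_prime[OF pr] Q.pre_idl[OF P'.is_ideal] by (auto simp: P_def)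
 have e: "P' = h ` P" unfolding P_def using image_pre[OF P'.a_subset] by simp
 interpret at: quot_at C A L h P by (rule quot_at[OF P])
 show "cm_local (loc_ring A (carrier A - P')) (loc_max_ideal A P') (loc_module A (carrier A - P') (Md U))"
  unfolding e using at.cm_localI[OF N _ seq[OF P(1)]] U by (simp add: at.good_def)
qed

lemma CM_D:
 assumes "cohen_macaulay_module A (Md U)" "is_maxl C P" "L <= P"
 shows "cm_local (loc_ring A (carrier A - h ` P)) (loc_max_ideal A (h ` P)) (loc_module A (carrier A - h ` P) (Md U))"
 using assms maximal_image by (auto simp: cohen_macaulay_module_def)

lemma foldr_image: "set bs <= C ==> foldr (\<otimes>) (map h bs) \<one> = h (prod_list bs) & prod_list bs : C"
 by (induction bs) (simp_all add: Q.h_one Q.h_mult)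

lemma image_power: "c : C ==> h c [^] (n :: nat) = h (c ^ n)"
 by (induction n) (simp_all add: Q.h_one Q.h_mult Q.R.m_comm)

end

lemma ideal_power_simps:
 "ideal_power A I 0 = carrier A" "ideal_power A I (Suc n) = ideal_prod A (ideal_power A I n) I"
 by (simp_all add: nat_pow_def ideals_set_def)

lemma (in cring) ideal_power_ideal: "ideal I R ==> ideal (ideal_power R I s) R"
 by (induction s) (simp_all only: ideal_power_simps oneideal ideal_prod_is_ideal)

text \<open>Tests containment of a power on s-fold products only, by moving one factor at a time
  into the colon ideal of Z by y.\<close>

lemma (in cring) ideal_power_sub_iff:
 assumes I: "ideal I R" and Z: "ideal Z R"
 shows "ideal_power R I s <= Z \<longleftrightarrow> (ALL xs. length xs = s --> set xs <= I --> foldr (\<otimes>) xs \<one> : Z)"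
 using Z
proof (induction s arbitrary: Z)
 case 0
 interpret Z: ideal Z R by fact
 show ?case using Z.one_imp_carrier Z.a_subset unfolding ideal_power_simps by auto
next
 case (Suc s)
 interpret Z: ideal Z R by fact
 interpret I: ideal I R by (rule I)
 interpret P: ideal "ideal_power R I s" R by (rule ideal_power_ideal[OF I])
 have q: "ideal {x : carrier R. x \<otimes> y : Z} R" if y: "y : carrier R" for y
 proof (rule idealI)
  show "subgroup {x : carrier R. x \<otimes> y : Z} (add_monoid R)"
   by (rule add.subgroupI) (use y in \<open>auto simp: l_distr l_minus intro: exI[of _ \<zero>]\<close>)
  show "z \<otimes> x : {x : carrier R. x \<otimes> y : Z}" if "x : {x : carrier R. x \<otimes> y : Z}" "z : carrier R" for x z
   using that y by (auto simp: m_assoc Z.I_l_closed)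
  then show "x \<otimes> z : {x : carrier R. x \<otimes> y : Z}" if "x : {x : carrier R. x \<otimes> y : Z}" "z : carrier R" for x z
   using that by (simp add: m_comm)
 qed (rule ring_axioms)
 have "ideal_power R I (Suc s) <= Z \<longleftrightarrow> (ALL y:I. ideal_power R I s <= {x : carrier R. x \<otimes> y : Z})"
 proof
  assume "ideal_power R I (Suc s) <= Z"
  then show "ALL y:I. ideal_power R I s <= {x : carrier R. x \<otimes> y : Z}"
   unfolding ideal_power_simps using ideal_prod.prod[of _ "ideal_power R I s" _ I R] P.Icarr by blast
 next
  assume *: "ALL y:I. ideal_power R I s <= {x : carrier R. x \<otimes> y : Z}"
  show "ideal_power R I (Suc s) <= Z" unfolding ideal_power_simps
  proof
   fix x assume "x : ideal_prod R (ideal_power R I s) I"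
   then show "x : Z" by (induction rule: ideal_prod.induct) (use * in auto)
  qed
 qed
 also have "\<dots> \<longleftrightarrow> (ALL y:I. ALL xs. length xs = s --> set xs <= I --> foldr (\<otimes>) xs \<one> : {x : carrier R. x \<otimes> y : Z})"
  by (intro ball_cong refl Suc.IH q I.Icarr)
 also have "\<dots> \<longleftrightarrow> (ALL y:I. ALL xs. length xs = s --> set xs <= I --> foldr (\<otimes>) (y # xs) \<one> : Z)"
 proof -
  have car: "foldr (\<otimes>) xs \<one> : carrier R" if "set xs <= I" for xs using that I.Icarr by (induction xs) auto
  have "foldr (\<otimes>) (y # xs) \<one> = foldr (\<otimes>) xs \<one> \<otimes> y" if "set xs <= I" "y : I" for xs y
   using car[OF that(1)] I.Icarr[OF that(2)] by (simp add: m_comm)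
  then show ?thesis using car by auto
 qed
 also have "\<dots> \<longleftrightarrow> (ALL xs. length xs = Suc s --> set xs <= I --> foldr (\<otimes>) xs \<one> : Z)"
 proof
  assume L: "ALL y:I. ALL xs. length xs = s --> set xs <= I --> foldr (\<otimes>) (y # xs) \<one> : Z"
  show "ALL xs. length xs = Suc s --> set xs <= I --> foldr (\<otimes>) xs \<one> : Z"
  proof (intro allI impI)
   fix xs assume "length xs = Suc s" "set xs <= I"
   then show "foldr (\<otimes>) xs \<one> : Z" using L by (cases xs) auto
  qed
 next
  assume R: "ALL xs. length xs = Suc s --> set xs <= I --> foldr (\<otimes>) xs \<one> : Z"
  show "ALL y:I. ALL xs. length xs = s --> set xs <= I --> foldr (\<otimes>) (y # xs) \<one> : Z"
   by (intro ballI allI impI R[rule_format]) auto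
 qed
 finally show ?case .
qed

section \<open>Translation to quotient rings and modules\<close>

lemma ideal_prod_tcr: "ideal_prod ring_of_type_algebra I J = iprod I J"
proof
 show "ideal_prod ring_of_type_algebra I J <= iprod I J"
 proof
  fix x assume "x : ideal_prod ring_of_type_algebra I J"
  then show "x : iprod I J" by (induction rule: ideal_prod.induct) (auto intro: iprod.intros)
 qed
 show "iprod I J <= ideal_prod ring_of_type_algebra I J"
 proof
  fix x assume "x : iprod I J"
  then show "x : ideal_prod ring_of_type_algebra I J"
  proof (induction rule: iprod.induct)
   case (iprodI x y) then show ?case using ideal_prod.prod[of x I y J ring_of_type_algebra] by simp
  next
   case (iprod_add x y) then show ?case using ideal_prod.sum[of x ring_of_type_algebra I J y] by simp
  qed
 qed
qed

lemma ideal_power_ipow: "ideal_power ring_of_type_algebra I n = ipow I n"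
proof (induction n)
 case (Suc n)
 then show ?case unfolding ideal_power_simps(2) ideal_prod_tcr by simp
qed (unfold ideal_power_simps, simp)

lemma gen_ideal_genid: "gen_ideal n a = genid n a"
proof -
 have "u.idl (genid n a)" unfolding genid_def by (rule idl_genid)
 then have "Idl\<^bsub>tcr UNIV\<^esub> (a ` {1..n}) = genid n a"
  unfolding u.genideal_tcr using genid_mem[of _ n a] genid_least[of _ a n] by blast
 then show ?thesis unfolding gen_ideal_def by (subst tcr_UNIV)
qed

lemma genid_Suc: "genid (Suc g) a = adj (genid g a) (a (Suc g))"
proof
 have J: "u.idl (genid g a)" unfolding genid_def by (rule idl_genid)
 have I: "u.idl (genid (Suc g) a)" unfolding genid_def by (rule idl_genid)
 show "genid (Suc g) a <= adj (genid g a) (a (Suc g))"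
  using adj_upper[OF J, of "a (Suc g)"] subsetD[OF adj_upper(1)[OF J, of "a (Suc g)"] genid_mem[of _ g a]]
  by (intro genid_least adj_ideal[OF J]) (auto simp: le_Suc_eq)
 show "adj (genid g a) (a (Suc g)) <= genid (Suc g) a"
  unfolding adj_def using genid_mem[of _ "Suc g" a]
  by (intro u.isum_least[OF I] genid_least[OF I] u.image_principal_sub[OF I]) auto
qed

lemma (in comm_subring) pres_self: "pres C (tcr C) {0} (%x. x)"
proof -
 interpret A: cring "tcr C" by (rule cring_tcr)
 show ?thesis unfolding pres_def by unfold_locales (auto simp: is_mult_def Units_def)
qed

lemma (in pres) pres_quot: assumes "ideal I A" shows "pres C (A Quot I) (Q.pre I) (%c. I +> h c)"
 using Q.quot_pres[OF assms] by (simp add: pres_def)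

lemma (in pres) pre_image_isum: assumes "is_ideal C U" shows "Q.pre (h ` U) = isum U L"
proof -
 have "h c : h ` U \<longleftrightarrow> c : isum U L" if c: "c : C" for c
 proof
  assume "h c : h ` U"
  then obtain u where u: "u : U" "h c = h u" by blast
  then have "c - u : L" using Q.h_eq c Q.idl_mem[OF assms] by simp
  then show "c : isum U L" using isumI[OF u(1)] by fastforce
 next
  assume "c : isum U L"
  then obtain u l where ul: "u : U" "l : L" "c = u + l" by (auto elim: isumE)
  then have "h c = h u" using Q.h_eq[of c u] c Q.idl_mem[OF assms] by simp
  then show "h c : h ` U" using ul(1) by blast
 qed
 moreover have "isum U L <= C" using idlD(1)[OF Q.idl_isum[OF assms L_idl]] .
 ultimately show ?thesis by (auto simp: Q.pre_def)
qed

lemma (in pres) coset_mem: "c : C ==> is_ideal C U ==> h ` U +> h c = {h (u + c) | u. u : U}"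
 using Q.idl_mem[of U] unfolding a_r_coset_def' by (auto simp: Q.h_add) (metis Q.h_add)

lemma induced_map_eq: "U ~= {} ==> (!!u. u : U ==> F u = y) ==> induced_map F U = y"
proof -
 assume "U ~= {}" "!!u. u : U ==> F u = y"
 then have "F ` U = {y}" by auto
 then show ?thesis by (simp add: induced_map_def)
qed

lemma span_eq_zero_iff:
 assumes "module A M" shows "span_module A M G = {\<zero>\<^bsub>M\<^esub>} \<longleftrightarrow> G <= {\<zero>\<^bsub>M\<^esub>}"
proof -
 interpret module A M by fact
 have "submodule {\<zero>\<^bsub>M\<^esub>} A M" by (intro submoduleI) auto
 moreover have "\<zero>\<^bsub>M\<^esub> : span_module A M G"
  unfolding span_module_def using subgroup.one_closed[OF submodule.axioms(1)] by fastforce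
 ultimately show ?thesis using span_least[of "{\<zero>\<^bsub>M\<^esub>}" A M G] span_upper[of G A M] by blast
qed

section \<open>The Rees algebra and Sym I as quotients of B\<close>

context aci
begin

definition "II = genid (Suc g) a"

lemma rees_map_rho: "b : B ==> rees_map a b = \<rho> b"
proof -
 interpret E: coeff_hom "%r :: 'a. [:r:]" by unfold_locales (auto simp: one_pCons)
 have "rees_map a b = mev (%r. [:r:]) (%i. monom (a i) 1) b" for b by (simp add: rees_map_def mev_def)
 moreover assume "b : B"
 then have "mev (%r. [:r:]) (%i. monom (a i) 1) b = \<rho> b"
  unfolding B_def by (induction b rule: MP_induct) (simp_all add: E.mev_add E.mev_mult rho_var rho_add rho_mult)
 ultimately show ?thesis by simp
qed

lemma rho_image: "\<rho> ` B = RS II"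
proof -
 have "\<rho> ` B = (%q. poly q (monom cc 1)) ` pol (RS J)" unfolding psi_image[symmetric] by (auto simp: \<rho>_def image_image)
 also have "\<dots> = RS (adj J cc)"
  using eval_mem[OF u.idl_C J_idl] eval_surj[OF u.idl_C J_idl] by blast
 finally show ?thesis by (simp add: II_def genid_Suc J_def cc_def)
qed

lemma rees_eq: "rees_algebra II = tcr (\<rho> ` B)"
proof -
 have "u.idl II" unfolding II_def genid_def by (rule idl_genid)
 then have "RS II = {p. ALL j. coeff p j : ipow II j}" using RS_iff by blast
 then show ?thesis by (simp add: rees_algebra_def ideal_power_ipow rho_image)
qed

sublocale Re: pres B "tcr (\<rho> ` B)" LL \<rho>
proof -
 interpret A: comm_subring "\<rho> ` B" by (rule rees_subring)
 interpret A: cring "tcr (\<rho> ` B)" by (rule A.cring_tcr)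
 have "1 : Units (tcr (\<rho> ` B))" using comm_subring.one_mem[OF rees_subring] unfolding Units_def by (auto intro!: bexI[of _ 1])
 then show "pres B (tcr (\<rho> ` B)) LL \<rho>"
  unfolding pres_def by unfold_locales (auto simp: is_mult_def rho_add rho_mult LL_eq)
qed

definition "S = tcr B Quot LI"
definition "\<sigma> b = LI +>\<^bsub>tcr B\<^esub> b"

sublocale Sy: pres B S LI \<sigma>
proof -
 interpret T: pres B "tcr B" "{0}" "%x. x" by (rule G.pres_self)
 have "ideal LI (tcr B)" using LI_idl G.ideal_tcr by blast
 moreover have "T.Q.pre LI = LI" using idlD(1)[OF LI_idl] by (auto simp: T.Q.pre_def)
 moreover have "\<sigma> = (%b. LI +>\<^bsub>tcr B\<^esub> b)" by (auto simp: \<sigma>_def)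
 ultimately show "pres B S LI \<sigma>" using T.pres_quot[of LI] unfolding S_def by simp
qed

lemma rees_rel: "rees_relations (Suc g) a = LL"
 unfolding rees_relations_def gen_ideal_genid II_def[symmetric] rees_eq mpoly_ring_tcr B_def[symmetric] a_kernel_def'
 using rees_map_rho by (auto simp: LL_eq)

lemma lin_rel: "linear_relations_ideal (Suc g) a = LI"
proof -
 have rho_lform: "\<rho> (lform (Suc g) co) = monom (\<Sum>i\<in>{1..Suc g}. co i * a i) 1" for co
 proof -
  have "\<rho> (lform (Suc g) co) = (\<Sum>i\<in>{1..Suc g}. monom (co i * a i) 1)"
   unfolding lform_def rho_sum by (intro sum.cong refl) (simp add: rho_mult rho_var smult_monom)
  also have "\<dots> = monom (\<Sum>i\<in>{1..Suc g}. co i * a i) 1"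
   by (rule monom_sum[symmetric])
  finally show ?thesis .
 qed
 have "linear_relations (Suc g) a = {lform (Suc g) co | co. (\<Sum>i\<in>{1..Suc g}. co i * a i) = 0}"
 proof (intro subset_antisym subsetI)
  fix p assume p: "p : linear_relations (Suc g) a"
  then have pL: "p : LL" "ALL e:keys p. mdegree e = 1" by (auto simp: linear_relations_def rees_rel)
  then obtain co where co: "p = lform (Suc g) co" using degree_one_lform LL_sub_B unfolding B_def by blast
  then show "p : {lform (Suc g) co | co. (\<Sum>i\<in>{1..Suc g}. co i * a i) = 0}"
   using pL(1) rho_lform[of co] by (auto simp: LL_eq)
 next
  fix p assume "p : {lform (Suc g) co | co. (\<Sum>i\<in>{1..Suc g}. co i * a i) = 0}"
  then obtain co where co: "p = lform (Suc g) co" "(\<Sum>i\<in>{1..Suc g}. co i * a i) = 0" by blast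
  then show "p : linear_relations (Suc g) a"
   using rho_lform[of co] lform_MP[of "Suc g" "Suc g" co] keys_lform by (auto simp: linear_relations_def rees_rel LL_eq B_def)
 qed
 then show ?thesis
  unfolding linear_relations_ideal_def mpoly_ring_tcr B_def[symmetric] G.genideal_tcr LI_def by simp
qed

lemma sym_eq: "sym_algebra (Suc g) a = S" "sym_const (Suc g) a = (%r. \<sigma> (mconst r))"
 by (auto simp: sym_algebra_def S_def lin_rel mpoly_ring_tcr B_def sym_const_def \<sigma>_def)

lemma T_eq: "nonlinear_relations (Suc g) a = \<sigma> ` LL"
 by (auto simp: nonlinear_relations_def \<sigma>_def lin_rel rees_rel mpoly_ring_tcr B_def)

lemma LL_idl: "is_ideal B LL" by (rule prmD(1)[OF LL_prime])

lemma noeth_B: "noeth_subring B" by (rule G.noeth_subring_axioms)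

lemma CM_S: "cohen_macaulay_ring S"
 using Sy.CM_I[OF noeth_B G.idl_C idlD(1)[OF LI_idl]] S_cm
 by (simp add: cohen_macaulay_ring_def colon_LI_B Sy.Md_C)

lemma rees_max: "rees_max_ideal \<mm> II = \<rho> ` MB"
 unfolding rees_max_ideal_def rees_eq using coeff_eval_0[of _ cc] psi_00 by (auto simp: \<rho>_def MB_def)

text \<open>\<open>depth\<close> asks for a proper last quotient; here this is automatic, since
  dividing by elements of \<open>MB\<close> stays inside \<open>MB\<close>.\<close>

lemma depth_rees: "enat n <= depth (rees_algebra II) (rees_max_ideal \<mm> II) (self_module (rees_algebra II)) \<longleftrightarrow> dpt {1} MB n B LL"
proof -
 have LB: "LL <= B" by (rule LL_sub_B)
 interpret M: loc_mod B "tcr (\<rho> ` B)" LL "{1}" \<rho> "Re.Md B" B LL \<rho> by (rule Re.mod_pres[OF G.idl_C LB])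
 note cl = G.clsd_one[OF G.idl_C]
 have "quo {1} B LL xs ~= B" if "set xs <= MB" for xs
 proof -
  have "quo {1} B LL xs <= MB"
   using that idlD(1,5)[OF MB_idl]
   by (intro G.quo_least[OF cl[OF LL_idl LB] G.mult_one _ cl[OF MB_idl] LL_sub_MB]) blast+
  then show ?thesis using prmD(2)[OF MB_prime] G.one_mem by blast
 qed
 then have "{enat (length xs) | xs. set xs <= MB & regseq {1} B LL xs & quo {1} B LL xs ~= B} =
  {enat (length xs) | xs. set xs <= MB & regseq {1} B LL xs}" by blast
 then show ?thesis
  using M.depth_eq[OF Re.ideal_image[OF MB_idl]] dpt_Sup[of n MB "{1}" B LL]
  by (simp add: rees_max rees_eq Re.Md_C Re.pre_image[OF MB_idl LL_sub_MB])
qed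

lemma CM_T: "cohen_macaulay_module S (self_module S\<lparr>carrier := \<sigma> ` LL\<rparr>) \<longleftrightarrow> dpt {1} MB d B LL"
proof
 assume "dpt {1} MB d B LL"
 then show "cohen_macaulay_module S (self_module S\<lparr>carrier := \<sigma> ` LL\<rparr>)"
  using Sy.CM_I[OF noeth_B LL_idl LI_sub_LL] T_cm by blast
next
 assume cm: "cohen_macaulay_module S (self_module S\<lparr>carrier := \<sigma> ` LL\<rparr>)"
 show "dpt {1} MB d B LL"
 proof (cases "LI = LL")
  case True
  then show ?thesis using dpt_mono[OF dpt_S, of d] by simp
 next
  case False
  have LM: "LI <= MB" using LI_sub_LL LL_sub_MB by blast
  interpret at: quot_at B S LI \<sigma> MB by (rule Sy.quot_at[OF MB_prime LM])
  note s = sat_MB[OF LL_gr LI_gr LI_sub_LL]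
  have "dpt (B - MB) MB (Suc d) LL (sat (B - MB) LL LI)"
   using at.cm_localD[OF noeth_B _ _ Sy.CM_D[OF cm MB_maxl LM] T_chain[OF False] T_dim] LL_idl LI_sub_LL False
   by (simp add: at.good_def s)
  then show ?thesis using T_dpt dpt_local[OF LL_gr LI_gr LI_sub_LL] s by simp
 qed
qed

end

lemma foldr_tcr: "foldr (\<otimes>\<^bsub>ring_of_type_algebra\<^esub>) xs \<one>\<^bsub>ring_of_type_algebra\<^esub> = prod_list xs"
 by (induction xs) simp_all

lemma cring_R: "cring (ring_of_type_algebra :: 'a::comm_ring_1 ring)"
 by (subst tcr_UNIV) (rule u.cring_tcr)

lemma ideal_R: "ideal I ring_of_type_algebra \<longleftrightarrow> u.idl I"
 using u.ideal_tcr[of I] by (simp flip: tcr_UNIV)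

lemma scalar_module_cring:
 assumes "cring A" "cring D" "h : ring_hom A D" shows "module A (scalar_module h D)"
proof -
 interpret D: cring D by fact
 have "scalar_module h D\<lparr>carrier := carrier D\<rparr> = scalar_module h D" by (simp add: scalar_module_def)
 then show ?thesis using scalar_module_module[OF assms D.oneideal] by (simp only:)
qed

lemma a_inv_scalar [simp]: "a_inv (scalar_module h A) = a_inv A"
 by (rule ext) (simp add: a_inv_def m_inv_def)

section \<open>Special fiber, nilradical and powers\<close>

context aci
begin

lemma mB_idl: "is_ideal B mB" by (rule prmD(1)[OF mB_prime])

lemma const_hom: assumes "pres B A L h" shows "(%r. h (mconst r)) : ring_hom ring_of_type_algebra A"
proof -
 interpret P: pres B A L h by fact
 show ?thesis by (rule ring_hom_memI) (simp_all add: mconst_hom P.Q.h_add P.Q.h_mult P.Q.h_one)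
qed

lemma extended_eq: assumes "pres B A L h" shows "extended_ideal (%r. h (mconst r)) A \<mm> = h ` mB"
proof -
 interpret P: pres B A L h by fact
 let ?D = "scalar_module (%r. h (mconst r)) A" and ?G = "{r \<odot>\<^bsub>scalar_module (%r. h (mconst r)) A\<^esub> v | r v. r : \<mm> & v : carrier A}"
 interpret D: module ring_of_type_algebra ?D
  by (rule scalar_module_cring[OF cring_R P.Q.R.cring_axioms const_hom[OF assms]])
 interpret E: ideal "h ` mB" A by (rule P.ideal_image[OF mB_idl])
 have "submodule (h ` mB) ring_of_type_algebra ?D"
  by (rule D.submoduleI) (use E.Icarr E.I_l_closed E.a_inv_closed E.a_closed in auto)
 moreover have "?G <= h ` mB" using E.I_r_closed mB_const by auto
 moreover have "h ` mB <= N" if N: "submodule N ring_of_type_algebra ?D" "?G <= N" for N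
 proof -
  note sN = D.submoduleE[OF N(1)]
  have "\<zero>\<^bsub>A\<^esub> : N" using subgroup.one_closed[OF submodule.axioms(1)[OF N(1)]] by simp
  then have "mB <= {b : B. h b : N}"
  proof (intro mB_add)
   fix r c assume r: "r : \<mm>" and c: "c : B"
   have "h (mconst r) \<otimes>\<^bsub>A\<^esub> h c : ?G" unfolding scalar_module_simps using r P.Q.h_closed[OF c] by blast
   then have "h (mconst r) \<otimes>\<^bsub>A\<^esub> h c : N" using N(2) by blast
   then show "mconst r * c : {b : B. h b : N}" using c by (simp add: P.Q.h_mult)
  qed (use sN(5) in \<open>auto simp: P.Q.h_zero P.Q.h_add\<close>)
  then show ?thesis by blast
 qed
 ultimately show ?thesis unfolding extended_ideal_def ideal_smult_def span_module_def scalar_module_simps(1) by (intro subset_antisym Inter_lower Inter_greatest) blast+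
qed

lemma ext_S: "extended_ideal (sym_const (Suc g) a) (sym_algebra (Suc g) a) \<mm> = \<sigma> ` mB"
 unfolding sym_eq by (rule extended_eq) unfold_locales

lemma ext_rees: "extended_ideal (%r. [:r:]) (rees_algebra II) \<mm> = \<rho> ` mB"
 using extended_eq[OF Re.pres_axioms] by (simp add: rees_eq)

lemma N_eq: "nonlinear_relations (Suc g) a \<inter> extended_ideal (sym_const (Suc g) a) (sym_algebra (Suc g) a) \<mm> = \<sigma> ` NB"
proof -
 have "\<sigma> b : \<sigma> ` mB \<longleftrightarrow> b : isum mB LI" if "b : B" for b
  using Sy.pre_image_isum[OF mB_idl] that by (auto simp: Sy.Q.pre_def)
 then show ?thesis unfolding ext_S T_eq NB_def using LL_sub_B by auto
qed

lemma NB_idl: "is_ideal B NB"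
 unfolding NB_def by (rule G.idl_Int[OF LL_idl G.idl_isum[OF mB_idl LI_idl]])

definition "\<phi> b = \<sigma> ` mB +>\<^bsub>S\<^esub> \<sigma> b"

sublocale Fi: pres B "S Quot (\<sigma> ` mB)" "isum mB LI" \<phi>
proof -
 have "\<phi> = (%c. \<sigma> ` mB +>\<^bsub>S\<^esub> \<sigma> c)" by (auto simp: \<phi>_def)
 then show "pres B (S Quot (\<sigma> ` mB)) (isum mB LI) \<phi>"
  using Sy.pres_quot[OF Sy.ideal_image[OF mB_idl]] Sy.pre_image_isum[OF mB_idl] by simp
qed

text \<open>S/mS is B modulo mB + LI and the special fiber is B modulo mB + LL, so the kernel is (mB
  + LL)/(mB + LI). The first two facts identify the two nested induced maps on cosets.\<close>

lemma fiber_rel: "fiber_relations \<mm> (Suc g) a = \<phi> ` LL"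
proof -
 let ?A = "tcr (\<rho> ` B)"
 interpret SF: pres B "?A Quot (\<rho> ` mB)" "isum mB LL" "%b. \<rho> ` mB +>\<^bsub>?A\<^esub> \<rho> b"
  using Re.pres_quot[OF Re.ideal_image[OF mB_idl]] Re.pre_image_isum[OF mB_idl] by simp
 have S1: "induced_map (rees_map a) (\<sigma> b) = \<rho> b" if b: "b : B" for b
 proof (rule induced_map_eq)
  have s: "\<sigma> b = {l + b | l. l : LI}" by (auto simp: \<sigma>_def a_r_coset_def')
  then show "\<sigma> b ~= {}" using idlD(2)[OF LI_idl] by blast
  fix u assume "u : \<sigma> b"
  then obtain l where l: "l : LI" "u = l + b" using s by blast
  then have "l : B" "\<rho> l = 0" using LI_sub_LL by (auto simp: LL_eq)
  then show "rees_map a u = \<rho> b" using rees_map_rho[of u] l(2) b by (simp add: rho_add)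
 qed
 have S2: "induced_map (%x. \<rho> ` mB +>\<^bsub>?A\<^esub> induced_map (rees_map a) x) (\<phi> b) = \<rho> ` mB +>\<^bsub>?A\<^esub> \<rho> b" if b: "b : B" for b
 proof (rule induced_map_eq)
  have s: "\<phi> b = {\<sigma> (u + b) | u. u : mB}" unfolding \<phi>_def using Sy.coset_mem[OF b mB_idl] .
  then show "\<phi> b ~= {}" using idlD(2)[OF mB_idl] by blast
  fix x assume "x : \<phi> b"
  then obtain u where u: "u : mB" "x = \<sigma> (u + b)" using s by blast
  have uB: "u : B" using u(1) by (simp add: mB_iff)
  have "u : isum mB LL" using G.isum_upper1[OF LL_idl] u(1) by blast
  then have "\<rho> ` mB +>\<^bsub>?A\<^esub> \<rho> (u + b) = \<rho> ` mB +>\<^bsub>?A\<^esub> \<rho> b"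
   using SF.Q.h_eq[of "u + b" b] uB b by simp
  then show "\<rho> ` mB +>\<^bsub>?A\<^esub> induced_map (rees_map a) x = \<rho> ` mB +>\<^bsub>?A\<^esub> \<rho> b" using S1 uB b u(2) by simp
 qed
 have "fiber_relations \<mm> (Suc g) a = {x : carrier (S Quot (\<sigma> ` mB)).
   induced_map (%x. \<rho> ` mB +>\<^bsub>?A\<^esub> induced_map (rees_map a) x) x = \<zero>\<^bsub>?A Quot (\<rho> ` mB)\<^esub>}"
  unfolding fiber_relations_def sym_fiber_def special_fiber_def gen_ideal_genid II_def[symmetric] ext_S ext_rees a_kernel_def'
  by (simp add: sym_eq rees_eq)
 also have "\<dots> = \<phi> ` {b : B. b : isum mB LL}"
  unfolding Fi.carrier_eq using S2 SF.Q.h_ker by auto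
 also have "\<dots> = \<phi> ` LL"
 proof
  show "\<phi> ` {b : B. b : isum mB LL} <= \<phi> ` LL"
  proof clarify
   fix b assume "b : B" "b : isum mB LL"
   then obtain m l where ml: "m : mB" "l : LL" "b = m + l" by (auto elim: isumE)
   then have "\<phi> b = \<phi> l" using Fi.Q.h_eq[of b l] G.isum_upper1[OF LI_idl, of mB] LL_sub_B \<open>b : B\<close> by auto
   then show "\<phi> b : \<phi> ` LL" using ml(2) by blast
  qed
  show "\<phi> ` LL <= \<phi> ` {b : B. b : isum mB LL}" using LL_sub_B G.isum_upper2[OF mB_idl] by blast
 qed
 finally show ?thesis .
qed

lemma fiber_eq: "sym_fiber \<mm> (Suc g) a = S Quot (\<sigma> ` mB)" "b : B ==> sym_fiber_proj \<mm> (Suc g) a (\<sigma> b) = \<phi> b"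
 by (simp_all only: sym_fiber_def sym_fiber_proj_def ext_S) (simp_all only: sym_eq(1) \<phi>_def)

text \<open>Let Z be the preimage in B of the ideal generated by F. That F generates modulo the
  maximal ideal says LL is inside mB + Z, and the modular law for Z inside LL gives LL = NB +
  Z.\<close>

lemma T_decomp:
 assumes F: "F <= \<sigma> ` LL" and gen: "Idl\<^bsub>S Quot (\<sigma> ` mB)\<^esub> (sym_fiber_proj \<mm> (Suc g) a ` F) = \<phi> ` LL"
 shows "\<sigma> ` LL = \<sigma> ` NB <+>\<^bsub>S\<^esub> Idl\<^bsub>S\<^esub> F"
proof -
 define G' where "G' = {b : LL. \<sigma> b : F}"
 have F_eq: "F = \<sigma> ` G'" using F by (auto simp: G'_def)
 have GB: "G' <= B" and GL: "G' <= LL" using LL_sub_B by (auto simp: G'_def)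
 define Z where "Z = Sy.gen (G' \<union> LI)"
 have LIB: "LI <= B" by (rule idlD(1)[OF LI_idl])
 have Z: "is_ideal B Z" "G' <= Z" "LI <= Z" unfolding Z_def using Sy.gen_idl[of "G' \<union> LI"] Sy.gen_upper[of "G' \<union> LI"] GB LIB by auto
 have ZL: "Z <= LL" unfolding Z_def using Sy.gen_least[OF LL_idl] GL LI_sub_LL by blast
 have IF: "Idl\<^bsub>S\<^esub> F = \<sigma> ` Z" unfolding F_eq Z_def by (rule Sy.Idl_image[OF GB])
 have E: "is_ideal B (isum mB Z)" using G.idl_isum[OF mB_idl Z(1)] .
 have pF: "sym_fiber_proj \<mm> (Suc g) a ` F = \<phi> ` G'" unfolding F_eq image_image using fiber_eq(2) GB by (intro image_cong) auto
 have EI: "isum mB LI <= isum mB Z" using Z(3) by (auto simp: isum_def)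
 have "Fi.gen (G' \<union> isum mB LI) <= isum mB Z"
  using Z(2) G.isum_upper2[OF mB_idl, of Z] EI by (intro Fi.gen_least[OF E]) blast
 then have sub: "\<phi> ` LL <= \<phi> ` isum mB Z" using gen Fi.Idl_image[OF GB] unfolding pF by (metis image_mono)
 have dec: "EX n:NB. EX z:Z. b = n + z" if b: "b : LL" for b
 proof -
  have "b : isum mB Z" using sub b LL_sub_B Fi.h_mem[OF E EI, of b] by blast
  then obtain m z where mz: "m : mB" "z : Z" "b = m + z" by (auto elim: isumE)
  have "m : LL" using G.idl_add_cancel[OF LL_idl, of m z] b mz ZL by auto
  then show ?thesis using mz G.isum_upper1[OF LI_idl, of mB] by (auto simp: NB_def)
 qed
 have add: "\<sigma> n \<oplus>\<^bsub>S\<^esub> \<sigma> z = \<sigma> (n + z)" if "n : NB" "z : Z" for n z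
  using that Sy.Q.h_add G.idl_mem[OF NB_idl] G.idl_mem[OF Z(1)] by simp
 have "\<sigma> ` NB <+>\<^bsub>S\<^esub> \<sigma> ` Z = \<sigma> ` LL"
 proof
  have "n + z : LL" if "n : NB" "z : Z" for n z using that ZL G.idl_add[OF LL_idl, of n z] by (auto simp: NB_def)
  then show "\<sigma> ` NB <+>\<^bsub>S\<^esub> \<sigma> ` Z <= \<sigma> ` LL" unfolding set_add_def' using add by auto
  show "\<sigma> ` LL <= \<sigma> ` NB <+>\<^bsub>S\<^esub> \<sigma> ` Z"
  proof clarify
   fix b assume "b : LL"
   then obtain n z where nz: "n : NB" "z : Z" "b = n + z" using dec by blast
   then have "\<sigma> b = \<sigma> n \<oplus>\<^bsub>S\<^esub> \<sigma> z" using add by simp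
   then show "\<sigma> b : \<sigma> ` NB <+>\<^bsub>S\<^esub> \<sigma> ` Z" unfolding set_add_def' using nz by blast
  qed
 qed
 then show ?thesis using IF by simp
qed

lemma fourth:
 assumes Y: "Y <= carrier (sym_fiber \<mm> (Suc g) a)" "Idl\<^bsub>sym_fiber \<mm> (Suc g) a\<^esub> Y = fiber_relations \<mm> (Suc g) a"
 shows "EX F<=\<sigma> ` LL. sym_fiber_proj \<mm> (Suc g) a ` F = Y"
  "F <= \<sigma> ` LL ==> sym_fiber_proj \<mm> (Suc g) a ` F = Y ==> \<sigma> ` LL = \<sigma> ` NB <+>\<^bsub>S\<^esub> Idl\<^bsub>S\<^esub> F"
proof -
 have "Y <= \<phi> ` LL" using Fi.Q.R.genideal_self[of Y] Y unfolding fiber_eq fiber_rel by simp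
 moreover have "sym_fiber_proj \<mm> (Suc g) a ` (\<sigma> ` {b : LL. \<phi> b : Y}) = \<phi> ` {b : LL. \<phi> b : Y}"
  unfolding image_image using fiber_eq(2) LL_sub_B by (intro image_cong) auto
 ultimately have "sym_fiber_proj \<mm> (Suc g) a ` (\<sigma> ` {b : LL. \<phi> b : Y}) = Y" by auto
 then show "EX F<=\<sigma> ` LL. sym_fiber_proj \<mm> (Suc g) a ` F = Y" by (intro exI[of _ "\<sigma> ` {b : LL. \<phi> b : Y}"]) auto
 show "\<sigma> ` LL = \<sigma> ` NB <+>\<^bsub>S\<^esub> Idl\<^bsub>S\<^esub> F" if F: "F <= \<sigma> ` LL" "sym_fiber_proj \<mm> (Suc g) a ` F = Y"
  using T_decomp[OF F(1)] Y(2) unfolding F(2) fiber_eq fiber_rel by simp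
qed

lemma hypersurface:
 assumes f: "f : \<sigma> ` LL" and gen: "Idl\<^bsub>sym_fiber \<mm> (Suc g) a\<^esub> {sym_fiber_proj \<mm> (Suc g) a f} = fiber_relations \<mm> (Suc g) a"
 shows "\<sigma> ` LL = Idl\<^bsub>S\<^esub> (insert f (\<sigma> ` NB))"
proof
 interpret T: ideal "\<sigma> ` LL" S by (rule Sy.ideal_image[OF LL_idl])
 have NL: "\<sigma> ` NB <= \<sigma> ` LL" by (auto simp: NB_def)
 then have car: "insert f (\<sigma> ` NB) <= carrier S" using f T.a_subset by blast
 interpret J: ideal "Idl\<^bsub>S\<^esub> (insert f (\<sigma> ` NB))" S by (rule Sy.Q.R.genideal_ideal[OF car])
 have "\<sigma> ` LL = \<sigma> ` NB <+>\<^bsub>S\<^esub> Idl\<^bsub>S\<^esub> {f}" using T_decomp[of "{f}"] f gen unfolding fiber_eq fiber_rel by simp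
 moreover have "Idl\<^bsub>S\<^esub> {f} <= Idl\<^bsub>S\<^esub> (insert f (\<sigma> ` NB))"
  using Sy.Q.R.genideal_self[OF car] by (intro Sy.Q.R.genideal_minimal J.is_ideal) auto
 moreover have "\<sigma> ` NB <= Idl\<^bsub>S\<^esub> (insert f (\<sigma> ` NB))" using Sy.Q.R.genideal_self[OF car] by auto
 ultimately show "\<sigma> ` LL <= Idl\<^bsub>S\<^esub> (insert f (\<sigma> ` NB))" by (auto simp: set_add_def' intro!: J.a_closed)
 show "Idl\<^bsub>S\<^esub> (insert f (\<sigma> ` NB)) <= \<sigma> ` LL" using NL f by (intro Sy.Q.R.genideal_minimal T.is_ideal) auto
qed

definition "nilp s \<longleftrightarrow> (ALL rs. length rs = s --> set rs <= \<mm> --> (ALL b:LL. mconst (prod_list rs) * b : LI))"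

lemma kills_iff: "(ALL x:ideal_power ring_of_type_algebra \<mm> s. ALL b:LL. mconst x * b : LI) \<longleftrightarrow> nilp s"
proof -
 interpret R: cring "ring_of_type_algebra :: 'a ring" by (rule cring_R)
 let ?Z = "{r. ALL b:LL. mconst r * b : LI}"
 have "u.idl ?Z" using idlD[OF LI_idl] by (auto simp: is_ideal_def mconst_hom distrib_right mult.assoc)
 then show ?thesis
  using R.ideal_power_sub_iff[of \<mm> ?Z s] m_idl unfolding ideal_R foldr_tcr nilp_def by blast
qed

lemma power_N: assumes "0 < s"
 shows "ideal_power S (\<sigma> ` NB) s = {\<zero>\<^bsub>S\<^esub>} \<longleftrightarrow> (ALL bs. length bs = s --> set bs <= NB --> prod_list bs : LI)"
proof -
 have NI: "ideal (\<sigma> ` NB) S" by (rule Sy.ideal_image[OF NB_idl])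
 have NB: "NB <= B" by (rule idlD(1)[OF NB_idl])
 have "ideal_power S (\<sigma> ` NB) s = {\<zero>\<^bsub>S\<^esub>} \<longleftrightarrow> ideal_power S (\<sigma> ` NB) s <= {\<zero>\<^bsub>S\<^esub>}"
  using additive_subgroup.zero_closed[OF ideal.axioms(1)[OF Sy.Q.R.ideal_power_ideal[OF NI]], of s] by blast
 also have "\<dots> \<longleftrightarrow> (ALL xs. length xs = s --> set xs <= \<sigma> ` NB --> foldr (\<otimes>\<^bsub>S\<^esub>) xs \<one>\<^bsub>S\<^esub> : {\<zero>\<^bsub>S\<^esub>})"
  by (rule Sy.Q.R.ideal_power_sub_iff[OF NI Sy.Q.R.zeroideal])
 also have "\<dots> \<longleftrightarrow> (ALL bs. length bs = s --> set bs <= NB --> foldr (\<otimes>\<^bsub>S\<^esub>) (map \<sigma> bs) \<one>\<^bsub>S\<^esub> : {\<zero>\<^bsub>S\<^esub>})"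
 proof (intro iffI allI impI)
  fix xs assume R: "ALL bs. length bs = s --> set bs <= NB --> foldr (\<otimes>\<^bsub>S\<^esub>) (map \<sigma> bs) \<one>\<^bsub>S\<^esub> : {\<zero>\<^bsub>S\<^esub>}"
   and xs: "length xs = s" "set xs <= \<sigma> ` NB"
  have "xs : map \<sigma> ` lists NB" using xs(2) by (simp flip: lists_image add: in_lists_conv_set subset_iff)
  then have "EX bs. xs = map \<sigma> bs & set bs <= NB" by (auto simp: in_lists_conv_set)
  then obtain bs where "xs = map \<sigma> bs" "set bs <= NB" by blast
  then show "foldr (\<otimes>\<^bsub>S\<^esub>) xs \<one>\<^bsub>S\<^esub> : {\<zero>\<^bsub>S\<^esub>}" using R xs(1) by auto
 next
  fix bs assume L: "ALL xs. length xs = s --> set xs <= \<sigma> ` NB --> foldr (\<otimes>\<^bsub>S\<^esub>) xs \<one>\<^bsub>S\<^esub> : {\<zero>\<^bsub>S\<^esub>}"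
   and bs: "length bs = s" "set bs <= NB"
  have "set (map \<sigma> bs) <= \<sigma> ` NB" using bs(2) by auto
  then show "foldr (\<otimes>\<^bsub>S\<^esub>) (map \<sigma> bs) \<one>\<^bsub>S\<^esub> : {\<zero>\<^bsub>S\<^esub>}"
   using L bs(1) length_map[of \<sigma> bs] by blast
 qed
 also have "\<dots> \<longleftrightarrow> (ALL bs. length bs = s --> set bs <= NB --> prod_list bs : LI)"
 proof -
  have "foldr (\<otimes>\<^bsub>S\<^esub>) (map \<sigma> bs) \<one>\<^bsub>S\<^esub> : {\<zero>\<^bsub>S\<^esub>} \<longleftrightarrow> prod_list bs : LI" if "set bs <= NB" for bs
   using Sy.foldr_image[of bs] that NB Sy.Q.h_ker by auto
  then show ?thesis by auto
 qed
 finally show ?thesis .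
qed

lemma power_m_T: "ideal_smult ring_of_type_algebra (scalar_module (sym_const (Suc g) a) S) (ideal_power ring_of_type_algebra \<mm> s) (\<sigma> ` LL) = {\<zero>\<^bsub>S\<^esub>} \<longleftrightarrow> nilp s"
proof -
 have m: "module ring_of_type_algebra (scalar_module (sym_const (Suc g) a) S)"
  unfolding sym_eq by (rule scalar_module_cring[OF cring_R Sy.Q.R.cring_axioms const_hom[OF Sy.pres_axioms]])
 have "\<sigma> (mconst x) \<otimes>\<^bsub>S\<^esub> \<sigma> b = \<zero>\<^bsub>S\<^esub> \<longleftrightarrow> mconst x * b : LI" if "b : LL" for x b
  using that LL_sub_B Sy.Q.h_ker[of "mconst x * b"] Sy.Q.h_mult[of "mconst x" b] by auto
 moreover have "{x \<odot>\<^bsub>scalar_module (sym_const (Suc g) a) S\<^esub> v | x v. x : I & v : \<sigma> ` LL} <= {\<zero>\<^bsub>S\<^esub>} \<longleftrightarrow>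
   (ALL x:I. ALL b:LL. \<sigma> (mconst x) \<otimes>\<^bsub>S\<^esub> \<sigma> b = \<zero>\<^bsub>S\<^esub>)" for I
  unfolding sym_eq(2) scalar_module_simps by blast
 ultimately have "{x \<odot>\<^bsub>scalar_module (sym_const (Suc g) a) S\<^esub> v | x v. x : I & v : \<sigma> ` LL} <= {\<zero>\<^bsub>S\<^esub>} \<longleftrightarrow>
   (ALL x:I. ALL b:LL. mconst x * b : LI)" for I by simp
 then show ?thesis unfolding kills_iff[symmetric] ideal_smult_def using span_eq_zero_iff[OF m] by simp
qed

lemma power_m_L: "ideal_smult ring_of_type_algebra (scalar_module mconst (mpoly_ring (Suc g))) (ideal_power ring_of_type_algebra \<mm> s) LL <= LI \<longleftrightarrow> nilp s"
proof -
 interpret T: pres B "tcr B" "{0}" "%x. x" by (rule G.pres_self)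
 interpret M: module ring_of_type_algebra "scalar_module mconst (tcr B)"
  by (rule scalar_module_cring[OF cring_R T.Q.R.cring_axioms const_hom[OF T.pres_axioms]])
 have "submodule LI ring_of_type_algebra (scalar_module mconst (tcr B))"
 proof (rule M.submoduleI)
  show "\<ominus>\<^bsub>scalar_module mconst (tcr B)\<^esub> x : LI" if "x : LI" for x
  proof -
   have "\<ominus>\<^bsub>scalar_module mconst (tcr B)\<^esub> x = - x"
    using that idlD(1)[OF LI_idl] by (intro M.minus_equality) auto
   then show ?thesis using G.idl_uminus[OF LI_idl that] by simp
  qed
 qed (use idlD[OF LI_idl] in auto)
 then have "span_module ring_of_type_algebra (scalar_module mconst (tcr B)) G' <= LI \<longleftrightarrow> G' <= LI" for G'
  using span_least[of LI _ _ G'] span_upper[of G'] by (meson subset_trans)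
 then show ?thesis
  unfolding kills_iff[symmetric] ideal_smult_def mpoly_ring_tcr B_def[symmetric] by auto
qed

lemma nilradical_S: assumes "!!b. b : B ==> (EX n. b ^ n : LI) \<longleftrightarrow> b : NB" shows "nilradical S = \<sigma> ` NB"
proof -
 have "nilradical S = {x : \<sigma> ` B. EX n::nat. x [^]\<^bsub>S\<^esub> n = \<zero>\<^bsub>S\<^esub>}" by (simp add: nilradical_def radical_def Sy.carrier_eq)
 also have "\<dots> = \<sigma> ` {b : B. EX n. b ^ n : LI}" using Sy.image_power Sy.Q.h_ker by force
 also have "{b : B. EX n. b ^ n : LI} = NB" using assms idlD(1)[OF NB_idl] by blast
 finally show ?thesis .
qed

lemma third:
 assumes A: "!!b. b : B ==> (EX n. b ^ n : LI) \<longleftrightarrow> b : NB"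
  and H: "!!s. 0 < s ==> (ALL bs. length bs = s --> set bs <= NB --> prod_list bs : LI) \<longleftrightarrow> nilp s"
 shows "\<sigma> ` NB = nilradical S"
  "0 < s ==> ideal_power S (\<sigma> ` NB) s = {\<zero>\<^bsub>S\<^esub>} \<longleftrightarrow>
   ideal_smult ring_of_type_algebra (scalar_module (sym_const (Suc g) a) S) (ideal_power ring_of_type_algebra \<mm> s) (\<sigma> ` LL) = {\<zero>\<^bsub>S\<^esub>}"
  "sdeg \<mm> (Suc g) a = nilpotency_index S"
proof -
 show nil: "\<sigma> ` NB = nilradical S" using nilradical_S[OF A] by simp
 show pow: "ideal_power S (\<sigma> ` NB) s = {\<zero>\<^bsub>S\<^esub>} \<longleftrightarrow>
   ideal_smult ring_of_type_algebra (scalar_module (sym_const (Suc g) a) S) (ideal_power ring_of_type_algebra \<mm> s) (\<sigma> ` LL) = {\<zero>\<^bsub>S\<^esub>}" if "0 < s" for s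
  using power_N[OF that] H[OF that] power_m_T by simp
 have "1 <= s ==> ideal_smult ring_of_type_algebra (scalar_module mconst (mpoly_ring (Suc g))) (ideal_power ring_of_type_algebra \<mm> s) LL <= LI \<longleftrightarrow>
   ideal_power S (\<sigma> ` NB) s = {\<zero>\<^bsub>S\<^esub>}" for s
  using power_N[of s] H[of s] power_m_L[of s] by simp
 then have "{enat s | s. 1 <= s & ideal_smult ring_of_type_algebra (scalar_module mconst (mpoly_ring (Suc g))) (ideal_power ring_of_type_algebra \<mm> s) LL <= LI} =
  {enat s | s. 1 <= s & ideal_power S (nilradical S) s = {\<zero>\<^bsub>S\<^esub>}}"
  unfolding nil[symmetric] by blast
 then show "sdeg \<mm> (Suc g) a = nilpotency_index S"
  by (simp only: sdeg_def nilpotency_index_def rees_rel lin_rel)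
qed

text \<open>If T = 0, then S is the Rees algebra, a domain; both N and T vanish, and every s >= 1
  works on both sides.\<close>

lemma third_trivial: assumes "LL = LI"
 shows "b : B ==> (EX n. b ^ n : LI) \<longleftrightarrow> b : NB"
  "0 < s ==> (ALL bs. length bs = s --> set bs <= NB --> prod_list bs : LI) \<longleftrightarrow> nilp s"
proof -
 have NB: "NB = LI" using G.isum_upper2[OF mB_idl, of LI] by (auto simp: NB_def assms)
 show "b : B ==> (EX n. b ^ n : LI) \<longleftrightarrow> b : NB"
  using G.prm_power[of LI b] LL_prime unfolding NB assms by (auto intro: exI[of _ 1])
 have "nilp s" using G.idl_mult[OF LI_idl const_B] by (auto simp: nilp_def assms)
 moreover have "prod_list bs : LI" if "0 < s" "length bs = s" "set bs <= NB" for bs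
 proof (cases bs)
  case (Cons b bs')
  have "prod_list bs' : B" using that(3) idlD(1)[OF NB_idl] unfolding Cons by (induction bs') auto
  then show ?thesis using G.idl_mult[OF LI_idl, of "prod_list bs'" b] that(3) Cons by (simp add: NB mult.commute)
 qed (use that in simp)
 ultimately show "0 < s ==> (ALL bs. length bs = s --> set bs <= NB --> prod_list bs : LI) \<longleftrightarrow> nilp s" by blast
qed

end

lemma (in aci_primary) third_primary:
 "b : B ==> (EX n. b ^ n : LI) \<longleftrightarrow> b : NB"
 "0 < s ==> (ALL bs. length bs = s --> set bs <= NB --> prod_list bs : LI) \<longleftrightarrow> nilp s"
 using nilpotent_iff nilpotency by (simp_all add: nilp_def)

section \<open>Cases (a), (b) and (c)\<close>

locale cm_setting =
 fixes \<mm> :: "'a::idom set" and d :: nat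
 assumes CM: "cohen_macaulay_local_ring (ring_of_type_algebra :: 'a ring) \<mm>"
  and kdim: "krull_dim (ring_of_type_algebra :: 'a ring) = enat d"
begin

abbreviation "R \<equiv> ring_of_type_algebra :: 'a ring"

sublocale P: pres "UNIV :: 'a set" R "{0}" "%x. x"
 using u.pres_self by (simp flip: tcr_UNIV)

lemma N: "noeth_subring (UNIV :: 'a set)"
 using noetherian_tcr[of "UNIV :: 'a set"] u.comm_subring_axioms CM unfolding cohen_macaulay_local_ring_def by (simp flip: tcr_UNIV)

sublocale N: noeth_subring "UNIV :: 'a set" by (rule N)

lemma prime_R: "primeideal Q R \<longleftrightarrow> u.prm Q"
 using u.primeideal_tcr[of Q] by (simp flip: tcr_UNIV)

lemma local: "maximalideal \<mm> R" "maximalideal \<nn> R ==> \<nn> = \<mm>"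
 using CM unfolding cohen_macaulay_local_ring_def local_ring_def by auto

lemma m: "u.prm \<mm>"
 using P.Q.R.maximalideal_prime[OF local(1)] by (simp add: prime_R)

text \<open>A proper ideal lies in a maximal one by the Noetherian property, and only one maximal
  ideal exists.\<close>

lemma proper_sub: assumes I: "u.idl I" "1 ~: I" shows "I <= \<mm>"
proof -
 define F where "F = {Z. u.idl Z & I <= Z & 1 ~: Z}"
 have "EX M:F. ALL Z:F. M <= Z --> Z = M" by (rule N.noeth) (use I in \<open>auto simp: F_def\<close>)
 then obtain M where "M : F" and mx: "ALL Z:F. M <= Z --> Z = M" by (elim bexE)
 then have M: "u.idl M" "I <= M" "1 ~: M" by (simp_all add: F_def)
 have mx: "Z = M" if "u.idl Z" "1 ~: Z" "M <= Z" for Z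
  using mx[rule_format, of Z] that M(2) by (simp add: F_def)
 have "maximalideal M R"
 proof (rule maximalidealI)
  show "ideal M R" using M(1) ideal_R by blast
  show "carrier R ~= M" using M(3) by auto
  fix Z assume Z: "ideal Z R" "M <= Z" "Z <= carrier R"
  show "Z = M \<or> Z = carrier R"
  proof (cases "1 : Z")
   case True
   then show ?thesis using ideal.one_imp_carrier[OF Z(1)] by simp
  next
   case False
   then show ?thesis using mx[of Z] Z ideal_R by blast
  qed
 qed
 then show ?thesis using local(2) M(2) by blast
qed

lemma unit: assumes "r ~: \<mm>" shows "EX s. s * r = 1"
proof (rule ccontr)
 assume neg: "~ ?thesis"
 have "u.idl (range ((*) r))" by (rule u.idl_image[OF u.idl_C UNIV_I])
 moreover have "1 ~: range ((*) r)" using neg by (metis mult.commute rangeE)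
 ultimately show False using proper_sub u.mem_principal[of r] assms by blast
qed

lemma prime_sub: "u.prm Q ==> Q <= \<mm>"
 using proper_sub prmD(1,2) by blast

lemma dim: assumes "pchain UNIV {0} n \<mm>" shows "n <= d"
proof -
 have "enat n <= krull_dim R" unfolding P.Q.krull_dim_eq using assms prmD(2)[OF m] by (intro Sup_upper) auto
 then show ?thesis by (simp add: kdim)
qed

sublocale M: loc_mod "UNIV :: 'a set" R "{0}" "{1}" "%x. x" "self_module R" UNIV "{0}" "%x. x"
 using P.mod_pres[OF u.idl_C subset_UNIV] unfolding P.Md_C .

lemma pre_id: "P.Q.pre I = I" by (simp add: P.Q.pre_def)

lemma m_ideal: "ideal \<mm> R" using m ideal_R prmD(1) by blast

lemma dp: "dpt {1} \<mm> d UNIV {0}"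
proof -
 have col: "colon UNIV {0} UNIV = {0 :: 'a}" unfolding colon_def by (auto dest: spec[of _ 1])
 have "module_dim R (self_module R) = krull_dim R"
  unfolding M.module_dim_eq P.Q.krull_dim_eq col ..
 moreover have "cm_local R \<mm> (self_module R)" using CM unfolding cohen_macaulay_local_ring_def by blast
 moreover have "(1 :: 'a) ~: {0}" by simp
 then have "carrier (self_module R) ~= {\<zero>\<^bsub>self_module R\<^esub>}" by (simp, blast)
 ultimately have "depth R \<mm> (self_module R) = enat d" unfolding cm_local_def kdim by simp
 moreover have "depth R \<mm> (self_module R) <= Sup {enat (length xs) | xs. set xs <= \<mm> & regseq {1} UNIV {0} xs}"
  unfolding M.depth_eq[OF m_ideal] pre_id by (intro Sup_subset_mono) blast
 ultimately show ?thesis using dpt_Sup[of d \<mm>] by simp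
qed

sublocale D: cm_domain d \<mm>
 by unfold_locales (rule N m unit dp dim | assumption)+

lemma height_iff: "(EX P. prime_chain R n P & P n = Q) \<longleftrightarrow> pchain UNIV {0} n Q"
proof
 assume "EX P. prime_chain R n P & P n = Q"
 then show "pchain UNIV {0} n Q" using P.Q.pchain_pre(1) pre_id by metis
next
 assume Q: "pchain UNIV {0} n Q"
 then have "Q \<inter> {1} = {}" using prmD(2) pchain_prime by blast
 moreover have "P.Q.ext Q = Q" by (auto simp: P.Q.ext_def)
 ultimately show "EX P. prime_chain R n P & P n = Q" using P.Q.pchain_ext[OF Q] by simp
qed

lemma height_le: "pchain UNIV {0} n Q ==> enat n <= prime_height R Q"
 unfolding prime_height_def using height_iff by (intro Sup_upper) blast

lemma height_ge: "enat n <= prime_height R Q ==> u.prm Q ==> pchain UNIV {0} n Q"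
proof (rule ccontr)
 assume n: "enat n <= prime_height R Q" and Q: "u.prm Q" and neg: "~ pchain UNIV {0} n Q"
 have "n ~= 0" using neg Q idlD(2)[OF prmD(1)[OF Q]] by (metis empty_subsetI insert_subset pchain.simps(1))
 then obtain k where k: "n = Suc k" by (cases n) auto
 have "i <= k" if "pchain UNIV {0} i Q" for i
  using neg pchain_le[OF that, of n] k by (cases "i <= k") auto
 then have "prime_height R Q <= enat k" unfolding prime_height_def using height_iff by (intro Sup_least) auto
 with n have "enat n <= enat k" by order
 then show False using k by simp
qed

end

locale aci_setting = cm_setting \<mm> d for a :: "nat => 'a::idom" and g :: nat and \<mm> d +
 assumes aci: "almost_complete_intersection g a"
  and abc: "is_primary_to R \<mm> (gen_ideal (g + 1) a) \<or>
   ideal_height R (gen_ideal (g + 1) a) + 1 = enat d \<or>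
   (ideal_height R (gen_ideal (g + 1) a) + 2 = enat d &
     1 <= depth R \<mm> (scalar_module (%r. gen_ideal (g + 1) a +>\<^bsub>R\<^esub> r) (R Quot gen_ideal (g + 1) a)))"
begin

abbreviation "J \<equiv> genid g a"
abbreviation "I \<equiv> genid (Suc g) a"
abbreviation "cc \<equiv> a (Suc g)"

lemma J_idl: "u.idl J" and I_idl: "u.idl I" unfolding genid_def by (rule idl_genid)+

lemma I_eq: "gen_ideal (g + 1) a = I"
 by (simp add: gen_ideal_genid)

lemma height_I: "ideal_height R I = enat g"
 using aci by (simp add: almost_complete_intersection_def gen_ideal_genid)

lemma JI: "J <= I" and ccI: "cc : I"
 using adj_upper[OF J_idl, of cc] by (simp_all add: genid_Suc)

lemma cc: "cc ~: J"
 using aci by (simp add: almost_complete_intersection_def gen_ideal_genid)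

lemma seq_exists: "EX xs. set xs <= \<mm> & regseq {1} UNIV {0} xs & quo {1} UNIV {0} xs = J"
proof -
 obtain xs where xs: "regular_sequence R (self_module R) xs" "J = Idl\<^bsub>R\<^esub> (set xs)"
  using aci by (auto simp: almost_complete_intersection_def complete_intersection_def gen_ideal_genid)
 have "list_all2 M.rep xs xs" by (auto simp: list_all2_same M.rep_def)
 then have rs: "regseq {1} UNIV {0} xs" "quo {1} UNIV {0} xs ~= UNIV" using xs(1) M.regular_sequence_iff by blast+
 let ?q = "quo {1} UNIV {0} xs"
 note cl = u.clsd_one[OF u.idl_C]
 note z = cl[OF u.idl_zero]
 have q: "u.idl ?q" using u.clsdD(2)[OF u.clsd_quo[OF z u.mult_one]] by simp
 have sub: "set xs <= ?q" using u.quo_upper_smult[OF z u.mult_one, of xs _ 1] by auto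
 have "?q = J"
 proof
  have "set xs <= J" using P.Q.R.genideal_self[of "set xs"] xs(2) by simp
  then show "?q <= J" using idlD(5)[OF J_idl] idlD(2)[OF J_idl]
   by (intro u.quo_least[OF z u.mult_one _ cl[OF J_idl]]) auto
  show "J <= ?q" unfolding xs(2) using q ideal_R sub by (intro P.Q.R.genideal_minimal) auto
 qed
 moreover have "1 ~: ?q" using rs(2) idlD(5)[OF q, of _ 1] by (metis UNIV_I UNIV_eq_I mult_1_left)
 ultimately show ?thesis using rs(1) proper_sub[OF q] sub by blast
qed

lemma height_prime_ge: assumes "u.prm Q" "I <= Q" shows "pchain UNIV {0} g Q"
proof (rule height_ge)
 have "ideal_height R I <= prime_height R Q" unfolding ideal_height_def
  using assms prime_R by (intro Inf_lower) blast
 then show "enat g <= prime_height R Q" by (simp add: height_I)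
qed (rule assms)

text \<open>The infimum of heights is attained at some Q of height g. A prime strictly between I and
  Q would have height at least g as well and force height g + 1 on Q.\<close>

lemma min_prime: "EX Q. min_over UNIV I Q & (ALL n. pchain UNIV {0} n Q --> n <= g)"
proof -
 let ?H = "{prime_height R Q | Q. primeideal Q R & I <= Q}"
 have "?H ~= {}" using height_I unfolding ideal_height_def by (auto simp: Inf_enat_def split: if_splits)
 then have "Inf ?H : ?H" unfolding Inf_enat_def by (auto intro: LeastI)
 then obtain Q where Q: "u.prm Q" "I <= Q" "prime_height R Q = enat g"
  using height_I unfolding ideal_height_def by (auto simp: prime_R)
 have le: "n <= g" if "pchain UNIV {0} n Q" for n using height_le[OF that] Q(3) by simp
 have "Q' = Q" if "u.prm Q'" "I <= Q'" "Q' <= Q" for Q'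
 proof (rule ccontr)
  assume "Q' ~= Q"
  then have "pchain UNIV {0} (Suc g) Q" using that Q(1) height_prime_ge[OF that(1,2)] by auto
  then show False using le by fastforce
 qed
 then show ?thesis using Q le unfolding min_over_def by blast
qed

lemma primary_height: assumes "is_primary_to R \<mm> I" shows "g = d"
proof -
 obtain Q where Q: "min_over UNIV I Q" "!!n. pchain UNIV {0} n Q ==> n <= g" using min_prime by blast
 have pw: "x [^]\<^bsub>R\<^esub> (n :: nat) = x ^ n" for x n using P.image_power[of x n] by simp
 have "\<mm> <= Q"
 proof
  fix x assume "x : \<mm>"
  then obtain n where "x ^ n : I" using assms by (auto simp: is_primary_to_def radical_def pw)
  then show "x : Q" using u.prm_power[OF min_overD(1)[OF Q(1)]] min_overD(2)[OF Q(1)] by blast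
 qed
 then have Qm: "Q = \<mm>" using prime_sub[OF min_overD(1)[OF Q(1)]] by blast
 obtain ys where "length ys = d" "set ys <= \<mm>" "regseq {1} UNIV {0} ys" using dp by (auto simp: dpt_def)
 then have "d <= g" using D.regseq_chain[OF m] Q(2) Qm by blast
 moreover have "g <= d" using dim height_prime_ge[OF min_overD(1,2)[OF Q(1)]] Qm by blast
 ultimately show ?thesis by simp
qed

lemma depth_RI: assumes "1 <= depth R \<mm> (scalar_module (%r. I +>\<^bsub>R\<^esub> r) (R Quot I))"
 shows "dpt {1} \<mm> 1 UNIV I"
proof -
 let ?A = "R Quot I" and ?h = "%r. I +>\<^bsub>R\<^esub> r"
 have I: "ideal I R" using I_idl ideal_R by blast
 interpret Q: pres UNIV ?A I ?h using P.pres_quot[OF I] by (simp add: pre_id)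
 interpret Md: module R "scalar_module ?h ?A"
  by (rule scalar_module_cring[OF P.Q.R.cring_axioms Q.Q.R.cring_axioms])
   (rule ring_hom_memI, simp_all add: Q.Q.h_mult[simplified] Q.Q.h_add[simplified] Q.Q.h_one Q.Q.h_closed[simplified])
 have "loc_mod UNIV R {0} {1} (%x. x) (scalar_module ?h ?A) UNIV I ?h"
 proof unfold_locales
  show "EX w:{1}. EX u:UNIV. w \<odot>\<^bsub>scalar_module ?h ?A\<^esub> x = ?h u" if x: "x : carrier (scalar_module ?h ?A)" for x
  proof -
   obtain u where u: "x = ?h u" using x Q.carrier_eq by auto
   then have "?h 1 \<otimes>\<^bsub>?A\<^esub> x = ?h u" using Q.Q.h_mult[of 1 u] by simp
   then show ?thesis by auto
  qed
 qed (use Q.Q.h_add Q.Q.h_mult Q.Q.h_ker Q.Q.h_closed in auto)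
 then interpret L: loc_mod UNIV R "{0}" "{1}" "%x. x" "scalar_module ?h ?A" UNIV I ?h .
 have "depth R \<mm> (scalar_module ?h ?A) <= Sup {enat (length xs) | xs. set xs <= \<mm> & regseq {1} UNIV I xs}"
  unfolding L.depth_eq[OF m_ideal] pre_id by (intro Sup_subset_mono) blast
 with assms have "enat 1 <= Sup {enat (length xs) | xs. set xs <= \<mm> & regseq {1} UNIV I xs}"
  by (simp add: one_enat_def)
 then show ?thesis by (simp add: dpt_Sup)
qed

context
 fixes xs :: "'a list"
 assumes xs: "set xs <= \<mm>" "regseq {1} UNIV {0} xs" "quo {1} UNIV {0} xs = J"
begin

lemma rideal_J: "rideal \<mm> (length xs) J"
 using rideal_regseq[OF xs(2,1)] xs(3) by simp

lemma len_d: "length xs <= d"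
 using dim D.regseq_chain[OF m xs(1,2)] by blast

lemma dpt_J: "dpt {1} \<mm> (d - length xs) UNIV J"
 by (rule rideal_quot_dpt[OF N D.m_idl dp rideal_J len_d])

lemma xs_J: "set xs <= J"
 using u.quo_upper_smult[OF u.clsd_one[OF u.idl_C u.idl_zero] u.mult_one, of xs _ 1] xs(3) by auto

text \<open>At a minimal prime Q of I of height g, the regular sequence xs bounds the height from
  below, and Krull's theorem for xs together with c bounds it from above.\<close>

lemma len_g: "length xs <= g" "g <= Suc (length xs)"
proof -
 obtain Q where Q: "min_over UNIV I Q" "!!n. pchain UNIV {0} n Q ==> n <= g" using min_prime by blast
 note Qp = min_overD(1)[OF Q(1)]
 have "set xs <= Q" using xs_J JI min_overD(2)[OF Q(1)] by blast
 then show "length xs <= g" using D.regseq_chain[OF Qp _ xs(2)] Q(2) by blast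
 have "Q' = Q" if Q': "u.prm Q'" "{0} \<union> set (cc # xs) <= Q'" "Q' <= Q" for Q'
 proof -
  note Qi = prmD(1)[OF Q'(1)]
  have "quo {1} UNIV {0} xs <= Q'"
   using idlD(2,5)[OF Qi] Q'(2)
   by (intro u.quo_least[OF u.clsd_one[OF u.idl_C u.idl_zero] u.mult_one _ u.clsd_one[OF u.idl_C Qi]]) auto
  then have "I <= Q'" unfolding xs(3) genid_Suc adj_def using Q'(2)
   by (intro u.isum_least[OF Qi] u.image_principal_sub[OF Qi]) auto
  then show ?thesis using min_overD(3)[OF Q(1)] Q' by blast
 qed
 then have "min_over UNIV ({0} \<union> set (cc # xs)) Q"
  using Qp \<open>set xs <= Q\<close> ccI min_overD(2)[OF Q(1)] idlD(2)[OF prmD(1)[OF Qp]] unfolding min_over_def by auto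
 then show "g <= Suc (length xs)" using N.krull_height[OF _ _ height_prime_ge[OF Qp min_overD(2)[OF Q(1)]]] by fastforce
qed

text \<open>Multiplication by c is an isomorphism from R/K onto I/J.\<close>

lemma colon_iso: "regseq {1} UNIV {k. cc * k : J} ys \<longleftrightarrow> regseq {1} I J ys"
proof -
 have K: "u.idl {k. cc * k : J}" using J_idl unfolding is_ideal_def by (simp add: distrib_left mult.left_commute)
 show ?thesis
 proof (rule u.regseq_corr[where \<phi> = "(*) cc", OF u.comm_subring_axioms u.mult_one u.mult_one])
  show "u.clsd {1} UNIV {k. cc * k : J}" "u.clsd {1} I J"
   using u.clsd_one K J_idl I_idl JI by auto
  show "cc * u : I" for u using idlD(5)[OF I_idl _ ccI] by blast
  show "EX w:{1}. EX u:UNIV. w * u' - cc * u : J" if "u' : I" for u'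
  proof -
   obtain s c where "s : J" "u' = s + cc * c" using \<open>u' : I\<close> unfolding genid_Suc by (rule adjE)
   then show ?thesis by (auto intro: exI[of _ c])
  qed
 qed (auto simp: list_all2_same algebra_simps)
qed

text \<open>R/K is replaced by I/J inside R/J, which has depth d - g. In case (a) this number is 0;
  in (b) it is 1 and passes to a submodule; in (c) it is 2, and depth R/I >= 1 lets the depth lemma
  give 2 for I/J.\<close>

lemma dK_top: assumes "g = length xs" shows "dpt {1} \<mm> (d - length xs) UNIV {k. cc * k : J}"
proof -
 have "dpt {1} \<mm> (d - length xs) I J"
  using abc unfolding I_eq
 proof (elim disjE conjE)
  assume "is_primary_to R \<mm> I"
  then show ?thesis using primary_height assms by simp
 next
  note cl = u.clsd_one[OF u.idl_C]
  have step: "dpt {1} \<mm> (Suc n) I J" if "d - length xs = Suc n" "dpt {1} \<mm> n UNIV I" for n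
   using N.depth_lemma_sub[OF u.mult_one D.m_idl cl[OF J_idl] cl[OF I_idl] JI _ that(2)] dpt_J that(1) by simp
  {
   assume "ideal_height R I + 1 = enat d"
   then have "g + 1 = d" by (simp add: height_I one_enat_def del: One_nat_def)
   then have "d - length xs = Suc 0" using assms by simp
   then show ?thesis using step[of 0] by simp
  next
   assume "ideal_height R I + 2 = enat d" and dep: "1 <= depth R \<mm> (scalar_module (%r. I +>\<^bsub>R\<^esub> r) (R Quot I))"
   then have "g + 2 = d" by (simp add: height_I numeral_eq_enat)
   then have "d - length xs = Suc 1" using assms by simp
   then show ?thesis using step[of 1] depth_RI[OF dep] by simp
  }
 qed
 then show ?thesis unfolding dpt_def colon_iso .
qed

text \<open>An associated prime Q of R/J containing c contains I, so its height is at least g = |xs|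
  + 1. Unmixedness of R/J gives a chain of length d - |xs| above Q, and the two together exceed
  d.\<close>

lemma cc_nzd: assumes "g = Suc (length xs)" shows "nzd_on cc UNIV J"
proof (rule ccontr)
 assume "~ ?thesis"
 from N.not_nzd_max_anns[OF u.idl_C J_idl UNIV_I this] obtain Q where Q: "Q : max_anns UNIV UNIV J" "cc : Q" by blast
 then obtain v where v: "v ~: J" "Q = annid UNIV J v" by (auto simp: max_anns_def)
 have Qp: "u.prm Q" by (rule N.max_anns_prime[OF u.idl_C J_idl Q(1)])
 have "J <= Q" using idlD(5)[OF J_idl] v(2) by (auto simp: annid_def)
 then have "I <= Q" unfolding genid_Suc adj_def using Q(2)
  by (intro u.isum_least u.image_principal_sub prmD(1)[OF Qp]) auto
 then have "pchain UNIV {0} g Q" by (rule height_prime_ge[OF Qp])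
 moreover have "pchain UNIV Q (d - length xs) \<mm>"
 proof -
  let ?W = "UNIV - \<mm>"
  have cl: "u.clsd ?W UNIV J"
  proof -
   have "x : J" if "w ~: \<mm>" "w * x : J" for w x
    using unit[OF that(1)] idlD(4)[OF J_idl UNIV_I that(2)] by (metis mult.assoc mult_1_left)
   then show ?thesis using J_idl by (auto simp: u.clsd_def nzd_on_def)
  qed
  have s: "sat ?W UNIV J = J" using u.sat_least[OF cl order_refl] u.sat_upper[OF u.mult_compl[OF m]] by blast
  obtain ys where ys: "length ys = d - length xs" "set ys <= \<mm>" "regseq {1} UNIV J ys" using dpt_J by (auto simp: dpt_def)
  have "{1} <= ?W" using prmD(2)[OF m] by auto
  then have rs: "regseq ?W UNIV J ys"
   using u.regseq_localize[OF u.mult_one u.mult_compl[OF m] _ u.clsd_one[OF u.idl_C J_idl] _ ys(3)] s by simp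
  show ?thesis using N.chain_of_annid[OF m cl _ ys(2) rs, of v] v ys(1) by simp
 qed
 ultimately have "pchain UNIV {0} (g + (d - length xs)) \<mm>" by (rule pchain_append)
 then have "g + (d - length xs) <= d" by (rule dim)
 then show False using assms len_d by simp
qed

lemma colon_J: "g = Suc (length xs) ==> {k. cc * k : J} = J"
 using nzd_onD[OF cc_nzd] idlD(4)[OF J_idl UNIV_I] by blast

lemma aci_xs: "aci a g d \<mm> xs"
proof
 show "dpt {1} \<mm> (d - length xs) UNIV {k. cc * k : J}"
 proof (cases "g = length xs")
  case False
  then have "g = Suc (length xs)" using len_g by simp
  then show ?thesis unfolding colon_J[OF \<open>g = Suc (length xs)\<close>] by (intro dpt_J)
 qed (rule dK_top)
qed (rule xs cc)+

end

end

text \<open>With K = J the kernel of evaluating t at cu is exactly (t - cu)JR[Ju,t], the image of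
  the linear relations; so I is of linear type.\<close>

lemma (in aci) LL_eq_LI: assumes "nzd_on cc UNIV J" shows "LL = LI"
proof
 have KJ: "K = J" using assms J_sub_K by (auto simp: K_def nzd_on_def)
 show "LL <= LI"
 proof
  fix b assume b: "b : LL"
  then obtain q where "q : pol (RK J J)" "\<psi> b = shift_lin cc * q"
   using eval_kernel[OF J_idl NZP_pow[OF NZP_J assms], where q = "\<psi> b"] psi_mem by (auto simp: LL_def)
  then show "b : LI" using b by (auto simp: LI_eq lin_ker_def KJ LL_def)
 qed
qed (rule LI_sub_LL)

theorem proposition2p5:
  fixes a :: "nat \<Rightarrow> 'a::idom" and \<mm> :: "'a set" and d g :: nat
  defines "R \<equiv> (ring_of_type_algebra :: 'a ring)"
    and "I \<equiv> gen_ideal (g + 1) a"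
    and "S \<equiv> sym_algebra (g + 1) a"
    and "T \<equiv> nonlinear_relations (g + 1) a"
    and "N \<equiv> nonlinear_relations (g + 1) a \<inter>
               extended_ideal (sym_const (g + 1) a) (sym_algebra (g + 1) a) \<mm>"
  assumes CM: "cohen_macaulay_local_ring R \<mm>"
    and dim: "krull_dim R = enat d" "1 \<le> d"
    and aci: "almost_complete_intersection g a"
    and abc: "is_primary_to R \<mm> I \<or>
      ideal_height R I + 1 = enat d \<or>
      (ideal_height R I + 2 = enat d \<and>
         1 \<le> depth R \<mm> (scalar_module (\<lambda>r. I +>\<^bsub>R\<^esub> r) (R Quot I)))"
  shows "cohen_macaulay_ring S \<and>
    (cohen_macaulay_module S ((self_module S)\<lparr>carrier := T\<rparr>) \<longleftrightarrow>
       enat d \<le> depth (rees_algebra I) (rees_max_ideal \<mm> I) (self_module (rees_algebra I))) \<and>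
    (is_primary_to R \<mm> I \<longrightarrow>
       N = nilradical S \<and>
       (\<forall>s\<ge>1. ideal_power S N s = {\<zero>\<^bsub>S\<^esub>} \<longleftrightarrow>
          ideal_smult R (scalar_module (sym_const (g + 1) a) S) (ideal_power R \<mm> s) T = {\<zero>\<^bsub>S\<^esub>}) \<and>
       sdeg \<mm> (g + 1) a = nilpotency_index S) \<and>
    (\<forall>Y \<subseteq> carrier (sym_fiber \<mm> (g + 1) a).
       Idl\<^bsub>sym_fiber \<mm> (g + 1) a\<^esub> Y = fiber_relations \<mm> (g + 1) a \<longrightarrow>
       (\<exists>F\<subseteq>T. sym_fiber_proj \<mm> (g + 1) a ` F = Y) \<and>
       (\<forall>F\<subseteq>T. sym_fiber_proj \<mm> (g + 1) a ` F = Y \<longrightarrow> T = N <+>\<^bsub>S\<^esub> Idl\<^bsub>S\<^esub> F)) \<and>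
    (\<forall>f\<in>T. Idl\<^bsub>sym_fiber \<mm> (g + 1) a\<^esub> {sym_fiber_proj \<mm> (g + 1) a f} =
         fiber_relations \<mm> (g + 1) a \<longrightarrow>
       T = Idl\<^bsub>S\<^esub> (insert f N))"
proof -
 interpret X: aci_setting a g \<mm> d
  using CM dim aci abc by unfold_locales (simp_all add: R_def I_def)
 obtain xs where xs: "set xs <= \<mm>" "regseq {1} UNIV {0} xs" "quo {1} UNIV {0} xs = X.J" using X.seq_exists by blast
 interpret A: aci a g d \<mm> xs by (rule X.aci_xs[OF xs])
 have I: "I = A.II" by (simp add: I_def gen_ideal_genid A.II_def)
 have S: "S = A.S" by (simp add: S_def A.sym_eq)
 have T: "T = A.\<sigma> ` A.LL" by (simp add: T_def A.T_eq)
 have N: "N = A.\<sigma> ` A.NB" using A.N_eq by (simp add: N_def)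
 have third: "N = nilradical S &
    (ALL s>=1. ideal_power S N s = {\<zero>\<^bsub>S\<^esub>} \<longleftrightarrow>
     ideal_smult R (scalar_module (sym_const (g + 1) a) S) (ideal_power R \<mm> s) T = {\<zero>\<^bsub>S\<^esub>}) &
    sdeg \<mm> (g + 1) a = nilpotency_index S" if "is_primary_to R \<mm> I"
 proof -
  have gd: "g = d" using X.primary_height that by (simp add: R_def I A.II_def)
  \<comment> \<open>Primary to the maximal ideal means g = d. If xs has d elements, the arguments of
    the primary case apply; otherwise it has d - 1, c is regular modulo J and T = 0.\<close>
  have key: "(ALL b:A.B. (EX n. b ^ n : A.LI) \<longleftrightarrow> b : A.NB) &
   (ALL s>0. (ALL bs. length bs = s --> set bs <= A.NB --> prod_list bs : A.LI) \<longleftrightarrow> A.nilp s)"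
  proof (cases "g = length xs")
   case True
   interpret Pr: aci_primary a g d \<mm> xs by unfold_locales (use True gd dim in auto)
   show ?thesis using Pr.third_primary by blast
  next
   case False
   then have "g = Suc (length xs)" using X.len_g[OF xs] by simp
   then have "A.LL = A.LI" using A.LL_eq_LI X.cc_nzd[OF xs] unfolding A.cc_def A.J_def by blast
   then show ?thesis using A.third_trivial by blast
  qed
  show ?thesis using A.third key unfolding S T N R_def by (simp add: Suc_le_eq)
 qed
 have "cohen_macaulay_ring S" using A.CM_S S by simp
 moreover have "cohen_macaulay_module S ((self_module S)\<lparr>carrier := T\<rparr>) \<longleftrightarrow>
   enat d <= depth (rees_algebra I) (rees_max_ideal \<mm> I) (self_module (rees_algebra I))"
  unfolding S T I A.CM_T A.depth_rees ..
 moreover have "ALL Y <= carrier (sym_fiber \<mm> (g + 1) a). Idl\<^bsub>sym_fiber \<mm> (g + 1) a\<^esub> Y = fiber_relations \<mm> (g + 1) a -->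
    (EX F<=T. sym_fiber_proj \<mm> (g + 1) a ` F = Y) &
    (ALL F<=T. sym_fiber_proj \<mm> (g + 1) a ` F = Y --> T = N <+>\<^bsub>S\<^esub> Idl\<^bsub>S\<^esub> F)"
  using A.fourth unfolding S T N by simp
 moreover have "ALL f:T. Idl\<^bsub>sym_fiber \<mm> (g + 1) a\<^esub> {sym_fiber_proj \<mm> (g + 1) a f} = fiber_relations \<mm> (g + 1) a -->
    T = Idl\<^bsub>S\<^esub> (insert f N)"
  using A.hypersurface unfolding S T N by simp
 ultimately show ?thesis using third by blast
qed

end
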